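(* Let $H\in(1/2,1)$, let $X=(X_t)_{t\ge 0}$ be the solution of $dX_t=\sigma(X_t)\circ dB^H_t+b(X_t)\,dt$ with $X_0$ independent of $B^H$, and let $L_N(t)$ be the empirical spectral measure of the $N\times N$ symmetric matrix $Y^N(t)$ built from i.i.d. copies of $X$ (see context). Suppose that for some $\varepsilon\in(0,H-\frac12)$ the functions $\sigma,b:\mathbb{R}\to\mathbb{R}$ have bounded derivatives which are Hölder continuous of order greater than $\frac1{H-\varepsilon}-1$, and that one of the following holds: (H1) $\sigma$ and $b$ are bounded; (H2) $\|\sigma'\|_\infty+\|b'\|_\infty>0$ and $\mathbb{E}[|X_0|^4]<\infty$. Assume that there exist a positive function $\varphi\in C^1(\mathbb{R})$ with bounded derivative and $\lim_{|x|\to\infty}\varphi(x)=\infty$, and a positive constant $C_0$, such that almost surely $\sup_{N\in\mathbb{N}}\langle\varphi,L_N(0)\rangle\le C_0$. Assume also $\mathbb{E}[|X_0|^2]<\infty$, and put $m_t=\mathbb{E}[X_t]$ and $d_t=(\mathbb{E}[|X_t|^2]-m_t^2)^{1/2}$. Then for any $T>0$, the sequence $\{L_N(t),t\in[0,T]\}_{N\in\mathbb{N}}$ converges to $\mu=\{\mu_t,t\in[0,T]\}$ in $C([0,T],\mathbf{P}(\mathbb{R}))$ almost surely, as $N\to\infty$. The limit measure $\mu_t$ has density $p_t(x)=p_{sc}(x/d_t)/d_t$, where $p_{sc}(x)=\frac{\sqrt{4-x^2}}{2\pi}1_{[-2,2]}(x)$.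
   Context: $B^H$ is a one-dimensional fractional Brownian motion with Hurst parameter $H$; the stochastic differential equation is understood in the Stratonovich sense, which for $H>1/2$ means that $\int\sigma(X_r)\circ dB^H_r$ is the pathwise Riemann–Stieltjes (Young) integral, and under the stated regularity it has a unique solution. $\{X_{ij}(t)\}_{i,j\ge1}$ are i.i.d. copies of the process $X$, all on one probability space. $Y^N(t)=(Y^N_{ij}(t))_{1\le i,j\le N}$ is the real symmetric matrix with $Y^N_{ij}(t)=\frac1{\sqrt N}X_{ij}(t)$ for $1\le i<j\le N$ and $Y^N_{ii}(t)=\frac{\sqrt2}{\sqrt N}X_{ii}(t)$. With $\lambda^N_1(t)\le\dots\le\lambda^N_N(t)$ its eigenvalues, $L_N(t)=\frac1N\sum_{i=1}^N\delta_{\lambda^N_i(t)}$. $\mathbf{P}(\mathbb{R})$ is the space of Borel probability measures on $\mathbb{R}$ with the weak topology (a Polish space) and $C([0,T],\mathbf{P}(\mathbb{R}))$ is the space of continuous maps $[0,T]\to\mathbf{P}(\mathbb{R})$ with the topology of uniform convergence. $\langle f,\mu\rangle=\int f\,d\mu$. $\|\cdot\|_\infty$ is the supremum norm. *)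

theory Defs
  imports
    "HOL-Probability.Probability"
    "Jordan_Normal_Form.Char_Poly"
begin

text \<open>Constants count as (degenerate) Gaussian random variables.\<close>

definition gaussian_rv :: "'w measure \<Rightarrow> ('w \<Rightarrow> real) \<Rightarrow> bool" where
  "gaussian_rv M Z \<longleftrightarrow> Z \<in> borel_measurable M \<and>
     ((\<exists>c. AE \<omega> in M. Z \<omega> = c) \<or>
      (\<exists>m s. 0 < s \<and> distributed M lborel Z (\<lambda>x. ennreal (normal_density m s x))))"

definition gaussian_process :: "'w measure \<Rightarrow> (real \<Rightarrow> 'w \<Rightarrow> real) \<Rightarrow> bool" where
  "gaussian_process M B \<longleftrightarrow>
     (\<forall>F c. finite F \<and> F \<subseteq> {0..} \<longrightarrow> gaussian_rv M (\<lambda>\<omega>. \<Sum>t\<in>F. c t * B t \<omega>))"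

definition fractional_brownian_motion :: "real \<Rightarrow> 'w measure \<Rightarrow> (real \<Rightarrow> 'w \<Rightarrow> real) \<Rightarrow> bool" where
  "fractional_brownian_motion H M B \<longleftrightarrow>
     gaussian_process M B \<and>
     (\<forall>t\<ge>0. (\<integral>\<omega>. B t \<omega> \<partial>M) = 0) \<and>
     (\<forall>s\<ge>0. \<forall>t\<ge>0. (\<integral>\<omega>. B s \<omega> * B t \<omega> \<partial>M) =
        (s powr (2 * H) + t powr (2 * H) - \<bar>t - s\<bar> powr (2 * H)) / 2) \<and>
     (AE \<omega> in M. continuous_on {0..} (\<lambda>t. B t \<omega>))"

definition holder_on :: "real \<Rightarrow> real set \<Rightarrow> (real \<Rightarrow> real) \<Rightarrow> bool" where
  "holder_on \<gamma> S f \<longleftrightarrow> 0 < \<gamma> \<and> \<gamma> \<le> 1 \<and>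
     (\<exists>C. \<forall>x\<in>S. \<forall>y\<in>S. \<bar>f x - f y\<bar> \<le> C * \<bar>x - y\<bar> powr \<gamma>)"

definition bounded_holder_derivative :: "real \<Rightarrow> (real \<Rightarrow> real) \<Rightarrow> bool" where
  "bounded_holder_derivative \<alpha> f \<longleftrightarrow>
     f differentiable_on UNIV \<and> bounded (range (deriv f)) \<and>
     (\<exists>\<gamma>>\<alpha>. holder_on \<gamma> UNIV (deriv f))"

text \<open>Riemann--Stieltjes integral of \<open>f\<close> against \<open>g\<close> over \<open>[a, b]\<close>: the Riemann sums over tagged
  partitions converge as the mesh tends to \<open>0\<close>.  The gauge is a ball of \<^emph>\<open>constant\<close> radius
  (otherwise this would be a Henstock-type integral).\<close>

definition has_rs_integral ::
    "(real \<Rightarrow> real) \<Rightarrow> (real \<Rightarrow> real) \<Rightarrow> real \<Rightarrow> real \<Rightarrow> real \<Rightarrow> bool" where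
  "has_rs_integral f g a b I \<longleftrightarrow>
     (\<forall>e>0. \<exists>d>0. \<forall>p. p tagged_division_of {a..b} \<and> (\<lambda>x. ball x d) fine p \<longrightarrow>
        \<bar>(\<Sum>(x, K)\<in>p. f x * (g (Sup K) - g (Inf K))) - I\<bar> < e)"

text \<open>Pathwise solution of \<open>dx\<^sub>t = \<sigma>(x\<^sub>t) dg\<^sub>t + b(x\<^sub>t) dt\<close>, \<open>t \<ge> 0\<close>, in the sense of Young, for a
  driving path \<open>g\<close> that is locally Hoelder continuous of every order smaller than \<open>H\<close>: the
  solution lives in the class of paths for which Young's condition \<open>\<beta> + (H-) > 1\<close> holds, which is
  the class in which existence and uniqueness are known.\<close>

definition young_solution ::
    "real \<Rightarrow> (real \<Rightarrow> real) \<Rightarrow> (real \<Rightarrow> real) \<Rightarrow> (real \<Rightarrow> real) \<Rightarrow> (real \<Rightarrow> real) \<Rightarrow> bool" where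
  "young_solution H \<sigma> b g x \<longleftrightarrow>
     (\<forall>T>0. \<exists>\<beta>>1 - H. holder_on \<beta> {0..T} x) \<and>
     (\<forall>t\<ge>0. \<exists>I. has_rs_integral (\<lambda>r. \<sigma> (x r)) g 0 t I \<and>
        x t = x 0 + I + integral {0..t} (\<lambda>r. b (x r)))"

text \<open>A process \<open>Z\<close> seen as one random element of \<open>\<real>\<^bsup>[0,\<infinity>)\<^esup>\<close> with the product sigma-algebra.\<close>

abbreviation path_space :: "(real \<Rightarrow> real) measure" where
  "path_space \<equiv> PiM {0..} (\<lambda>_. borel)"

definition path_of :: "(real \<Rightarrow> 'w \<Rightarrow> real) \<Rightarrow> 'w \<Rightarrow> real \<Rightarrow> real" where
  "path_of Z \<omega> = (\<lambda>t\<in>{0..}. Z t \<omega>)"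

definition sde_solution ::
    "real \<Rightarrow> (real \<Rightarrow> real) \<Rightarrow> (real \<Rightarrow> real) \<Rightarrow> 'w measure \<Rightarrow>
     (real \<Rightarrow> 'w \<Rightarrow> real) \<Rightarrow> (real \<Rightarrow> 'w \<Rightarrow> real) \<Rightarrow> bool" where
  "sde_solution H \<sigma> b M B X \<longleftrightarrow>
     (\<forall>t\<ge>0. X t \<in> borel_measurable M) \<and>
     prob_space.indep_set M
       (sets (vimage_algebra (space M) (X 0) borel))
       (sets (vimage_algebra (space M) (path_of B) path_space)) \<and>
     (AE \<omega> in M. young_solution H \<sigma> b (\<lambda>t. B t \<omega>) (\<lambda>t. X t \<omega>))"

text \<open>The law on \<open>path_space\<close> does not determine path continuity, so that the copies
  have continuous paths, as \<open>X\<close> does, is required separately.\<close>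

definition iid_copies ::
    "'v measure \<Rightarrow> (nat \<Rightarrow> nat \<Rightarrow> real \<Rightarrow> 'v \<Rightarrow> real) \<Rightarrow> 'w measure \<Rightarrow> (real \<Rightarrow> 'w \<Rightarrow> real) \<Rightarrow> bool" where
  "iid_copies M Xs P X \<longleftrightarrow>
     prob_space.indep_vars M (\<lambda>_. path_space) (\<lambda>(i, j). path_of (Xs i j)) UNIV \<and>
     (\<forall>i j. distr M path_space (path_of (Xs i j)) = distr P path_space (path_of X)) \<and>
     (\<forall>i j. AE \<omega> in M. continuous_on {0..} (\<lambda>t. Xs i j t \<omega>))"

text \<open>Rows and columns are indexed by \<open>0, \<dots>, N - 1\<close>.\<close>

definition wigner_matrix :: "nat \<Rightarrow> (nat \<Rightarrow> nat \<Rightarrow> real) \<Rightarrow> real mat" where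
  "wigner_matrix N x = mat N N (\<lambda>(i, j).
     if i = j then sqrt 2 / sqrt (real N) * x i i
     else 1 / sqrt (real N) * x (min i j) (max i j))"

text \<open>Real eigenvalues in increasing order, repeated according to algebraic multiplicity; by
  \<open>length_ordered_eigenvalues\<close> below, these are all the eigenvalues if \<open>A\<close> is symmetric.\<close>

definition ordered_eigenvalues :: "real mat \<Rightarrow> real list" where
  "ordered_eigenvalues A = sorted_list_of_multiset (proots (char_poly A))"

text \<open>The push-forward of the uniform distribution on the indices is \<open>N\<^sup>-\<^sup>1 \<Sum>\<^sub>i \<delta>\<^bsub>\<lambda>\<^sub>i\<^esub>\<close>.\<close>

definition empirical_spectral_measure :: "real mat \<Rightarrow> real measure" where
  "empirical_spectral_measure A =
     distr (uniform_count_measure {..<dim_row A}) borel (\<lambda>i. ordered_eigenvalues A ! i)"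

lemma symmetric_complex_eigenvalue_real:
  assumes A: "A \<in> carrier_mat n n" "transpose_mat A = A"
    and z: "eigenvalue (map_mat complex_of_real A) z"
  shows "z \<in> \<real>"
proof -
  let ?A = "map_mat complex_of_real A"
  have cA: "?A \<in> carrier_mat n n" using A by simp
  obtain v where v: "v \<in> carrier_vec n" "v \<noteq> 0\<^sub>v n" "?A *\<^sub>v v = z \<cdot>\<^sub>v v"
    using z cA unfolding eigenvalue_def eigenvector_def by auto
  have cv: "conjugate v \<in> carrier_vec n" using v by simp
  have conj: "?A *\<^sub>v conjugate v = conjugate (?A *\<^sub>v v)"
    using A v(1) by (intro eq_vecI) (auto simp: scalar_prod_def cnj_sum)
  have "(?A *\<^sub>v v) \<bullet> conjugate v = v \<bullet> (?A *\<^sub>v conjugate v)"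
  proof -
    have "transpose_mat ?A = ?A" using A(2) by (metis map_mat_transpose)
    then show ?thesis
      using transpose_vec_mult_scalar[OF cA v(1) cv] v(1) cv cA
      by (metis comm_scalar_prod mult_mat_vec_carrier)
  qed
  then have "z * (v \<bullet>c v) = cnj z * (v \<bullet>c v)"
    using v cv unfolding conj by (simp add: conjugate_smult_vec)
  moreover have "v \<bullet>c v \<noteq> 0" using v by simp
  ultimately have "cnj z = z" by simp
  then show ?thesis by (simp add: Reals_cnj_iff)
qed

lemma size_proots_real_rooted:
  fixes p :: "real poly"
  assumes "p \<noteq> 0" "\<And>z. poly (map_poly complex_of_real p) z = 0 \<Longrightarrow> z \<in> \<real>"
  shows "size (proots p) = degree p"
  using assms
proof (induction "degree p" arbitrary: p)
  case 0
  then show ?case using size_proots_le[of p] by simp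
next
  case (Suc n)
  interpret h: map_poly_comm_ring_hom complex_of_real ..
  have "\<not> constant (poly (map_poly complex_of_real p))"
    using Suc(2) by (simp add: constant_degree)
  then obtain z where z: "poly (map_poly complex_of_real p) z = 0"
    using fundamental_theorem_of_algebra by blast
  then obtain r where "z = complex_of_real r" using Suc.prems Reals_cases by metis
  with z have "poly p r = 0" by simp
  then obtain q where q: "p = [:-r, 1:] * q" by (auto simp: poly_eq_0_iff_dvd elim: dvdE)
  have "q \<noteq> 0" using q Suc.prems(1) by auto
  then have deg: "degree p = Suc (degree q)" unfolding q by (subst degree_mult_eq) auto
  have "poly (map_poly complex_of_real p) w = (w - of_real r) * poly (map_poly complex_of_real q) w" for w
    unfolding q h.hom_mult by (simp add: algebra_simps)
  then have "size (proots q) = degree q"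
    using Suc.hyps Suc.prems(2) deg \<open>q \<noteq> 0\<close> by auto
  then show ?case unfolding q using \<open>q \<noteq> 0\<close> deg[unfolded q] by (subst proots_mult) auto
qed

lemma length_ordered_eigenvalues:
  assumes "A \<in> carrier_mat n n" "transpose_mat A = A"
  shows "length (ordered_eigenvalues A) = n"
proof -
  have "size (proots (char_poly A)) = degree (char_poly A)"
  proof (rule size_proots_real_rooted)
    show "char_poly A \<noteq> 0" using degree_monic_char_poly[OF assms(1)] by auto
    fix z assume "poly (map_poly complex_of_real (char_poly A)) z = 0"
    then have "eigenvalue (map_mat complex_of_real A) z"
      using assms(1) by (simp add: eigenvalue_root_char_poly of_real_hom.char_poly_hom)
    then show "z \<in> \<real>" using symmetric_complex_eigenvalue_real assms by blast
  qed
  then show ?thesis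
    unfolding ordered_eigenvalues_def using degree_monic_char_poly[OF assms(1)]
    by (metis mset_sorted_list_of_multiset size_mset)
qed

lemma wigner_matrix_symmetric:
  "wigner_matrix N x \<in> carrier_mat N N" "transpose_mat (wigner_matrix N x) = wigner_matrix N x"
  by (auto simp: wigner_matrix_def min.commute max.commute)

definition weak_topology :: "real measure topology" where
  "weak_topology = topology_generated_by
     {{\<mu>. real_distribution \<mu> \<and> (\<integral>x. f x \<partial>\<mu>) \<in> U} | f U.
        continuous_on UNIV f \<and> bounded (range f) \<and> open (U :: real set)}"

definition levy_near :: "real measure \<Rightarrow> real measure \<Rightarrow> real \<Rightarrow> bool" where
  "levy_near \<mu> \<nu> e \<longleftrightarrow> (\<forall>x. cdf \<mu> (x - e) - e \<le> cdf \<nu> x \<and> cdf \<nu> x \<le> cdf \<mu> (x + e) + e)"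

text \<open>The Levy metric; it induces the weak topology (\<open>mtopology_of_prob_metric\<close> below).  On a compact
  time interval the topology of uniform convergence depends only on the topology of the target
  space, not on the choice of this metric.  The capping at \<open>1\<close> has no effect on probability measures; it only makes
  the infimum well-defined for arbitrary arguments.\<close>

definition levy_dist :: "real measure \<Rightarrow> real measure \<Rightarrow> real" where
  "levy_dist \<mu> \<nu> = Inf (insert 1 {e. 0 < e \<and> levy_near \<mu> \<nu> e})"

definition prob_metric :: "real measure metric" where
  "prob_metric = metric (Collect real_distribution, levy_dist)"

lemma levy_near_commute: "levy_near \<mu> \<nu> e \<longleftrightarrow> levy_near \<nu> \<mu> e"
proof -
  have "levy_near \<nu> \<mu> e" if "levy_near \<mu> \<nu> e" for \<mu> \<nu>
    unfolding levy_near_def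
  proof
    fix x
    have "cdf \<nu> (x - e) \<le> cdf \<mu> ((x - e) + e) + e" "cdf \<mu> ((x + e) - e) - e \<le> cdf \<nu> (x + e)"
      using that unfolding levy_near_def by blast+
    then show "cdf \<nu> (x - e) - e \<le> cdf \<mu> x \<and> cdf \<mu> x \<le> cdf \<nu> (x + e) + e" by simp
  qed
  then show ?thesis by blast
qed

lemma levy_bdd_below: "bdd_below (insert 1 {e. 0 < e \<and> levy_near \<mu> \<nu> e})"
  by (auto simp: bdd_below_def intro!: exI[of _ 0])

lemma levy_dist_nonneg: "0 \<le> levy_dist \<mu> \<nu>"
  unfolding levy_dist_def by (rule cInf_greatest) auto

lemma levy_dist_le: "levy_near \<mu> \<nu> e \<Longrightarrow> 0 < e \<Longrightarrow> levy_dist \<mu> \<nu> \<le> e"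
  unfolding levy_dist_def by (rule cInf_lower[OF _ levy_bdd_below]) auto

lemma levy_dist_le_1: "levy_dist \<mu> \<nu> \<le> 1"
  unfolding levy_dist_def by (rule cInf_lower[OF _ levy_bdd_below]) auto

lemma levy_near_1:
  assumes "real_distribution \<mu>" "real_distribution \<nu>"
  shows "levy_near \<mu> \<nu> 1"
  unfolding levy_near_def
proof
  fix x
  interpret \<mu>: real_distribution \<mu> by fact
  interpret \<nu>: real_distribution \<nu> by fact
  show "cdf \<mu> (x - 1) - 1 \<le> cdf \<nu> x \<and> cdf \<nu> x \<le> cdf \<mu> (x + 1) + 1"
    using \<mu>.cdf_bounded_prob[of "x-1"] \<nu>.cdf_bounded_prob[of x] \<mu>.cdf_nonneg[of "x+1"] \<nu>.cdf_nonneg[of x]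
    by linarith
qed

lemma levy_near_mono:
  assumes "real_distribution \<mu>" "levy_near \<mu> \<nu> d" "d \<le> e"
  shows "levy_near \<mu> \<nu> e"
  unfolding levy_near_def
proof
  fix x
  interpret \<mu>: real_distribution \<mu> by fact
  have "cdf \<mu> (x - d) - d \<le> cdf \<nu> x" "cdf \<nu> x \<le> cdf \<mu> (x + d) + d"
    using assms(2) unfolding levy_near_def by blast+
  then show "cdf \<mu> (x - e) - e \<le> cdf \<nu> x \<and> cdf \<nu> x \<le> cdf \<mu> (x + e) + e"
    using \<mu>.cdf_nondecreasing[of "x - e" "x - d"] \<mu>.cdf_nondecreasing[of "x + d" "x + e"] assms(3)
    by linarith
qed

lemma levy_near_if_dist_less:
  assumes "real_distribution \<mu>" "real_distribution \<nu>" "levy_dist \<mu> \<nu> < e"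
  shows "levy_near \<mu> \<nu> e"
proof -
  obtain d where "d \<in> insert 1 {e. 0 < e \<and> levy_near \<mu> \<nu> e}" "d < e"
    using assms(3) cInf_less_iff[OF _ levy_bdd_below] unfolding levy_dist_def by blast
  then have "levy_near \<mu> \<nu> d" "d \<le> e"
    using levy_near_1[OF assms(1,2)] by auto
  then show ?thesis using levy_near_mono assms(1) by blast
qed

lemma levy_near_trans:
  assumes "levy_near \<mu> \<nu> d" "levy_near \<nu> \<rho> e"
  shows "levy_near \<mu> \<rho> (d + e)"
  unfolding levy_near_def
proof
  fix x
  have "cdf \<mu> ((x - e) - d) - d \<le> cdf \<nu> (x - e)" "cdf \<nu> (x - e) - e \<le> cdf \<rho> x"
    "cdf \<rho> x \<le> cdf \<nu> (x + e) + e" "cdf \<nu> (x + e) \<le> cdf \<mu> ((x + e) + d) + d"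
    using assms unfolding levy_near_def by blast+
  then show "cdf \<mu> (x - (d + e)) - (d + e) \<le> cdf \<rho> x \<and> cdf \<rho> x \<le> cdf \<mu> (x + (d + e)) + (d + e)"
    by (simp add: algebra_simps)
qed

lemma cdf_le_if_levy_near:
  assumes "real_distribution \<mu>" "\<And>e. 0 < e \<Longrightarrow> levy_near \<mu> \<nu> e"
  shows "cdf \<nu> x \<le> cdf \<mu> x"
proof -
  interpret \<mu>: real_distribution \<mu> by fact
  have "((\<lambda>y. cdf \<mu> y + (y - x)) \<longlongrightarrow> cdf \<mu> x + (x - x)) (at_right x)"
    using \<mu>.cdf_is_right_cont[of x] unfolding continuous_within by (intro tendsto_intros)
  moreover have "\<forall>\<^sub>F y in at_right x. cdf \<nu> x \<le> cdf \<mu> y + (y - x)"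
  proof -
    have "cdf \<nu> x \<le> cdf \<mu> y + (y - x)" if "x < y" for y
      using assms(2)[of "y - x"] that unfolding levy_near_def by (auto dest: spec[of _ x])
    then show ?thesis by (simp add: eventually_at_filter)
  qed
  ultimately show ?thesis
    using tendsto_lowerbound by fastforce
qed

interpretation levy: Metric_space "Collect real_distribution" levy_dist
proof
  fix \<mu> \<nu> \<rho> :: "real measure"
  show "0 \<le> levy_dist \<mu> \<nu>" by (rule levy_dist_nonneg)
  show "levy_dist \<mu> \<nu> = levy_dist \<nu> \<mu>"
    unfolding levy_dist_def using levy_near_commute[of \<mu> \<nu>] by simp
  show "levy_dist \<mu> \<nu> = 0 \<longleftrightarrow> \<mu> = \<nu>"
    if "\<mu> \<in> Collect real_distribution" "\<nu> \<in> Collect real_distribution"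
  proof
    assume "levy_dist \<mu> \<nu> = 0"
    then have *: "levy_near \<mu> \<nu> e" if "0 < e" for e
      using levy_near_if_dist_less that \<open>\<mu> \<in> _\<close> \<open>\<nu> \<in> _\<close> by simp
    then have "cdf \<nu> x \<le> cdf \<mu> x" "cdf \<mu> x \<le> cdf \<nu> x" for x
      using cdf_le_if_levy_near[of \<mu> \<nu> x] cdf_le_if_levy_near[of \<nu> \<mu> x] levy_near_commute that by auto
    then have "cdf \<mu> = cdf \<nu>" by (auto intro!: ext antisym)
    then show "\<mu> = \<nu>" using cdf_unique that by blast
  next
    assume "\<mu> = \<nu>"
    interpret real_distribution \<mu> using that by simp
    have "levy_near \<mu> \<nu> e" if "0 < e" for e
      unfolding levy_near_def
    proof
      fix x
      show "cdf \<mu> (x - e) - e \<le> cdf \<nu> x \<and> cdf \<nu> x \<le> cdf \<mu> (x + e) + e"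
        using that cdf_nondecreasing[of "x - e" x] cdf_nondecreasing[of x "x + e"] \<open>\<mu> = \<nu>\<close> by auto
    qed
    then have "levy_dist \<mu> \<nu> \<le> 0 + e" if "0 < e" for e
      using levy_dist_le that by simp
    then have "levy_dist \<mu> \<nu> \<le> 0" by (rule field_le_epsilon)
    then show "levy_dist \<mu> \<nu> = 0" using levy_dist_nonneg antisym by blast
  qed
  show "levy_dist \<mu> \<rho> \<le> levy_dist \<mu> \<nu> + levy_dist \<nu> \<rho>"
    if "\<mu> \<in> Collect real_distribution" "\<nu> \<in> Collect real_distribution" "\<rho> \<in> Collect real_distribution"
  proof (rule field_le_epsilon)
    fix e :: real assume "0 < e"
    have "levy_near \<mu> \<rho> ((levy_dist \<mu> \<nu> + e/2) + (levy_dist \<nu> \<rho> + e/2))"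
      using that \<open>0 < e\<close>
      by (intro levy_near_trans[of \<mu> \<nu>] levy_near_if_dist_less) auto
    then have "levy_dist \<mu> \<rho> \<le> (levy_dist \<mu> \<nu> + e/2) + (levy_dist \<nu> \<rho> + e/2)"
      using \<open>0 < e\<close> levy_dist_nonneg[of \<mu> \<nu>] levy_dist_nonneg[of \<nu> \<rho>]
      by (intro levy_dist_le) auto
    then show "levy_dist \<mu> \<rho> \<le> levy_dist \<mu> \<nu> + levy_dist \<nu> \<rho> + e" by simp
  qed
qed

lemma mspace_prob_metric [simp]: "mspace prob_metric = Collect real_distribution"
  and mdist_prob_metric [simp]: "mdist prob_metric = levy_dist"
  unfolding prob_metric_def by simp_all

lemma isCont_cts_step: "a < b \<Longrightarrow> continuous_on UNIV (cts_step a b)"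
  by (intro uniformly_continuous_imp_continuous cts_step_uniformly_continuous)

lemma bounded_cts_step: "bounded (range (cts_step a b))"
  by (rule boundedI[of _ 1]) (auto simp: cts_step_def)

lemma openin_weak_topology_basic:
  assumes "continuous_on UNIV f" "bounded (range f)" "open (U :: real set)"
  shows "openin weak_topology {\<mu>. real_distribution \<mu> \<and> (\<integral>x. f x \<partial>\<mu>) \<in> U}"
  unfolding weak_topology_def using assms by (intro topology_generated_by_Basis) blast

lemma topspace_weak_topology: "topspace weak_topology = Collect real_distribution"
proof -
  have "Collect real_distribution = {\<mu>. real_distribution \<mu> \<and> (\<integral>x. (\<lambda>_. 0::real) x \<partial>\<mu>) \<in> UNIV}"
    by auto
  also have "openin weak_topology \<dots>" by (rule openin_weak_topology_basic) auto
  finally have "Collect real_distribution \<subseteq> topspace weak_topology"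
    by (rule openin_subset)
  moreover have "topspace weak_topology \<subseteq> Collect real_distribution"
    unfolding weak_topology_def by auto
  ultimately show ?thesis by blast
qed

lemma levy_dist_imp_weak_conv:
  assumes "\<And>n. real_distribution (\<nu> n)" "real_distribution \<mu>" "(\<lambda>n. levy_dist \<mu> (\<nu> n)) \<longlonglongrightarrow> 0"
  shows "weak_conv_m \<nu> \<mu>"
  unfolding weak_conv_m_def weak_conv_def
proof (intro allI impI)
  fix x assume x: "isCont (cdf \<mu>) x"
  show "(\<lambda>n. cdf (\<nu> n) x) \<longlonglongrightarrow> cdf \<mu> x"
  proof (rule LIMSEQ_I)
    fix r :: real assume "0 < r"
    then obtain d where d: "0 < d" "\<And>y. dist y x < d \<Longrightarrow> dist (cdf \<mu> y) (cdf \<mu> x) < r/2"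
      using x unfolding continuous_at_eps_delta by (metis half_gt_zero)
    define e where "e = min (d/2) (r/2)"
    have e: "0 < e" "e \<le> r/2" "e < d" using d \<open>0 < r\<close> by (auto simp: e_def)
    obtain N where N: "\<And>n. n \<ge> N \<Longrightarrow> levy_dist \<mu> (\<nu> n) < e"
      using LIMSEQ_D[OF assms(3) e(1)] by auto
    have "norm (cdf (\<nu> n) x - cdf \<mu> x) < r" if "n \<ge> N" for n
    proof -
      have "levy_near \<mu> (\<nu> n) e"
        using levy_near_if_dist_less[OF assms(2) assms(1) N[OF that]] .
      then have "cdf \<mu> (x - e) - e \<le> cdf (\<nu> n) x" "cdf (\<nu> n) x \<le> cdf \<mu> (x + e) + e"
        unfolding levy_near_def by auto
      moreover have "\<bar>cdf \<mu> (x - e) - cdf \<mu> x\<bar> < r/2" "\<bar>cdf \<mu> (x + e) - cdf \<mu> x\<bar> < r/2"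
        using d(2)[of "x - e"] d(2)[of "x + e"] e by (auto simp: dist_real_def)
      ultimately show ?thesis using e unfolding real_norm_def by linarith
    qed
    then show "\<exists>N. \<forall>n\<ge>N. norm (cdf (\<nu> n) x - cdf \<mu> x) < r" by blast
  qed
qed

lemma levy_ball_in_weak_nbhd:
  assumes "continuous_on UNIV f" "bounded (range f)" "open (U :: real set)"
    and \<mu>: "real_distribution \<mu>" "(\<integral>x. f x \<partial>\<mu>) \<in> U"
  shows "\<exists>r>0. \<forall>\<nu>. real_distribution \<nu> \<and> levy_dist \<mu> \<nu> < r \<longrightarrow> (\<integral>x. f x \<partial>\<nu>) \<in> U"
proof (rule ccontr)
  assume "\<not> ?thesis"
  then have "\<forall>n. \<exists>\<nu>. real_distribution \<nu> \<and> levy_dist \<mu> \<nu> < 1 / real (Suc n) \<and> (\<integral>x. f x \<partial>\<nu>) \<notin> U"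
    by (metis of_nat_0_less_iff zero_less_Suc zero_less_divide_1_iff)
  then obtain \<nu> where \<nu>: "\<And>n. real_distribution (\<nu> n)" "\<And>n. levy_dist \<mu> (\<nu> n) < 1 / real (Suc n)"
    "\<And>n. (\<integral>x. f x \<partial>\<nu> n) \<notin> U"
    by metis
  have "(\<lambda>n. levy_dist \<mu> (\<nu> n)) \<longlonglongrightarrow> 0"
  proof (rule tendsto_sandwich[of "\<lambda>_. 0" _ _ "\<lambda>n. 1 / real (Suc n)"])
    show "(\<lambda>n. 1 / real (Suc n)) \<longlonglongrightarrow> 0"
      by (rule LIMSEQ_Suc[OF lim_1_over_n])
    show "\<forall>\<^sub>F n in sequentially. levy_dist \<mu> (\<nu> n) \<le> 1 / real (Suc n)"
      using \<nu>(2) less_imp_le by (intro always_eventually allI) blast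
  qed (auto simp: levy_dist_nonneg)
  then have "weak_conv_m \<nu> \<mu>" using levy_dist_imp_weak_conv \<nu>(1) \<mu>(1) by blast
  moreover obtain B where "\<And>x. norm (f x) \<le> B"
    using assms(2) unfolding bounded_iff by auto
  moreover have "isCont f x" for x
    using assms(1) by (simp add: continuous_on_eq_continuous_at)
  ultimately have "(\<lambda>n. \<integral>x. f x \<partial>\<nu> n) \<longlonglongrightarrow> (\<integral>x. f x \<partial>\<mu>)"
    using \<nu>(1) \<mu>(1) by (intro weak_conv_imp_integral_bdd_continuous_conv) auto
  then have "\<forall>\<^sub>F n in sequentially. (\<integral>x. f x \<partial>\<nu> n) \<in> U"
    using assms(3) \<mu>(2) by (rule topological_tendstoD)
  then show False using \<nu>(3) by (simp add: eventually_sequentially)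
qed

lemma weak_nbhd_in_levy_ball:
  assumes "real_distribution \<mu>" "0 < r"
  shows "\<exists>V. openin weak_topology V \<and> \<mu> \<in> V \<and> (\<forall>\<nu>\<in>V. levy_dist \<mu> \<nu> < r)"
proof -
  interpret \<mu>: real_distribution \<mu> by fact
  define e where "e = r/4"
  have e: "0 < e" "3 * e < r" using assms(2) by (auto simp: e_def)
  have "\<forall>\<^sub>F x in at_bot. cdf \<mu> x < e" 
    using \<mu>.cdf_lim_at_bot e(1) by (rule order_tendstoD)
  then obtain a where a: "cdf \<mu> a < e" by (meson eventually_at_bot_linorder order_refl)
  have "\<forall>\<^sub>F x in at_top. cdf \<mu> x > 1 - e" 
    using \<mu>.cdf_lim_at_top_prob by (rule order_tendstoD) (use e in simp)
  then obtain b where b: "cdf \<mu> b > 1 - e" by (meson eventually_at_top_linorder order_refl)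
  define y where "y i = a - e + real i * e" for i :: nat
  obtain n where n: "b \<le> y n"
  proof -
    obtain n where "(b - a + e) / e \<le> real n" using real_arch_simple by blast
    then have "b \<le> y n" using e(1) by (simp add: y_def field_simps)
    then show ?thesis using that by blast
  qed
  have y_Suc: "y (Suc i) = y i + e" for i by (simp add: y_def algebra_simps)
  then have y_less: "y i < y (Suc i)" for i using e(1) by simp
  define V where "V i = {\<nu>. real_distribution \<nu> \<and> (\<integral>x. cts_step (y i) (y (Suc i)) x \<partial>\<nu>) \<in>
      ball (\<integral>x. cts_step (y i) (y (Suc i)) x \<partial>\<mu>) e}" for i
  have "openin weak_topology (\<Inter>i\<in>{..Suc n}. V i)"
    unfolding V_def
    by (intro openin_INT2 openin_weak_topology_basic isCont_cts_step bounded_cts_step y_less) auto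
  moreover have "\<mu> \<in> (\<Inter>i\<in>{..Suc n}. V i)" using assms e by (auto simp: V_def)
  moreover have "levy_dist \<mu> \<nu> < r" if \<nu>V: "\<nu> \<in> (\<Inter>i\<in>{..Suc n}. V i)" for \<nu>
  proof -
    have \<nu>: "real_distribution \<nu>" using \<nu>V by (auto simp: V_def)
    interpret \<nu>: real_distribution \<nu> by fact
    have up: "cdf \<nu> (y i) \<le> cdf \<mu> (y (Suc i)) + e"
      and lo: "cdf \<mu> (y i) - e \<le> cdf \<nu> (y (Suc i))" if "i \<le> Suc n" for i
    proof -
      have "\<bar>(\<integral>x. cts_step (y i) (y (Suc i)) x \<partial>\<mu>) - (\<integral>x. cts_step (y i) (y (Suc i)) x \<partial>\<nu>)\<bar> < e"
        using \<nu>V that by (auto simp: V_def dist_real_def)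
      then show "cdf \<nu> (y i) \<le> cdf \<mu> (y (Suc i)) + e" "cdf \<mu> (y i) - e \<le> cdf \<nu> (y (Suc i))"
        using \<mu>.cdf_cts_step[OF y_less[of i]] \<nu>.cdf_cts_step[OF y_less[of i]] by linarith+
    qed
    have bound: "cdf \<mu> (x - 3 * e) - 3 * e \<le> cdf \<nu> x \<and> cdf \<nu> x \<le> cdf \<mu> (x + 3 * e) + 3 * e" for x
    proof -
      consider "x < y 0" | "y (Suc n) \<le> x" | "y 0 \<le> x" "x < y (Suc n)" by linarith
      then show ?thesis
      proof cases
        case 1
        then have "cdf \<mu> (x - 3 * e) \<le> cdf \<mu> a" 
          using e by (intro \<mu>.cdf_nondecreasing) (simp add: y_def)
        moreover have "cdf \<nu> x \<le> cdf \<nu> (y 0)" using 1 by (intro \<nu>.cdf_nondecreasing) simp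
        moreover have "y (Suc 0) = a" by (simp add: y_def)
        ultimately show ?thesis
          using a up[of 0] \<nu>.cdf_nonneg[of x] \<mu>.cdf_nonneg[of "x + 3 * e"] e by auto
      next
        case 2
        have "cdf \<nu> (y (Suc n)) \<le> cdf \<nu> x" using 2 by (intro \<nu>.cdf_nondecreasing) simp
        moreover have "cdf \<mu> b \<le> cdf \<mu> (y n)" using n by (intro \<mu>.cdf_nondecreasing) simp
        moreover have "cdf \<mu> b \<le> cdf \<mu> (x + 3 * e)" 
          using n 2 y_less[of n] e by (intro \<mu>.cdf_nondecreasing) linarith
        ultimately show ?thesis
          using b lo[of n] \<nu>.cdf_bounded_prob[of x] \<mu>.cdf_bounded_prob[of "x - 3 * e"] e by auto
      next
        case 3
        define i where "i = nat \<lfloor>(x - y 0) / e\<rfloor>"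
        have "real i \<le> (x - y 0) / e" "(x - y 0) / e < real i + 1"
          using 3(1) e(1) unfolding i_def by (auto simp: of_nat_nat)
        then have i: "y i \<le> x" "x < y (Suc i)"
          using e(1) by (auto simp: y_def field_simps)
        have "i \<le> n"
        proof (rule ccontr)
          assume "\<not> i \<le> n"
          then have "real (Suc n) * e \<le> real i * e" using e(1) by (intro mult_right_mono) auto
          then show False using i(1) 3(2) by (simp add: y_def)
        qed
        have "cdf \<nu> x \<le> cdf \<nu> (y (Suc i))" using i by (intro \<nu>.cdf_nondecreasing) simp
        moreover have "cdf \<mu> (y (Suc (Suc i))) \<le> cdf \<mu> (x + 3 * e)" 
          using i e(1) by (intro \<mu>.cdf_nondecreasing) (simp add: y_Suc)
        moreover have "cdf \<mu> (x - 3 * e) - 2 * e \<le> cdf \<nu> x"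
        proof (cases i)
          case 0
          then have "cdf \<mu> (x - 3 * e) \<le> cdf \<mu> a" 
            using i e(1) by (intro \<mu>.cdf_nondecreasing) (simp add: y_def)
          then show ?thesis using a e(1) \<nu>.cdf_nonneg[of x] by linarith
        next
          case (Suc j)
          have "cdf \<mu> (x - 3 * e) \<le> cdf \<mu> (y j)" 
            using i e(1) Suc by (intro \<mu>.cdf_nondecreasing) (simp add: y_Suc)
          moreover have "cdf \<nu> (y i) \<le> cdf \<nu> x" using i by (intro \<nu>.cdf_nondecreasing) simp
          ultimately show ?thesis using lo[of j] Suc \<open>i \<le> n\<close> e(1) by auto
        qed
        ultimately show ?thesis using up[of "Suc i"] \<open>i \<le> n\<close> e(1) by auto
      qed
    qed
    then have "levy_near \<mu> \<nu> (3 * e)" unfolding levy_near_def by blast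
    then have "levy_dist \<mu> \<nu> \<le> 3 * e" using e by (intro levy_dist_le) auto
    then show ?thesis using e by simp
  qed
  ultimately show ?thesis by blast
qed

theorem mtopology_of_prob_metric: "mtopology_of prob_metric = weak_topology"
proof -
  have eq: "mtopology_of prob_metric = levy.mtopology"
    by (simp add: mtopology_of_def)
  have 1: "openin levy.mtopology {\<mu>. real_distribution \<mu> \<and> (\<integral>x. f x \<partial>\<mu>) \<in> U}"
    if "continuous_on UNIV f" "bounded (range f)" "open (U :: real set)" for f U
    unfolding levy.openin_mtopology
    using levy_ball_in_weak_nbhd[OF that] by (fastforce simp: levy.mball_def)
  have "continuous_map levy.mtopology weak_topology id"
    unfolding weak_topology_def
  proof (rule continuous_on_generated_topo)
    fix V assume "V \<in> {{\<mu>. real_distribution \<mu> \<and> (\<integral>x. f x \<partial>\<mu>) \<in> U} | f U.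
        continuous_on UNIV f \<and> bounded (range f) \<and> open (U :: real set)}"
    then have "openin levy.mtopology V" using 1 by blast
    moreover from this have "id -` V \<inter> topspace levy.mtopology = V"
      using openin_subset by fastforce
    ultimately show "openin levy.mtopology (id -` V \<inter> topspace levy.mtopology)" by simp
  next
    show "id ` topspace levy.mtopology \<subseteq> \<Union> {{\<mu>. real_distribution \<mu> \<and> (\<integral>x. f x \<partial>\<mu>) \<in> U} | f U.
        continuous_on UNIV f \<and> bounded (range f) \<and> open (U :: real set)}"
      using topspace_weak_topology unfolding weak_topology_def by simp
  qed
  moreover have "openin weak_topology S" if S: "openin levy.mtopology S" for S
  proof (subst openin_subopen, intro ballI)
    fix \<mu> assume "\<mu> \<in> S"
    then have \<mu>: "real_distribution \<mu>"
      using S unfolding levy.openin_mtopology by auto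
    obtain r where "0 < r" "levy.mball \<mu> r \<subseteq> S"
      using S \<open>\<mu> \<in> S\<close> unfolding levy.openin_mtopology by blast
    obtain V where V: "openin weak_topology V" "\<mu> \<in> V" "\<forall>\<nu>\<in>V. levy_dist \<mu> \<nu> < r"
      using weak_nbhd_in_levy_ball[OF \<mu> \<open>0 < r\<close>] by blast
    have "V \<subseteq> levy.mball \<mu> r"
      using V \<mu> openin_subset[OF V(1)] by (auto simp: levy.mball_def topspace_weak_topology)
    then show "\<exists>T. openin weak_topology T \<and> \<mu> \<in> T \<and> T \<subseteq> S"
      using V \<open>levy.mball \<mu> r \<subseteq> S\<close> by blast
  qed
  moreover have "openin levy.mtopology S" if "openin weak_topology S" for S
  proof -
    have "openin levy.mtopology {\<mu> \<in> topspace levy.mtopology. id \<mu> \<in> S}"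
      using openin_continuous_map_preimage calculation(1) that by blast
    moreover have "{\<mu> \<in> topspace levy.mtopology. id \<mu> \<in> S} = S"
      using openin_subset[OF that] by (auto simp: topspace_weak_topology)
    ultimately show ?thesis by simp
  qed
  ultimately show ?thesis unfolding eq topology_eq by blast
qed

definition semicircle_density :: "real \<Rightarrow> real" where
  "semicircle_density x = sqrt (4 - x\<^sup>2) / (2 * pi) * indicator {-2..2} x"

end

theory Submission
  imports Defs "Jordan_Normal_Form.Schur_Decomposition"
begin

text \<open>Let \<open>s\<^sub>N(z)\<close> be the Stieltjes transform of the empirical spectral measure.  For bounded entries
  of variance \<open>v\<close>, expanding the resolvent in a single entry gives
  \<open>E[v s\<^sub>N\<^sup>2 + z s\<^sub>N + 1] \<rightarrow> 0\<close> and McDiarmid's inequality makes \<open>s\<^sub>N\<close> concentrate;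
  square integrable entries are truncated, because \<open>s\<^sub>N\<close> is Lipschitz in the Hilbert--Schmidt norm.
  The only probability measure whose Stieltjes transform solves \<open>v s\<^sup>2 + z s + 1 = 0\<close> is the
  semicircle law, so this settles every fixed time.  The same Lipschitz bound transfers the
  convergence from rational times to all times, uniformly, once \<open>sup\<^sub>t |X\<^sub>t|\<close> is square integrable:
  the averaged squared moduli of continuity are then small by a law of large numbers.  For the second
  moment, a Young estimate on intervals where \<open>B\<^sup>H\<close> has small Hoelder norm \<open>G\<close> yields
  \<open>sup\<^sub>t |X\<^sub>t| \<le> exp(c G\<^bsup>1/\<gamma>\<^esup>) (1 + |X\<^sub>0|)\<close> with \<open>1/\<gamma> < 2\<close>, \<open>G\<close> has Gaussian tails, and
  \<open>X\<^sub>0\<close> is independent of \<open>B\<^sup>H\<close>.\<close>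

section \<open>Resolvents of real symmetric matrices\<close>

text \<open>The statement involves uncountably many times and points \<open>z\<close>, so the random
  input is cut down to countably many events: rational times, a countable dense set of
  \<open>z\<close>, truncation levels, modulus indices. Off one null set everything is
  deterministic.

  The entries are not centred, yet only their variance reaches the limit: the mean enters as
  \<open>m / sqrt N\<close> times the sum of all off-diagonal resolvent entries, which is of order
  \<open>N\<close> because the resolvent has operator norm at most \<open>1 / Im z\<close>. After
  division by \<open>N\<close> this vanishes.

  The transform of the semicircle law is never computed: the sign of \<open>Im s\<close> selects the
  root of the quadratic equation, and Stieltjes inversion turns boundary values of
  \<open>Im s\<close> into the density.

  The exponent \<open>1/\<gamma>\<close> in the growth bound is a count of steps. A step of length
  \<open>h\<close> closes the Young estimate when \<open>G h^\<gamma>\<close> is small, and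
  \<open>1 + |X|\<close> at most doubles on it. The absorption presupposes a finite Hoelder seminorm
  of order \<open>\<gamma>\<close>, while a solution is given only with some order above
  \<open>1 - H\<close> that may depend on the path; hence its regularity is upgraded first.\<close>

definition shifted_mat :: "real mat \<Rightarrow> complex \<Rightarrow> complex mat" where
  "shifted_mat A z = map_mat complex_of_real A - z \<cdot>\<^sub>m 1\<^sub>m (dim_row A)"

text \<open>The adjugate formula makes every entry a polynomial in the matrix entries times an
  inverse determinant, so measurability in random entries is immediate. It is a true inverse once
  the determinant is nonzero, which holds for real symmetric matrices and
  \<open>Im z > 0\<close>.\<close>

definition resolvent :: "real mat \<Rightarrow> complex \<Rightarrow> complex mat" where
  "resolvent A z = inverse (det (shifted_mat A z)) \<cdot>\<^sub>m adj_mat (shifted_mat A z)"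

lemma shifted_mat_carrier [simp]: "A \<in> carrier_mat n n \<Longrightarrow> shifted_mat A z \<in> carrier_mat n n"
  by (auto simp: shifted_mat_def)

lemma shifted_mat_nth:
  "A \<in> carrier_mat n n \<Longrightarrow> i < n \<Longrightarrow> j < n \<Longrightarrow>
    shifted_mat A z $$ (i, j) = complex_of_real (A $$ (i, j)) - (if i = j then z else 0)"
  by (auto simp: shifted_mat_def)

lemma resolvent_carrier [simp]: "A \<in> carrier_mat n n \<Longrightarrow> resolvent A z \<in> carrier_mat n n"
  unfolding resolvent_def by (intro smult_carrier_mat adj_mat(1)) simp

lemma sum_norm_mult_le_L2:
  fixes u w :: "'a \<Rightarrow> complex"
  shows "(cmod (\<Sum>k\<in>I. u k * w k))\<^sup>2 \<le> (\<Sum>k\<in>I. (cmod (u k))\<^sup>2) * (\<Sum>k\<in>I. (cmod (w k))\<^sup>2)"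
proof -
  have "cmod (\<Sum>k\<in>I. u k * w k) \<le> (\<Sum>k\<in>I. cmod (u k) * cmod (w k))"
    by (rule order_trans[OF norm_sum]) (simp add: norm_mult)
  then have "(cmod (\<Sum>k\<in>I. u k * w k))\<^sup>2 \<le> (\<Sum>k\<in>I. cmod (u k) * cmod (w k))\<^sup>2"
    by (intro power_mono) auto
  also have "\<dots> \<le> (\<Sum>k\<in>I. (cmod (u k))\<^sup>2) * (\<Sum>k\<in>I. (cmod (w k))\<^sup>2)"
    by (rule Cauchy_Schwarz_ineq_sum)
  finally show ?thesis .
qed

section \<open>Bounds on the resolvent of a single symmetric matrix\<close>

context
  fixes A :: "real mat" and n :: nat and z :: complex
  assumes A: "A \<in> carrier_mat n n" "transpose_mat A = A" and z: "0 < Im z"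
begin

lemma symmetric_nth: "i < n \<Longrightarrow> j < n \<Longrightarrow> A $$ (i, j) = A $$ (j, i)"
  using A by (metis carrier_matD index_transpose_mat(1))

text \<open>The quadratic form of a real symmetric matrix is real at every complex vector, so the
  form of the shifted matrix at \<open>u\<close> has imaginary part exactly \<open>- Im z\<close>
  times the squared norm of \<open>u\<close>; Cauchy-Schwarz finishes. Invertibility and the
  operator norm bound \<open>1 / Im z\<close> both come from this inequality, without
  diagonalisation.\<close>

lemma shifted_vec_bound:
  "(Im z)\<^sup>2 * (\<Sum>k<n. (cmod (u k))\<^sup>2) \<le> (\<Sum>k<n. (cmod (\<Sum>l<n. shifted_mat A z $$ (k, l) * u l))\<^sup>2)"
proof -
  define S W where "S = (\<Sum>k<n. (cmod (u k))\<^sup>2)"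
    and "W = (\<Sum>k<n. (cmod (\<Sum>l<n. shifted_mat A z $$ (k, l) * u l))\<^sup>2)"
  define Q where "Q = (\<Sum>k<n. \<Sum>l<n. cnj (u k) * of_real (A $$ (k, l)) * u l)"
  have "cnj Q = (\<Sum>k<n. \<Sum>l<n. u k * of_real (A $$ (k, l)) * cnj (u l))"
    by (simp add: Q_def)
  also have "\<dots> = (\<Sum>l<n. \<Sum>k<n. u k * of_real (A $$ (k, l)) * cnj (u l))"
    by (rule sum.swap)
  also have "\<dots> = Q"
    unfolding Q_def by (intro sum.cong refl) (auto simp: symmetric_nth)
  finally have Q: "Im Q = 0" by (simp add: complex_eq_iff)
  have "(\<Sum>k<n. cnj (u k) * (\<Sum>l<n. shifted_mat A z $$ (k, l) * u l)) = Q - z * of_real S"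
  proof -
    have "cnj (u k) * (\<Sum>l<n. shifted_mat A z $$ (k, l) * u l) =
        (\<Sum>l<n. cnj (u k) * of_real (A $$ (k, l)) * u l) - z * of_real ((cmod (u k))\<^sup>2)" if "k < n" for k
    proof -
      have "cnj (u k) * (\<Sum>l<n. shifted_mat A z $$ (k, l) * u l) =
        (\<Sum>l<n. cnj (u k) * of_real (A $$ (k, l)) * u l - (if k = l then z * (u k * cnj (u k)) else 0))"
        unfolding sum_distrib_left
        by (intro sum.cong refl) (auto simp: shifted_mat_nth[OF A(1)] that algebra_simps)
      also have "\<dots> = (\<Sum>l<n. cnj (u k) * of_real (A $$ (k, l)) * u l) - z * (u k * cnj (u k))"
        using that by (simp add: sum_subtractf)
      also have "u k * cnj (u k) = of_real ((cmod (u k))\<^sup>2)"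
        by (rule complex_norm_square[symmetric])
      finally show ?thesis .
    qed
    then have "(\<Sum>k<n. cnj (u k) * (\<Sum>l<n. shifted_mat A z $$ (k, l) * u l)) =
        (\<Sum>k<n. (\<Sum>l<n. cnj (u k) * of_real (A $$ (k, l)) * u l) - z * of_real ((cmod (u k))\<^sup>2))"
      by (intro sum.cong refl) simp
    then show ?thesis by (simp only: Q_def S_def sum_subtractf sum_distrib_left of_real_sum)
  qed
  then have "Im z * S = - Im (\<Sum>k<n. cnj (u k) * (\<Sum>l<n. shifted_mat A z $$ (k, l) * u l))"
    using Q by (simp only:) simp
  then have "\<bar>Im z * S\<bar> \<le> cmod (\<Sum>k<n. cnj (u k) * (\<Sum>l<n. shifted_mat A z $$ (k, l) * u l))"
    by (simp only: abs_minus_cancel abs_Im_le_cmod)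
  then have "(Im z * S)\<^sup>2 \<le> (cmod (\<Sum>k<n. cnj (u k) * (\<Sum>l<n. shifted_mat A z $$ (k, l) * u l)))\<^sup>2"
    by (simp only: abs_le_square_iff[symmetric] abs_norm_cancel)
  also have "\<dots> \<le> S * W"
    using sum_norm_mult_le_L2[of "\<lambda>k. cnj (u k)"] by (simp add: S_def W_def)
  finally have "S * ((Im z)\<^sup>2 * S) \<le> S * W" by (simp add: power2_eq_square algebra_simps)
  moreover have "0 \<le> S" "0 \<le> W" by (auto simp: S_def W_def intro!: sum_nonneg)
  ultimately have "(Im z)\<^sup>2 * S \<le> W"
    by (cases "S = 0") auto
  then show ?thesis by (simp add: S_def W_def)
qed

lemma det_shifted_mat_nonzero: "det (shifted_mat A z) \<noteq> 0"
proof
  assume "det (shifted_mat A z) = 0"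
  then obtain v where v: "v \<in> carrier_vec n" "v \<noteq> 0\<^sub>v n" "shifted_mat A z *\<^sub>v v = 0\<^sub>v n"
    using det_0_iff_vec_prod_zero_field[OF shifted_mat_carrier[OF A(1)]] by auto
  have "(\<Sum>l<n. shifted_mat A z $$ (k, l) * vec_index v l) = 0" if "k < n" for k
  proof -
    have "(shifted_mat A z *\<^sub>v v) $ k = 0" using v(3) that by simp
    then show ?thesis using that v(1) carrier_matD[OF shifted_mat_carrier[OF A(1), of z]]
      by (simp add: scalar_prod_def lessThan_atLeast0)
  qed
  then have "(Im z)\<^sup>2 * (\<Sum>k<n. (cmod (vec_index v k))\<^sup>2) \<le> 0"
    using shifted_vec_bound[of "\<lambda>k. vec_index v k"] by simp
  then have "(\<Sum>k<n. (cmod (vec_index v k))\<^sup>2) \<le> 0"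
    using z by (simp add: mult_le_0_iff)
  then have "(\<Sum>k<n. (cmod (vec_index v k))\<^sup>2) = 0"
    by (intro antisym sum_nonneg) auto
  then have "v $ k = 0" if "k < n" for k using that by (simp add: sum_nonneg_eq_0_iff)
  then have "v = 0\<^sub>v n" using v(1) by auto
  then show False using v by simp
qed

lemma resolvent_right: "shifted_mat A z * resolvent A z = 1\<^sub>m n"
  and resolvent_left: "resolvent A z * shifted_mat A z = 1\<^sub>m n"
proof -
  note c = shifted_mat_carrier[OF A(1), of z]
  note adj = adj_mat[OF c]
  have "inverse d \<cdot>\<^sub>m (d \<cdot>\<^sub>m 1\<^sub>m n) = 1\<^sub>m n" if "d \<noteq> 0" for d :: complex
    using that by (intro eq_matI) auto
  then show "shifted_mat A z * resolvent A z = 1\<^sub>m n" "resolvent A z * shifted_mat A z = 1\<^sub>m n"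
    unfolding resolvent_def mult_smult_distrib[OF c adj(1)] mult_smult_assoc_mat[OF adj(1) c] adj(2,3)
    using det_shifted_mat_nonzero by simp_all
qed

lemma resolvent_right_sum:
  "i < n \<Longrightarrow> j < n \<Longrightarrow> (\<Sum>k<n. shifted_mat A z $$ (i, k) * resolvent A z $$ (k, j)) = (if i = j then 1 else 0)"
  and resolvent_left_sum:
  "i < n \<Longrightarrow> j < n \<Longrightarrow> (\<Sum>k<n. resolvent A z $$ (i, k) * shifted_mat A z $$ (k, j)) = (if i = j then 1 else 0)"
  using resolvent_right resolvent_left carrier_matD[OF shifted_mat_carrier[OF A(1), of z]]
    carrier_matD[OF resolvent_carrier[OF A(1), of z]]
  by (auto simp: scalar_prod_def lessThan_atLeast0 mat_eq_iff)

text \<open>The shifted matrix \<open>C\<close> is complex symmetric, not Hermitian. Transposing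
  \<open>C R = 1\<close> shows that the transpose of the resolvent is a left inverse of
  \<open>C\<close>, hence the resolvent itself.\<close>

lemma resolvent_symmetric: 
  assumes "i < n" "j < n" 
  shows "resolvent A z $$ (i, j) = resolvent A z $$ (j, i)"
proof -
  let ?C = "shifted_mat A z" and ?R = "resolvent A z"
  have c: "?C \<in> carrier_mat n n" "?R \<in> carrier_mat n n" using A by auto
  have "transpose_mat ?C = ?C" using A(1) carrier_matD[OF c(1)]
    by (intro eq_matI) (auto simp: shifted_mat_nth[OF A(1)] symmetric_nth)
  then have "transpose_mat ?R * ?C = 1\<^sub>m n"
    using resolvent_right c by (metis transpose_mult transpose_one)
  then have "transpose_mat ?R * (?C * ?R) = ?R"
    using c by (subst assoc_mult_mat[symmetric, of _ n n _ n _ n]) auto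
  then have "transpose_mat ?R = ?R"
    using c by (simp add: resolvent_right)
  then show ?thesis using assms c by (metis carrier_matD index_transpose_mat(1))
qed

text \<open>\<open>shifted_vec_bound\<close> for the vector \<open>R v\<close>, whose image under
  the shifted matrix is \<open>v\<close>.\<close>

lemma resolvent_vec_bound:
  "(\<Sum>k<n. (cmod (\<Sum>l<n. resolvent A z $$ (k, l) * v l))\<^sup>2) \<le> (\<Sum>k<n. (cmod (v k))\<^sup>2) / (Im z)\<^sup>2"
proof -
  have "(\<Sum>l<n. shifted_mat A z $$ (k, l) * (\<Sum>m<n. resolvent A z $$ (l, m) * v m)) = v k" if "k < n" for k
  proof -
    have "(\<Sum>l<n. shifted_mat A z $$ (k, l) * (\<Sum>m<n. resolvent A z $$ (l, m) * v m))
       = (\<Sum>l<n. \<Sum>m<n. shifted_mat A z $$ (k, l) * resolvent A z $$ (l, m) * v m)"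
      by (simp add: sum_distrib_left mult.assoc)
    also have "\<dots> = (\<Sum>m<n. \<Sum>l<n. shifted_mat A z $$ (k, l) * resolvent A z $$ (l, m) * v m)"
      by (rule sum.swap)
    also have "\<dots> = (\<Sum>m<n. (if k = m then 1 else 0) * v m)"
      using that by (intro sum.cong refl) (simp add: resolvent_right_sum flip: sum_distrib_right)
    also have "\<dots> = v k" using that by (simp add: if_distrib[of "\<lambda>x. x * _"] cong: if_cong)
    finally show ?thesis .
  qed
  then have "(\<Sum>k<n. (cmod (v k))\<^sup>2) =
      (\<Sum>k<n. (cmod (\<Sum>l<n. shifted_mat A z $$ (k, l) * (\<Sum>m<n. resolvent A z $$ (l, m) * v m)))\<^sup>2)"
    by simp
  then show ?thesis
    using shifted_vec_bound[of "\<lambda>l. \<Sum>m<n. resolvent A z $$ (l, m) * v m"] z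
    by (simp add: field_simps)
qed

lemma resolvent_column_bound: "j < n \<Longrightarrow> (\<Sum>k<n. (cmod (resolvent A z $$ (k, j)))\<^sup>2) \<le> 1 / (Im z)\<^sup>2"
  using resolvent_vec_bound[of "\<lambda>l. if l = j then 1 else 0"]
  by (simp add: if_distrib[of "\<lambda>x. _ * x"] if_distrib[of cmod] if_distrib[of "\<lambda>x. x\<^sup>2"] cong: if_cong)

lemma resolvent_entry_bound: 
  assumes "i < n" "j < n" shows "cmod (resolvent A z $$ (i, j)) \<le> 1 / Im z"
proof -
  have "(cmod (resolvent A z $$ (i, j)))\<^sup>2 \<le> (\<Sum>k<n. (cmod (resolvent A z $$ (k, j)))\<^sup>2)"
    using assms by (intro member_le_sum) auto
  also have "\<dots> \<le> (1 / Im z)\<^sup>2" using resolvent_column_bound[OF assms(2)] by (simp add: power_divide)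
  finally show ?thesis using z by (simp add: power2_le_iff_abs_le)
qed

lemma resolvent_sum_sq_bound:
  "(\<Sum>i<n. \<Sum>j<n. (cmod (resolvent A z $$ (j, i)))\<^sup>2) \<le> real n / (Im z)\<^sup>2"
  using sum_bounded_above[of "{..<n}" "\<lambda>i. \<Sum>j<n. (cmod (resolvent A z $$ (j, i)))\<^sup>2" "1 / (Im z)\<^sup>2"]
    resolvent_column_bound by simp

text \<open>The sum is the bilinear form of the resolvent at the all-ones vector, whose squared norm
  is \<open>n\<close>. The entrywise bound would only give order \<open>n\<^sup>2\<close>; the
  gained factor is what makes the common mean of the entries harmless.\<close>

lemma resolvent_sum_bound:
  "cmod (\<Sum>i<n. \<Sum>j<n. resolvent A z $$ (i, j)) \<le> real n / Im z"
proof -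
  define r where "r i = (\<Sum>j<n. resolvent A z $$ (i, j))" for i
  have "(\<Sum>i<n. (cmod (r i))\<^sup>2) \<le> real n / (Im z)\<^sup>2"
    using resolvent_vec_bound[of "\<lambda>_. 1"] by (simp add: r_def)
  then have "(cmod (\<Sum>i<n. r i))\<^sup>2 \<le> real n * (real n / (Im z)\<^sup>2)"
    using sum_norm_mult_le_L2[of "\<lambda>_. 1" r "{..<n}"]
      mult_left_mono[of "\<Sum>i<n. (cmod (r i))\<^sup>2" "real n / (Im z)\<^sup>2" "real n"]
    by simp
  also have "\<dots> = (real n / Im z)\<^sup>2" by (simp add: power2_eq_square)
  finally show ?thesis using z by (simp add: power2_le_iff_abs_le r_def)
qed

text \<open>The trace of \<open>(A - z) R = 1\<close>. In expectation its left side will be expanded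
  entry by entry.\<close>

lemma resolvent_trace_identity:
  "(\<Sum>i<n. \<Sum>j<n. of_real (A $$ (i, j)) * resolvent A z $$ (j, i)) =
    of_nat n + z * (\<Sum>i<n. resolvent A z $$ (i, i))"
proof -
  have "(\<Sum>j<n. of_real (A $$ (i, j)) * resolvent A z $$ (j, i)) = 1 + z * resolvent A z $$ (i, i)" 
    if "i < n" for i
  proof -
    have "1 = (\<Sum>j<n. shifted_mat A z $$ (i, j) * resolvent A z $$ (j, i))"
      using resolvent_right_sum[OF that that] by simp
    also have "\<dots> = (\<Sum>j<n. of_real (A $$ (i, j)) * resolvent A z $$ (j, i) - (if i = j then z * resolvent A z $$ (i, i) else 0))"
      using that by (intro sum.cong refl) (auto simp: shifted_mat_nth[OF A(1)] algebra_simps)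
    also have "\<dots> = (\<Sum>j<n. of_real (A $$ (i, j)) * resolvent A z $$ (j, i)) - z * resolvent A z $$ (i, i)"
      using that by (simp add: sum_subtractf)
    finally show ?thesis by (simp add: algebra_simps)
  qed
  then show ?thesis by (simp add: sum.distrib sum_distrib_left)
qed

end

section \<open>Perturbation of the resolvent\<close>

lemma resolvent_diff:
  assumes A: "A \<in> carrier_mat n n" "transpose_mat A = A"
    and B: "B \<in> carrier_mat n n" "transpose_mat B = B" and z: "0 < Im z" and ij: "i < n" "j < n"
  shows "resolvent A z $$ (i, j) - resolvent B z $$ (i, j) =
    (\<Sum>k<n. \<Sum>l<n. resolvent A z $$ (i, k) * of_real (B $$ (k, l) - A $$ (k, l)) * resolvent B z $$ (l, j))"
proof -
  let ?R = "\<lambda>i j. resolvent A z $$ (i, j)" and ?S = "\<lambda>i j. resolvent B z $$ (i, j)"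
  \<comment> \<open>\<open>B - A\<close> is the difference of the two shifted matrices, and each of
    them cancels against its own resolvent.\<close>
  have "(\<Sum>k<n. \<Sum>l<n. ?R i k * of_real (B $$ (k, l) - A $$ (k, l)) * ?S l j) =
     (\<Sum>k<n. \<Sum>l<n. ?R i k * (shifted_mat B z $$ (k, l) * ?S l j)) - (\<Sum>k<n. \<Sum>l<n. ?R i k * shifted_mat A z $$ (k, l) * ?S l j)"
    by (simp add: sum_subtractf[symmetric] shifted_mat_nth[OF A(1)] shifted_mat_nth[OF B(1)] algebra_simps)
  also have "(\<Sum>k<n. \<Sum>l<n. ?R i k * (shifted_mat B z $$ (k, l) * ?S l j)) = ?R i j"
    using ij by (simp add: sum_distrib_left[symmetric] resolvent_right_sum[OF B z] if_distrib[of "\<lambda>x. _ * x"] cong: if_cong)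
  also have "(\<Sum>k<n. \<Sum>l<n. ?R i k * shifted_mat A z $$ (k, l) * ?S l j) =
      (\<Sum>l<n. \<Sum>k<n. ?R i k * shifted_mat A z $$ (k, l) * ?S l j)"
    by (rule sum.swap)
  also have "\<dots> = ?S i j"
    using ij by (simp add: sum_distrib_right[symmetric] resolvent_left_sum[OF A z] if_distrib[of "\<lambda>x. x * _"] cong: if_cong)
  finally show ?thesis by simp
qed

text \<open>The trace of the resolvent identity, with the factors rotated cyclically so that the
  perturbation is paired with the entries of one product of resolvents.\<close>

lemma resolvent_trace_diff:
  assumes A: "A \<in> carrier_mat n n" "transpose_mat A = A"
    and B: "B \<in> carrier_mat n n" "transpose_mat B = B" and z: "0 < Im z"
  shows "(\<Sum>i<n. resolvent A z $$ (i, i)) - (\<Sum>i<n. resolvent B z $$ (i, i)) =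
    (\<Sum>k<n. \<Sum>l<n. of_real (B $$ (k, l) - A $$ (k, l)) * (\<Sum>i<n. resolvent B z $$ (l, i) * resolvent A z $$ (i, k)))"
proof -
  let ?R = "\<lambda>i j. resolvent A z $$ (i, j)" and ?S = "\<lambda>i j. resolvent B z $$ (i, j)"
  let ?D = "\<lambda>k l. of_real (B $$ (k, l) - A $$ (k, l)) :: complex"
  have "(\<Sum>i<n. ?R i i) - (\<Sum>i<n. ?S i i) = (\<Sum>i<n. \<Sum>k<n. \<Sum>l<n. ?R i k * ?D k l * ?S l i)"
    unfolding sum_subtractf[symmetric] by (intro sum.cong refl) (simp add: resolvent_diff[OF A B z])
  also have "\<dots> = (\<Sum>k<n. \<Sum>i<n. \<Sum>l<n. ?R i k * ?D k l * ?S l i)" by (rule sum.swap)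
  also have "\<dots> = (\<Sum>k<n. \<Sum>l<n. \<Sum>i<n. ?R i k * ?D k l * ?S l i)"
    by (rule sum.cong[OF refl]) (rule sum.swap)
  also have "\<dots> = (\<Sum>k<n. \<Sum>l<n. ?D k l * (\<Sum>i<n. ?S l i * ?R i k))"
    unfolding sum_distrib_left by (intro sum.cong refl) (simp add: mult_ac)
  finally show ?thesis .
qed

text \<open>A column of the product is the resolvent of \<open>B\<close> applied to a column of the
  resolvent of \<open>A\<close>, and each of the two contributes a factor
  \<open>1 / (Im z)\<^sup>2\<close> to the squared norm.\<close>

lemma resolvent_product_entry_bound:
  assumes A: "A \<in> carrier_mat n n" "transpose_mat A = A"
    and B: "B \<in> carrier_mat n n" "transpose_mat B = B" and z: "0 < Im z" and k: "k < n"
  shows "(\<Sum>l<n. (cmod (\<Sum>i<n. resolvent B z $$ (l, i) * resolvent A z $$ (i, k)))\<^sup>2) \<le> 1 / (Im z)^4"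
proof -
  have "(\<Sum>l<n. (cmod (\<Sum>i<n. resolvent B z $$ (l, i) * resolvent A z $$ (i, k)))\<^sup>2) \<le> (\<Sum>i<n. (cmod (resolvent A z $$ (i, k)))\<^sup>2) / (Im z)\<^sup>2"
    by (rule resolvent_vec_bound[OF B z])
  also have "\<dots> \<le> (1 / (Im z)\<^sup>2) / (Im z)\<^sup>2"
    by (intro divide_right_mono resolvent_column_bound[OF A z k]) auto
  finally show ?thesis by (simp add: power_divide eval_nat_numeral field_simps)
qed

text \<open>Cauchy-Schwarz for the Hilbert-Schmidt inner product: the product of resolvents has
  \<open>n\<close> columns of squared norm at most \<open>1 / (Im z)^4\<close>. After normalisation,
  the Stieltjes transform moves by at most a root mean square of the changes of the entries.\<close>

lemma resolvent_trace_diff_HS: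
  assumes A: "A \<in> carrier_mat n n" "transpose_mat A = A"
    and B: "B \<in> carrier_mat n n" "transpose_mat B = B" and z: "0 < Im z"
  shows "cmod ((\<Sum>i<n. resolvent A z $$ (i, i)) - (\<Sum>i<n. resolvent B z $$ (i, i))) \<le>
     sqrt (real n * (\<Sum>k<n. \<Sum>l<n. (A $$ (k, l) - B $$ (k, l))\<^sup>2)) / (Im z)\<^sup>2"
proof -
  let ?P = "\<lambda>k l. (\<Sum>i<n. resolvent B z $$ (l, i) * resolvent A z $$ (i, k))"
  let ?D = "\<lambda>k l. of_real (B $$ (k, l) - A $$ (k, l)) :: complex"
  let ?d = "cmod ((\<Sum>i<n. resolvent A z $$ (i, i)) - (\<Sum>i<n. resolvent B z $$ (i, i)))"
  have "?d\<^sup>2 = (cmod (\<Sum>p\<in>{..<n} \<times> {..<n}. ?D (fst p) (snd p) * ?P (fst p) (snd p)))\<^sup>2"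
    unfolding resolvent_trace_diff[OF A B z] by (simp add: sum.cartesian_product split_beta)
  also have "\<dots> \<le> (\<Sum>p\<in>{..<n} \<times> {..<n}. (cmod (?D (fst p) (snd p)))\<^sup>2) * (\<Sum>p\<in>{..<n} \<times> {..<n}. (cmod (?P (fst p) (snd p)))\<^sup>2)"
    by (rule sum_norm_mult_le_L2)
  also have "\<dots> = (\<Sum>k<n. \<Sum>l<n. (cmod (?D k l))\<^sup>2) * (\<Sum>k<n. \<Sum>l<n. (cmod (?P k l))\<^sup>2)"
    by (simp add: sum.cartesian_product split_beta del: norm_of_real)
  also have "\<dots> \<le> (\<Sum>k<n. \<Sum>l<n. (cmod (?D k l))\<^sup>2) * (\<Sum>k<n. 1 / (Im z)^4)"
    by (intro mult_left_mono sum_mono resolvent_product_entry_bound A B z sum_nonneg) auto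
  also have "(\<Sum>k<n. \<Sum>l<n. (cmod (?D k l))\<^sup>2) = (\<Sum>k<n. \<Sum>l<n. (A $$ (k, l) - B $$ (k, l))\<^sup>2)"
    unfolding norm_of_real by (simp add: power2_commute)
  also have "\<dots> * (\<Sum>k<n. 1 / (Im z)^4) = (sqrt (real n * (\<Sum>k<n. \<Sum>l<n. (A $$ (k, l) - B $$ (k, l))\<^sup>2)) / (Im z)\<^sup>2)\<^sup>2"
    using z by (simp add: power_divide real_sqrt_pow2 sum_nonneg mult_ac)
  finally show ?thesis by (rule power2_le_imp_le) (auto intro!: divide_nonneg_nonneg mult_nonneg_nonneg sum_nonneg)
qed

text \<open>A symmetric change of one entry touches at most two positions, and the entries of the
  product of resolvents are at most \<open>1 / (Im z)\<^sup>2\<close>. So the trace moves by an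
  amount free of \<open>n\<close>; this is the bounded difference behind concentration.\<close>

lemma resolvent_trace_diff_entry:
  assumes A: "A \<in> carrier_mat n n" "transpose_mat A = A"
    and B: "B \<in> carrier_mat n n" "transpose_mat B = B" and z: "0 < Im z"
    and ij: "i < n" "j < n" and \<delta>: "\<bar>A $$ (i, j) - B $$ (i, j)\<bar> \<le> \<delta>"
    and other: "\<And>k l. k < n \<Longrightarrow> l < n \<Longrightarrow> \<not> (k = i \<and> l = j) \<Longrightarrow> \<not> (k = j \<and> l = i) \<Longrightarrow> A $$ (k, l) = B $$ (k, l)"
  shows "cmod ((\<Sum>i<n. resolvent A z $$ (i, i)) - (\<Sum>i<n. resolvent B z $$ (i, i))) \<le> 2 * \<delta> / (Im z)\<^sup>2"
proof -
  let ?P = "\<lambda>k l. (\<Sum>i<n. resolvent B z $$ (l, i) * resolvent A z $$ (i, k))"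
  let ?D = "\<lambda>k l. of_real (B $$ (k, l) - A $$ (k, l)) :: complex"
  have P: "cmod (?P k l) \<le> 1 / (Im z)\<^sup>2" if "k < n" "l < n" for k l
  proof -
    have "(cmod (?P k l))\<^sup>2 \<le> (\<Sum>l<n. (cmod (?P k l))\<^sup>2)"
      using that by (intro member_le_sum) auto
    also have "\<dots> \<le> (1 / (Im z)\<^sup>2)\<^sup>2"
      using resolvent_product_entry_bound[OF A B z \<open>k < n\<close>] by (simp add: power_divide)
    finally show ?thesis by (rule power2_le_imp_le) simp
  qed
  have "0 \<le> \<delta>" using \<delta> by linarith
  have sym: "A $$ (j, i) - B $$ (j, i) = A $$ (i, j) - B $$ (i, j)"
    using symmetric_nth[OF A z ij] symmetric_nth[OF B z ij] by simp
  have D: "cmod (?D k l * ?P k l) \<le> \<delta> * (1 / (Im z)\<^sup>2)" if "(k, l) \<in> {(i, j), (j, i)}" for k l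
  proof -
    have "cmod (?D k l) \<le> \<delta>"
      unfolding norm_of_real using that \<delta> sym by auto
    then show ?thesis unfolding norm_mult using that ij \<open>0 \<le> \<delta>\<close> by (intro mult_mono P) auto
  qed
  have "(\<Sum>k<n. \<Sum>l<n. ?D k l * ?P k l) = (\<Sum>p\<in>{..<n} \<times> {..<n}. ?D (fst p) (snd p) * ?P (fst p) (snd p))"
    by (simp add: sum.cartesian_product split_beta)
  also have "\<dots> = (\<Sum>p\<in>{(i, j), (j, i)}. ?D (fst p) (snd p) * ?P (fst p) (snd p))"
  proof (intro sum.mono_neutral_right ballI)
    fix p assume "p \<in> {..<n} \<times> {..<n} - {(i, j), (j, i)}"
    then have "A $$ (fst p, snd p) = B $$ (fst p, snd p)" by (intro other) auto
    then show "?D (fst p) (snd p) * ?P (fst p) (snd p) = 0" by simp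
  qed (use ij in auto)
  finally have "cmod (\<Sum>k<n. \<Sum>l<n. ?D k l * ?P k l) \<le> (\<Sum>p\<in>{(i, j), (j, i)}. cmod (?D (fst p) (snd p) * ?P (fst p) (snd p)))"
    by (simp only: norm_sum)
  also have "\<dots> \<le> of_nat (card {(i, j), (j, i)}) * (\<delta> * (1 / (Im z)\<^sup>2))"
  proof (rule sum_bounded_above)
    fix p assume "p \<in> {(i, j), (j, i)}"
    then have "(fst p, snd p) \<in> {(i, j), (j, i)}" by simp
    then show "cmod (?D (fst p) (snd p) * ?P (fst p) (snd p)) \<le> \<delta> * (1 / (Im z)\<^sup>2)" by (rule D)
  qed
  also have "\<dots> \<le> 2 * (\<delta> * (1 / (Im z)\<^sup>2))"
  proof (rule mult_right_mono)
    show "of_nat (card {(i, j), (j, i)}) \<le> (2 :: real)" by (cases "i = j") auto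
    show "0 \<le> \<delta> * (1 / (Im z)\<^sup>2)" using \<open>0 \<le> \<delta>\<close> by simp
  qed
  finally show ?thesis unfolding resolvent_trace_diff[OF A B z] by simp
qed

section \<open>Measurability of determinants and resolvents\<close>

lemma det_measurable:
  fixes C :: "'w \<Rightarrow> complex mat"
  assumes "\<And>\<omega>. C \<omega> \<in> carrier_mat n n"
    and "\<And>i j. i < n \<Longrightarrow> j < n \<Longrightarrow> (\<lambda>\<omega>. C \<omega> $$ (i, j)) \<in> borel_measurable M"
  shows "(\<lambda>\<omega>. det (C \<omega>)) \<in> borel_measurable M"
proof -
  have "(\<lambda>\<omega>. det (C \<omega>)) = (\<lambda>\<omega>. \<Sum>p | p permutes {0..<n}. signof p * (\<Prod>i = 0..<n. C \<omega> $$ (i, p i)))"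
    using det_def'[OF assms(1)] by blast
  also have "\<dots> \<in> borel_measurable M"
    by (intro borel_measurable_sum borel_measurable_times borel_measurable_const borel_measurable_prod assms(2))
      (auto dest: permutes_in_image)
  finally show ?thesis .
qed

lemma resolvent_measurable:
  fixes A :: "'w \<Rightarrow> real mat"
  assumes A: "\<And>\<omega>. A \<omega> \<in> carrier_mat n n"
    and meas: "\<And>i j. i < n \<Longrightarrow> j < n \<Longrightarrow> (\<lambda>\<omega>. A \<omega> $$ (i, j)) \<in> borel_measurable M"
    and ij: "i < n" "j < n"
  shows "(\<lambda>\<omega>. resolvent (A \<omega>) z $$ (i, j)) \<in> borel_measurable M"
proof -
  note c = shifted_mat_carrier[OF A]
  have m: "(\<lambda>\<omega>. shifted_mat (A \<omega>) z $$ (k, l)) \<in> borel_measurable M" if "k < n" "l < n" for k l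
    unfolding shifted_mat_nth[OF A that] using meas[OF that] by measurable
  have "(\<lambda>\<omega>. det (mat_delete (shifted_mat (A \<omega>) z) j i)) \<in> borel_measurable M"
  proof (rule det_measurable[where n = "n - 1"])
    show "mat_delete (shifted_mat (A \<omega>) z) j i \<in> carrier_mat (n - 1) (n - 1)" for \<omega>
      by (rule mat_delete_carrier[OF c])
    fix k l assume kl: "k < n - 1" "l < n - 1"
    have "(\<lambda>\<omega>. mat_delete (shifted_mat (A \<omega>) z) j i $$ (k, l)) =
        (\<lambda>\<omega>. shifted_mat (A \<omega>) z $$ (if k < j then k else Suc k, if l < i then l else Suc l))"
      using kl carrier_matD[OF c] unfolding mat_delete_def by (intro ext) (subst index_mat; simp)
    also have "\<dots> \<in> borel_measurable M"
      using kl by (intro m) auto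
    finally show "(\<lambda>\<omega>. mat_delete (shifted_mat (A \<omega>) z) j i $$ (k, l)) \<in> borel_measurable M" .
  qed
  then have "(\<lambda>\<omega>. inverse (det (shifted_mat (A \<omega>) z)) * ((-1) ^ (j + i) * det (mat_delete (shifted_mat (A \<omega>) z) j i)))
      \<in> borel_measurable M"
    using det_measurable[OF c m] by measurable
  also have "(\<lambda>\<omega>. inverse (det (shifted_mat (A \<omega>) z)) * ((-1) ^ (j + i) * det (mat_delete (shifted_mat (A \<omega>) z) j i)))
      = (\<lambda>\<omega>. resolvent (A \<omega>) z $$ (i, j))"
    using ij carrier_matD[OF c] unfolding resolvent_def adj_mat_def cofactor_def by auto
  finally show ?thesis .
qed

section \<open>Traces in terms of the ordered eigenvalues\<close>

lemma trace_mult_commute: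
  fixes X Y :: "'a :: comm_semiring_0 mat"
  assumes "X \<in> carrier_mat n n" "Y \<in> carrier_mat n n"
  shows "(\<Sum>i<n. (X * Y) $$ (i, i)) = (\<Sum>i<n. (Y * X) $$ (i, i))"
proof -
  have "(\<Sum>i<n. (X * Y) $$ (i, i)) = (\<Sum>i<n. \<Sum>k<n. X $$ (i, k) * Y $$ (k, i))"
    using assms by (intro sum.cong refl) (auto simp: scalar_prod_def lessThan_atLeast0)
  also have "\<dots> = (\<Sum>k<n. \<Sum>i<n. X $$ (i, k) * Y $$ (k, i))" by (rule sum.swap)
  also have "\<dots> = (\<Sum>i<n. (Y * X) $$ (i, i))"
    using assms by (intro sum.cong refl) (auto simp: scalar_prod_def lessThan_atLeast0 mult.commute)
  finally show ?thesis .
qed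

text \<open>A left inverse of an upper triangular matrix is upper triangular too, by induction over
  the columns; on the diagonal the product then has a single surviving term.\<close>

lemma triangular_inverse_diag:
  fixes T :: "'a :: field mat"
  assumes T: "T \<in> carrier_mat n n" "upper_triangular T" and G: "G \<in> carrier_mat n n" "G * T = 1\<^sub>m n"
    and diag: "\<And>i. i < n \<Longrightarrow> T $$ (i, i) \<noteq> 0" and j: "j < n"
  shows "G $$ (j, j) = 1 / T $$ (j, j)"
proof -
  have prod: "(\<Sum>k<n. G $$ (i, k) * T $$ (k, j)) = (if i = j then 1 else 0)" if "i < n" "j < n" for i j
  proof -
    have "(G * T) $$ (i, j) = (\<Sum>k<n. G $$ (i, k) * T $$ (k, j))"
      using that T G(1) by (auto simp: scalar_prod_def lessThan_atLeast0)
    then show ?thesis using that G(2) by simp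
  qed
  have zero: "T $$ (k, j) = 0" if "j < k" "k < n" for k j
    using T that by (auto simp: upper_triangular_def)
  have lower: "\<forall>i<n. j < i \<longrightarrow> G $$ (i, j) = 0" if "j < n" for j
    using that
  proof (induction j rule: less_induct)
    case (less j)
    show ?case
    proof (intro allI impI)
      fix i assume i: "i < n" "j < i"
      have "(\<Sum>k<n. G $$ (i, k) * T $$ (k, j)) = (\<Sum>k\<in>{j}. G $$ (i, k) * T $$ (k, j))"
      proof (intro sum.mono_neutral_right ballI)
        fix k assume "k \<in> {..<n} - {j}"
        then consider "k < j" | "j < k" "k < n" by force
        then show "G $$ (i, k) * T $$ (k, j) = 0"
          using less i zero by cases (auto simp: less.prems)
      qed (use less.prems in auto)
      then show "G $$ (i, j) = 0" using prod[OF i(1) less.prems] i diag[OF less.prems] by simp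
    qed
  qed
  have "(\<Sum>k<n. G $$ (j, k) * T $$ (k, j)) = (\<Sum>k\<in>{j}. G $$ (j, k) * T $$ (k, j))"
  proof (intro sum.mono_neutral_right ballI)
    fix k assume "k \<in> {..<n} - {j}"
    then consider "k < j" "k < n" | "j < k" "k < n" by force
    then show "G $$ (j, k) * T $$ (k, j) = 0"
      using lower j zero by cases auto
  qed (use j in auto)
  then show ?thesis using prod[OF j j] diag[OF j] by (simp add: field_simps)
qed

lemma linear_factors_if_size_proots:
  fixes p :: "real poly"
  assumes "monic p" "size (proots p) = degree p"
  shows "p = (\<Prod>a\<in>#proots p. [:- a, 1:])"
  using assms
proof (induction "degree p" arbitrary: p)
  case 0
  then show ?case by (auto simp: monic_degree_0)
next
  case (Suc n)
  then have "proots p \<noteq> {#}" by auto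
  then obtain r where "r \<in># proots p" by blast
  moreover have "p \<noteq> 0" using Suc.prems(1) by auto
  ultimately have "poly p r = 0" by simp
  then obtain q where q: "p = [:-r, 1:] * q" by (auto simp: poly_eq_0_iff_dvd elim: dvdE)
  have "q \<noteq> 0" using q \<open>p \<noteq> 0\<close> by auto
  have deg: "degree p = Suc (degree q)" unfolding q using \<open>q \<noteq> 0\<close> by (subst degree_mult_eq) auto
  have roots: "proots p = add_mset r (proots q)" unfolding q using \<open>q \<noteq> 0\<close> by (subst proots_mult) auto
  have "monic q" using Suc.prems(1) unfolding q lead_coeff_mult by simp
  then have "q = (\<Prod>a\<in>#proots q. [:- a, 1:])"
    using Suc roots deg by auto
  then show ?case using q roots by simp
qed

context
  fixes A :: "real mat" and n :: nat
  assumes A: "A \<in> carrier_mat n n" "transpose_mat A = A"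
begin

lemma char_poly_ordered_eigenvalues:
  "char_poly A = (\<Prod>e\<leftarrow>ordered_eigenvalues A. [:- e, 1:])"
proof -
  have "length (ordered_eigenvalues A) = size (proots (char_poly A))"
    unfolding ordered_eigenvalues_def by (metis mset_sorted_list_of_multiset size_mset)
  then have "size (proots (char_poly A)) = degree (char_poly A)"
    using length_ordered_eigenvalues[OF A] degree_monic_char_poly[OF A(1)] by simp
  then have "char_poly A = (\<Prod>a\<in>#proots (char_poly A). [:- a, 1:])"
    using degree_monic_char_poly[OF A(1)] by (intro linear_factors_if_size_proots) auto
  also have "\<dots> = (\<Prod>e\<leftarrow>ordered_eigenvalues A. [:- e, 1:])"
    unfolding ordered_eigenvalues_def by (metis mset_map mset_sorted_list_of_multiset prod_mset_prod_list)
  finally show ?thesis .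
qed

text \<open>All eigenvalues are real, so the matrix can be made triangular over the reals.
  Similarity is enough, since only traces are compared afterwards.\<close>

lemma schur_ordered_eigenvalues:
  obtains B P Q where "B \<in> carrier_mat n n" "P \<in> carrier_mat n n" "Q \<in> carrier_mat n n"
    "P * Q = 1\<^sub>m n" "Q * P = 1\<^sub>m n" "A = P * B * Q" "upper_triangular B"
    "\<And>i. i < n \<Longrightarrow> B $$ (i, i) = ordered_eigenvalues A ! i"
proof -
  obtain B P Q where "schur_decomposition A (ordered_eigenvalues A) = (B, P, Q)"
    by (cases "schur_decomposition A (ordered_eigenvalues A)")
  then have BPQ: "similar_mat_wit A B P Q" "upper_triangular B" "diag_mat B = ordered_eigenvalues A"
    using schur_decomposition[OF A(1) char_poly_ordered_eigenvalues] by auto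
  note D = similar_mat_witD2[OF A(1) BPQ(1)]
  have "B $$ (i, i) = ordered_eigenvalues A ! i" if "i < n" for i
    using that D(5) by (simp flip: BPQ(3) add: diag_mat_def)
  then show ?thesis using D BPQ by (intro that[of B P Q]) auto
qed

text \<open>By symmetry the left side is the trace of the square of \<open>A\<close>, which is
  invariant under similarity, and the square of a triangular matrix has the squared eigenvalues on
  its diagonal.\<close>

lemma sum_sq_entries_eq_eigenvalues:
  "(\<Sum>i<n. \<Sum>j<n. (A $$ (i, j))\<^sup>2) = (\<Sum>i<n. (ordered_eigenvalues A ! i)\<^sup>2)"
proof -
  obtain B P Q where D: "B \<in> carrier_mat n n" "P \<in> carrier_mat n n" "Q \<in> carrier_mat n n"
    "P * Q = 1\<^sub>m n" "Q * P = 1\<^sub>m n" "A = P * B * Q" "upper_triangular B"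
    "\<And>i. i < n \<Longrightarrow> B $$ (i, i) = ordered_eigenvalues A ! i"
    using schur_ordered_eigenvalues by blast
  have sym: "A $$ (i, j) = A $$ (j, i)" if "i < n" "j < n" for i j
    using that A by (metis carrier_matD index_transpose_mat(1))
  have "(\<Sum>i<n. \<Sum>j<n. (A $$ (i, j))\<^sup>2) = (\<Sum>i<n. \<Sum>j<n. A $$ (i, j) * A $$ (j, i))"
    by (intro sum.cong refl) (auto simp: sym power2_eq_square)
  also have "\<dots> = (\<Sum>i<n. (A * A) $$ (i, i))"
    using A by (intro sum.cong refl) (auto simp: scalar_prod_def lessThan_atLeast0)
  also have "A * A = P * (B * (B * Q))"
  proof -
    have "A * A = P * B * (Q * (P * (B * Q)))"
      using D by (simp add: assoc_mult_mat[of _ n n _ n _ n])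
    also have "Q * (P * (B * Q)) = (Q * P) * (B * Q)"
      using D(1-3) by (intro assoc_mult_mat[symmetric, of _ n n _ n _ n]) auto
    also have "\<dots> = B * Q" using D by (simp add: left_mult_one_mat[of _ n n])
    finally show ?thesis using D by (simp add: assoc_mult_mat[of _ n n _ n _ n])
  qed
  also have "(\<Sum>i<n. (P * (B * (B * Q))) $$ (i, i)) = (\<Sum>i<n. ((B * (B * Q)) * P) $$ (i, i))"
    using D by (intro trace_mult_commute) auto
  also have "(B * (B * Q)) * P = B * (B * (Q * P))"
    using D(1,2,3) by (simp add: assoc_mult_mat[of _ n n _ n _ n])
  also have "\<dots> = B * B" using D by simp
  also have "(\<Sum>i<n. (B * B) $$ (i, i)) = (\<Sum>i<n. (ordered_eigenvalues A ! i)\<^sup>2)"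
  proof (intro sum.cong refl)
    fix i assume "i \<in> {..<n}"
    then have i: "i < n" by simp
    have "(B * B) $$ (i, i) = (\<Sum>k<n. B $$ (i, k) * B $$ (k, i))"
      using D(1) i by (auto simp: scalar_prod_def lessThan_atLeast0)
    also have "\<dots> = (\<Sum>k\<in>{i}. B $$ (i, k) * B $$ (k, i))"
    proof (intro sum.mono_neutral_right ballI)
      fix k assume "k \<in> {..<n} - {i}"
      then consider "k < i" "k < n" | "i < k" "k < n" by force
      then show "B $$ (i, k) * B $$ (k, i) = 0"
        using D(1,7) i by cases (auto simp: upper_triangular_def)
    qed (use i in auto)
    finally show "(B * B) $$ (i, i) = (ordered_eigenvalues A ! i)\<^sup>2"
      using D(8)[OF i] by (simp add: power2_eq_square)
  qed
  finally show ?thesis .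
qed

text \<open>Conjugating the resolvent by the triangularisation gives the inverse of the triangular
  matrix \<open>B - z\<close>, whose diagonal is known; conjugation preserves the trace.\<close>

lemma trace_resolvent_eq_eigenvalues:
  assumes z: "0 < Im z"
  shows "(\<Sum>i<n. resolvent A z $$ (i, i)) = (\<Sum>i<n. 1 / (of_real (ordered_eigenvalues A ! i) - z))"
proof -
  obtain B P Q where D: "B \<in> carrier_mat n n" "P \<in> carrier_mat n n" "Q \<in> carrier_mat n n"
    "P * Q = 1\<^sub>m n" "Q * P = 1\<^sub>m n" "A = P * B * Q" "upper_triangular B"
    "\<And>i. i < n \<Longrightarrow> B $$ (i, i) = ordered_eigenvalues A ! i"
    using schur_ordered_eigenvalues by blast
  note [simp] = assoc_mult_mat[of _ n n _ n _ n]
  define P' Q' where "P' = map_mat complex_of_real P" and "Q' = map_mat complex_of_real Q"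
  define C R T where "C = shifted_mat A z" and "R = resolvent A z" and "T = shifted_mat B z"
  have car: "P' \<in> carrier_mat n n" "Q' \<in> carrier_mat n n" "C \<in> carrier_mat n n" "R \<in> carrier_mat n n" "T \<in> carrier_mat n n"
    using A D by (auto simp: P'_def Q'_def C_def R_def T_def)
  have PQ: "P' * Q' = 1\<^sub>m n" "Q' * P' = 1\<^sub>m n"
    using D unfolding P'_def Q'_def
    by (metis of_real_hom.mat_hom_mult of_real_hom.mat_hom_one)+
  have CR: "C * R = 1\<^sub>m n" unfolding C_def R_def by (rule resolvent_right[OF A z])
  have "Q * A = (Q * P) * (B * Q)" using D(1-3,6) by simp
  then have "Q * A = B * Q" using D(1-3,5) by (simp add: left_mult_one_mat[of _ n n] del: assoc_mult_mat)
  then have QA: "Q' * map_mat complex_of_real A = map_mat complex_of_real B * Q'"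
    using of_real_hom.mat_hom_mult[OF D(3) A(1), where ?'a = complex] of_real_hom.mat_hom_mult[OF D(1,3), where ?'a = complex]
    unfolding Q'_def by simp
  have QC: "Q' * C = T * Q'"
  proof -
    have "Q' * C = Q' * map_mat complex_of_real A - z \<cdot>\<^sub>m Q'"
      using A(1) car(2) unfolding C_def shifted_mat_def
      by (subst mult_minus_distrib_mat[of _ n n _ n]) (auto simp: mult_smult_distrib[of _ n n _ n])
    moreover have "T * Q' = map_mat complex_of_real B * Q' - z \<cdot>\<^sub>m Q'"
      using D(1) car(2) unfolding T_def shifted_mat_def
      by (subst minus_mult_distrib_mat[of _ n n _ _ n]) (auto simp: mult_smult_assoc_mat[of _ n n _ n])
    ultimately show ?thesis using QA by simp
  qed
  define G where "G = Q' * (R * P')"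
  have G: "G \<in> carrier_mat n n" using car by (auto simp: G_def)
  have "T * G = (T * Q') * (R * P')" using car by (simp add: G_def)
  also have "\<dots> = Q' * ((C * R) * P')" unfolding QC[symmetric] using car by simp
  also have "\<dots> = 1\<^sub>m n" unfolding CR using car PQ by simp
  \<comment> \<open>A right inverse of a square matrix is also a left inverse, the side expected by
    \<open>triangular_inverse_diag\<close>.\<close>
  finally have GT: "G * T = 1\<^sub>m n" using mat_mult_left_right_inverse[OF car(5) G] by simp
  have Tii: "T $$ (i, i) = of_real (ordered_eigenvalues A ! i) - z" if "i < n" for i
    unfolding T_def using shifted_mat_nth[OF D(1) that that] D(8)[OF that] by simp
  have Gii: "G $$ (i, i) = 1 / (of_real (ordered_eigenvalues A ! i) - z)" if "i < n" for i
    unfolding Tii[OF that, symmetric]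
  proof (rule triangular_inverse_diag[OF car(5) _ G GT _ that])
    show "upper_triangular T"
      using D(1,7) carrier_matD[OF car(5)] shifted_mat_nth[OF D(1), of _ _ z]
      unfolding T_def[symmetric] by (auto simp: upper_triangular_def)
    show "T $$ (i, i) \<noteq> 0" if "i < n" for i using Tii[OF that] z by (auto simp: complex_eq_iff)
  qed
  have "(\<Sum>i<n. R $$ (i, i)) = (\<Sum>i<n. (R * (P' * Q')) $$ (i, i))"
    using car PQ by simp
  also have "R * (P' * Q') = (R * P') * Q'" using car by simp
  also have "(\<Sum>i<n. ((R * P') * Q') $$ (i, i)) = (\<Sum>i<n. G $$ (i, i))"
    unfolding G_def using car by (intro trace_mult_commute) auto
  finally show ?thesis using Gii by (simp add: R_def)
qed

lemma integral_empirical_spectral_measure: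
  fixes f :: "real \<Rightarrow> 'b :: {banach, second_countable_topology}"
  assumes "f \<in> borel_measurable borel"
  shows "(\<integral>x. f x \<partial>empirical_spectral_measure A) = (\<Sum>i<n. f (ordered_eigenvalues A ! i)) /\<^sub>R real n"
  unfolding empirical_spectral_measure_def using A(1) assms
  by (subst integral_distr) (auto simp: integral_uniform_count_measure uniform_count_measure_def
      lebesgue_integral_point_measure_finite scaleR_sum_right divide_inverse)

lemma real_distribution_empirical_spectral_measure:
  assumes "0 < n"
  shows "real_distribution (empirical_spectral_measure A)"
proof -
  interpret prob_space "uniform_count_measure {..<n}"
    using assms by (intro prob_space_uniform_count_measure) auto
  show ?thesis
    unfolding empirical_spectral_measure_def using A(1)
    by (auto intro!: real_distribution_distr simp: measurable_cong_sets[OF sets_uniform_count_measure_count_space refl])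
qed

end

section \<open>The Stieltjes transform and the semicircle law\<close>

text \<open>With \<open>x - z\<close> rather than \<open>z - x\<close> the transform maps the upper
  half plane into itself; this sign later selects the root of the quadratic equation.\<close>

definition stieltjes :: "real measure \<Rightarrow> complex \<Rightarrow> complex" where
  "stieltjes \<nu> z = (\<integral>x. 1 / (complex_of_real x - z) \<partial>\<nu>)"

lemma norm_cauchy_kernel_le:
  assumes "0 < Im z"
  shows "cmod (1 / (complex_of_real x - z)) \<le> 1 / Im z"
proof -
  have "Im z \<le> cmod (complex_of_real x - z)"
    using abs_Im_le_cmod[of "complex_of_real x - z"] assms by simp
  then show ?thesis using assms by (simp add: norm_divide frac_le)
qed

lemma Im_cauchy_kernel: "Im (1 / (complex_of_real x - Complex E \<eta>)) = \<eta> / ((x - E)\<^sup>2 + \<eta>\<^sup>2)"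
  by (simp add: Im_divide)

lemma continuous_cauchy_kernel: "0 < Im z \<Longrightarrow> isCont (\<lambda>x. 1 / (complex_of_real x - z)) x"
  by (intro continuous_intros) (auto simp: complex_eq_iff)

context real_distribution
begin

lemma integrable_cauchy_kernel: "0 < Im z \<Longrightarrow> integrable M (\<lambda>x. 1 / (complex_of_real x - z))"
  by (rule integrable_const_bound[where B = "1 / Im z"]) (auto intro!: norm_cauchy_kernel_le AE_I2)

lemma norm_stieltjes_le: 
  assumes "0 < Im z" shows "cmod (stieltjes M z) \<le> 1 / Im z"
proof -
  have "cmod (stieltjes M z) \<le> (\<integral>x. cmod (1 / (complex_of_real x - z)) \<partial>M)"
    unfolding stieltjes_def by (rule integral_norm_bound)
  also have "\<dots> \<le> (\<integral>x. 1 / Im z \<partial>M)"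
    using assms by (intro integral_mono integrable_norm integrable_cauchy_kernel norm_cauchy_kernel_le) auto
  finally show ?thesis using prob_space by simp
qed

text \<open>The scalar resolvent identity. It carries an equation known on a dense set of
  \<open>z\<close> to the whole upper half plane.\<close>

lemma stieltjes_lipschitz:
  assumes z: "0 < Im z" and w: "0 < Im w"
  shows "cmod (stieltjes M z - stieltjes M w) \<le> cmod (z - w) / (Im z * Im w)"
proof -
  have "cmod (stieltjes M z - stieltjes M w) = cmod (\<integral>x. 1 / (complex_of_real x - z) - 1 / (complex_of_real x - w) \<partial>M)"
    unfolding stieltjes_def using assms by (simp add: integrable_cauchy_kernel)
  also have "\<dots> \<le> (\<integral>x. cmod (1 / (complex_of_real x - z) - 1 / (complex_of_real x - w)) \<partial>M)"
    by (rule integral_norm_bound)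
  also have "\<dots> \<le> (\<integral>x. cmod (z - w) / (Im z * Im w) \<partial>M)"
  proof (intro integral_mono integrable_norm Bochner_Integration.integrable_diff integrable_cauchy_kernel assms)
    fix x :: real
    have "complex_of_real x - z \<noteq> 0" "complex_of_real x - w \<noteq> 0"
      using assms by (auto simp: complex_eq_iff)
    then have "1 / (complex_of_real x - z) - 1 / (complex_of_real x - w) =
        (z - w) * ((1 / (complex_of_real x - z)) * (1 / (complex_of_real x - w)))"
      by (simp add: field_simps)
    then have "cmod (1 / (complex_of_real x - z) - 1 / (complex_of_real x - w)) =
        cmod (z - w) * (cmod (1 / (complex_of_real x - z)) * cmod (1 / (complex_of_real x - w)))"
      by (simp only: norm_mult)
    also have "\<dots> \<le> cmod (z - w) * ((1 / Im z) * (1 / Im w))"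
      using assms by (intro mult_left_mono mult_mono norm_cauchy_kernel_le) auto
    finally show "cmod (1 / (complex_of_real x - z) - 1 / (complex_of_real x - w)) \<le> cmod (z - w) / (Im z * Im w)"
      by simp
  qed auto
  finally show ?thesis using prob_space by simp
qed

lemma Im_stieltjes: 
  "0 < \<eta> \<Longrightarrow> Im (stieltjes M (Complex E \<eta>)) = (\<integral>x. \<eta> / ((x - E)\<^sup>2 + \<eta>\<^sup>2) \<partial>M)"
  unfolding stieltjes_def
  by (subst integral_Im[symmetric]) (auto simp: integrable_cauchy_kernel Im_cauchy_kernel)

lemma Im_stieltjes_pos: 
  assumes "0 < Im z" shows "0 < Im (stieltjes M z)"
proof -
  define E \<eta> where "E = Re z" and "\<eta> = Im z"
  have z: "z = Complex E \<eta>" and \<eta>: "0 < \<eta>" using assms by (auto simp: E_def \<eta>_def)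
  have "integrable M (\<lambda>x. Im (1 / (complex_of_real x - z)))"
    using integrable_cauchy_kernel[OF assms] by (rule integrable_Im)
  then have int: "integrable M (\<lambda>x. \<eta> / ((x - E)\<^sup>2 + \<eta>\<^sup>2))" unfolding z Im_cauchy_kernel .
  have pos: "0 < \<eta> / ((x - E)\<^sup>2 + \<eta>\<^sup>2)" for x
    using \<eta> by (intro divide_pos_pos add_nonneg_pos) auto
  have "(\<integral>x. \<eta> / ((x - E)\<^sup>2 + \<eta>\<^sup>2) \<partial>M) \<noteq> 0"
  proof
    assume "(\<integral>x. \<eta> / ((x - E)\<^sup>2 + \<eta>\<^sup>2) \<partial>M) = 0"
    then have "AE x in M. \<eta> / ((x - E)\<^sup>2 + \<eta>\<^sup>2) = 0"
      using integral_nonneg_eq_0_iff_AE[OF int] pos less_imp_le by auto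
    then have "AE x in M. False" by (rule AE_mp) (use pos in \<open>auto intro!: AE_I2 dest: less_imp_neq\<close>)
    then show False by simp
  qed
  moreover have "0 \<le> (\<integral>x. \<eta> / ((x - E)\<^sup>2 + \<eta>\<^sup>2) \<partial>M)"
    by (intro integral_nonneg_AE AE_I2 pos[THEN less_imp_le])
  ultimately show ?thesis unfolding z Im_stieltjes[OF \<eta>] by (simp only: less_le) simp
qed

text \<open>Fubini for the Poisson kernel, which is bounded by \<open>1 / \<eta>\<close> on a finite
  product measure and has an arctangent as its primitive in \<open>E\<close>.\<close>

lemma stieltjes_inversion_fixed:
  assumes \<eta>: "0 < \<eta>" and ab: "a \<le> b"
  shows "(LBINT E:{a..b}. Im (stieltjes M (Complex E \<eta>))) = (\<integral>x. arctan ((b - x) / \<eta>) - arctan ((a - x) / \<eta>) \<partial>M)"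
proof -
  define R where "R = restrict_space lborel {a..b}"
  have fin: "finite_measure R"
    unfolding R_def using ab by (intro finite_measureI) (simp add: emeasure_restrict_space space_restrict_space)
  interpret R: finite_measure R by fact
  interpret pair: pair_sigma_finite R M ..
  interpret RM: finite_measure "R \<Otimes>\<^sub>M M" by (rule finite_measure_pair_measure) unfold_locales
  have [measurable]: "(\<lambda>x. x) \<in> borel_measurable R"
    unfolding R_def by (rule measurable_restrict_space1) simp
  have bound: "norm (\<eta> / ((x - E)\<^sup>2 + \<eta>\<^sup>2)) \<le> 1 / \<eta>" for x E
  proof -
    have "\<eta> / ((x - E)\<^sup>2 + \<eta>\<^sup>2) \<le> \<eta> / \<eta>\<^sup>2" using \<eta> by (intro divide_left_mono mult_pos_pos add_nonneg_pos) auto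
    also have "\<dots> = 1 / \<eta>" using \<eta> by (simp add: power2_eq_square)
    finally show ?thesis using \<eta> by (simp add: add_nonneg_nonneg)
  qed
  have "integrable (R \<Otimes>\<^sub>M M) (\<lambda>(E, x). \<eta> / ((x - E)\<^sup>2 + \<eta>\<^sup>2))"
  proof (rule RM.integrable_const_bound[where B = "1 / \<eta>"])
    show "(\<lambda>(E, x). \<eta> / ((x - E)\<^sup>2 + \<eta>\<^sup>2)) \<in> borel_measurable (R \<Otimes>\<^sub>M M)" by measurable
  qed (use bound in \<open>auto simp: split_beta\<close>)
  then have "(\<integral>E. (\<integral>x. \<eta> / ((x - E)\<^sup>2 + \<eta>\<^sup>2) \<partial>M) \<partial>R) = (\<integral>x. (\<integral>E. \<eta> / ((x - E)\<^sup>2 + \<eta>\<^sup>2) \<partial>R) \<partial>M)"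
    by (rule pair.Fubini_integral[symmetric])
  moreover have "(\<integral>E. \<eta> / ((x - E)\<^sup>2 + \<eta>\<^sup>2) \<partial>R) = arctan ((b - x) / \<eta>) - arctan ((a - x) / \<eta>)" for x
  proof -
    have "(\<integral>E. \<eta> / ((x - E)\<^sup>2 + \<eta>\<^sup>2) \<partial>R) = (LBINT E. \<eta> / ((x - E)\<^sup>2 + \<eta>\<^sup>2) * indicat_real {a..b} E)"
      unfolding R_def by (subst integral_restrict_space) (auto simp: mult.commute)
    also have "\<dots> = arctan ((b - x) / \<eta>) - arctan ((a - x) / \<eta>)"
    proof (rule integral_FTC_Icc_real[OF ab])
      fix E
      have "0 < (x - E)\<^sup>2 + \<eta>\<^sup>2" using \<eta> by (intro add_nonneg_pos) auto
      then show "isCont (\<lambda>E. \<eta> / ((x - E)\<^sup>2 + \<eta>\<^sup>2)) E"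
        by (intro continuous_intros) auto
      have "((\<lambda>E. arctan ((E - x) / \<eta>)) has_real_derivative inverse (1 + ((E - x) / \<eta>)\<^sup>2) * (1 / \<eta>)) (at E)"
        using \<eta> by (auto intro!: derivative_eq_intros)
      moreover have "inverse (1 + ((E - x) / \<eta>)\<^sup>2) * (1 / \<eta>) = \<eta> / ((x - E)\<^sup>2 + \<eta>\<^sup>2)"
      proof -
        have "1 + ((E - x) / \<eta>)\<^sup>2 = ((x - E)\<^sup>2 + \<eta>\<^sup>2) / \<eta>\<^sup>2"
          using \<eta> by (simp add: field_simps power2_commute)
        then show ?thesis using \<eta> by (simp add: field_simps power2_eq_square)
      qed
      ultimately show "((\<lambda>E. arctan ((E - x) / \<eta>)) has_real_derivative \<eta> / ((x - E)\<^sup>2 + \<eta>\<^sup>2)) (at E)" by simp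
    qed
    finally show ?thesis .
  qed
  ultimately have "(\<integral>E. (\<integral>x. \<eta> / ((x - E)\<^sup>2 + \<eta>\<^sup>2) \<partial>M) \<partial>R) = (\<integral>x. arctan ((b - x) / \<eta>) - arctan ((a - x) / \<eta>) \<partial>M)"
    by simp
  then show ?thesis
    unfolding R_def set_lebesgue_integral_def Im_stieltjes[OF \<eta>]
    by (subst (asm) integral_restrict_space) auto
qed

text \<open>As \<open>\<eta>\<close> tends to 0, the arctangent difference tends to
  \<open>pi\<close> inside the interval and to 0 outside its closure. At the endpoints the limit
  would be half of \<open>pi\<close>, hence the condition on atoms.\<close>

lemma stieltjes_inversion:
  assumes ab: "a < b" and atoms: "measure M {a} = 0" "measure M {b} = 0"
  shows "(\<lambda>n. LBINT E:{a..b}. Im (stieltjes M (Complex E (1 / real (Suc n))))) \<longlonglongrightarrow> pi * measure M {a<..b}"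
proof -
  have lim: "(\<lambda>n. arctan (c * real (Suc n))) \<longlonglongrightarrow> (if 0 < c then pi / 2 else - (pi / 2))" if "c \<noteq> 0" for c
  proof (cases "0 < c")
    case True
    then have "filterlim (\<lambda>n. c * real (Suc n)) at_top sequentially"
      by (intro filterlim_tendsto_pos_mult_at_top[OF tendsto_const] filterlim_compose[OF filterlim_real_sequentially filterlim_Suc]) auto
    then show ?thesis using True tendsto_arctan_at_top by (auto intro: filterlim_compose)
  next
    case False
    then have "filterlim (\<lambda>n. c * real (Suc n)) at_bot sequentially"
      using that by (intro filterlim_tendsto_neg_mult_at_bot[OF tendsto_const] filterlim_compose[OF filterlim_real_sequentially filterlim_Suc]) auto
    then show ?thesis using False tendsto_arctan_at_bot by (auto intro: filterlim_compose)
  qed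
  have "(\<lambda>n. \<integral>x. arctan ((b - x) * real (Suc n)) - arctan ((a - x) * real (Suc n)) \<partial>M) \<longlonglongrightarrow> (\<integral>x. pi * indicat_real {a<..b} x \<partial>M)"
  proof (rule integral_dominated_convergence[where w = "\<lambda>_. pi"])
    have "AE x in M. x \<noteq> c" if "measure M {c} = 0" for c
      using that by (intro AE_I[where N = "{c}"]) (auto simp: emeasure_eq_measure)
    then have "AE x in M. x \<noteq> a" "AE x in M. x \<noteq> b" using atoms by auto
    then show "AE x in M. (\<lambda>n. arctan ((b - x) * real (Suc n)) - arctan ((a - x) * real (Suc n))) \<longlonglongrightarrow> pi * indicat_real {a<..b} x"
    proof eventually_elim
      fix x assume x: "x \<noteq> a" "x \<noteq> b"
      have "(\<lambda>n. arctan ((b - x) * real (Suc n)) - arctan ((a - x) * real (Suc n))) \<longlonglongrightarrow>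
         (if 0 < b - x then pi / 2 else - (pi / 2)) - (if 0 < a - x then pi / 2 else - (pi / 2))"
        using x by (intro tendsto_diff lim) auto
      moreover have "(if 0 < b - x then pi / 2 else - (pi / 2)) - (if 0 < a - x then pi / 2 else - (pi / 2)) = pi * indicat_real {a<..b} x"
        using x ab by (auto simp: indicator_def)
      ultimately show "(\<lambda>n. arctan ((b - x) * real (Suc n)) - arctan ((a - x) * real (Suc n))) \<longlonglongrightarrow> pi * indicat_real {a<..b} x"
        by simp
    qed
    show "AE x in M. norm (arctan ((b - x) * real (Suc n)) - arctan ((a - x) * real (Suc n))) \<le> pi" for n
    proof (rule AE_I2)
      fix x
      show "norm (arctan ((b - x) * real (Suc n)) - arctan ((a - x) * real (Suc n))) \<le> pi"
        using arctan_bounded[of "(b - x) * real (Suc n)"] arctan_bounded[of "(a - x) * real (Suc n)"]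
        unfolding real_norm_def abs_le_iff by linarith
    qed
  qed auto
  moreover have "(\<integral>x. arctan ((b - x) * real (Suc n)) - arctan ((a - x) * real (Suc n)) \<partial>M) =
     (LBINT E:{a..b}. Im (stieltjes M (Complex E (1 / real (Suc n)))))" for n
    using stieltjes_inversion_fixed[of "1 / real (Suc n)" a b] ab by simp
  ultimately show ?thesis by simp
qed

end

text \<open>The complement of a countable set is dense. Letting the left end run to minus infinity
  through it gives equality of the distribution functions off \<open>D\<close>; right continuity
  extends it to all points.\<close>

lemma real_distribution_eqI_nonatoms:
  assumes \<mu>: "real_distribution \<mu>" and \<nu>: "real_distribution \<nu>" and D: "countable D"
    and eq: "\<And>a b. a < b \<Longrightarrow> a \<notin> D \<Longrightarrow> b \<notin> D \<Longrightarrow> measure \<mu> {a<..b} = measure \<nu> {a<..b}"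
  shows "\<mu> = \<nu>"
proof -
  interpret \<mu>: real_distribution \<mu> by fact
  interpret \<nu>: real_distribution \<nu> by fact
  have ex: "\<exists>y. x < y \<and> y < z \<and> y \<notin> D" if "x < z" for x z :: real
  proof -
    have "\<not> {x<..<z} \<subseteq> D" using that D uncountable_open_interval countable_subset by metis
    then show ?thesis by auto
  qed
  have eqD: "cdf \<mu> b = cdf \<nu> b" if b: "b \<notin> D" for b
  proof -
    have "\<exists>y. b - real n - 2 < y \<and> y < b - real n - 1 \<and> y \<notin> D" for n by (intro ex) simp
    then obtain a where a: "\<And>n. a n < b - real n - 1" "\<And>n. a n \<notin> D" by metis
    have "filterlim (\<lambda>n. b - 1 + - real n) at_bot sequentially"
      by (intro filterlim_tendsto_add_at_bot_iff[OF tendsto_const, THEN iffD2]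
          filterlim_compose[OF filterlim_uminus_at_bot_at_top] filterlim_real_sequentially)
    then have "filterlim a at_bot sequentially"
      by (rule filterlim_at_bot_mono) (use a(1)[THEN less_imp_le] in \<open>auto intro!: always_eventually simp: algebra_simps\<close>)
    then have "(\<lambda>n. (cdf \<mu> b - cdf \<mu> (a n)) - (cdf \<nu> b - cdf \<nu> (a n))) \<longlonglongrightarrow> (cdf \<mu> b - 0) - (cdf \<nu> b - 0)"
      by (intro tendsto_intros filterlim_compose[OF \<mu>.cdf_lim_at_bot] filterlim_compose[OF \<nu>.cdf_lim_at_bot])
    moreover have "(cdf \<mu> b - cdf \<mu> (a n)) - (cdf \<nu> b - cdf \<nu> (a n)) = 0" for n
    proof -
      have "a n < b" using a(1)[of n] by linarith
      then show ?thesis using \<mu>.cdf_diff_eq \<nu>.cdf_diff_eq eq a(2) b by auto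
    qed
    ultimately show ?thesis by (simp add: LIMSEQ_const_iff)
  qed
  have "cdf \<mu> x = cdf \<nu> x" for x
  proof -
    have "\<exists>y. x < y \<and> y < x + 1 / real (Suc n) \<and> y \<notin> D" for n by (intro ex) simp
    then obtain y where y: "\<And>n. x < y n" "\<And>n. y n < x + 1 / real (Suc n)" "\<And>n. y n \<notin> D" by metis
    have "(\<lambda>n. x + 1 / real (Suc n)) \<longlonglongrightarrow> x + 0"
      by (intro tendsto_intros LIMSEQ_Suc[OF lim_1_over_n])
    then have "y \<longlonglongrightarrow> x"
      by (intro tendsto_sandwich[of "\<lambda>_. x" y sequentially "\<lambda>n. x + 1 / real (Suc n)"])
        (auto intro!: always_eventually intro: less_imp_le[OF y(1)] less_imp_le[OF y(2)[simplified]])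
    then have "filterlim y (at_right x) sequentially"
      unfolding filterlim_at using less_imp_neq[OF y(1)] y(1) by (auto intro!: always_eventually)
    then have "(\<lambda>n. cdf \<mu> (y n)) \<longlonglongrightarrow> cdf \<mu> x" "(\<lambda>n. cdf \<nu> (y n)) \<longlonglongrightarrow> cdf \<nu> x"
      using \<mu>.cdf_is_right_cont[of x] \<nu>.cdf_is_right_cont[of x]
      by (auto simp: continuous_within intro: filterlim_compose)
    then show ?thesis using eqD[OF y(3)] LIMSEQ_unique by auto
  qed
  then have "cdf \<mu> = cdf \<nu>" by blast
  then show ?thesis using cdf_unique \<mu> \<nu> by blast
qed

lemma stieltjes_unique:
  assumes \<mu>: "real_distribution \<mu>" and \<nu>: "real_distribution \<nu>"
    and eq: "\<And>z. 0 < Im z \<Longrightarrow> stieltjes \<mu> z = stieltjes \<nu> z"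
  shows "\<mu> = \<nu>"
proof (rule real_distribution_eqI_nonatoms[OF \<mu> \<nu>])
  interpret \<mu>: real_distribution \<mu> by fact
  interpret \<nu>: real_distribution \<nu> by fact
  show "countable ({x. 0 < measure \<mu> {x}} \<union> {x. 0 < measure \<nu> {x}})"
    using \<mu>.countable_atoms \<nu>.countable_atoms by auto
  fix a b assume ab: "a < b" "a \<notin> {x. 0 < measure \<mu> {x}} \<union> {x. 0 < measure \<nu> {x}}" "b \<notin> {x. 0 < measure \<mu> {x}} \<union> {x. 0 < measure \<nu> {x}}"
  then have "measure \<mu> {a} = 0" "measure \<mu> {b} = 0" "measure \<nu> {a} = 0" "measure \<nu> {b} = 0"
    by (auto simp: not_less intro: antisym)
  then have "pi * measure \<mu> {a<..b} = pi * measure \<nu> {a<..b}"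
    using \<mu>.stieltjes_inversion[OF ab(1)] \<nu>.stieltjes_inversion[OF ab(1)]
    by (intro LIMSEQ_unique[where X = "\<lambda>n. LBINT E:{a..b}. Im (stieltjes \<nu> (Complex E (1 / real (Suc n))))"])
      (simp_all add: eq)
  then show "measure \<mu> {a<..b} = measure \<nu> {a<..b}" by simp
qed

section \<open>The semicircle law and the quadratic equation\<close>

definition semicircle_law :: "real \<Rightarrow> real measure" where
  "semicircle_law d = (if d = 0 then return borel 0
     else density lborel (\<lambda>x. ennreal (semicircle_density (x / d) / d)))"

lemma semicircle_density_nonneg: "0 \<le> semicircle_density x"
  by (auto simp: semicircle_density_def indicator_def intro!: divide_nonneg_nonneg abs_le_square_iff[THEN iffD1, of x 2, simplified])

lemma semicircle_density_measurable [measurable]: "semicircle_density \<in> borel_measurable borel"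
  unfolding semicircle_density_def[abs_def] by measurable

lemma nn_integral_semicircle_density: "(\<integral>\<^sup>+x. ennreal (semicircle_density x) \<partial>lborel) = 1"
proof -
  \<comment> \<open>A primitive of the density. It is differentiated only in the open interval,
    because the arcsine is not differentiable at the ends.\<close>
  define F where "F x = (x / 2 * sqrt (4 - x\<^sup>2) + 2 * arcsin (x / 2)) / (2 * pi)" for x :: real
  have "((\<lambda>x. sqrt (4 - x\<^sup>2) / (2 * pi)) has_integral F 2 - F (-2)) {-2..2}"
  proof (rule fundamental_theorem_of_calculus_interior)
    show "continuous_on {-2..2} F"
      unfolding F_def by (intro continuous_intros) auto
    fix x :: real assume x: "x \<in> {-2<..<2}"
    then have x2: "x\<^sup>2 < 4" using abs_square_less_1[of "x / 2"] by (auto simp: power_divide abs_if)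
    have s: "sqrt (1 - (x / 2)\<^sup>2) = sqrt (4 - x\<^sup>2) / 2"
    proof -
      have "sqrt ((4 - x\<^sup>2) / 4) = sqrt (4 - x\<^sup>2) / 2" by (simp add: real_sqrt_divide)
      moreover have "1 - (x / 2)\<^sup>2 = (4 - x\<^sup>2) / 4" by (simp add: power_divide field_simps)
      ultimately show ?thesis by (simp only:)
    qed
    have "((\<lambda>x. x / 2 * sqrt (4 - x\<^sup>2) + 2 * arcsin (x / 2)) has_real_derivative
        (1 / 2 * sqrt (4 - x\<^sup>2) + x / 2 * (inverse (sqrt (4 - x\<^sup>2)) / 2 * (- (2 * x)))) + 2 * (inverse (sqrt (1 - (x / 2)\<^sup>2)) * (1 / 2))) (at x)"
      using x x2 by (auto intro!: derivative_eq_intros simp: mult_ac)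
    also have "(1 / 2 * sqrt (4 - x\<^sup>2) + x / 2 * (inverse (sqrt (4 - x\<^sup>2)) / 2 * (- (2 * x)))) + 2 * (inverse (sqrt (1 - (x / 2)\<^sup>2)) * (1 / 2))
       = sqrt (4 - x\<^sup>2)"
    proof -
      define r where "r = sqrt (4 - x\<^sup>2)"
      have r: "0 < r" "x * x = 4 - r * r" using x2 by (auto simp: r_def power2_eq_square)
      have "(1 / 2 * r + x / 2 * (inverse r / 2 * (- (2 * x)))) + 2 * (inverse (r / 2) * (1 / 2)) = (r * r - x * x + 4) / (2 * r)"
        using r(1) by (simp add: field_simps)
      also have "\<dots> = r" using r by (simp add: field_simps)
      finally show ?thesis unfolding s r_def[symmetric] .
    qed
    finally have "(F has_real_derivative sqrt (4 - x\<^sup>2) / (2 * pi)) (at x)"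
      unfolding F_def by (intro DERIV_cdivide) 
    then show "(F has_vector_derivative sqrt (4 - x\<^sup>2) / (2 * pi)) (at x)"
      by (simp add: has_real_derivative_iff_has_vector_derivative)
  qed simp
  moreover have "F 2 - F (-2) = 1" by (simp add: F_def)
  ultimately have "((\<lambda>x. sqrt (4 - x\<^sup>2) / (2 * pi)) has_integral 1) {-2..2}" by simp
  then have "((\<lambda>x. if x \<in> {-2..2} then sqrt (4 - x\<^sup>2) / (2 * pi) else 0) has_integral 1) UNIV"
    by (subst has_integral_restrict_UNIV)
  moreover have "(\<lambda>x. if x \<in> {-2..2} then sqrt (4 - x\<^sup>2) / (2 * pi) else 0) = semicircle_density"
    by (auto simp: semicircle_density_def)
  ultimately show ?thesis
    using nn_integral_has_integral_lborel[OF semicircle_density_measurable semicircle_density_nonneg] by simp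
qed

lemma real_distribution_semicircle_law:
  assumes "0 \<le> d" shows "real_distribution (semicircle_law d)"
proof (cases "d = 0")
  case True
  interpret prob_space "return borel (0 :: real)" by (intro prob_space_return) simp
  show ?thesis using True by (simp add: semicircle_law_def real_distribution_def real_distribution_axioms_def prob_space_axioms)
next
  case False
  then have d: "0 < d" using assms by simp
  have "(\<integral>\<^sup>+x. ennreal (semicircle_density (x / d) / d) \<partial>lborel) = ennreal d * (\<integral>\<^sup>+x. ennreal (semicircle_density x / d) \<partial>lborel)"
    using d nn_integral_real_affine[of "\<lambda>x. ennreal (semicircle_density (x / d) / d)" d 0] by simp
  also have "(\<integral>\<^sup>+x. ennreal (semicircle_density x / d) \<partial>lborel) = (\<integral>\<^sup>+x. ennreal (1 / d) * ennreal (semicircle_density x) \<partial>lborel)"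
    using d by (intro nn_integral_cong) (simp add: ennreal_mult[symmetric] semicircle_density_nonneg)
  also have "\<dots> = ennreal (1 / d)"
    by (simp add: nn_integral_cmult nn_integral_semicircle_density)
  also have "ennreal d * ennreal (1 / d) = 1" using d by (simp add: ennreal_mult[symmetric])
  finally have "prob_space (semicircle_law d)"
    using False by (intro prob_spaceI) (simp add: semicircle_law_def emeasure_density)
  then show ?thesis using False by (simp add: semicircle_law_def real_distribution_def real_distribution_axioms_def)
qed

text \<open>Completing the square: \<open>r = 2 v s + z\<close> satisfies
  \<open>r\<^sup>2 = z\<^sup>2 - 4 v\<close>, and
  \<open>|r\<^sup>2| - Re r\<^sup>2 = 2 (Im r)\<^sup>2\<close>. Since \<open>Im r\<close> is
  nonnegative it is determined, without choosing a branch of the complex square root.\<close>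

lemma Im_quadratic_solution:
  assumes v: "0 < v" and s: "complex_of_real v * s\<^sup>2 + z * s + 1 = 0" and pos: "0 \<le> Im s" "0 < Im z"
  shows "Im s = (sqrt ((cmod (z\<^sup>2 - of_real (4 * v)) - Re (z\<^sup>2 - of_real (4 * v))) / 2) - Im z) / (2 * v)"
proof -
  define r where "r = of_real (2 * v) * s + z"
  have "r\<^sup>2 = 4 * of_real v * (of_real v * s\<^sup>2 + z * s + 1) + z\<^sup>2 - of_real (4 * v)"
    by (simp add: r_def power2_eq_square algebra_simps)
  then have r2: "r\<^sup>2 = z\<^sup>2 - of_real (4 * v)" using s by simp
  have "cmod (r\<^sup>2) - Re (r\<^sup>2) = 2 * (Im r)\<^sup>2"
    unfolding norm_power cmod_power2 by (simp add: power2_eq_square)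
  then have "sqrt ((cmod (z\<^sup>2 - of_real (4 * v)) - Re (z\<^sup>2 - of_real (4 * v))) / 2) = \<bar>Im r\<bar>"
    by (simp add: r2)
  also have "\<dots> = 2 * v * Im s + Im z" using v pos by (simp add: r_def)
  finally show ?thesis using v by (simp add: field_simps)
qed

text \<open>For \<open>d = 0\<close> the equation reads \<open>z s = -1\<close>, which gives the
  transform of the point mass at 0. Otherwise \<open>Im s\<close> is explicit, stays bounded near
  the real line and tends to \<open>pi\<close> times the density, so Stieltjes inversion yields the
  mass of intervals.\<close>

lemma semicircle_law_if_quadratic:
  assumes \<nu>: "real_distribution \<nu>" and d: "0 \<le> d"
    and quad: "\<And>z. 0 < Im z \<Longrightarrow> of_real (d\<^sup>2) * (stieltjes \<nu> z)\<^sup>2 + z * stieltjes \<nu> z + 1 = 0"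
  shows "\<nu> = semicircle_law d"
proof (cases "d = 0")
  case True
  have "stieltjes \<nu> z = stieltjes (return borel 0) z" if z: "0 < Im z" for z
  proof -
    have "z * stieltjes \<nu> z = -1" using quad[OF z] True by (simp add: eq_neg_iff_add_eq_0)
    moreover have "z \<noteq> 0" using z by auto
    ultimately have "stieltjes \<nu> z = - 1 / z" using nonzero_mult_div_cancel_left[of z "stieltjes \<nu> z"] by simp
    then show ?thesis by (simp add: stieltjes_def integral_return)
  qed
  then show ?thesis
    using True \<nu> real_distribution_semicircle_law[of 0] by (auto simp: semicircle_law_def intro!: stieltjes_unique)
next
  case False
  then have d: "0 < d" using d by simp
  define p where "p E = semicircle_density (E / d) / d" for E
  have p: "0 \<le> p E" for E using d by (simp add: p_def semicircle_density_nonneg)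
  have [measurable]: "p \<in> borel_measurable borel" unfolding p_def[abs_def] by measurable
  interpret \<nu>: real_distribution \<nu> by fact
  have sc: "real_distribution (semicircle_law d)" using d by (intro real_distribution_semicircle_law) simp
  interpret sc: real_distribution "semicircle_law d" by fact
  have law: "semicircle_law d = density lborel (\<lambda>x. ennreal (p x))" using False by (simp add: semicircle_law_def p_def)
  show ?thesis
  proof (rule real_distribution_eqI_nonatoms[OF \<nu> sc \<nu>.countable_atoms])
    fix a b assume ab: "a < b" "a \<notin> {x. 0 < measure \<nu> {x}}" "b \<notin> {x. 0 < measure \<nu> {x}}"
    then have atoms: "measure \<nu> {a} = 0" "measure \<nu> {b} = 0" by (auto simp: not_less intro: antisym)
    \<comment> \<open>The right side of \<open>Im_quadratic_solution\<close> at
      \<open>z = E + i \<eta>\<close>. Unlike the transform it also makes sense at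
      \<open>\<eta> = 0\<close>, where it equals \<open>pi * p E\<close>.\<close>
    define g where "g E \<eta> = (sqrt ((cmod ((Complex E \<eta>)\<^sup>2 - of_real (4 * d\<^sup>2)) - Re ((Complex E \<eta>)\<^sup>2 - of_real (4 * d\<^sup>2))) / 2) - \<eta>) / (2 * d\<^sup>2)" for E \<eta>
    have g: "Im (stieltjes \<nu> (Complex E \<eta>)) = g E \<eta>" if "0 < \<eta>" for E \<eta>
      using Im_quadratic_solution[OF _ quad, of "Complex E \<eta>"] \<nu>.Im_stieltjes_pos[of "Complex E \<eta>"] that d
      by (simp add: g_def)
    have lim: "(\<lambda>n. g E (1 / real (Suc n))) \<longlonglongrightarrow> pi * p E" for E
    proof -
      have "(\<lambda>n. 1 / real (Suc n)) \<longlonglongrightarrow> 0" by (rule LIMSEQ_Suc[OF lim_1_over_n])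
      then have "(\<lambda>n. g E (1 / real (Suc n))) \<longlonglongrightarrow> g E 0"
        unfolding g_def Complex_eq using d by (intro tendsto_intros) auto
      moreover have "g E 0 = pi * p E"
      proof -
        have "cmod ((Complex E 0)\<^sup>2 - of_real (4 * d\<^sup>2)) = \<bar>E\<^sup>2 - 4 * d\<^sup>2\<bar>"
        proof -
          have "(Complex E 0)\<^sup>2 - of_real (4 * d\<^sup>2) = of_real (E\<^sup>2 - 4 * d\<^sup>2)"
            by (simp add: complex_eq_iff power2_eq_square)
          then show ?thesis by (simp only: norm_of_real)
        qed
        moreover have "Re ((Complex E 0)\<^sup>2 - of_real (4 * d\<^sup>2)) = E\<^sup>2 - 4 * d\<^sup>2"
          by (simp add: power2_eq_square)
        ultimately have g0: "g E 0 = sqrt ((\<bar>E\<^sup>2 - 4 * d\<^sup>2\<bar> - (E\<^sup>2 - 4 * d\<^sup>2)) / 2) / (2 * d\<^sup>2)"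
          by (simp add: g_def)
        have mem: "E / d \<in> {-2..2} \<longleftrightarrow> E\<^sup>2 \<le> 4 * d\<^sup>2"
        proof -
          have "E / d \<in> {-2..2} \<longleftrightarrow> \<bar>E / d\<bar> \<le> \<bar>2\<bar>"
            unfolding abs_numeral abs_le_iff atLeastAtMost_iff by linarith
          also have "\<dots> \<longleftrightarrow> E\<^sup>2 \<le> 4 * d\<^sup>2" unfolding abs_le_square_iff using d by (simp add: power_divide field_simps)
          finally show ?thesis .
        qed
        show ?thesis
        proof (cases "E\<^sup>2 \<le> 4 * d\<^sup>2")
          case True
          have "sqrt (4 - (E / d)\<^sup>2) = sqrt (4 * d\<^sup>2 - E\<^sup>2) / d"
          proof -
            have "4 - (E / d)\<^sup>2 = (4 * d\<^sup>2 - E\<^sup>2) / d\<^sup>2" using d by (simp add: field_simps)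
            then show ?thesis using d by (simp add: real_sqrt_divide)
          qed
          moreover have "(\<bar>E\<^sup>2 - 4 * d\<^sup>2\<bar> - (E\<^sup>2 - 4 * d\<^sup>2)) / 2 = 4 * d\<^sup>2 - E\<^sup>2" using True by simp
          ultimately have "pi * p E = sqrt (4 * d\<^sup>2 - E\<^sup>2) / d / 2 / d"
            and "g E 0 = sqrt (4 * d\<^sup>2 - E\<^sup>2) / (2 * d\<^sup>2)"
            using True mem unfolding g0 p_def semicircle_density_def by (simp_all only:) simp_all
          then show ?thesis by (simp add: power2_eq_square divide_divide_eq_left mult_ac)
        next
          case False
          then show ?thesis using mem unfolding g0 p_def semicircle_density_def by simp
        qed
      qed
      ultimately show ?thesis by simp
    qed
    \<comment> \<open>Uniform in \<open>E\<close> and in \<open>\<eta> \<le> 1\<close>, to dominate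
      the integrands in the inversion formula.\<close>
    have bound: "\<bar>g E \<eta>\<bar> \<le> (sqrt ((\<bar>a\<bar> + \<bar>b\<bar>)\<^sup>2 + 1 + 4 * d\<^sup>2) + 1) / (2 * d\<^sup>2)" if E: "E \<in> {a..b}" and \<eta>: "0 < \<eta>" "\<eta> \<le> 1" for E \<eta>
    proof -
      let ?w = "(Complex E \<eta>)\<^sup>2 - of_real (4 * d\<^sup>2)"
      have "cmod ?w \<le> cmod ((Complex E \<eta>)\<^sup>2) + cmod (of_real (4 * d\<^sup>2))" by (rule norm_triangle_ineq4)
      also have "cmod ((Complex E \<eta>)\<^sup>2) = E\<^sup>2 + \<eta>\<^sup>2" by (simp add: norm_power cmod_power2)
      also have "E\<^sup>2 \<le> (\<bar>a\<bar> + \<bar>b\<bar>)\<^sup>2" using E by (intro abs_le_square_iff[THEN iffD1]) auto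
      also have "\<eta>\<^sup>2 \<le> 1" using \<eta> by (simp add: power_le_one)
      also have "cmod (of_real (4 * d\<^sup>2)) = 4 * d\<^sup>2" by (simp only: norm_of_real) simp
      finally have w: "cmod ?w \<le> (\<bar>a\<bar> + \<bar>b\<bar>)\<^sup>2 + 1 + 4 * d\<^sup>2" by simp
      have R: "\<bar>Re ?w\<bar> \<le> cmod ?w" by (rule abs_Re_le_cmod)
      have "(cmod ?w - Re ?w) / 2 \<le> cmod ?w" using R unfolding abs_le_iff by (simp del: Re_power2)
      moreover have "0 \<le> (cmod ?w - Re ?w) / 2" using R unfolding abs_le_iff by (simp del: Re_power2)
      ultimately have "\<bar>sqrt ((cmod ?w - Re ?w) / 2) - \<eta>\<bar> \<le> sqrt ((\<bar>a\<bar> + \<bar>b\<bar>)\<^sup>2 + 1 + 4 * d\<^sup>2) + 1"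
        using w \<eta> real_sqrt_le_mono[of "(cmod ?w - Re ?w) / 2" "(\<bar>a\<bar> + \<bar>b\<bar>)\<^sup>2 + 1 + 4 * d\<^sup>2"]
          real_sqrt_ge_zero[of "(cmod ?w - Re ?w) / 2"] by linarith
      then show ?thesis unfolding g_def using d by (simp add: abs_divide divide_right_mono)
    qed
    have gm[measurable]: "(\<lambda>E. g E \<eta>) \<in> borel_measurable borel" for \<eta>
      unfolding g_def Complex_eq by measurable
    have "(\<lambda>n. LBINT E:{a..b}. g E (1 / real (Suc n))) \<longlonglongrightarrow> (LBINT E:{a..b}. pi * p E)"
      unfolding set_lebesgue_integral_def
    proof (rule integral_dominated_convergence[where w = "\<lambda>E. indicat_real {a..b} E *\<^sub>R ((sqrt ((\<bar>a\<bar> + \<bar>b\<bar>)\<^sup>2 + 1 + 4 * d\<^sup>2) + 1) / (2 * d\<^sup>2))"])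
      show "AE x in lborel. (\<lambda>i. indicat_real {a..b} x *\<^sub>R g x (1 / real (Suc i))) \<longlonglongrightarrow> indicat_real {a..b} x *\<^sub>R (pi * p x)"
        by (intro AE_I2 tendsto_intros lim)
      show "AE x in lborel. norm (indicat_real {a..b} x *\<^sub>R g x (1 / real (Suc i))) \<le> indicat_real {a..b} x *\<^sub>R ((sqrt ((\<bar>a\<bar> + \<bar>b\<bar>)\<^sup>2 + 1 + 4 * d\<^sup>2) + 1) / (2 * d\<^sup>2))" for i
        using bound by (intro AE_I2) (auto simp: indicator_def)
      show "integrable lborel (\<lambda>E. indicat_real {a..b} E *\<^sub>R ((sqrt ((\<bar>a\<bar> + \<bar>b\<bar>)\<^sup>2 + 1 + 4 * d\<^sup>2) + 1) / (2 * d\<^sup>2)))"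
        unfolding set_integrable_def[symmetric] by (rule borel_integrable_atLeastAtMost') (rule continuous_on_const)
    qed auto
    moreover have "(\<lambda>n. LBINT E:{a..b}. g E (1 / real (Suc n))) \<longlonglongrightarrow> pi * measure \<nu> {a<..b}"
      using \<nu>.stieltjes_inversion[OF ab(1) atoms] g by simp
    ultimately have "pi * measure \<nu> {a<..b} = (LBINT E:{a..b}. pi * p E)" by (metis LIMSEQ_unique)
    then have "measure \<nu> {a<..b} = (LBINT E:{a..b}. p E)" by simp
    also have "(LBINT E:{a..b}. p E) = measure (semicircle_law d) {a..b}"
      unfolding set_lebesgue_integral_def law measure_def using p
      by (subst integral_eq_nn_integral)
        (auto simp: emeasure_density indicator_def intro!: arg_cong[where f = enn2real] nn_integral_cong)
    also have "measure (semicircle_law d) {a..b} = measure (semicircle_law d) {a<..b}"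
    proof -
      have "emeasure (semicircle_law d) {a..b} = emeasure (semicircle_law d) {a<..b}"
        unfolding law
        using AE_lborel_singleton[of a]
        by (auto simp: emeasure_density indicator_def elim!: eventually_mono intro!: nn_integral_cong_AE)
      then show ?thesis by (simp add: measure_def)
    qed
    finally show "measure \<nu> {a<..b} = measure (semicircle_law d) {a<..b}" .
  qed
qed

section \<open>Tightness and convergence in the Levy metric\<close>

lemma tight_if_second_moments_bounded:
  assumes \<nu>: "\<And>n. real_distribution (\<nu> n)" and int: "\<And>n. integrable (\<nu> n) (\<lambda>x. x\<^sup>2)"
    and C: "\<And>n. (\<integral>x. x\<^sup>2 \<partial>\<nu> n) \<le> C"
  shows "tight \<nu>"
  unfolding tight_def
proof (intro conjI allI impI \<nu>)
  fix e :: real assume e: "0 < e"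
  have C0: "0 \<le> C" using C[of 0] by (rule order_trans[rotated]) (auto intro: integral_nonneg_AE)
  \<comment> \<open>The radius at which Chebyshev leaves mass below \<open>e\<close> outside; the
    two added units give the strict inequality and \<open>1 \<le> R\<close>.\<close>
  define R where "R = sqrt ((C + 1) / e) + 1"
  have sq: "0 \<le> sqrt ((C + 1) / e)" using C0 e by simp
  then have "(C + 1) / e = (sqrt ((C + 1) / e))\<^sup>2" using C0 e by simp
  also have "\<dots> < R\<^sup>2" unfolding R_def using sq by (intro power_strict_mono) auto
  finally have "C + 1 < e * R\<^sup>2" using e by (simp add: field_simps)
  moreover have R1: "1 \<le> R" using sq by (simp add: R_def)
  ultimately have R: "C / R\<^sup>2 < e" "1 \<le> R" by (auto simp: field_simps)
  have "1 - e < measure (\<nu> n) {-R<..R}" for n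
  proof -
    interpret real_distribution "\<nu> n" by fact
    have "\<P>(x in \<nu> n. R\<^sup>2 \<le> x\<^sup>2) \<le> (\<integral>x. x\<^sup>2 \<partial>\<nu> n) / R\<^sup>2"
      using R by (intro integral_Markov_inequality_measure[where A = "{}"] int) auto
    also have "\<dots> \<le> C / R\<^sup>2" using C R by (intro divide_right_mono) auto
    finally have 1: "\<P>(x in \<nu> n. R\<^sup>2 \<le> x\<^sup>2) < e" using R by simp
    have "1 - prob {-R<..R} = prob (UNIV - {-R<..R})" using prob_compl[of "{-R<..R}"] by simp
    also have "\<dots> \<le> prob {x \<in> space (\<nu> n). R\<^sup>2 \<le> x\<^sup>2}"
      using R by (intro finite_measure_mono) (auto simp flip: abs_le_square_iff)
    finally show ?thesis using 1 by simp
  qed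
  then show "\<exists>a b. a < b \<and> (\<forall>n. 1 - e < measure (\<nu> n) {a<..b})"
    using R(2) by (intro exI[of _ "-R"] exI[of _ R]) auto
qed

text \<open>Induction over the generation of the weak topology from its subbasis; weak convergence
  enters only at the subbasic sets.\<close>

lemma weak_conv_imp_eventually_weak_open:
  assumes \<nu>: "\<And>n. real_distribution (\<nu> n)" and \<mu>: "real_distribution \<mu>" and "weak_conv_m \<nu> \<mu>"
    and V: "openin weak_topology V" and "\<mu> \<in> V"
  shows "\<forall>\<^sub>F n in sequentially. \<nu> n \<in> V"
proof -
  have "generate_topology_on
     {{\<mu>. real_distribution \<mu> \<and> (\<integral>x. f x \<partial>\<mu>) \<in> U} | f U.
        continuous_on UNIV f \<and> bounded (range f) \<and> open (U :: real set)} V"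
    using V unfolding weak_topology_def openin_topology_generated_by_iff .
  then show ?thesis using \<open>\<mu> \<in> V\<close>
  proof (induction rule: generate_topology_on.induct)
    case (UN K)
    then obtain k where "k \<in> K" "\<mu> \<in> k" by blast
    with UN have "\<forall>\<^sub>F n in sequentially. \<nu> n \<in> k" by blast
    then show ?case by (rule eventually_mono) (use \<open>k \<in> K\<close> in blast)
  next
    case (Basis W)
    then obtain f U where W: "W = {\<mu>. real_distribution \<mu> \<and> (\<integral>x. f x \<partial>\<mu>) \<in> U}"
      "continuous_on UNIV f" "bounded (range f)" "open (U :: real set)" by blast
    obtain B where "\<And>x. norm (f x) \<le> B" using W(3) unfolding bounded_iff by auto
    then have "(\<lambda>n. \<integral>x. f x \<partial>\<nu> n) \<longlonglongrightarrow> (\<integral>x. f x \<partial>\<mu>)"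
      using assms(3) W(2) by (intro weak_conv_imp_integral_bdd_continuous_conv \<nu> \<mu>) (auto simp: continuous_on_eq_continuous_at)
    then have "\<forall>\<^sub>F n in sequentially. (\<integral>x. f x \<partial>\<nu> n) \<in> U"
      using W Basis.prems by (intro topological_tendstoD) auto
    then show ?case by (rule eventually_mono) (use W \<nu> in auto)
  qed (auto elim: eventually_elim2)
qed

text \<open>A subsequence at distance at least \<open>e\<close> from \<open>\<mu>\<close> has, by
  tightness, a weakly convergent further subsequence. The Cauchy kernel is bounded and continuous,
  so the transforms converge to that of the limit, which \<open>lim\<close> identifies as
  \<open>\<mu>\<close>; this contradicts the distance.\<close>

lemma levy_dist_tendsto_if_stieltjes_limits_unique:
  assumes \<nu>: "\<And>n. real_distribution (\<nu> n)" and int: "\<And>n. integrable (\<nu> n) (\<lambda>x. x\<^sup>2)"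
    and C: "\<And>n. (\<integral>x. x\<^sup>2 \<partial>\<nu> n) \<le> C" and \<mu>: "real_distribution \<mu>"
    and lim: "\<And>r \<rho>. strict_mono r \<Longrightarrow> real_distribution \<rho> \<Longrightarrow>
      (\<And>z. 0 < Im z \<Longrightarrow> (\<lambda>n. stieltjes (\<nu> (r n)) z) \<longlonglongrightarrow> stieltjes \<rho> z) \<Longrightarrow> \<rho> = \<mu>"
  shows "(\<lambda>n. levy_dist \<mu> (\<nu> n)) \<longlonglongrightarrow> 0"
proof (rule ccontr)
  assume "\<not> ?thesis"
  then obtain e where e: "0 < e" "\<not> (\<forall>\<^sub>F n in sequentially. levy_dist \<mu> (\<nu> n) < e)"
    using levy_dist_nonneg unfolding tendsto_iff by (auto simp: dist_real_def abs_of_nonneg)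
  have inf: "infinite {n. e \<le> levy_dist \<mu> (\<nu> n)}"
    using e(2) unfolding eventually_sequentially infinite_nat_iff_unbounded_le by (auto simp: not_less)
  define s where "s = enumerate {n. e \<le> levy_dist \<mu> (\<nu> n)}"
  have s: "strict_mono s" "\<And>n. e \<le> levy_dist \<mu> (\<nu> (s n))"
    using strict_mono_enumerate[OF inf] enumerate_in_set[OF inf] by (auto simp: s_def)
  have "tight \<nu>" using tight_if_second_moments_bounded \<nu> int C by blast
  from tight_imp_convergent_subsubsequence[OF this s(1)]
  obtain r \<rho> where r: "strict_mono r" "real_distribution \<rho>" "weak_conv_m (\<nu> \<circ> s \<circ> r) \<rho>"
    by blast
  have "\<rho> = \<mu>"
  proof (rule lim)
    show "strict_mono (s \<circ> r)" using s(1) r(1) by (rule strict_mono_o)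
    fix z :: complex assume z: "0 < Im z"
    have "(\<lambda>n. \<integral>x. 1 / (complex_of_real x - z) \<partial>((\<nu> \<circ> s \<circ> r) n)) \<longlonglongrightarrow> (\<integral>x. 1 / (complex_of_real x - z) \<partial>\<rho>)"
      using z r(2,3) \<nu> by (intro weak_conv_imp_integral_bdd_continuous_conv[where B = "1 / Im z"])
        (auto intro!: norm_cauchy_kernel_le continuous_cauchy_kernel simp: comp_def)
    then show "(\<lambda>n. stieltjes (\<nu> ((s \<circ> r) n)) z) \<longlonglongrightarrow> stieltjes \<rho> z"
      by (simp add: stieltjes_def)
  qed (rule r)
  obtain V where V: "openin weak_topology V" "\<mu> \<in> V" "\<forall>\<nu>\<in>V. levy_dist \<mu> \<nu> < e"
    using weak_nbhd_in_levy_ball[OF \<mu> e(1)] by blast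
  have "\<forall>\<^sub>F n in sequentially. (\<nu> \<circ> s \<circ> r) n \<in> V"
    using r(3) V \<mu> \<nu> unfolding \<open>\<rho> = \<mu>\<close>
    by (intro weak_conv_imp_eventually_weak_open[where \<mu> = \<mu>]) (auto simp: comp_def)
  then obtain n where "(\<nu> \<circ> s \<circ> r) n \<in> V" unfolding eventually_sequentially by blast
  then show False using V(3) s(2)[of "r n"] by fastforce
qed

section \<open>Bounded differences and iid arrays\<close>

text \<open>Integrating out one coordinate at a time; Hoeffding's lemma bounds the contribution of each.\<close>

lemma bounded_differences_exp_moment:
  fixes N :: "'i \<Rightarrow> 'b measure" and f :: "('i \<Rightarrow> 'b) \<Rightarrow> real"
  assumes N: "\<And>i. prob_space (N i)" and I: "finite I"
    and meas: "f \<in> borel_measurable (PiM I N)" 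
    and bdd: "\<And>x. x \<in> space (PiM I N) \<Longrightarrow> \<bar>f x\<bar> \<le> K"
    and diff: "\<And>x i y. x \<in> space (PiM I N) \<Longrightarrow> i \<in> I \<Longrightarrow> y \<in> space (N i) \<Longrightarrow> \<bar>f (x(i := y)) - f x\<bar> \<le> c i"
  shows "(\<integral>\<^sup>+x. ennreal (exp (f x - (\<integral>x. f x \<partial>PiM I N))) \<partial>PiM I N) \<le> ennreal (exp ((\<Sum>i\<in>I. (c i)\<^sup>2) / 2))"
  using I meas bdd diff
proof (induction I arbitrary: f rule: finite_induct)
  interpret product_prob_space N by (intro product_prob_spaceI N)
  case empty
  have sp: "space (PiM {} N) = {\<lambda>_. undefined}" by (simp add: space_PiM)
  interpret e: prob_space "PiM {} N" by (intro prob_space_PiM N)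
  have "(\<integral>x. f x \<partial>PiM {} N) = (\<integral>x. f (\<lambda>_. undefined) \<partial>PiM {} N)"
    by (intro Bochner_Integration.integral_cong refl) (simp add: sp)
  also have "\<dots> = f (\<lambda>_. undefined)" using e.prob_space by simp
  finally show ?case by (simp add: nn_integral_empty)
next
  case (insert i I)
  interpret PI: prob_space "PiM I N" by (intro prob_space_PiM N)
  interpret PII: prob_space "PiM (insert i I) N" by (intro prob_space_PiM N)
  interpret Ni: prob_space "N i" by (rule N)
  interpret product_prob_space N by (intro product_prob_spaceI N)
  note f = insert.prems(1)
  define g where "g x = (\<integral>y. f (x(i := y)) \<partial>N i)" for x
  have upd: "(\<lambda>(x, y). f (x(i := y))) \<in> borel_measurable (PiM I N \<Otimes>\<^sub>M N i)"
  proof -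
    have "(\<lambda>p. f ((\<lambda>(x, y). x(i := y)) p)) \<in> borel_measurable (PiM I N \<Otimes>\<^sub>M N i)"
      by (rule measurable_compose[OF measurable_add_dim f])
    also have "(\<lambda>p. f ((\<lambda>(x, y). x(i := y)) p)) = (\<lambda>(x, y). f (x(i := y)))" by (auto simp: fun_eq_iff)
    finally show ?thesis .
  qed
  then have updy: "(\<lambda>y. f (x(i := y))) \<in> borel_measurable (N i)" if "x \<in> space (PiM I N)" for x
    using measurable_compose[OF measurable_Pair1'[OF that] upd] by simp
  have g: "g \<in> borel_measurable (PiM I N)"
    unfolding g_def using upd prob_space_imp_sigma_finite[OF N]
    by (intro sigma_finite_measure.borel_measurable_lebesgue_integral)
  have sp: "x(i := y) \<in> space (PiM (insert i I) N)" if "x \<in> space (PiM I N)" "y \<in> space (N i)" for x y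
    using that by (auto simp: space_PiM PiE_def extensional_def)
  have fK: "norm (f (x(i := y))) \<le> K" if "x \<in> space (PiM I N)" "y \<in> space (N i)" for x y
    unfolding real_norm_def by (rule insert.prems(2)[OF sp[OF that]])
  have inty: "integrable (N i) (\<lambda>y. f (x(i := y)))" if "x \<in> space (PiM I N)" for x
    by (rule Ni.integrable_const_bound[where B = K, OF AE_I2 updy[OF that]]) (rule fK[OF that])
  have intf: "integrable (PiM (insert i I) N) f"
    using insert.prems(2) by (intro PII.integrable_const_bound[where B = K] f AE_I2) auto
  have K0: "\<bar>g x\<bar> \<le> K" if "x \<in> space (PiM I N)" for x
  proof -
    have "\<bar>g x\<bar> \<le> (\<integral>y. \<bar>f (x(i := y))\<bar> \<partial>N i)" unfolding g_def by (rule integral_abs_bound)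
    also have "\<dots> \<le> (\<integral>y. K \<partial>N i)"
      by (rule integral_mono[OF integrable_abs[OF inty[OF that]]]) (simp, rule fK[OF that, unfolded real_norm_def])
    finally show ?thesis using Ni.prob_space by simp
  qed
  have gdiff: "\<bar>g (x(j := y)) - g x\<bar> \<le> c j" if x: "x \<in> space (PiM I N)" and j: "j \<in> I" and y: "y \<in> space (N j)" for x j y
  proof -
    have ij: "i \<noteq> j" using insert j by auto
    have x': "x(j := y) \<in> space (PiM I N)" using x j y by (auto simp: space_PiM PiE_def extensional_def)
    have "g (x(j := y)) - g x = (\<integral>t. f ((x(j := y))(i := t)) - f (x(i := t)) \<partial>N i)"
      unfolding g_def using inty[OF x] inty[OF x'] by simp
    also have "\<bar>\<dots>\<bar> \<le> (\<integral>t. \<bar>f ((x(j := y))(i := t)) - f (x(i := t))\<bar> \<partial>N i)"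
      by (rule integral_abs_bound)
    also have "\<dots> \<le> (\<integral>t. c j \<partial>N i)"
    proof (intro integral_mono integrable_abs Bochner_Integration.integrable_diff inty x x')
      fix t assume "t \<in> space (N i)"
      then have "\<bar>f ((x(i := t))(j := y)) - f (x(i := t))\<bar> \<le> c j"
        by (rule insert.prems(3)[OF sp[OF x]]) (use j y in auto)
      then show "\<bar>f ((x(j := y))(i := t)) - f (x(i := t))\<bar> \<le> c j"
        using fun_upd_twist[OF ij, of x t y] by simp
    qed simp
    finally show ?thesis using Ni.prob_space by simp
  qed
  have Ef: "(\<integral>x. f x \<partial>PiM (insert i I) N) = (\<integral>x. g x \<partial>PiM I N)" (is "?E = _")
    unfolding g_def using insert.hyps intf by (intro product_integral_insert)
  have "(\<integral>\<^sup>+x. ennreal (exp (f x - ?E)) \<partial>PiM (insert i I) N) =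
      (\<integral>\<^sup>+x. (\<integral>\<^sup>+y. ennreal (exp (f (x(i := y)) - ?E)) \<partial>N i) \<partial>PiM I N)"
    using insert.hyps f by (intro product_nn_integral_insert) auto
  also have "\<dots> \<le> (\<integral>\<^sup>+x. ennreal (exp ((c i)\<^sup>2 / 2)) * ennreal (exp (g x - ?E)) \<partial>PiM I N)"
  proof (intro nn_integral_mono)
    fix x assume x: "x \<in> space (PiM I N)"
    obtain y0 where y0: "y0 \<in> space (N i)" using Ni.not_empty by blast
    \<comment> \<open>The values lie in an interval of length \<open>2 * c i\<close> around a
      reference value, so Hoeffding's lemma gives the exponent
      \<open>(2 * c i)\<^sup>2 / 8 = (c i)\<^sup>2 / 2\<close>.\<close>
    have "f (x(i := y)) \<in> {f (x(i := y0)) - c i..f (x(i := y0)) + c i}" if "y \<in> space (N i)" for y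
    proof -
      have "\<bar>f ((x(i := y0))(i := y)) - f (x(i := y0))\<bar> \<le> c i"
        by (rule insert.prems(3)[OF sp[OF x y0]]) (use that in auto)
      then show ?thesis unfolding fun_upd_upd abs_le_iff atLeastAtMost_iff by linarith
    qed
    then interpret interval_bounded_random_variable "N i" "\<lambda>y. f (x(i := y))" "f (x(i := y0)) - c i" "f (x(i := y0)) + c i"
      using updy[OF x] by unfold_locales auto
    have "(\<integral>\<^sup>+y. ennreal (exp (f (x(i := y)) - ?E)) \<partial>N i) =
        (\<integral>\<^sup>+y. ennreal (exp (g x - ?E)) * ennreal (exp (f (x(i := y)) - g x)) \<partial>N i)"
      by (intro nn_integral_cong) (simp add: ennreal_mult[symmetric] exp_add[symmetric])
    also have "\<dots> = ennreal (exp (g x - ?E)) * (\<integral>\<^sup>+y. ennreal (exp (f (x(i := y)) - g x)) \<partial>N i)"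
      using updy[OF x] by (intro nn_integral_cmult) measurable
    also have "\<dots> \<le> ennreal (exp (g x - ?E)) * ennreal (exp ((c i)\<^sup>2 / 2))"
      using Hoeffdings_lemma_nn_integral[of 1] by (intro mult_left_mono) (simp_all add: g_def power2_eq_square)
    finally show "(\<integral>\<^sup>+y. ennreal (exp (f (x(i := y)) - ?E)) \<partial>N i) \<le> ennreal (exp ((c i)\<^sup>2 / 2)) * ennreal (exp (g x - ?E))"
      by (simp only: mult.commute)
  qed
  also have "\<dots> = ennreal (exp ((c i)\<^sup>2 / 2)) * (\<integral>\<^sup>+x. ennreal (exp (g x - (\<integral>x. g x \<partial>PiM I N))) \<partial>PiM I N)"
  proof -
    have [measurable]: "(\<lambda>x. ennreal (exp (g x - e))) \<in> borel_measurable (PiM I N)" for e using g by measurable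
    show ?thesis unfolding Ef by (intro nn_integral_cmult) measurable
  qed
  also have "\<dots> \<le> ennreal (exp ((c i)\<^sup>2 / 2)) * ennreal (exp ((\<Sum>i\<in>I. (c i)\<^sup>2) / 2))"
    by (intro mult_left_mono insert.IH g K0 gdiff) auto
  also have "\<dots> = ennreal (exp ((\<Sum>i\<in>insert i I. (c i)\<^sup>2) / 2))"
    using insert.hyps by (simp add: ennreal_mult[symmetric] exp_add[symmetric] add_divide_distrib)
  finally show ?case .
qed

text \<open>Chernoff bound: by independence the law of the vector is a product measure, to which
  \<open>bounded_differences_exp_moment\<close> applies with \<open>l\<close> times
  \<open>f\<close>.\<close>

lemma (in prob_space) bounded_differences_upper_tail:
  fixes X :: "'i \<Rightarrow> 'a \<Rightarrow> 'b" and f :: "('i \<Rightarrow> 'b) \<Rightarrow> real"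
  assumes I: "finite I" "I \<noteq> {}" and X: "\<And>i. random_variable (N i) (X i)" and indep: "indep_vars N X I"
    and meas: "f \<in> borel_measurable (PiM I N)" 
    and bdd: "\<And>x. x \<in> space (PiM I N) \<Longrightarrow> \<bar>f x\<bar> \<le> K"
    and diff: "\<And>x i y. x \<in> space (PiM I N) \<Longrightarrow> i \<in> I \<Longrightarrow> y \<in> space (N i) \<Longrightarrow> \<bar>f (x(i := y)) - f x\<bar> \<le> c i"
    and S: "0 < S" "(\<Sum>i\<in>I. (c i)\<^sup>2) \<le> S" and e: "0 < e"
  defines "h \<equiv> \<lambda>\<omega>. f (\<lambda>i\<in>I. X i \<omega>)"
  shows "prob {\<omega> \<in> space M. e \<le> h \<omega> - expectation h} \<le> exp (- (e\<^sup>2 / (2 * S)))"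
proof -
  define D where "D i = distr M (N i) (X i)" for i
  \<comment> \<open>The minimiser of the exponent
    \<open>- l * e + l\<^sup>2 * S / 2\<close>.\<close>
  define l where "l = e / S"
  have l: "0 < l" using S e by (simp add: l_def)
  have D: "prob_space (D i)" for i unfolding D_def by (intro prob_space_distr X)
  have distr: "distr M (PiM I N) (\<lambda>\<omega>. \<lambda>i\<in>I. X i \<omega>) = PiM I D"
    using indep_vars_iff_distr_eq_PiM[OF I(2) X] indep unfolding D_def by simp
  have sets: "sets (PiM I D) = sets (PiM I N)" by (intro sets_PiM_cong) (auto simp: D_def)
  have space: "space (PiM I D) = space (PiM I N)" by (rule sets_eq_imp_space_eq[OF sets])
  have Xm: "(\<lambda>\<omega>. \<lambda>i\<in>I. X i \<omega>) \<in> measurable M (PiM I N)" using X by measurable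
  have fD: "f \<in> borel_measurable (PiM I D)" using meas by (subst measurable_cong_sets[OF sets refl])
  have hm: "random_variable borel h" unfolding h_def using measurable_compose[OF Xm meas] .
  have Eh: "expectation h = (\<integral>x. f x \<partial>PiM I D)"
    unfolding distr[symmetric] h_def by (rule integral_distr[symmetric, OF Xm meas])
  have "(\<integral>\<^sup>+\<omega>. ennreal (exp (l * (h \<omega> - expectation h))) \<partial>M) =
      (\<integral>\<^sup>+x. ennreal (exp (l * f x - (\<integral>x. l * f x \<partial>PiM I D))) \<partial>PiM I D)"
    unfolding Eh unfolding distr[symmetric] h_def
    using meas by (subst nn_integral_distr[OF Xm]) (auto simp: algebra_simps)
  also have "\<dots> \<le> ennreal (exp ((\<Sum>i\<in>I. (l * c i)\<^sup>2) / 2))"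
  proof (rule bounded_differences_exp_moment[where K = "l * K"])
    show "(\<lambda>x. l * f x) \<in> borel_measurable (PiM I D)" using fD by measurable
    show "\<bar>l * f x\<bar> \<le> l * K" if "x \<in> space (PiM I D)" for x
      using bdd that l unfolding space by (simp add: abs_mult)
    show "\<bar>l * f (x(i := y)) - l * f x\<bar> \<le> l * c i" if "x \<in> space (PiM I D)" "i \<in> I" "y \<in> space (D i)" for x i y
    proof -
      have "l * f (x(i := y)) - l * f x = l * (f (x(i := y)) - f x)" by (simp add: algebra_simps)
      then show ?thesis using diff[of x i y] that l unfolding space D_def by (simp add: abs_mult)
    qed
  qed (use D I in auto)
  also have "(\<Sum>i\<in>I. (l * c i)\<^sup>2) \<le> l\<^sup>2 * S"
    using S(2) by (simp add: power_mult_distrib sum_distrib_left[symmetric] mult_left_mono)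
  finally have exp: "(\<integral>\<^sup>+\<omega>. ennreal (exp (l * (h \<omega> - expectation h))) \<partial>M) \<le> ennreal (exp (l\<^sup>2 * S / 2))"
    by (simp add: ennreal_leI)
  have "emeasure M {\<omega> \<in> space M. e \<le> h \<omega> - expectation h} =
      emeasure M {\<omega> \<in> space M. 1 \<le> ennreal (exp (- l * e)) * ennreal (exp (l * (h \<omega> - expectation h)))}"
  proof -
    have "1 \<le> ennreal (exp (- l * e)) * ennreal (exp (l * (h \<omega> - expectation h))) \<longleftrightarrow> e \<le> h \<omega> - expectation h" for \<omega>
    proof -
      have "ennreal (exp (- l * e)) * ennreal (exp (l * (h \<omega> - expectation h))) = ennreal (exp (l * ((h \<omega> - expectation h) - e)))"
        by (simp add: ennreal_mult[symmetric] exp_add[symmetric] algebra_simps)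
      then show ?thesis using l by (simp add: zero_le_mult_iff)
    qed
    then show ?thesis by simp
  qed
  also have "\<dots> \<le> ennreal (exp (- l * e)) * (\<integral>\<^sup>+\<omega>. ennreal (exp (l * (h \<omega> - expectation h))) * indicator (space M) \<omega> \<partial>M)"
    using hm by (intro nn_integral_Markov_inequality) auto
  also have "(\<integral>\<^sup>+\<omega>. ennreal (exp (l * (h \<omega> - expectation h))) * indicator (space M) \<omega> \<partial>M) = (\<integral>\<^sup>+\<omega>. ennreal (exp (l * (h \<omega> - expectation h))) \<partial>M)"
    by (intro nn_integral_cong) simp
  also have "ennreal (exp (- l * e)) * \<dots> \<le> ennreal (exp (- l * e)) * ennreal (exp (l\<^sup>2 * S / 2))"
    by (intro mult_left_mono exp) auto
  also have "\<dots> = ennreal (exp (- (e\<^sup>2 / (2 * S))))"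
  proof -
    have "- l * e + l\<^sup>2 * S / 2 = - (e\<^sup>2 / (2 * S))" using S by (simp add: l_def field_simps power2_eq_square)
    then show ?thesis by (simp add: ennreal_mult[symmetric] exp_add[symmetric])
  qed
  finally show ?thesis by (simp add: emeasure_eq_measure)
qed

lemma (in prob_space) bounded_differences_tail:
  fixes X :: "'i \<Rightarrow> 'a \<Rightarrow> 'b" and f :: "('i \<Rightarrow> 'b) \<Rightarrow> real"
  assumes I: "finite I" "I \<noteq> {}" and X: "\<And>i. random_variable (N i) (X i)" and indep: "indep_vars N X I"
    and meas: "f \<in> borel_measurable (PiM I N)" 
    and bdd: "\<And>x. x \<in> space (PiM I N) \<Longrightarrow> \<bar>f x\<bar> \<le> K"
    and diff: "\<And>x i y. x \<in> space (PiM I N) \<Longrightarrow> i \<in> I \<Longrightarrow> y \<in> space (N i) \<Longrightarrow> \<bar>f (x(i := y)) - f x\<bar> \<le> c i"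
    and S: "0 < S" "(\<Sum>i\<in>I. (c i)\<^sup>2) \<le> S" and e: "0 < e"
  defines "h \<equiv> \<lambda>\<omega>. f (\<lambda>i\<in>I. X i \<omega>)"
  shows "prob {\<omega> \<in> space M. e \<le> \<bar>h \<omega> - expectation h\<bar>} \<le> 2 * exp (- (e\<^sup>2 / (2 * S)))"
proof -
  have Xm: "(\<lambda>\<omega>. \<lambda>i\<in>I. X i \<omega>) \<in> measurable M (PiM I N)" using X by measurable
  have [measurable]: "random_variable borel h" unfolding h_def using measurable_compose[OF Xm meas] .
  have up: "prob {\<omega> \<in> space M. e \<le> h \<omega> - expectation h} \<le> exp (- (e\<^sup>2 / (2 * S)))"
    unfolding h_def by (rule bounded_differences_upper_tail[OF I X indep meas bdd diff S e])
  have "prob {\<omega> \<in> space M. e \<le> - f (\<lambda>i\<in>I. X i \<omega>) - expectation (\<lambda>\<omega>. - f (\<lambda>i\<in>I. X i \<omega>))} \<le> exp (- (e\<^sup>2 / (2 * S)))"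
  proof (rule bounded_differences_upper_tail[OF I X indep, where f = "\<lambda>x. - f x"])
    show "\<bar>- f (x(i := y)) - - f x\<bar> \<le> c i" if "x \<in> space (PiM I N)" "i \<in> I" "y \<in> space (N i)" for x i y
      using diff[OF that] by (simp add: abs_minus_commute)
  qed (use meas bdd S e in auto)
  then have low: "prob {\<omega> \<in> space M. e \<le> - (h \<omega> - expectation h)} \<le> exp (- (e\<^sup>2 / (2 * S)))"
    by (simp add: h_def)
  have "prob {\<omega> \<in> space M. e \<le> \<bar>h \<omega> - expectation h\<bar>} \<le>
      prob ({\<omega> \<in> space M. e \<le> h \<omega> - expectation h} \<union> {\<omega> \<in> space M. e \<le> - (h \<omega> - expectation h)})"
    by (intro finite_measure_mono) (auto simp: abs_if split: if_splits)
  also have "\<dots> \<le> prob {\<omega> \<in> space M. e \<le> h \<omega> - expectation h} + prob {\<omega> \<in> space M. e \<le> - (h \<omega> - expectation h)}"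
    by (rule measure_Un_le) auto
  finally show ?thesis using up low by simp
qed

section \<open>Growth of sums over square iid arrays\<close>

lemma sum_powers_below_le: 
  fixes x :: real assumes "0 \<le> x"
  shows "(\<Sum>k<n. 4 ^ k * (if 4 ^ k < x then 1 else 0)) \<le> 2 * x"
proof (induction n)
  case (Suc n)
  \<comment> \<open>If the last power is below \<open>x\<close>, the earlier ones add up to less
    than a third of it, so the total stays below \<open>4 / 3 * x\<close>.\<close>
  have geo: "(\<Sum>k<n. 4 ^ k * (if 4 ^ k < x then 1 else 0)) \<le> (4 ^ n - 1) / (3 :: real)"
  proof -
    have "(\<Sum>k<n. 4 ^ k * (if 4 ^ k < x then 1 else 0)) \<le> (\<Sum>k<n. (4 :: real) ^ k)"
      by (intro sum_mono) auto
    also have "\<dots> = (4 ^ n - 1) / 3" by (subst geometric_sum) auto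
    finally show ?thesis .
  qed
  show ?case
  proof (cases "4 ^ n < x")
    case True
    moreover have "0 \<le> (4 :: real) ^ n" by simp
    ultimately show ?thesis using geo by (simp del: zero_le_power)
  qed (use Suc in simp)
qed (use assms in simp)

text \<open>The nonzero terms start at the first power that is at least \<open>x\<close> and decay
  with ratio \<open>1 / 4\<close>. The induction closes because it carries the remainder
  \<open>x / 4 ^ n / 3\<close> of the geometric series.\<close>

lemma sum_inverse_powers_above_le: 
  fixes x :: real assumes "0 \<le> x"
  shows "(\<Sum>k<n. (if x \<le> 4 ^ k then x / 4 ^ k else 0)) \<le> 4 / 3"
proof -
  have "(\<Sum>k<Suc n. (if x \<le> 4 ^ k then x / 4 ^ k else 0)) \<le> (if x \<le> 4 ^ n then 4 / 3 - x / 4 ^ n / 3 else 0)" for n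
  proof (induction n)
    case (Suc n)
    show ?case
    proof (cases "x \<le> 4 ^ n")
      case True
      then have "x \<le> 4 ^ Suc n" using assms by (simp add: order_trans[OF _ mult_right_mono[of 1 4 "4 ^ n"]])
      then show ?thesis using Suc True by (simp add: field_simps)
    next
      case False
      define u where "u = x / 4 ^ Suc n"
      have T: "(\<Sum>k<Suc n. (if x \<le> 4 ^ k then x / 4 ^ k else 0)) \<le> 0" using Suc False by simp
      show ?thesis
      proof (cases "x \<le> 4 ^ Suc n")
        case True
        then have "u \<le> 1" by (simp add: u_def)
        moreover have "(\<Sum>k<Suc (Suc n). (if x \<le> 4 ^ k then x / 4 ^ k else 0)) = (\<Sum>k<Suc n. (if x \<le> 4 ^ k then x / 4 ^ k else 0)) + u"
          using True unfolding u_def by (subst sum.lessThan_Suc) simp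
        ultimately show ?thesis using T True unfolding u_def[symmetric] by simp
      qed (use T in simp)
    qed
  qed auto
  from this[of n]
  have *: "(\<Sum>k<n. (if x \<le> 4 ^ k then x / 4 ^ k else 0)) + (if x \<le> 4 ^ n then x / 4 ^ n else 0) \<le>
      (if x \<le> 4 ^ n then 4 / 3 - x / 4 ^ n / 3 else 0)" by simp
  have "0 \<le> x / 4 ^ n" using assms by simp
  with * show ?thesis by (cases "x \<le> 4 ^ n") simp_all
qed

context prob_space
begin

lemma variance_sum_indep_le:
  fixes Y :: "'i \<Rightarrow> 'a \<Rightarrow> real"
  assumes I: "finite I" and indep: "indep_vars (\<lambda>_. borel) Y I"
    and bdd: "\<And>i. i \<in> I \<Longrightarrow> AE \<omega> in M. \<bar>Y i \<omega>\<bar> \<le> K"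
  shows "expectation (\<lambda>\<omega>. ((\<Sum>i\<in>I. Y i \<omega>) - expectation (\<lambda>\<omega>. \<Sum>i\<in>I. Y i \<omega>))\<^sup>2) \<le> (\<Sum>i\<in>I. expectation (\<lambda>\<omega>. (Y i \<omega>)\<^sup>2))"
proof -
  have rv[measurable]: "random_variable borel (Y i)" if "i \<in> I" for i using indep that by (auto simp: indep_vars_def)
  have int: "integrable M (Y i)" if "i \<in> I" for i
    using bdd[OF that] rv[OF that] by (intro integrable_const_bound[where B = K]) auto
  define m where "m i = expectation (Y i)" for i
  define W where "W i \<omega> = Y i \<omega> - m i" for i \<omega>
  have Wrv[measurable]: "random_variable borel (W i)" if "i \<in> I" for i unfolding W_def using rv[OF that] by measurable
  have Wbdd: "AE \<omega> in M. \<bar>W i \<omega>\<bar> \<le> K + \<bar>m i\<bar>" if "i \<in> I" for i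
    using bdd[OF that] by eventually_elim (simp add: W_def)
  have Wint: "integrable M (W i)" if "i \<in> I" for i unfolding W_def using int[OF that] by simp
  have W0: "expectation (W i) = 0" if "i \<in> I" for i unfolding W_def using int[OF that] prob_space by (simp add: m_def)
  have Wprod: "integrable M (\<lambda>\<omega>. W i \<omega> * W j \<omega>)" if "i \<in> I" "j \<in> I" for i j
  proof (rule integrable_const_bound[where B = "(K + \<bar>m i\<bar>) * (K + \<bar>m j\<bar>)"])
    show "AE \<omega> in M. norm (W i \<omega> * W j \<omega>) \<le> (K + \<bar>m i\<bar>) * (K + \<bar>m j\<bar>)"
      using Wbdd[OF that(1)] Wbdd[OF that(2)]
    proof eventually_elim
      case (elim \<omega>)
      then show ?case unfolding real_norm_def abs_mult by (intro mult_mono) (auto intro: order_trans[OF abs_ge_zero])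
    qed
  qed (use that in measurable)
  have "(\<Sum>i\<in>I. Y i \<omega>) - expectation (\<lambda>\<omega>. \<Sum>i\<in>I. Y i \<omega>) = (\<Sum>i\<in>I. W i \<omega>)" for \<omega>
    using int by (simp add: W_def m_def sum_subtractf)
  then have "expectation (\<lambda>\<omega>. ((\<Sum>i\<in>I. Y i \<omega>) - expectation (\<lambda>\<omega>. \<Sum>i\<in>I. Y i \<omega>))\<^sup>2)
     = expectation (\<lambda>\<omega>. \<Sum>i\<in>I. \<Sum>j\<in>I. W i \<omega> * W j \<omega>)"
    by (simp add: power2_eq_square sum_product)
  also have "\<dots> = (\<Sum>i\<in>I. \<Sum>j\<in>I. expectation (\<lambda>\<omega>. W i \<omega> * W j \<omega>))"
    using Wprod by (subst Bochner_Integration.integral_sum) (auto intro!: sum.cong Bochner_Integration.integral_sum)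
  also have "\<dots> = (\<Sum>i\<in>I. expectation (\<lambda>\<omega>. (W i \<omega>)\<^sup>2))"
  proof (rule sum.cong[OF refl])
    fix i assume i: "i \<in> I"
    have "expectation (\<lambda>\<omega>. W i \<omega> * W j \<omega>) = 0" if "j \<in> I" "j \<noteq> i" for j
    proof -
      have "indep_vars (\<lambda>_. borel) Y (insert i {j})"
        using indep i that by (intro indep_vars_subset[OF indep]) auto
      then have "indep_var borel (Y i) borel (Y j)"
        using indep_vars_sum[of "{j}" i Y] that by simp
      then have "indep_var borel ((\<lambda>y. y - m i) \<circ> Y i) borel ((\<lambda>y. y - m j) \<circ> Y j)"
        by (rule indep_var_compose) auto
      then have "expectation (\<lambda>\<omega>. W i \<omega> * W j \<omega>) = expectation (W i) * expectation (W j)"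
        using Wint i that by (intro indep_var_lebesgue_integral) (auto simp: comp_def W_def[abs_def])
      then show ?thesis using W0 i by simp
    qed
    then have "(\<Sum>j\<in>I. expectation (\<lambda>\<omega>. W i \<omega> * W j \<omega>)) = (\<Sum>j\<in>{i}. expectation (\<lambda>\<omega>. W i \<omega> * W j \<omega>))"
      using i I by (intro sum.mono_neutral_right) auto
    then show "(\<Sum>j\<in>I. expectation (\<lambda>\<omega>. W i \<omega> * W j \<omega>)) = expectation (\<lambda>\<omega>. (W i \<omega>)\<^sup>2)"
      by (simp add: power2_eq_square)
  qed
  also have "\<dots> \<le> (\<Sum>i\<in>I. expectation (\<lambda>\<omega>. (Y i \<omega>)\<^sup>2))"
  proof (rule sum_mono)
    fix i assume i: "i \<in> I"
    have "integrable M (\<lambda>\<omega>. (Y i \<omega>)\<^sup>2)"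
    proof (rule integrable_const_bound[where B = "K\<^sup>2"])
      show "AE \<omega> in M. norm ((Y i \<omega>)\<^sup>2) \<le> K\<^sup>2"
        using bdd[OF i] by eventually_elim (simp add: abs_le_square_iff[symmetric])
    qed (use i in measurable)
    then have "expectation (\<lambda>\<omega>. (W i \<omega>)\<^sup>2) = expectation (\<lambda>\<omega>. (Y i \<omega>)\<^sup>2) - (m i)\<^sup>2"
      unfolding W_def m_def using int[OF i] by (intro variance_eq)
    then show "expectation (\<lambda>\<omega>. (W i \<omega>)\<^sup>2) \<le> expectation (\<lambda>\<omega>. (Y i \<omega>)\<^sup>2)" by simp
  qed
  finally show ?thesis .
qed

text \<open>Only the blocks of side \<open>2\<^sup>k\<close> are controlled, with truncation at the number \<open>4\<^sup>k\<close> of their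
  entries; monotonicity fills the gaps at the price of a factor \<open>4\<close>.\<close>

lemma iid_square_array_eventually_le:
  fixes Z :: "nat \<times> nat \<Rightarrow> 'a \<Rightarrow> real"
  assumes indep: "indep_vars (\<lambda>_. borel) Z UNIV" and nonneg: "\<And>p \<omega>. 0 \<le> Z p \<omega>"
    and dist: "\<And>p. distr M borel (Z p) = distr M borel (Z (0, 0))"
    and int: "integrable M (Z (0, 0))" and e: "expectation (Z (0, 0)) < e"
  shows "AE \<omega> in M. \<forall>\<^sub>F N in sequentially. (\<Sum>i<N. \<Sum>j<N. Z (i, j) \<omega>) \<le> 4 * (real N)\<^sup>2 * e"
proof -
  have rv[measurable]: "random_variable borel (Z p)" for p using indep unfolding indep_vars_def by blast
  define E where "E = expectation (Z (0, 0))"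
  define Y where "Y k p \<omega> = (if Z p \<omega> \<le> 4 ^ k then Z p \<omega> else 0)" for k :: nat and p \<omega>
  define I where "I k = {..<2 ^ k :: nat} \<times> {..<2 ^ k :: nat}" for k :: nat
  have card: "real (card (I k)) = 4 ^ k" and fin: "finite (I k)" for k
    by (simp_all add: I_def card_cartesian_product power_mult_distrib[symmetric])
  have Yrv[measurable]: "random_variable borel (Y k p)" for k p unfolding Y_def by measurable
  have same: "expectation (\<lambda>\<omega>. h (Z p \<omega>)) = expectation (\<lambda>\<omega>. h (Z (0, 0) \<omega>))" if [measurable]: "h \<in> borel_measurable borel" for h :: "real \<Rightarrow> real" and p
    using dist[of p] integral_distr[OF rv that, of p] integral_distr[OF rv that, of "(0, 0)"] by simp
  have Ybdd: "\<bar>Y k p \<omega>\<bar> \<le> 4 ^ k" for k p \<omega> using nonneg by (auto simp: Y_def)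
  have EY: "expectation (Y k p) \<le> E" for k p
  proof -
    have "expectation (Y k p) = expectation (Y k (0, 0))"
      unfolding Y_def by (rule same[of "\<lambda>x. if x \<le> 4 ^ k then x else 0"]) measurable
    also have "\<dots> \<le> E" unfolding E_def
    proof (rule integral_mono[OF _ int])
      show "integrable M (Y k (0, 0))" using Ybdd by (intro integrable_const_bound[where B = "4 ^ k"]) auto
    qed (use nonneg in \<open>auto simp: Y_def\<close>)
    finally show ?thesis .
  qed
  \<comment> \<open>First Borel-Cantelli argument: eventually truncation at \<open>4 ^ k\<close>
    changes no entry of the block, since the products of \<open>4 ^ k\<close> with the probability
    of exceeding \<open>4 ^ k\<close> sum to at most twice the mean of \<open>Z\<close>.\<close>
  have "AE \<omega> in M. \<forall>\<^sub>F k in sequentially. \<omega> \<in> space M - {\<omega> \<in> space M. \<exists>p\<in>I k. 4 ^ k < Z p \<omega>}"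
  proof (rule borel_cantelli_AE1)
    have meas: "{\<omega> \<in> space M. \<exists>p\<in>I k. 4 ^ k < Z p \<omega>} \<in> events" for k using fin by measurable
    then show "{\<omega> \<in> space M. \<exists>p\<in>I k. 4 ^ k < Z p \<omega>} \<in> events" for k .
    show "emeasure M {\<omega> \<in> space M. \<exists>p\<in>I k. 4 ^ k < Z p \<omega>} < \<infinity>" for k by (simp add: emeasure_eq_measure)
    define a :: "nat \<Rightarrow> real" where "a k = 4 ^ k * expectation (\<lambda>\<omega>. if 4 ^ k < Z (0, 0) \<omega> then 1 else 0)" for k
    have a_int: "integrable M (\<lambda>\<omega>. 4 ^ k * (if 4 ^ k < Z (0, 0) \<omega> then 1 else 0) :: real)" for k
      by (intro integrable_const_bound[where B = "4 ^ k"]) auto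
    have le: "prob {\<omega> \<in> space M. \<exists>p\<in>I k. 4 ^ k < Z p \<omega>} \<le> a k" for k
    proof -
      have "{\<omega> \<in> space M. \<exists>p\<in>I k. 4 ^ k < Z p \<omega>} = (\<Union>p\<in>I k. {\<omega> \<in> space M. 4 ^ k < Z p \<omega>})" by auto
      then have "prob {\<omega> \<in> space M. \<exists>p\<in>I k. 4 ^ k < Z p \<omega>} \<le> (\<Sum>p\<in>I k. prob {\<omega> \<in> space M. 4 ^ k < Z p \<omega>})"
        using fin by (auto intro!: finite_measure_subadditive_finite)
      also have "\<dots> = (\<Sum>p\<in>I k. expectation (\<lambda>\<omega>. if 4 ^ k < Z (0, 0) \<omega> then 1 else 0))"
      proof (rule sum.cong[OF refl])
        fix p
        have "prob {\<omega> \<in> space M. 4 ^ k < Z p \<omega>} = expectation (indicator {\<omega> \<in> space M. 4 ^ k < Z p \<omega>})" by simp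
        also have "\<dots> = expectation (\<lambda>\<omega>. if 4 ^ k < Z p \<omega> then 1 else 0)"
          by (intro Bochner_Integration.integral_cong refl) (auto simp: indicator_def)
        also have "\<dots> = expectation (\<lambda>\<omega>. if 4 ^ k < Z (0, 0) \<omega> then 1 else 0)"
          by (rule same[of "\<lambda>x. if 4 ^ k < x then 1 else 0"]) measurable
        finally show "prob {\<omega> \<in> space M. 4 ^ k < Z p \<omega>} = expectation (\<lambda>\<omega>. if 4 ^ k < Z (0, 0) \<omega> then 1 else 0)" .
      qed
      also have "\<dots> = a k" using card by (simp add: a_def)
      finally show ?thesis .
    qed
    have "summable a"
    proof (rule summableI_nonneg_bounded)
      show "0 \<le> a k" for k unfolding a_def by (intro mult_nonneg_nonneg integral_nonneg_AE) auto
      fix n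
      have "(\<Sum>k<n. a k) = expectation (\<lambda>\<omega>. \<Sum>k<n. 4 ^ k * (if 4 ^ k < Z (0, 0) \<omega> then 1 else 0))"
        unfolding a_def using a_int by (subst Bochner_Integration.integral_sum) auto
      also have "\<dots> \<le> expectation (\<lambda>\<omega>. 2 * Z (0, 0) \<omega>)"
        using int a_int by (intro integral_mono sum_powers_below_le nonneg Bochner_Integration.integrable_sum) auto
      also have "\<dots> = 2 * E" by (simp add: E_def)
      finally show "(\<Sum>k<n. a k) \<le> 2 * E" .
    qed
    then show "summable (\<lambda>k. prob {\<omega> \<in> space M. \<exists>p\<in>I k. 4 ^ k < Z p \<omega>})"
      by (rule summable_comparison_test'[of a 0]) (simp only: real_norm_def abs_of_nonneg[OF measure_nonneg] le)
  qed
  \<comment> \<open>Second Borel-Cantelli argument, by Chebyshev: the variance of the block sum is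
    at most \<open>4 ^ k\<close> truncated second moments, and these moments divided by
    \<open>4 ^ k\<close> sum to at most \<open>4 / 3\<close> of the mean of
    \<open>Z\<close>.\<close>
  moreover have "AE \<omega> in M. \<forall>\<^sub>F k in sequentially. \<omega> \<in> space M - {\<omega> \<in> space M. (e - E) * 4 ^ k \<le>
      \<bar>(\<Sum>p\<in>I k. Y k p \<omega>) - expectation (\<lambda>\<omega>. \<Sum>p\<in>I k. Y k p \<omega>)\<bar>}"
  proof (rule borel_cantelli_AE1)
    let ?A = "\<lambda>k. {\<omega> \<in> space M. (e - E) * 4 ^ k \<le> \<bar>(\<Sum>p\<in>I k. Y k p \<omega>) - expectation (\<lambda>\<omega>. \<Sum>p\<in>I k. Y k p \<omega>)\<bar>}"
    show "?A k \<in> events" for k by measurable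
    show "emeasure M (?A k) < \<infinity>" for k by (simp add: emeasure_eq_measure)
    define a where "a k = expectation (\<lambda>\<omega>. (Y k (0, 0) \<omega>)\<^sup>2) / 4 ^ k" for k
    have Y2int: "integrable M (\<lambda>\<omega>. (Y k (0, 0) \<omega>)\<^sup>2)" for k
      using Ybdd[of k] by (intro integrable_const_bound[where B = "(4 ^ k)\<^sup>2"]) (auto simp: abs_le_square_iff[symmetric])
    have eE: "0 < e - E" using e by (simp add: E_def)
    have le: "prob (?A k) \<le> a k / (e - E)\<^sup>2" for k
    proof -
      have "prob (?A k) \<le> expectation (\<lambda>\<omega>. ((\<Sum>p\<in>I k. Y k p \<omega>) - expectation (\<lambda>\<omega>. \<Sum>p\<in>I k. Y k p \<omega>))\<^sup>2) / ((e - E) * 4 ^ k)\<^sup>2"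
      proof (rule Chebyshev_inequality)
        have "\<bar>\<Sum>p\<in>I k. Y k p \<omega>\<bar> \<le> (\<Sum>p\<in>I k. 4 ^ k)" for \<omega>
          by (rule order_trans[OF sum_abs sum_mono]) (rule Ybdd)
        then show "integrable M (\<lambda>\<omega>. (\<Sum>p\<in>I k. Y k p \<omega>)\<^sup>2)"
          by (intro integrable_const_bound[where B = "(\<Sum>p\<in>I k. 4 ^ k)\<^sup>2"])
            (auto simp: abs_le_square_iff[symmetric] sum_nonneg intro!: AE_I2)
      qed (use eE in auto)
      also have "\<dots> \<le> (\<Sum>p\<in>I k. expectation (\<lambda>\<omega>. (Y k p \<omega>)\<^sup>2)) / ((e - E) * 4 ^ k)\<^sup>2"
      proof (intro divide_right_mono variance_sum_indep_le[where K = "4 ^ k"] fin)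
        have "indep_vars (\<lambda>_. borel) (\<lambda>p \<omega>. if Z p \<omega> \<le> 4 ^ k then Z p \<omega> else 0) UNIV"
          by (rule indep_vars_compose2[OF indep]) measurable
        then show "indep_vars (\<lambda>_. borel) (Y k) (I k)"
          unfolding Y_def[abs_def] by (rule indep_vars_subset) simp
      qed (use Ybdd in auto)
      also have "(\<Sum>p\<in>I k. expectation (\<lambda>\<omega>. (Y k p \<omega>)\<^sup>2)) = (\<Sum>p\<in>I k. expectation (\<lambda>\<omega>. (Y k (0, 0) \<omega>)\<^sup>2))"
        unfolding Y_def by (intro sum.cong refl same[of "\<lambda>x. (if x \<le> 4 ^ k then x else 0)\<^sup>2"]) measurable
      also have "\<dots> / ((e - E) * 4 ^ k)\<^sup>2 = a k / (e - E)\<^sup>2"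
      proof -
        have "q * c / (f * q)\<^sup>2 = c / q / f\<^sup>2" if "q \<noteq> 0" for q c f :: real
          using that by (simp add: power2_eq_square mult_ac)
        from this[of "4 ^ k"] show ?thesis unfolding a_def sum_constant card by simp
      qed
      finally show ?thesis .
    qed
    have "summable a"
    proof (rule summableI_nonneg_bounded)
      show "0 \<le> a k" for k unfolding a_def by (intro divide_nonneg_nonneg integral_nonneg_AE) auto
      fix n
      have "(\<Sum>k<n. a k) = expectation (\<lambda>\<omega>. \<Sum>k<n. (Y k (0, 0) \<omega>)\<^sup>2 / 4 ^ k)"
        unfolding a_def using Y2int by (subst Bochner_Integration.integral_sum) auto
      also have "\<dots> \<le> expectation (\<lambda>\<omega>. 4 / 3 * Z (0, 0) \<omega>)"
      proof (intro integral_mono Bochner_Integration.integrable_sum)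
        fix \<omega>
        have "(\<Sum>k<n. (Y k (0, 0) \<omega>)\<^sup>2 / 4 ^ k) = Z (0, 0) \<omega> * (\<Sum>k<n. (if Z (0, 0) \<omega> \<le> 4 ^ k then Z (0, 0) \<omega> / 4 ^ k else 0))"
          unfolding sum_distrib_left by (intro sum.cong refl) (simp add: Y_def power2_eq_square)
        also have "\<dots> \<le> Z (0, 0) \<omega> * (4 / 3)"
          by (intro mult_left_mono sum_inverse_powers_above_le nonneg)
        finally show "(\<Sum>k<n. (Y k (0, 0) \<omega>)\<^sup>2 / 4 ^ k) \<le> 4 / 3 * Z (0, 0) \<omega>" by simp
      qed (use int Y2int in auto)
      also have "\<dots> = 4 / 3 * E" by (simp add: E_def)
      finally show "(\<Sum>k<n. a k) \<le> 4 / 3 * E" .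
    qed
    then have "summable (\<lambda>k. a k / (e - E)\<^sup>2)" by (rule summable_divide)
    then show "summable (\<lambda>k. prob (?A k))"
      by (rule summable_comparison_test'[of "\<lambda>k. a k / (e - E)\<^sup>2" 0]) (simp only: real_norm_def abs_of_nonneg[OF measure_nonneg] le)
  qed
  ultimately show ?thesis
  proof eventually_elim
    case (elim \<omega>)
    then have "\<forall>\<^sub>F k in sequentially. (\<Sum>p\<in>I k. Z p \<omega>) \<le> 4 ^ k * e"
    proof eventually_elim
      case (elim k)
      then have Z: "Z p \<omega> \<le> 4 ^ k" if "p \<in> I k" for p using that by (auto simp: not_less)
      have "(\<Sum>p\<in>I k. Z p \<omega>) = (\<Sum>p\<in>I k. Y k p \<omega>)"
        by (intro sum.cong refl) (simp add: Y_def Z)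
      also have "\<dots> \<le> expectation (\<lambda>\<omega>. \<Sum>p\<in>I k. Y k p \<omega>) + (e - E) * 4 ^ k" using elim by auto
      also have "expectation (\<lambda>\<omega>. \<Sum>p\<in>I k. Y k p \<omega>) = (\<Sum>p\<in>I k. expectation (Y k p))"
        using Ybdd by (intro Bochner_Integration.integral_sum integrable_const_bound[where B = "4 ^ k"]) auto
      also have "\<dots> \<le> (\<Sum>p\<in>I k. E)" by (intro sum_mono EY)
      also have "(\<Sum>p\<in>I k. E) = 4 ^ k * E" using card by simp
      finally show ?case by (simp add: algebra_simps)
    qed
    then obtain k0 where k0: "\<And>k. k0 \<le> k \<Longrightarrow> (\<Sum>p\<in>I k. Z p \<omega>) \<le> 4 ^ k * e"
      unfolding eventually_sequentially by blast
    have "0 \<le> E" unfolding E_def using nonneg by (intro integral_nonneg_AE) auto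
    then have "0 < e" using e by (simp add: E_def)
    \<comment> \<open>A square of side \<open>N\<close> fits into the next dyadic block, whose side
      is at most \<open>2 * N\<close>; hence the factor 4.\<close>
    have "(\<Sum>i<N. \<Sum>j<N. Z (i, j) \<omega>) \<le> 4 * (real N)\<^sup>2 * e" if N: "2 ^ k0 \<le> N" for N
    proof -
      have "1 \<le> N" using N by (meson le_trans one_le_numeral one_le_power)
      then obtain k where k: "2 ^ k \<le> N" "N < 2 ^ Suc k" using ex_power_ivl1[of 2 N] by auto
      then have "k0 \<le> Suc k" using N by (meson le_less_trans less_imp_le nat_power_less_imp_less one_less_numeral_iff pos2 power_strict_increasing_iff semiring_norm(76))
      have "(\<Sum>i<N. \<Sum>j<N. Z (i, j) \<omega>) = (\<Sum>p\<in>{..<N} \<times> {..<N}. Z p \<omega>)" by (simp add: sum.cartesian_product)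
      also have "\<dots> \<le> (\<Sum>p\<in>I (Suc k). Z p \<omega>)"
        using k nonneg fin by (intro sum_mono2) (auto simp: I_def)
      also have "\<dots> \<le> 4 ^ Suc k * e" by (rule k0) fact
      also have "(4 :: real) ^ Suc k = 4 * (2 ^ k)\<^sup>2" by (simp add: power2_eq_square power_mult_distrib[symmetric])
      also have "4 * ((2 :: real) ^ k)\<^sup>2 * e \<le> 4 * (real N)\<^sup>2 * e"
      proof -
        have "(2 :: real) ^ k \<le> real N" using k(1) by (metis of_nat_le_iff of_nat_numeral of_nat_power)
        then show ?thesis using \<open>0 < e\<close> by (intro mult_right_mono mult_left_mono power_mono) auto
      qed
      finally show ?thesis .
    qed
    then show ?case unfolding eventually_sequentially by blast
  qed
qed

end

section \<open>Wigner matrices with bounded entries\<close>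

lemma stieltjes_empirical_spectral_measure:
  assumes A: "A \<in> carrier_mat n n" "transpose_mat A = A" and z: "0 < Im z"
  shows "stieltjes (empirical_spectral_measure A) z = (\<Sum>i<n. resolvent A z $$ (i, i)) / of_nat n"
  unfolding stieltjes_def trace_resolvent_eq_eigenvalues[OF A z]
  by (subst integral_empirical_spectral_measure[OF A]) (auto simp: scaleR_conv_of_real divide_inverse mult.commute)

lemma wigner_matrix_nth:
  "i < N \<Longrightarrow> j < N \<Longrightarrow> wigner_matrix N x $$ (i, j) =
    (if i = j then sqrt 2 / sqrt (real N) * x i i else 1 / sqrt (real N) * x (min i j) (max i j))"
  by (simp add: wigner_matrix_def)

lemma wigner_matrix_cong:
  "(\<And>i j. i \<le> j \<Longrightarrow> j < N \<Longrightarrow> x i j = y i j) \<Longrightarrow> wigner_matrix N x = wigner_matrix N y"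
  unfolding wigner_matrix_def by (intro cong_mat) auto

text \<open>\<open>A - B\<close> has the entry \<open>y\<close> at two positions only, so the
  resolvent identity has two terms. Crude entry bounds give the first claim; feeding it back into
  the \<open>(j, i)\<close> entry gives an expansion to first order in \<open>y\<close> with a
  quadratic remainder.\<close>

lemma resolvent_single_entry_expansion:
  assumes A: "A \<in> carrier_mat n n" "transpose_mat A = A"
    and B: "B \<in> carrier_mat n n" "transpose_mat B = B" and z: "0 < Im z"
    and ij: "i < n" "j < n" "i \<noteq> j" and y: "A $$ (i, j) = y" and zero: "B $$ (i, j) = 0"
    and other: "\<And>k l. k < n \<Longrightarrow> l < n \<Longrightarrow> \<not> (k = i \<and> l = j) \<Longrightarrow> \<not> (k = j \<and> l = i) \<Longrightarrow> A $$ (k, l) = B $$ (k, l)"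
  shows "a < n \<Longrightarrow> b < n \<Longrightarrow> cmod (resolvent A z $$ (a, b) - resolvent B z $$ (a, b)) \<le> 2 * \<bar>y\<bar> / (Im z)\<^sup>2"
    and "cmod (resolvent A z $$ (j, i) - resolvent B z $$ (j, i) + of_real y *
      ((resolvent B z $$ (j, i))\<^sup>2 + resolvent B z $$ (j, j) * resolvent B z $$ (i, i))) \<le> 4 * y\<^sup>2 / (Im z)^3"
proof -
  let ?R = "\<lambda>a b. resolvent A z $$ (a, b)" and ?S = "\<lambda>a b. resolvent B z $$ (a, b)"
  have sym: "A $$ (j, i) = y" "B $$ (j, i) = 0"
    using symmetric_nth[OF A z ij(1,2)] symmetric_nth[OF B z ij(1,2)] y zero by auto
  have diff: "?S a b - ?R a b = of_real y * (?S a i * ?R j b + ?S a j * ?R i b)" if ab: "a < n" "b < n" for a b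
  proof -
    have "?S a b - ?R a b = (\<Sum>k<n. \<Sum>l<n. ?S a k * of_real (A $$ (k, l) - B $$ (k, l)) * ?R l b)"
      by (rule resolvent_diff[OF B A z ab])
    also have "\<dots> = (\<Sum>p\<in>{..<n} \<times> {..<n}. ?S a (fst p) * of_real (A $$ (fst p, snd p) - B $$ (fst p, snd p)) * ?R (snd p) b)"
      by (simp add: sum.cartesian_product split_beta)
    also have "\<dots> = (\<Sum>p\<in>{(i, j), (j, i)}. ?S a (fst p) * of_real (A $$ (fst p, snd p) - B $$ (fst p, snd p)) * ?R (snd p) b)"
    proof (intro sum.mono_neutral_right ballI)
      fix p assume "p \<in> {..<n} \<times> {..<n} - {(i, j), (j, i)}"
      then have "A $$ (fst p, snd p) = B $$ (fst p, snd p)" by (intro other) auto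
      then show "?S a (fst p) * of_real (A $$ (fst p, snd p) - B $$ (fst p, snd p)) * ?R (snd p) b = 0" by simp
    qed (use ij in auto)
    also have "\<dots> = of_real y * (?S a i * ?R j b + ?S a j * ?R i b)"
      using ij y zero sym by (simp add: algebra_simps)
    finally show ?thesis .
  qed
  have Rb: "cmod (?R a b) \<le> 1 / Im z" and Sb: "cmod (?S a b) \<le> 1 / Im z" if "a < n" "b < n" for a b
    using resolvent_entry_bound[OF A z that] resolvent_entry_bound[OF B z that] by auto
  have dist: "cmod (?R a b - ?S a b) \<le> 2 * \<bar>y\<bar> / (Im z)\<^sup>2" if ab: "a < n" "b < n" for a b
  proof -
    have "cmod (?S a i * ?R j b + ?S a j * ?R i b) \<le> cmod (?S a i) * cmod (?R j b) + cmod (?S a j) * cmod (?R i b)"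
      by (rule order_trans[OF norm_triangle_ineq]) (simp add: norm_mult)
    also have "\<dots> \<le> (1 / Im z) * (1 / Im z) + (1 / Im z) * (1 / Im z)"
      using ab ij z by (intro add_mono mult_mono Rb Sb) auto
    finally have "\<bar>y\<bar> * cmod (?S a i * ?R j b + ?S a j * ?R i b) \<le> \<bar>y\<bar> * ((1 / Im z) * (1 / Im z) + (1 / Im z) * (1 / Im z))"
      by (rule mult_left_mono) simp
    moreover have "cmod (?R a b - ?S a b) = \<bar>y\<bar> * cmod (?S a i * ?R j b + ?S a j * ?R i b)"
      by (subst norm_minus_commute) (simp only: diff[OF ab] norm_mult norm_of_real)
    ultimately show ?thesis by (simp add: power2_eq_square mult.commute)
  qed
  then show "a < n \<Longrightarrow> b < n \<Longrightarrow> cmod (?R a b - ?S a b) \<le> 2 * \<bar>y\<bar> / (Im z)\<^sup>2" .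
  have "?R j i - ?S j i + of_real y * ((?S j i)\<^sup>2 + ?S j j * ?S i i) =
      - (of_real y * (?S j i * (?R j i - ?S j i) + ?S j j * (?R i i - ?S i i)))"
    using diff[OF ij(2,1)] by (simp add: power2_eq_square algebra_simps)
  then have eq: "cmod (?R j i - ?S j i + of_real y * ((?S j i)\<^sup>2 + ?S j j * ?S i i)) =
      \<bar>y\<bar> * cmod (?S j i * (?R j i - ?S j i) + ?S j j * (?R i i - ?S i i))"
    by (simp only: norm_minus_cancel norm_mult norm_of_real)
  have "cmod (?S j i * (?R j i - ?S j i) + ?S j j * (?R i i - ?S i i)) \<le>
      cmod (?S j i) * cmod (?R j i - ?S j i) + cmod (?S j j) * cmod (?R i i - ?S i i)"
    by (rule order_trans[OF norm_triangle_ineq]) (simp add: norm_mult)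
  also have "\<dots> \<le> (1 / Im z) * (2 * \<bar>y\<bar> / (Im z)\<^sup>2) + (1 / Im z) * (2 * \<bar>y\<bar> / (Im z)\<^sup>2)"
    using ij z by (intro add_mono mult_mono dist Sb) auto
  finally have "\<bar>y\<bar> * cmod (?S j i * (?R j i - ?S j i) + ?S j j * (?R i i - ?S i i)) \<le>
      \<bar>y\<bar> * ((1 / Im z) * (2 * \<bar>y\<bar> / (Im z)\<^sup>2) + (1 / Im z) * (2 * \<bar>y\<bar> / (Im z)\<^sup>2))"
    by (rule mult_left_mono) simp
  also have "\<dots> = 4 * y\<^sup>2 / (Im z)^3"
    using abs_mult_self_eq[of y] by (simp add: power2_eq_square power3_eq_cube mult_ac)
  finally show "cmod (?R j i - ?S j i + of_real y * ((?S j i)\<^sup>2 + ?S j j * ?S i i)) \<le> 4 * y\<^sup>2 / (Im z)^3"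
    unfolding eq .
qed

section \<open>The self-consistent equation in expectation\<close>

locale bounded_wigner = prob_space +
  fixes x :: "nat \<times> nat \<Rightarrow> 'a \<Rightarrow> real" and K m v :: real and z :: complex
  assumes indep: "indep_vars (\<lambda>_. borel) x UNIV" and K: "1 \<le> K" "\<And>p \<omega>. \<bar>x p \<omega>\<bar> \<le> K"
    and mean: "\<And>p. expectation (x p) = m" and var: "\<And>p. expectation (\<lambda>\<omega>. (x p \<omega>)\<^sup>2) = m\<^sup>2 + v"
    and z: "0 < Im z"
begin

definition W where "W N \<omega> = wigner_matrix N (\<lambda>i j. x (i, j) \<omega>)"
definition R where "R N i j \<omega> = resolvent (W N \<omega>) z $$ (i, j)"
definition s where "s N \<omega> = (\<Sum>i<N. R N i i \<omega>) / of_nat N"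

abbreviation \<eta> where "\<eta> \<equiv> Im z"

lemma x_measurable [measurable]: "x p \<in> borel_measurable M"
  using indep unfolding indep_vars_def by blast

lemma W_carrier: "W N \<omega> \<in> carrier_mat N N" "transpose_mat (W N \<omega>) = W N \<omega>"
  unfolding W_def by (rule wigner_matrix_symmetric)+

lemma R_measurable [measurable]: "i < N \<Longrightarrow> j < N \<Longrightarrow> R N i j \<in> borel_measurable M"
  unfolding R_def
proof (rule resolvent_measurable[OF W_carrier(1)])
  fix i j assume "i < N" "j < N"
  then show "(\<lambda>\<omega>. W N \<omega> $$ (i, j)) \<in> borel_measurable M"
    unfolding W_def by (cases "i = j") (simp_all add: wigner_matrix_nth)
qed

lemma R_bound: "i < N \<Longrightarrow> j < N \<Longrightarrow> cmod (R N i j \<omega>) \<le> 1 / \<eta>"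
  unfolding R_def by (rule resolvent_entry_bound[OF W_carrier z])

lemma R_sym: "i < N \<Longrightarrow> j < N \<Longrightarrow> R N i j \<omega> = R N j i \<omega>"
  unfolding R_def by (rule resolvent_symmetric[OF W_carrier z])

lemma s_measurable [measurable]: "s N \<in> borel_measurable M"
  unfolding s_def by (intro borel_measurable_divide borel_measurable_sum) auto

lemma s_bound: "cmod (s N \<omega>) \<le> 1 / \<eta>"
proof (cases "N = 0")
  case False
  have "cmod (\<Sum>i<N. R N i i \<omega>) \<le> real N * (1 / \<eta>)"
    using sum_norm_bound[of "{..<N}" "\<lambda>i. R N i i \<omega>" "1 / \<eta>"] R_bound by simp
  then show ?thesis using False by (simp add: s_def norm_divide divide_le_eq mult.commute)
qed (use z in \<open>simp add: s_def\<close>)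

lemma integrable_bounded: "f \<in> borel_measurable M \<Longrightarrow> (\<And>\<omega>. cmod (f \<omega>) \<le> B) \<Longrightarrow> integrable M f"
  by (rule integrable_const_bound[where B = B]) auto

lemma norm_expectation_le: "(\<And>\<omega>. cmod (f \<omega>) \<le> B) \<Longrightarrow> f \<in> borel_measurable M \<Longrightarrow> cmod (expectation f) \<le> B" for f :: "'a \<Rightarrow> complex"
proof -
  assume f: "\<And>\<omega>. cmod (f \<omega>) \<le> B" "f \<in> borel_measurable M"
  have "cmod (expectation f) \<le> expectation (\<lambda>\<omega>. cmod (f \<omega>))" by (rule integral_norm_bound)
  also have "\<dots> \<le> expectation (\<lambda>_. B)"
    using f by (intro integral_mono integrable_norm integrable_bounded) auto
  finally show ?thesis using prob_space by simp
qed

lemma m_bound: "\<bar>m\<bar> \<le> K"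
proof -
  have "\<bar>m\<bar> \<le> expectation (\<lambda>\<omega>. \<bar>x (0, 0) \<omega>\<bar>)" unfolding mean[of "(0, 0)", symmetric] by (rule integral_abs_bound)
  also have "\<dots> \<le> expectation (\<lambda>_. K)"
    using K by (intro integral_mono integrable_const_bound[where B = K]) auto
  finally show ?thesis using prob_space by simp
qed

lemma v_bound: "0 \<le> v" "v \<le> K\<^sup>2"
proof -
  have x2: "(x (0, 0) \<omega>)\<^sup>2 \<le> K\<^sup>2" for \<omega>
    using K(1) K(2)[of "(0, 0)" \<omega>] by (intro abs_le_square_iff[THEN iffD1]) auto
  have i1: "integrable M (x (0, 0))" using K(2) by (intro integrable_const_bound[where B = K]) auto
  have i2: "integrable M (\<lambda>\<omega>. (x (0, 0) \<omega>)\<^sup>2)" using x2 by (intro integrable_const_bound[where B = "K\<^sup>2"]) auto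
  have "v = expectation (\<lambda>\<omega>. (x (0, 0) \<omega> - m)\<^sup>2)"
    using variance_eq[OF i1 i2] var[of "(0, 0)"] mean[of "(0, 0)"] by simp
  then show "0 \<le> v" by simp
  have "m\<^sup>2 + v \<le> expectation (\<lambda>_. K\<^sup>2)"
    unfolding var[of "(0, 0)", symmetric] using x2 i2 by (intro integral_mono) auto
  then have "m\<^sup>2 + v \<le> K\<^sup>2" using prob_space by simp
  then show "v \<le> K\<^sup>2" using zero_le_power2[of m] by linarith
qed

text \<open>This stands in for Gaussian integration by parts. The entry \<open>Y\<close> is
  independent of the resolvent \<open>S\<close> with that entry removed. In
  \<open>R = S - Y Q + C\<close> the centred factor \<open>Y - c\<close> annihilates
  \<open>S\<close>, pairs with \<open>Y\<close> to the variance \<open>v / N\<close>, and meets a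
  remainder \<open>C\<close> of order \<open>1 / N\<close>. Returning from \<open>S\<close> to
  \<open>R\<close> inside \<open>Q\<close> costs a factor of order \<open>1 / sqrt N\<close>
  more.\<close>

lemma offdiagonal_expectation:
  assumes ij: "i < j" "j < N"
  defines "q \<equiv> sqrt (real N)"
  shows "cmod (expectation (\<lambda>\<omega>. of_real (x (i, j) \<omega> / q) * R N j i \<omega>) -
     (of_real (m / q) * expectation (R N j i) - of_real (v / real N) * expectation (\<lambda>\<omega>. (R N j i \<omega>)\<^sup>2 + R N j j \<omega> * R N i i \<omega>)))
     \<le> 16 * K^3 / (q^3 * \<eta>^3)"
proof -
  have N: "i < N" "j < N" "i \<noteq> j" "0 < real N" and q: "0 < q" "q\<^sup>2 = real N" using ij by (auto simp: q_def)
  \<comment> \<open>\<open>\<rho>\<close> depends on the coordinates other than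
    \<open>(i, j)\<close> and puts 0 in that place, so independence of disjoint blocks of
    coordinates applies to it.\<close>
  define \<rho> where "\<rho> a b g = resolvent (wigner_matrix N (\<lambda>k l. if (k, l) = (i, j) then 0 else g (k, l))) z $$ (a, b)" for a b and g :: "nat \<times> nat \<Rightarrow> real"
  define S where "S a b \<omega> = \<rho> a b (\<lambda>p\<in>UNIV - {(i, j)}. x p \<omega>)" for a b \<omega>
  have \<rho>m: "\<rho> a b \<in> borel_measurable (PiM (UNIV - {(i, j)}) (\<lambda>_. borel))" if "a < N" "b < N" for a b
    unfolding \<rho>_def
  proof (rule resolvent_measurable[OF wigner_matrix_symmetric(1) _ that])
    fix k l assume kl: "k < N" "l < N"
    have m: "(\<lambda>g. c * (if p = (i, j) then 0 else g p)) \<in> borel_measurable (PiM (UNIV - {(i, j)}) (\<lambda>_. borel))" for p and c :: real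
      by (cases "p = (i, j)") auto
    show "(\<lambda>g. wigner_matrix N (\<lambda>k l. if (k, l) = (i, j) then 0 else g (k, l)) $$ (k, l)) \<in> borel_measurable (PiM (UNIV - {(i, j)}) (\<lambda>_. borel))"
    proof (cases "k = l")
      case True
      then show ?thesis using m[of "sqrt 2 / sqrt (real N)" "(k, k)"] unfolding wigner_matrix_nth[OF kl] by (simp only: if_True refl)
    next
      case False
      then show ?thesis using m[of "1 / sqrt (real N)" "(min k l, max k l)"] unfolding wigner_matrix_nth[OF kl] by (simp only: if_False)
    qed
  qed
  have rm: "(\<lambda>\<omega>. \<lambda>p\<in>UNIV - {(i, j)}. x p \<omega>) \<in> measurable M (PiM (UNIV - {(i, j)}) (\<lambda>_. borel))"
    by measurable
  have Sm[measurable]: "S a b \<in> borel_measurable M" if "a < N" "b < N" for a b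
    unfolding S_def using measurable_compose[OF rm \<rho>m[OF that]] .
  define B where "B \<omega> = wigner_matrix N (\<lambda>k l. if (k, l) = (i, j) then 0 else x (k, l) \<omega>)" for \<omega>
  have Bc: "B \<omega> \<in> carrier_mat N N" "transpose_mat (B \<omega>) = B \<omega>" for \<omega>
    unfolding B_def by (rule wigner_matrix_symmetric)+
  have SB: "S a b \<omega> = resolvent (B \<omega>) z $$ (a, b)" for a b \<omega>
  proof -
    have "wigner_matrix N (\<lambda>k l. if (k, l) = (i, j) then 0 else (\<lambda>p\<in>UNIV - {(i, j)}. x p \<omega>) (k, l)) = B \<omega>"
      unfolding B_def by (rule wigner_matrix_cong) auto
    then show ?thesis by (simp only: S_def \<rho>_def)
  qed
  have Sb: "cmod (S a b \<omega>) \<le> 1 / \<eta>" if "a < N" "b < N" for a b \<omega>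
    unfolding SB by (rule resolvent_entry_bound[OF Bc z that])
  define Y where "Y \<omega> = x (i, j) \<omega> / q" for \<omega>
  have Ym[measurable]: "Y \<in> borel_measurable M" unfolding Y_def by measurable
  have Yb: "\<bar>Y \<omega>\<bar> \<le> K / q" for \<omega> using K(2) q by (simp add: Y_def divide_right_mono)
  have WY: "W N \<omega> $$ (i, j) = Y \<omega>" for \<omega> using N ij by (simp add: W_def wigner_matrix_nth Y_def q_def)
  have BY: "B \<omega> $$ (i, j) = 0" for \<omega> using N ij by (simp add: B_def wigner_matrix_nth)
  have other: "W N \<omega> $$ (k, l) = B \<omega> $$ (k, l)" if "k < N" "l < N" "\<not> (k = i \<and> l = j)" "\<not> (k = j \<and> l = i)" for k l \<omega>
  proof -
    have "(min k l, max k l) \<noteq> (i, j)" using that ij(1) by (auto simp: min_def max_def split: if_splits)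
    then show ?thesis using that ij by (auto simp: W_def B_def wigner_matrix_nth)
  qed
  have exp1: "cmod (R N a b \<omega> - S a b \<omega>) \<le> 2 * \<bar>Y \<omega>\<bar> / \<eta>\<^sup>2" if "a < N" "b < N" for a b \<omega>
    unfolding R_def SB
    by (rule resolvent_single_entry_expansion(1)[OF W_carrier Bc z N(1-3) WY BY _ that]) (rule other)
  have exp2: "cmod (R N j i \<omega> - S j i \<omega> + of_real (Y \<omega>) * ((S j i \<omega>)\<^sup>2 + S j j \<omega> * S i i \<omega>)) \<le> 4 * (Y \<omega>)\<^sup>2 / \<eta>^3" for \<omega>
    unfolding R_def SB
    by (rule resolvent_single_entry_expansion(2)[OF W_carrier Bc z N(1-3) WY BY]) (rule other)
  define Q where "Q \<omega> = (S j i \<omega>)\<^sup>2 + S j j \<omega> * S i i \<omega>" for \<omega>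
  define Q' where "Q' \<omega> = (R N j i \<omega>)\<^sup>2 + R N j j \<omega> * R N i i \<omega>" for \<omega>
  have Qm[measurable]: "Q \<in> borel_measurable M" "Q' \<in> borel_measurable M"
    unfolding Q_def Q'_def using N by measurable
  have prod2: "cmod (a * b) \<le> 1 / \<eta>\<^sup>2" if "cmod a \<le> 1 / \<eta>" "cmod b \<le> 1 / \<eta>" for a b :: complex
    unfolding norm_mult using mult_mono[OF that] z by (simp add: power2_eq_square)
  have Qb: "cmod (Q \<omega>) \<le> 2 / \<eta>\<^sup>2" and Q'b: "cmod (Q' \<omega>) \<le> 2 / \<eta>\<^sup>2" for \<omega>
    unfolding Q_def Q'_def power2_eq_square[of "S j i \<omega>"] power2_eq_square[of "R N j i \<omega>"]
    using N order_trans[OF norm_triangle_ineq add_mono[OF prod2 prod2]] Sb R_bound by simp_all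
  have QQ': "cmod (Q \<omega> - Q' \<omega>) \<le> 8 * K / (q * \<eta>^3)" for \<omega>
  proof -
    have dab: "cmod (a * b - c * d) \<le> 2 * (1 / \<eta>) * (2 * (K / q) / \<eta>\<^sup>2)"
      if "cmod a \<le> 1 / \<eta>" "cmod d \<le> 1 / \<eta>" "cmod (a - c) \<le> 2 * (K / q) / \<eta>\<^sup>2" "cmod (b - d) \<le> 2 * (K / q) / \<eta>\<^sup>2" for a b c d :: complex
    proof -
      have "a * b - c * d = a * (b - d) + (a - c) * d" by (simp add: algebra_simps)
      then have "cmod (a * b - c * d) \<le> cmod a * cmod (b - d) + cmod (a - c) * cmod d"
        by (metis norm_mult norm_triangle_ineq)
      also have "\<dots> \<le> (1 / \<eta>) * (2 * (K / q) / \<eta>\<^sup>2) + (2 * (K / q) / \<eta>\<^sup>2) * (1 / \<eta>)"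
        using that z K q by (intro add_mono mult_mono) auto
      finally show ?thesis by (simp add: mult_ac)
    qed
    have d: "cmod (S a b \<omega> - R N a b \<omega>) \<le> 2 * (K / q) / \<eta>\<^sup>2" if "a < N" "b < N" for a b
    proof -
      have "cmod (S a b \<omega> - R N a b \<omega>) \<le> 2 * \<bar>Y \<omega>\<bar> / \<eta>\<^sup>2" using exp1[OF that] by (simp add: norm_minus_commute)
      also have "\<dots> \<le> 2 * (K / q) / \<eta>\<^sup>2" by (intro divide_right_mono mult_left_mono Yb) auto
      finally show ?thesis .
    qed
    have "cmod (Q \<omega> - Q' \<omega>) \<le> cmod (S j i \<omega> * S j i \<omega> - R N j i \<omega> * R N j i \<omega>) + cmod (S j j \<omega> * S i i \<omega> - R N j j \<omega> * R N i i \<omega>)"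
    proof -
      have "Q \<omega> - Q' \<omega> = (S j i \<omega> * S j i \<omega> - R N j i \<omega> * R N j i \<omega>) + (S j j \<omega> * S i i \<omega> - R N j j \<omega> * R N i i \<omega>)"
        by (simp add: Q_def Q'_def power2_eq_square)
      then show ?thesis by (metis norm_triangle_ineq)
    qed
    also have "\<dots> \<le> 2 * (1 / \<eta>) * (2 * (K / q) / \<eta>\<^sup>2) + 2 * (1 / \<eta>) * (2 * (K / q) / \<eta>\<^sup>2)"
      using N by (intro add_mono dab d Sb R_bound) auto
    also have "\<dots> = 8 * K / (q * \<eta>^3)" by (simp add: power2_eq_square power3_eq_cube)
    finally show ?thesis .
  qed
  define C where "C \<omega> = R N j i \<omega> - S j i \<omega> + of_real (Y \<omega>) * Q \<omega>" for \<omega>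
  have Cm[measurable]: "C \<in> borel_measurable M" unfolding C_def using N by measurable
  have Cb: "cmod (C \<omega>) \<le> 4 * (K / q)\<^sup>2 / \<eta>^3" for \<omega>
  proof -
    have "cmod (C \<omega>) \<le> 4 * (Y \<omega>)\<^sup>2 / \<eta>^3" unfolding C_def Q_def by (rule exp2)
    also have "\<dots> \<le> 4 * (K / q)\<^sup>2 / \<eta>^3"
      using z Yb[of \<omega>] K q by (intro divide_right_mono mult_left_mono abs_le_square_iff[THEN iffD1]) auto
    finally show ?thesis .
  qed
  have factor: "expectation (\<lambda>\<omega>. of_real (h (x (i, j) \<omega>)) * f (\<lambda>p\<in>UNIV - {(i, j)}. x p \<omega>)) =
      of_real (expectation (\<lambda>\<omega>. h (x (i, j) \<omega>))) * expectation (\<lambda>\<omega>. f (\<lambda>p\<in>UNIV - {(i, j)}. x p \<omega>))"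
    if h[measurable]: "h \<in> borel_measurable borel" and f: "f \<in> borel_measurable (PiM (UNIV - {(i, j)}) (\<lambda>_. borel))"
      and hb: "\<And>\<omega>. \<bar>h (x (i, j) \<omega>)\<bar> \<le> b1" and fb: "\<And>\<omega>. cmod (f (\<lambda>p\<in>UNIV - {(i, j)}. x p \<omega>)) \<le> b2"
    for h :: "real \<Rightarrow> real" and f :: "(nat \<times> nat \<Rightarrow> real) \<Rightarrow> complex" and b1 b2
  proof -
    have "indep_var (PiM {(i, j)} (\<lambda>_. borel)) (\<lambda>\<omega>. \<lambda>p\<in>{(i, j)}. x p \<omega>) (PiM (UNIV - {(i, j)}) (\<lambda>_. borel)) (\<lambda>\<omega>. \<lambda>p\<in>UNIV - {(i, j)}. x p \<omega>)"
      by (rule indep_var_restrict[OF indep]) auto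
    then have "indep_var borel ((\<lambda>g. complex_of_real (h (g (i, j)))) \<circ> (\<lambda>\<omega>. \<lambda>p\<in>{(i, j)}. x p \<omega>)) borel (f \<circ> (\<lambda>\<omega>. \<lambda>p\<in>UNIV - {(i, j)}. x p \<omega>))"
      by (rule indep_var_compose) (use f in measurable)
    then have "indep_var borel (\<lambda>\<omega>. complex_of_real (h (x (i, j) \<omega>))) borel (\<lambda>\<omega>. f (\<lambda>p\<in>UNIV - {(i, j)}. x p \<omega>))"
      by (simp add: comp_def)
    moreover have "integrable M (\<lambda>\<omega>. complex_of_real (h (x (i, j) \<omega>)))"
      by (rule integrable_bounded[where B = b1]) (measurable, simp add: hb)
    moreover have "integrable M (\<lambda>\<omega>. f (\<lambda>p\<in>UNIV - {(i, j)}. x p \<omega>))"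
      by (rule integrable_bounded[OF measurable_compose[OF rm f] fb])
    ultimately show ?thesis by (subst indep_var_lebesgue_integral) auto
  qed
  have x2: "(x (i, j) \<omega>)\<^sup>2 \<le> K\<^sup>2" for \<omega>
    using K(1) K(2)[of "(i, j)" \<omega>] by (intro abs_le_square_iff[THEN iffD1]) auto
  have ix: "integrable M (x (i, j))" using K(2) by (intro integrable_const_bound[where B = K]) auto
  have ix2: "integrable M (\<lambda>\<omega>. (x (i, j) \<omega>)\<^sup>2)" using x2 by (intro integrable_const_bound[where B = "K\<^sup>2"]) auto
  define c where "c = m / q"
  have cb: "\<bar>c\<bar> \<le> K / q" using m_bound q by (simp add: c_def divide_right_mono)
  have Ycb: "\<bar>Y \<omega> - c\<bar> \<le> 2 * (K / q)" for \<omega> using Yb[of \<omega>] cb by linarith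
  have E1: "expectation (\<lambda>\<omega>. of_real (Y \<omega> - c) * S j i \<omega>) = 0"
  proof -
    have "expectation (\<lambda>\<omega>. of_real (Y \<omega> - c) * S j i \<omega>) = of_real (expectation (\<lambda>\<omega>. x (i, j) \<omega> / q - c)) * expectation (S j i)"
      using factor[of "\<lambda>y. y / q - c" "\<rho> j i" "2 * (K / q)" "1 / \<eta>"] \<rho>m[OF N(2,1)] Ycb Sb[OF N(2,1)]
      unfolding S_def Y_def by simp
    moreover have "expectation (\<lambda>\<omega>. x (i, j) \<omega> / q - c) = 0" using ix mean prob_space by (simp add: c_def)
    ultimately show ?thesis by simp
  qed
  have E2: "expectation (\<lambda>\<omega>. of_real ((Y \<omega> - c) * Y \<omega>) * Q \<omega>) = of_real (v / real N) * expectation Q"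
  proof -
    have "expectation (\<lambda>\<omega>. of_real ((Y \<omega> - c) * Y \<omega>) * Q \<omega>) = of_real (expectation (\<lambda>\<omega>. (x (i, j) \<omega> / q - c) * (x (i, j) \<omega> / q))) * expectation Q"
    proof -
      have "(\<lambda>g. (\<rho> j i g)\<^sup>2 + \<rho> j j g * \<rho> i i g) \<in> borel_measurable (PiM (UNIV - {(i, j)}) (\<lambda>_. borel))"
        using \<rho>m N by measurable
      moreover have "\<bar>(x (i, j) \<omega> / q - c) * (x (i, j) \<omega> / q)\<bar> \<le> (2 * (K / q)) * (K / q)" for \<omega>
        using Ycb[of \<omega>] Yb[of \<omega>] K q unfolding abs_mult Y_def by (intro mult_mono) auto
      ultimately show ?thesis
        using factor[of "\<lambda>y. (y / q - c) * (y / q)" "\<lambda>g. (\<rho> j i g)\<^sup>2 + \<rho> j j g * \<rho> i i g" "(2 * (K / q)) * (K / q)" "2 / \<eta>\<^sup>2"]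
          Qb unfolding Q_def S_def Y_def by simp
    qed
    also have "expectation (\<lambda>\<omega>. (x (i, j) \<omega> / q - c) * (x (i, j) \<omega> / q)) = v / real N"
    proof -
      have "expectation (\<lambda>\<omega>. (x (i, j) \<omega> / q - c) * (x (i, j) \<omega> / q)) = expectation (\<lambda>\<omega>. (x (i, j) \<omega>)\<^sup>2 / q\<^sup>2 - m / q\<^sup>2 * x (i, j) \<omega>)"
        by (intro Bochner_Integration.integral_cong refl) (simp add: c_def power2_eq_square algebra_simps)
      also have "\<dots> = (m\<^sup>2 + v) / q\<^sup>2 - m / q\<^sup>2 * m" using ix ix2 by (simp add: var mean)
      also have "\<dots> = v / real N" using q(2) by (simp add: power2_eq_square add_divide_distrib)
      finally show ?thesis .
    qed
    finally show ?thesis .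
  qed
  have bnd3: "cmod (of_real r * w) \<le> b1 * b2" if "\<bar>r\<bar> \<le> b1" "cmod w \<le> b2" for r w b1 b2
    unfolding norm_mult norm_of_real using that order_trans[OF abs_ge_zero that(1)] by (intro mult_mono) auto
  have I1: "integrable M (\<lambda>\<omega>. of_real (Y \<omega> - c) * S j i \<omega>)"
    by (rule integrable_bounded[OF _ bnd3[OF Ycb Sb[OF N(2,1)]]]) (use N in measurable)
  have I2: "integrable M (\<lambda>\<omega>. of_real ((Y \<omega> - c) * Y \<omega>) * Q \<omega>)"
  proof (rule integrable_bounded[OF _ bnd3[OF _ Qb]])
    show "\<bar>(Y \<omega> - c) * Y \<omega>\<bar> \<le> (2 * (K / q)) * (K / q)" for \<omega>
      using Ycb[of \<omega>] Yb[of \<omega>] K q unfolding abs_mult by (intro mult_mono) auto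
  qed measurable
  have I3: "integrable M (\<lambda>\<omega>. of_real (Y \<omega> - c) * C \<omega>)"
    by (rule integrable_bounded[OF _ bnd3[OF Ycb Cb]]) measurable
  have I4: "integrable M (R N j i)" using N R_bound by (intro integrable_bounded) auto
  have I5: "integrable M (\<lambda>\<omega>. of_real (Y \<omega>) * R N j i \<omega>)"
    by (rule integrable_bounded[OF _ bnd3[OF Yb R_bound[OF N(2,1)]]]) (use N in measurable)
  have I6: "integrable M Q" "integrable M Q'"
    by (rule integrable_bounded[OF Qm(1) Qb], rule integrable_bounded[OF Qm(2) Q'b])
  \<comment> \<open>By definition of \<open>C\<close>, the entry \<open>(j, i)\<close> of the full
    resolvent is \<open>S - Y * Q + C\<close>; \<open>c\<close> is the mean of
    \<open>Y\<close>.\<close>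
  have "expectation (\<lambda>\<omega>. of_real (Y \<omega>) * R N j i \<omega>) - of_real c * expectation (R N j i) =
      expectation (\<lambda>\<omega>. of_real (Y \<omega> - c) * S j i \<omega> - of_real ((Y \<omega> - c) * Y \<omega>) * Q \<omega> + of_real (Y \<omega> - c) * C \<omega>)"
  proof -
    have "expectation (\<lambda>\<omega>. of_real (Y \<omega>) * R N j i \<omega>) - of_real c * expectation (R N j i) = expectation (\<lambda>\<omega>. of_real (Y \<omega>) * R N j i \<omega> - of_real c * R N j i \<omega>)"
      using I4 I5 by simp
    also have "\<dots> = expectation (\<lambda>\<omega>. of_real (Y \<omega> - c) * S j i \<omega> - of_real ((Y \<omega> - c) * Y \<omega>) * Q \<omega> + of_real (Y \<omega> - c) * C \<omega>)"
      by (intro Bochner_Integration.integral_cong refl) (simp add: C_def algebra_simps)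
    finally show ?thesis .
  qed
  also have "\<dots> = - of_real (v / real N) * expectation Q + expectation (\<lambda>\<omega>. of_real (Y \<omega> - c) * C \<omega>)"
    using I1 I2 I3 E1 E2 by simp
  finally have main: "expectation (\<lambda>\<omega>. of_real (Y \<omega>) * R N j i \<omega>) - (of_real c * expectation (R N j i) - of_real (v / real N) * expectation Q') =
     expectation (\<lambda>\<omega>. of_real (Y \<omega> - c) * C \<omega>) - of_real (v / real N) * expectation (\<lambda>\<omega>. Q \<omega> - Q' \<omega>)"
    using I6 by (simp add: algebra_simps)
  have "cmod (expectation (\<lambda>\<omega>. of_real (Y \<omega>) * R N j i \<omega>) - (of_real c * expectation (R N j i) - of_real (v / real N) * expectation Q'))
      \<le> cmod (expectation (\<lambda>\<omega>. of_real (Y \<omega> - c) * C \<omega>)) + v / real N * cmod (expectation (\<lambda>\<omega>. Q \<omega> - Q' \<omega>))"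
    unfolding main using v_bound by (intro order_trans[OF norm_triangle_ineq4]) (simp add: norm_mult norm_divide)
  also have "\<dots> \<le> (2 * (K / q)) * (4 * (K / q)\<^sup>2 / \<eta>^3) + K\<^sup>2 / real N * (8 * K / (q * \<eta>^3))"
  proof (intro add_mono mult_mono)
    show "cmod (expectation (\<lambda>\<omega>. of_real (Y \<omega> - c) * C \<omega>)) \<le> (2 * (K / q)) * (4 * (K / q)\<^sup>2 / \<eta>^3)"
      by (rule norm_expectation_le[OF bnd3[OF Ycb Cb]]) measurable
    show "cmod (expectation (\<lambda>\<omega>. Q \<omega> - Q' \<omega>)) \<le> 8 * K / (q * \<eta>^3)"
      by (rule norm_expectation_le[OF QQ']) measurable
  qed (use v_bound in \<open>auto intro: divide_right_mono\<close>)
  \<comment> \<open>Since \<open>real N = q\<^sup>2\<close>, both summands equal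
    \<open>8 * K^3 / (q^3 * \<eta>^3)\<close>.\<close>
  also have "\<dots> = 16 * K^3 / (q^3 * \<eta>^3)"
    by (simp add: q(2)[symmetric] power2_eq_square power3_eq_cube)
  finally show ?thesis unfolding Y_def c_def Q'_def .
qed

end

context bounded_wigner
begin

lemma integrable_R: "i < N \<Longrightarrow> j < N \<Longrightarrow> integrable M (R N i j)"
  using R_bound by (intro integrable_bounded) auto

lemma integrable_R_mult: "i < N \<Longrightarrow> j < N \<Longrightarrow> k < N \<Longrightarrow> l < N \<Longrightarrow> integrable M (\<lambda>\<omega>. R N i j \<omega> * R N k l \<omega>)"
proof (rule integrable_bounded[where B = "(1 / \<eta>) * (1 / \<eta>)"])
  fix \<omega> assume "i < N" "j < N" "k < N" "l < N"
  then show "cmod (R N i j \<omega> * R N k l \<omega>) \<le> (1 / \<eta>) * (1 / \<eta>)"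
    unfolding norm_mult using z by (intro mult_mono R_bound) auto
qed simp

lemma integrable_s: "integrable M (s N)" "integrable M (\<lambda>\<omega>. (s N \<omega>)\<^sup>2)"
proof -
  show "integrable M (s N)" using s_bound by (intro integrable_bounded) auto
  show "integrable M (\<lambda>\<omega>. (s N \<omega>)\<^sup>2)"
    using power_mono[OF s_bound, of _ _ 2] by (intro integrable_bounded[where B = "(1 / \<eta>)\<^sup>2"]) (auto simp: norm_power)
qed

text \<open>By the trace identity, \<open>N\<close> times the mean of \<open>1 + z s\<close> is the
  sum of the means of \<open>W i j * R j i\<close>. Off the diagonal these are expanded, and the
  products \<open>R j j * R i i\<close> assemble to \<open>- v * N\<close> times the mean of
  \<open>s\<^sup>2\<close>. All else is at most of order \<open>sqrt N\<close>: the diagonal, the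
  mean of the entries by \<open>resolvent_sum_bound\<close>, the squares of \<open>R j i\<close> by
  \<open>resolvent_sum_sq_bound\<close>, and \<open>N\<^sup>2\<close> remainders of order
  \<open>N powr (-3/2)\<close>.\<close>

lemma expectation_quadratic_bound:
  assumes N: "1 \<le> N"
  shows "cmod (expectation (\<lambda>\<omega>. of_real v * (s N \<omega>)\<^sup>2 + z * s N \<omega> + 1)) \<le>
    (4 * K / \<eta> + 3 * K\<^sup>2 / \<eta>\<^sup>2 + 16 * K^3 / \<eta>^3) / sqrt (real N)"
proof -
  define q where "q = sqrt (real N)"
  have q: "1 \<le> q" "q * q = real N" using N by (auto simp: q_def)
  define F where "F i j = expectation (\<lambda>\<omega>. of_real (W N \<omega> $$ (i, j)) * R N j i \<omega>)" for i j
  define G where "G i j = of_real (m / q) * expectation (R N j i) - of_real (v / real N) * expectation (\<lambda>\<omega>. (R N j i \<omega>)\<^sup>2 + R N j j \<omega> * R N i i \<omega>)" for i j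
  have xm[measurable]: "(\<lambda>\<omega>. W N \<omega> $$ (i, j)) \<in> borel_measurable M" if "i < N" "j < N" for i j
    using that unfolding W_def by (cases "i = j") (simp_all add: wigner_matrix_nth)
  have Wb: "\<bar>W N \<omega> $$ (i, j)\<bar> \<le> 2 * K / q" if "i < N" "j < N" for i j \<omega>
  proof -
    have "sqrt 2 * \<bar>x (i, i) \<omega>\<bar> \<le> 2 * K"
      using K sqrt2_less_2 by (intro mult_mono) auto
    moreover have "\<bar>x (min i j, max i j) \<omega>\<bar> \<le> 2 * K" using K(1) K(2)[of "(min i j, max i j)" \<omega>] by linarith
    ultimately show ?thesis
      using that q(1) by (auto simp: W_def wigner_matrix_nth abs_mult abs_divide q_def[symmetric] divide_right_mono)
  qed
  have intF: "integrable M (\<lambda>\<omega>. of_real (W N \<omega> $$ (i, j)) * R N j i \<omega>)" if ij: "i < N" "j < N" for i j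
  proof (rule integrable_bounded[where B = "(2 * K / q) * (1 / \<eta>)"])
    show "cmod (of_real (W N \<omega> $$ (i, j)) * R N j i \<omega>) \<le> (2 * K / q) * (1 / \<eta>)" for \<omega>
      unfolding norm_mult norm_of_real using ij K q z by (intro mult_mono Wb R_bound) auto
  qed (use ij in measurable)
  have off: "cmod (F i j - G i j) \<le> 16 * K^3 / (q^3 * \<eta>^3)" if ij: "i < N" "j < N" "i \<noteq> j" for i j
  proof -
    have sym: "F i j = F j i" "G i j = G j i" if "i < N" "j < N" for i j
    proof -
      have "W N \<omega> $$ (i, j) = W N \<omega> $$ (j, i)" for \<omega> by (rule symmetric_nth[OF W_carrier z that])
      moreover have "R N i j = R N j i" using R_sym[OF that] by blast
      ultimately show "F i j = F j i" "G i j = G j i"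
        unfolding F_def G_def by (simp_all add: mult.commute)
    qed
    have lt: "cmod (F i j - G i j) \<le> 16 * K^3 / (q^3 * \<eta>^3)" if "i < j" "j < N" for i j
      using offdiagonal_expectation[OF that] that
      unfolding F_def G_def q_def[symmetric] by (simp add: W_def wigner_matrix_nth q_def[symmetric])
    show ?thesis
    proof (cases "i < j")
      case False
      then show ?thesis using lt[of j i] sym[of i j] ij by simp
    qed (use lt ij in simp)
  qed
  have diag: "cmod (F i i) \<le> (2 * K / q) * (1 / \<eta>)" if "i < N" for i
    unfolding F_def using that K q z
    by (intro norm_expectation_le) (auto simp: norm_mult simp del: times_divide_eq_right times_divide_eq_left intro!: mult_mono Wb R_bound)
  let ?O = "{p \<in> {..<N} \<times> {..<N}. fst p \<noteq> snd p}"
  have split: "(\<Sum>i<N. \<Sum>j<N. f i j) = (\<Sum>i<N. f i i) + (\<Sum>p\<in>?O. f (fst p) (snd p))" for f :: "nat \<Rightarrow> nat \<Rightarrow> complex"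
  proof -
    have "(\<Sum>i<N. \<Sum>j<N. f i j) = (\<Sum>p\<in>{..<N} \<times> {..<N}. f (fst p) (snd p))"
      by (simp add: sum.cartesian_product split_beta)
    also have "{..<N} \<times> {..<N} = (\<lambda>i. (i, i)) ` {..<N} \<union> ?O" by auto
    also have "(\<Sum>p\<in>\<dots>. f (fst p) (snd p)) = (\<Sum>p\<in>(\<lambda>i. (i, i)) ` {..<N}. f (fst p) (snd p)) + (\<Sum>p\<in>?O. f (fst p) (snd p))"
      by (intro sum.union_disjoint) auto
    also have "(\<Sum>p\<in>(\<lambda>i. (i, i)) ` {..<N}. f (fst p) (snd p)) = (\<Sum>i<N. f i i)"
      by (subst sum.reindex) (auto simp: inj_on_def)
    finally show ?thesis .
  qed
  have cardO: "real (card ?O) \<le> real N * real N"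
  proof -
    have "card ?O \<le> card ({..<N} \<times> {..<N})" by (intro card_mono) auto
    then show ?thesis by (simp flip: of_nat_mult)
  qed
  have s_eq: "(\<Sum>i<N. R N i i \<omega>) = of_nat N * s N \<omega>" for \<omega> using N by (simp add: s_def)
  have E1: "(\<Sum>i<N. \<Sum>j<N. F i j) = of_nat N * expectation (\<lambda>\<omega>. 1 + z * s N \<omega>)"
  proof -
    have "(\<Sum>i<N. \<Sum>j<N. F i j) = expectation (\<lambda>\<omega>. \<Sum>i<N. \<Sum>j<N. of_real (W N \<omega> $$ (i, j)) * R N j i \<omega>)"
      unfolding F_def using intF
      by (subst Bochner_Integration.integral_sum) (auto intro!: sum.cong Bochner_Integration.integral_sum[symmetric])
    also have "\<dots> = expectation (\<lambda>\<omega>. of_nat N * (1 + z * s N \<omega>))"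
    proof (intro Bochner_Integration.integral_cong refl)
      fix \<omega>
      have "(\<Sum>i<N. \<Sum>j<N. of_real (W N \<omega> $$ (i, j)) * R N j i \<omega>) = of_nat N + z * (\<Sum>i<N. R N i i \<omega>)"
        unfolding R_def by (rule resolvent_trace_identity[OF W_carrier z])
      then show "(\<Sum>i<N. \<Sum>j<N. of_real (W N \<omega> $$ (i, j)) * R N j i \<omega>) = of_nat N * (1 + z * s N \<omega>)"
        unfolding s_eq by (simp add: algebra_simps)
    qed
    finally show ?thesis by simp
  qed
  have intG: "integrable M (\<lambda>\<omega>. (R N j i \<omega>)\<^sup>2 + R N j j \<omega> * R N i i \<omega>)" if "i < N" "j < N" for i j
    using that integrable_R_mult by (auto simp: power2_eq_square)
  have E2: "cmod ((\<Sum>p\<in>?O. G (fst p) (snd p)) + of_nat N * (of_real v * expectation (\<lambda>\<omega>. (s N \<omega>)\<^sup>2))) \<le> 2 * K * q / \<eta> + 3 * K\<^sup>2 / \<eta>\<^sup>2"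
  proof -
    \<comment> \<open>\<open>A\<close> sums the off-diagonal entries. \<open>D\<close> collects what
      does not belong to \<open>(N s)\<^sup>2\<close>; its factor 2 removes the diagonal from the
      squares as well as from the products \<open>R j j * R i i\<close>.\<close>
    define A where "A \<omega> = (\<Sum>i<N. \<Sum>j<N. R N i j \<omega>) - (\<Sum>i<N. R N i i \<omega>)" for \<omega>
    define D where "D \<omega> = (\<Sum>i<N. \<Sum>j<N. (R N j i \<omega>)\<^sup>2) - 2 * (\<Sum>i<N. (R N i i \<omega>)\<^sup>2)" for \<omega>
    have Am: "A \<in> borel_measurable M" "D \<in> borel_measurable M"
      unfolding A_def D_def by (auto intro!: borel_measurable_diff borel_measurable_sum borel_measurable_times borel_measurable_power)
    have Ab: "cmod (A \<omega>) \<le> 2 * real N / \<eta>" for \<omega>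
    proof -
      have "cmod (\<Sum>i<N. \<Sum>j<N. R N i j \<omega>) \<le> real N / \<eta>"
        unfolding R_def by (rule resolvent_sum_bound[OF W_carrier z])
      moreover have "cmod (\<Sum>i<N. R N i i \<omega>) \<le> real N * (1 / \<eta>)"
        using sum_norm_bound[of "{..<N}" "\<lambda>i. R N i i \<omega>" "1 / \<eta>"] R_bound by simp
      ultimately show ?thesis
        unfolding A_def using norm_triangle_ineq4[of "\<Sum>i<N. \<Sum>j<N. R N i j \<omega>" "\<Sum>i<N. R N i i \<omega>"] by simp
    qed
    have Db: "cmod (D \<omega>) \<le> 3 * real N / \<eta>\<^sup>2" for \<omega>
    proof -
      have "cmod (\<Sum>i<N. \<Sum>j<N. (R N j i \<omega>)\<^sup>2) \<le> (\<Sum>i<N. \<Sum>j<N. (cmod (R N j i \<omega>))\<^sup>2)"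
        by (rule order_trans[OF norm_sum sum_mono[OF order_trans[OF norm_sum]]]) (simp add: norm_power)
      also have "\<dots> \<le> real N / \<eta>\<^sup>2"
        unfolding R_def by (rule resolvent_sum_sq_bound[OF W_carrier z])
      finally have 1: "cmod (\<Sum>i<N. \<Sum>j<N. (R N j i \<omega>)\<^sup>2) \<le> real N / \<eta>\<^sup>2" .
      have "cmod (\<Sum>i<N. (R N i i \<omega>)\<^sup>2) \<le> real N * (1 / \<eta>)\<^sup>2"
        using sum_norm_bound[of "{..<N}" "\<lambda>i. (R N i i \<omega>)\<^sup>2" "(1 / \<eta>)\<^sup>2"] power_mono[OF R_bound, of _ N _ _ 2]
        by (simp add: norm_power)
      then have "cmod (2 * (\<Sum>i<N. (R N i i \<omega>)\<^sup>2)) \<le> 2 * (real N / \<eta>\<^sup>2)" by (simp add: norm_mult power_divide)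
      then show ?thesis
        unfolding D_def using 1 norm_triangle_ineq4[of "\<Sum>i<N. \<Sum>j<N. (R N j i \<omega>)\<^sup>2" "2 * (\<Sum>i<N. (R N i i \<omega>)\<^sup>2)"] by simp
    qed
    have GE: "G i j = expectation (\<lambda>\<omega>. of_real (m / q) * R N j i \<omega> - of_real (v / real N) * ((R N j i \<omega>)\<^sup>2 + R N j j \<omega> * R N i i \<omega>))" if "i < N" "j < N" for i j
      unfolding G_def using integrable_R intG that by simp
    have "(\<Sum>p\<in>?O. G (fst p) (snd p)) = expectation (\<lambda>\<omega>. \<Sum>p\<in>?O. of_real (m / q) * R N (snd p) (fst p) \<omega> -
        of_real (v / real N) * ((R N (snd p) (fst p) \<omega>)\<^sup>2 + R N (snd p) (snd p) \<omega> * R N (fst p) (fst p) \<omega>))"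
    proof (subst Bochner_Integration.integral_sum)
      fix p assume "p \<in> ?O"
      then show "integrable M (\<lambda>\<omega>. of_real (m / q) * R N (snd p) (fst p) \<omega> -
        of_real (v / real N) * ((R N (snd p) (fst p) \<omega>)\<^sup>2 + R N (snd p) (snd p) \<omega> * R N (fst p) (fst p) \<omega>))"
        using integrable_R intG[of "fst p" "snd p"] by auto
    qed (intro sum.cong refl GE; auto)
    also have "\<dots> = expectation (\<lambda>\<omega>. of_real (m / q) * A \<omega> - of_real (v / real N) * (D \<omega> + (of_nat N * s N \<omega>)\<^sup>2))"
    proof (intro Bochner_Integration.integral_cong refl)
      fix \<omega>
      have 1: "(\<Sum>p\<in>?O. R N (snd p) (fst p) \<omega>) = A \<omega>"
      proof -
        have sw: "(\<Sum>i<N. \<Sum>j<N. R N i j \<omega>) = (\<Sum>i<N. \<Sum>j<N. R N j i \<omega>)" by (rule sum.swap)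
        show ?thesis unfolding A_def sw split[of "\<lambda>i j. R N j i \<omega>"] by simp
      qed
      have 2: "(\<Sum>p\<in>?O. (R N (snd p) (fst p) \<omega>)\<^sup>2 + R N (snd p) (snd p) \<omega> * R N (fst p) (fst p) \<omega>) = D \<omega> + (of_nat N * s N \<omega>)\<^sup>2"
      proof -
        have "(\<Sum>i<N. \<Sum>j<N. (R N j i \<omega>)\<^sup>2 + R N j j \<omega> * R N i i \<omega>) = (\<Sum>i<N. \<Sum>j<N. (R N j i \<omega>)\<^sup>2) + (\<Sum>i<N. R N i i \<omega>)\<^sup>2"
          by (simp add: sum.distrib power2_eq_square[of "sum _ _"] sum_product mult.commute)
        then show ?thesis using split[of "\<lambda>i j. (R N j i \<omega>)\<^sup>2 + R N j j \<omega> * R N i i \<omega>"] unfolding s_eq[symmetric]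
          by (simp add: D_def power2_eq_square sum.distrib sum_distrib_left algebra_simps)
      qed
      show "(\<Sum>p\<in>?O. of_real (m / q) * R N (snd p) (fst p) \<omega> - of_real (v / real N) * ((R N (snd p) (fst p) \<omega>)\<^sup>2 + R N (snd p) (snd p) \<omega> * R N (fst p) (fst p) \<omega>))
        = of_real (m / q) * A \<omega> - of_real (v / real N) * (D \<omega> + (of_nat N * s N \<omega>)\<^sup>2)"
        unfolding sum_subtractf sum_distrib_left[symmetric] 1 2 ..
    qed
    also have "\<dots> = of_real (m / q) * expectation A - of_real (v / real N) * expectation D - of_nat N * (of_real v * expectation (\<lambda>\<omega>. (s N \<omega>)\<^sup>2))"
    proof -
      have "integrable M A" "integrable M D" using Am Ab Db by (auto intro: integrable_bounded)
      then show ?thesis using integrable_s N by (simp add: power_mult_distrib power2_eq_square[of "of_nat N :: complex"] algebra_simps)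
    qed
    finally have "(\<Sum>p\<in>?O. G (fst p) (snd p)) + of_nat N * (of_real v * expectation (\<lambda>\<omega>. (s N \<omega>)\<^sup>2)) =
        of_real (m / q) * expectation A - of_real (v / real N) * expectation D" by simp
    then have "cmod ((\<Sum>p\<in>?O. G (fst p) (snd p)) + of_nat N * (of_real v * expectation (\<lambda>\<omega>. (s N \<omega>)\<^sup>2))) =
        cmod (of_real (m / q) * expectation A - of_real (v / real N) * expectation D)"
      by (rule arg_cong)
    also have "\<dots> \<le> cmod (of_real (m / q) * expectation A) + cmod (of_real (v / real N) * expectation D)"
      by (rule norm_triangle_ineq4)
    also have "\<dots> = \<bar>m / q\<bar> * cmod (expectation A) + \<bar>v / real N\<bar> * cmod (expectation D)"
      by (simp only: norm_mult norm_of_real)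
    also have "\<dots> \<le> (K / q) * (2 * real N / \<eta>) + (K\<^sup>2 / real N) * (3 * real N / \<eta>\<^sup>2)"
      using m_bound v_bound q Ab Db Am K
      by (intro add_mono mult_mono norm_expectation_le) (auto simp: abs_divide intro!: divide_right_mono)
    also have "\<dots> = 2 * K * q / \<eta> + 3 * K\<^sup>2 / \<eta>\<^sup>2"
      using q N by (simp add: q(2)[symmetric] mult_ac)
    finally show ?thesis .
  qed
  have E3: "cmod ((\<Sum>p\<in>?O. F (fst p) (snd p)) - (\<Sum>p\<in>?O. G (fst p) (snd p))) \<le> 16 * K^3 * q / \<eta>^3"
  proof -
    have "cmod ((\<Sum>p\<in>?O. F (fst p) (snd p)) - (\<Sum>p\<in>?O. G (fst p) (snd p))) \<le> real (card ?O) * (16 * K^3 / (q^3 * \<eta>^3))"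
      unfolding sum_subtractf[symmetric] by (rule sum_norm_bound) (auto intro!: off)
    also have "\<dots> \<le> (real N * real N) * (16 * K^3 / (q^3 * \<eta>^3))"
      using cardO K q z by (intro mult_right_mono) auto
    also have "\<dots> = 16 * K^3 * q / \<eta>^3" using q by (simp add: q(2)[symmetric] power3_eq_cube mult_ac)
    finally show ?thesis .
  qed
  have E4: "cmod (\<Sum>i<N. F i i) \<le> 2 * K * q / \<eta>"
  proof -
    have "cmod (\<Sum>i<N. F i i) \<le> real N * ((2 * K / q) * (1 / \<eta>))"
      using sum_norm_bound[of "{..<N}" "\<lambda>i. F i i" "(2 * K / q) * (1 / \<eta>)"] diag by simp
    also have "\<dots> = 2 * K * q / \<eta>" using q by (simp add: q(2)[symmetric])
    finally show ?thesis .
  qed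
  have "of_nat N * expectation (\<lambda>\<omega>. of_real v * (s N \<omega>)\<^sup>2 + z * s N \<omega> + 1) =
      (\<Sum>i<N. F i i) + ((\<Sum>p\<in>?O. F (fst p) (snd p)) - (\<Sum>p\<in>?O. G (fst p) (snd p))) +
      ((\<Sum>p\<in>?O. G (fst p) (snd p)) + of_nat N * (of_real v * expectation (\<lambda>\<omega>. (s N \<omega>)\<^sup>2)))"
    using E1 split[of F] integrable_s[of N] prob_space by (simp add: algebra_simps)
  then have "cmod (of_nat N * expectation (\<lambda>\<omega>. of_real v * (s N \<omega>)\<^sup>2 + z * s N \<omega> + 1)) \<le>
     2 * K * q / \<eta> + 16 * K^3 * q / \<eta>^3 + (2 * K * q / \<eta> + 3 * K\<^sup>2 / \<eta>\<^sup>2)"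
    using order_trans[OF norm_triangle_ineq add_mono[OF order_trans[OF norm_triangle_ineq add_mono[OF E4 E3]] E2]]
    by (simp only:)
  then have "real N * cmod (expectation (\<lambda>\<omega>. of_real v * (s N \<omega>)\<^sup>2 + z * s N \<omega> + 1)) \<le>
     2 * K * q / \<eta> + 16 * K^3 * q / \<eta>^3 + (2 * K * q / \<eta> + 3 * K\<^sup>2 / \<eta>\<^sup>2)"
    unfolding norm_mult norm_of_nat .
  also have "\<dots> \<le> q * (4 * K / \<eta> + 3 * K\<^sup>2 / \<eta>\<^sup>2 + 16 * K^3 / \<eta>^3)"
  proof -
    have "3 * K\<^sup>2 / \<eta>\<^sup>2 \<le> q * (3 * K\<^sup>2 / \<eta>\<^sup>2)" using q(1) mult_right_mono[of 1 q "3 * K\<^sup>2 / \<eta>\<^sup>2"] by simp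
    then show ?thesis by (simp add: algebra_simps)
  qed
  finally have "q * cmod (expectation (\<lambda>\<omega>. of_real v * (s N \<omega>)\<^sup>2 + z * s N \<omega> + 1)) \<le> 4 * K / \<eta> + 3 * K\<^sup>2 / \<eta>\<^sup>2 + 16 * K^3 / \<eta>^3"
    using q(1) unfolding q(2)[symmetric] mult.assoc by (subst (asm) mult_le_cancel_left_pos) auto
  then show ?thesis unfolding q_def[symmetric] using q(1) by (simp add: pos_le_divide_eq mult.commute)
qed

end

section \<open>Concentration and the almost sure equation\<close>

context bounded_wigner
begin

text \<open>The concentration inequality is for real functions; \<open>part\<close> will be the real
  and the imaginary part.\<close>

lemma Re_Im_s_tail:
  fixes part :: "complex \<Rightarrow> real"
  assumes N: "1 \<le> N" and e: "0 < e" and part: "bounded_linear part" "\<And>w. \<bar>part w\<bar> \<le> cmod w"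
  shows "prob {\<omega> \<in> space M. e \<le> \<bar>part (s N \<omega>) - expectation (\<lambda>\<omega>. part (s N \<omega>))\<bar>}
     \<le> 2 * exp (- (e\<^sup>2 * \<eta>^4 / (128 * K\<^sup>2))) ^ N"
proof -
  let ?I = "{..<N} \<times> {..<N}"
  let ?P = "PiM ?I (\<lambda>_. borel :: real measure)"
  \<comment> \<open>Bounded differences are required on the whole product space and not only on the
    range of the entries. Clipping at \<open>K\<close> achieves this and leaves the actual entries
    unchanged.\<close>
  define clip where "clip y = max (- K) (min K y)" for y :: real
  have clip: "\<bar>clip y\<bar> \<le> K" for y using K(1) by (auto simp: clip_def)
  have clip_x: "clip (x p \<omega>) = x p \<omega>" for p \<omega> using K(2)[of p \<omega>] by (auto simp: clip_def abs_le_iff)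
  have [measurable]: "clip \<in> borel_measurable borel" unfolding clip_def by measurable
  define A where "A g = wigner_matrix N (\<lambda>i j. clip (g (i, j)))" for g :: "nat \<times> nat \<Rightarrow> real"
  have Ac: "A g \<in> carrier_mat N N" "transpose_mat (A g) = A g" for g unfolding A_def by (rule wigner_matrix_symmetric)+
  define tr where "tr g = (\<Sum>i<N. resolvent (A g) z $$ (i, i))" for g
  define f where "f g = part (tr g / of_nat N)" for g
  have tr_m: "tr \<in> borel_measurable ?P"
    unfolding tr_def
  proof (intro borel_measurable_sum resolvent_measurable[OF Ac(1)])
    fix k l assume kl: "k < N" "l < N"
    have [measurable]: "(\<lambda>g. g p) \<in> borel_measurable ?P" if "p \<in> ?I" for p
      using that by (rule measurable_component_singleton)
    have c: "(\<lambda>g. c * clip (g p)) \<in> borel_measurable ?P" if "p \<in> ?I" for p c using that by measurable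
    show "(\<lambda>g. A g $$ (k, l)) \<in> borel_measurable ?P"
      unfolding A_def wigner_matrix_nth[OF kl] using kl c[of "(k, k)"] c[of "(min k l, max k l)"] by (cases "k = l") auto
  qed auto
  have f_m: "f \<in> borel_measurable ?P"
    unfolding f_def using tr_m borel_measurable_continuous_onI[OF linear_continuous_on[OF part(1), of UNIV]]
    by measurable
  have tr_b: "cmod (tr g) \<le> real N * (1 / \<eta>)" for g
    unfolding tr_def using sum_norm_bound[of "{..<N}" "\<lambda>i. resolvent (A g) z $$ (i, i)" "1 / \<eta>"] resolvent_entry_bound[OF Ac z] by simp
  have f_b: "\<bar>f g\<bar> \<le> 1 / \<eta>" for g
  proof -
    have "\<bar>f g\<bar> \<le> cmod (tr g) / real N" unfolding f_def using part(2)[of "tr g / of_nat N"] by (simp add: norm_divide)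
    also have "\<dots> \<le> 1 / \<eta>" using tr_b[of g] N by (simp add: divide_le_eq mult.commute)
    finally show ?thesis .
  qed
  \<comment> \<open>An entry of the clipped matrix moves by at most \<open>4 * K / sqrt N\<close>,
    the trace by twice that over \<open>\<eta>\<^sup>2\<close>, and the trace is divided by
    \<open>N\<close>. Over \<open>N\<^sup>2\<close> coordinates the squares of \<open>c\<close> sum
    to order \<open>1 / N\<close>, whence a tail geometric in \<open>N\<close>.\<close>
  define c where "c = 8 * K / (real N * sqrt (real N) * \<eta>\<^sup>2)"
  have f_d: "\<bar>f (g(p := y)) - f g\<bar> \<le> c" if p: "p \<in> ?I" for g p y
  proof -
    obtain i j where ij: "p = (i, j)" "i < N" "j < N" using p by auto
    have same: "A (g(p := y)) $$ (k, l) = A g $$ (k, l)" if "k < N" "l < N" "\<not> (k = i \<and> l = j)" "\<not> (k = j \<and> l = i)" for k l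
    proof -
      have "(min k l, max k l) \<noteq> p" "k = l \<Longrightarrow> (k, k) \<noteq> p" using that ij by (auto simp: min_def max_def split: if_splits)
      then show ?thesis using that by (auto simp: A_def wigner_matrix_nth)
    qed
    have en: "\<bar>A h $$ (i, j)\<bar> \<le> 2 * K / sqrt (real N)" for h
    proof -
      have "sqrt 2 * \<bar>clip (h (i, i))\<bar> \<le> 2 * K" using clip K sqrt2_less_2 by (intro mult_mono) auto
      moreover have "\<bar>clip (h (min i j, max i j))\<bar> \<le> 2 * K" using clip[of "h (min i j, max i j)"] K(1) by linarith
      ultimately show ?thesis using ij N by (auto simp: A_def wigner_matrix_nth abs_mult abs_divide divide_right_mono)
    qed
    have "\<bar>A (g(p := y)) $$ (i, j) - A g $$ (i, j)\<bar> \<le> 4 * K / sqrt (real N)"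
      using en[of "g(p := y)"] en[of g] by linarith
    from resolvent_trace_diff_entry[OF Ac Ac z ij(2,3) this same]
    have d: "cmod (tr (g(p := y)) - tr g) \<le> 2 * (4 * K / sqrt (real N)) / \<eta>\<^sup>2" unfolding tr_def by simp
    have "f (g(p := y)) - f g = part ((tr (g(p := y)) - tr g) / of_nat N)"
      unfolding f_def using linear_diff[OF bounded_linear.linear[OF part(1)]] by (simp add: diff_divide_distrib)
    then have "\<bar>f (g(p := y)) - f g\<bar> \<le> cmod (tr (g(p := y)) - tr g) / real N"
      using part(2)[of "(tr (g(p := y)) - tr g) / of_nat N"] by (simp add: norm_divide)
    also have "\<dots> \<le> (2 * (4 * K / sqrt (real N)) / \<eta>\<^sup>2) / real N" by (intro divide_right_mono d) simp
    also have "\<dots> = c" by (simp add: c_def mult_ac)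
    finally show ?thesis .
  qed
  define S where "S = 64 * K\<^sup>2 / (real N * \<eta>^4)"
  have S: "0 < S" using K z N by (simp add: S_def)
  have csum: "(\<Sum>p\<in>?I. c\<^sup>2) \<le> S"
  proof -
    have "c\<^sup>2 = 64 * K\<^sup>2 / (real N * real N * real N * \<eta>^4)"
      using N by (simp add: c_def power_divide power_mult_distrib power2_eq_square eval_nat_numeral)
    then have "(\<Sum>p\<in>?I. c\<^sup>2) = S" using N by (simp add: S_def card_cartesian_product)
    then show ?thesis by simp
  qed
  have eq: "part (s N \<omega>) = f (\<lambda>p\<in>?I. x p \<omega>)" for \<omega>
  proof -
    have "A (\<lambda>p\<in>?I. x p \<omega>) = W N \<omega>"
      unfolding A_def W_def by (rule wigner_matrix_cong) (auto simp: clip_x)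
    then show ?thesis by (simp add: f_def tr_def s_def R_def)
  qed
  have "prob {\<omega> \<in> space M. e \<le> \<bar>part (s N \<omega>) - expectation (\<lambda>\<omega>. part (s N \<omega>))\<bar>} \<le> 2 * exp (- (e\<^sup>2 / (2 * S)))"
    unfolding eq
  proof (rule bounded_differences_tail[where K = "1 / \<eta>" and c = "\<lambda>_. c"])
    show "\<bar>f (g(p := y)) - f g\<bar> \<le> c" if "p \<in> ?I" for g p y by (rule f_d[OF that])
    show "?I \<noteq> {}" using N by (auto simp: lessThan_empty_iff)
    show "indep_vars (\<lambda>_. borel) x ?I" by (rule indep_vars_subset[OF indep]) simp
  qed (use f_m f_b S csum e in auto)
  also have "e\<^sup>2 / (2 * S) = real N * (e\<^sup>2 * \<eta>^4 / (128 * K\<^sup>2))"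
    using K z N by (simp add: S_def)
  also have "exp (- (real N * (e\<^sup>2 * \<eta>^4 / (128 * K\<^sup>2)))) = exp (- (e\<^sup>2 * \<eta>^4 / (128 * K\<^sup>2))) ^ N"
    using exp_of_nat_mult[of N "- (e\<^sup>2 * \<eta>^4 / (128 * K\<^sup>2))"] by simp
  finally show ?thesis .
qed

text \<open>The tails are summable in \<open>N\<close> for each threshold \<open>1 / Suc k\<close>,
  so Borel-Cantelli applies to countably many thresholds at once.\<close>

lemma Re_Im_s_concentration:
  fixes part :: "complex \<Rightarrow> real"
  assumes part: "bounded_linear part" "\<And>w. \<bar>part w\<bar> \<le> cmod w"
  shows "AE \<omega> in M. (\<lambda>N. part (s N \<omega>) - part (expectation (s N))) \<longlonglongrightarrow> 0"
proof -
  have [measurable]: "part \<in> borel_measurable borel"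
    by (rule borel_measurable_continuous_onI[OF linear_continuous_on[OF part(1)]])
  have Ep: "expectation (\<lambda>\<omega>. part (s N \<omega>)) = part (expectation (s N))" for N
    by (rule integral_bounded_linear[OF part(1) integrable_s(1)])
  have "AE \<omega> in M. \<forall>\<^sub>F N in sequentially. \<omega> \<in> space M - {\<omega> \<in> space M. 1 / real (Suc k) \<le> \<bar>part (s N \<omega>) - part (expectation (s N))\<bar>}" for k
  proof (rule borel_cantelli_AE1)
    define e where "e = 1 / real (Suc k)"
    define \<rho> where "\<rho> = exp (- (e\<^sup>2 * \<eta>^4 / (128 * K\<^sup>2)))"
    have "0 < e\<^sup>2 * \<eta>^4 / (128 * K\<^sup>2)" using z K by (simp add: e_def)
    then have \<rho>: "0 < \<rho>" "\<rho> < 1" by (simp_all add: \<rho>_def)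
    then have "summable (\<lambda>N. 2 * \<rho> ^ N)" by (intro summable_mult summable_geometric) simp
    then show "summable (\<lambda>N. prob {\<omega> \<in> space M. 1 / real (Suc k) \<le> \<bar>part (s N \<omega>) - part (expectation (s N))\<bar>})"
    proof (rule summable_comparison_test'[where N = 1])
      fix N :: nat assume "1 \<le> N"
      from Re_Im_s_tail[OF this _ part, of e]
      show "norm (prob {\<omega> \<in> space M. 1 / real (Suc k) \<le> \<bar>part (s N \<omega>) - part (expectation (s N))\<bar>}) \<le> 2 * \<rho> ^ N"
        unfolding Ep \<rho>_def[symmetric] by (simp add: e_def)
    qed
  qed (simp_all add: emeasure_eq_measure)
  then have "AE \<omega> in M. \<forall>k. \<forall>\<^sub>F N in sequentially. \<omega> \<in> space M - {\<omega> \<in> space M. 1 / real (Suc k) \<le> \<bar>part (s N \<omega>) - part (expectation (s N))\<bar>}"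
    by (simp only: AE_all_countable) blast
  then show ?thesis
  proof eventually_elim
    case (elim \<omega>)
    show ?case
    proof (rule tendstoI)
      fix e :: real assume "0 < e"
      then obtain k where k: "1 / real (Suc k) < e" using nat_approx_posE by blast
      show "\<forall>\<^sub>F N in sequentially. dist (part (s N \<omega>) - part (expectation (s N))) 0 < e"
        using elim[rule_format, of k] by (rule eventually_mono) (use k in \<open>auto simp: not_le\<close>)
    qed
  qed
qed

text \<open>The equation is known with the mean of \<open>s\<^sup>2\<close>, not with the square of
  the mean \<open>y N\<close>. Concentration and boundedness make the mean of
  \<open>(s - y)\<^sup>2\<close> vanish, so the numbers \<open>y N\<close> solve the equation
  asymptotically, and then so do the random \<open>s N\<close>.\<close>

lemma quadratic_limit: "AE \<omega> in M. (\<lambda>N. of_real v * (s N \<omega>)\<^sup>2 + z * s N \<omega> + 1) \<longlonglongrightarrow> 0"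
proof -
  define y where "y N = expectation (s N)" for N
  have yb: "cmod (y N) \<le> 1 / \<eta>" for N unfolding y_def by (rule norm_expectation_le[OF s_bound s_measurable])
  have conc: "AE \<omega> in M. (\<lambda>N. s N \<omega> - y N) \<longlonglongrightarrow> 0"
    using Re_Im_s_concentration[OF bounded_linear_Re abs_Re_le_cmod] Re_Im_s_concentration[OF bounded_linear_Im abs_Im_le_cmod]
  proof eventually_elim
    case (elim \<omega>)
    then show ?case unfolding y_def tendsto_complex_iff by simp
  qed
  have dist: "cmod (s N \<omega> - y N) \<le> 2 / \<eta>" for N \<omega>
    using norm_triangle_ineq4[of "s N \<omega>" "y N"] s_bound[of N \<omega>] yb[of N] by simp
  have var0: "(\<lambda>N. expectation (\<lambda>\<omega>. (s N \<omega> - y N)\<^sup>2)) \<longlonglongrightarrow> expectation (\<lambda>\<omega>. 0)"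
  proof (rule integral_dominated_convergence[where w = "\<lambda>_. (2 / \<eta>)\<^sup>2"])
    show "AE \<omega> in M. (\<lambda>N. (s N \<omega> - y N)\<^sup>2) \<longlonglongrightarrow> 0"
      using conc by eventually_elim (auto intro: tendsto_eq_intros)
    show "AE \<omega> in M. norm ((s N \<omega> - y N)\<^sup>2) \<le> (2 / \<eta>)\<^sup>2" for N
      unfolding norm_power by (intro AE_I2 power_mono dist) auto
  qed auto
  have "(\<lambda>N. expectation (\<lambda>\<omega>. of_real v * (s N \<omega>)\<^sup>2 + z * s N \<omega> + 1)) \<longlonglongrightarrow> 0"
  proof (rule Lim_null_comparison)
    show "\<forall>\<^sub>F N in sequentially. norm (expectation (\<lambda>\<omega>. of_real v * (s N \<omega>)\<^sup>2 + z * s N \<omega> + 1)) \<le>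
      (4 * K / \<eta> + 3 * K\<^sup>2 / \<eta>\<^sup>2 + 16 * K^3 / \<eta>^3) / sqrt (real N)"
      by (rule eventually_sequentiallyI[of 1]) (rule expectation_quadratic_bound)
    show "(\<lambda>N. (4 * K / \<eta> + 3 * K\<^sup>2 / \<eta>\<^sup>2 + 16 * K^3 / \<eta>^3) / sqrt (real N)) \<longlonglongrightarrow> 0"
      by (intro tendsto_divide_0[OF tendsto_const] filterlim_at_top_imp_at_infinity
          filterlim_compose[OF sqrt_at_top filterlim_real_sequentially])
  qed
  then have "(\<lambda>N. expectation (\<lambda>\<omega>. of_real v * (s N \<omega>)\<^sup>2 + z * s N \<omega> + 1) - of_real v * expectation (\<lambda>\<omega>. (s N \<omega> - y N)\<^sup>2)) \<longlonglongrightarrow> 0 - of_real v * expectation (\<lambda>\<omega>. 0)"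
    by (rule tendsto_diff[OF _ tendsto_mult[OF tendsto_const var0]])
  moreover have "expectation (\<lambda>\<omega>. of_real v * (s N \<omega>)\<^sup>2 + z * s N \<omega> + 1) - of_real v * expectation (\<lambda>\<omega>. (s N \<omega> - y N)\<^sup>2)
     = of_real v * (y N)\<^sup>2 + z * y N + 1" for N
  proof -
    have "expectation (\<lambda>\<omega>. (s N \<omega> - y N)\<^sup>2) = expectation (\<lambda>\<omega>. (s N \<omega>)\<^sup>2 - 2 * y N * s N \<omega> + (y N)\<^sup>2)"
      by (intro Bochner_Integration.integral_cong refl) (simp add: power2_eq_square algebra_simps)
    also have "\<dots> = expectation (\<lambda>\<omega>. (s N \<omega>)\<^sup>2) - 2 * y N * y N + (y N)\<^sup>2"
      using integrable_s[of N] prob_space by (simp add: y_def)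
    finally show ?thesis using integrable_s[of N] prob_space by (simp add: y_def[symmetric] power2_eq_square algebra_simps)
  qed
  ultimately have ylim: "(\<lambda>N. of_real v * (y N)\<^sup>2 + z * y N + 1) \<longlonglongrightarrow> 0" by simp
  show ?thesis
    using conc
  proof eventually_elim
    case (elim \<omega>)
    have b: "cmod (of_real v * (s N \<omega> + y N) + z) \<le> v * (2 / \<eta>) + cmod z" for N
    proof -
      have "cmod (s N \<omega> + y N) \<le> 2 / \<eta>" using norm_triangle_ineq[of "s N \<omega>" "y N"] s_bound[of N \<omega>] yb[of N] by simp
      then have "cmod (of_real v * (s N \<omega> + y N)) \<le> v * (2 / \<eta>)"
        unfolding norm_mult norm_of_real using v_bound(1) mult_left_mono[of "cmod (s N \<omega> + y N)" "2 / \<eta>" v] by simp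
      then show ?thesis using norm_triangle_ineq[of "of_real v * (s N \<omega> + y N)" z] by linarith
    qed
    have "(\<lambda>N. (of_real v * (s N \<omega> + y N) + z) * (s N \<omega> - y N)) \<longlonglongrightarrow> 0"
    proof (rule Lim_null_comparison)
      show "\<forall>\<^sub>F N in sequentially. norm ((of_real v * (s N \<omega> + y N) + z) * (s N \<omega> - y N)) \<le> (v * (2 / \<eta>) + cmod z) * cmod (s N \<omega> - y N)"
        unfolding norm_mult by (intro always_eventually allI mult_right_mono b) auto
      show "(\<lambda>N. (v * (2 / \<eta>) + cmod z) * cmod (s N \<omega> - y N)) \<longlonglongrightarrow> 0"
        by (intro tendsto_mult_right_zero tendsto_norm_zero elim)
    qed
    from tendsto_add[OF this ylim] show ?case
      by (simp add: power2_eq_square algebra_simps)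
  qed
qed

end

section \<open>Young integration and linear growth\<close>

text \<open>Kolmogorov chaining: \<open>s\<close> and \<open>t\<close> are approached through their
  dyadic floors, starting at a level where the two floors are equal or adjacent; the remaining
  increments are dominated by geometric series of ratio \<open>2 powr - \<gamma>\<close>.\<close>

lemma dyadic_chaining:
  fixes g :: "real \<Rightarrow> real" and T :: nat
  assumes cont: "continuous_on {0..} g" and \<gamma>: "0 < \<gamma>" and K: "0 \<le> K"
    and incr: "\<And>n k. k < T * 2 ^ n \<Longrightarrow> \<bar>g (real (Suc k) / 2 ^ n) - g (real k / 2 ^ n)\<bar> \<le> K * (2 powr - \<gamma>) ^ n"
    and st: "0 \<le> s" "s \<le> t" "t \<le> real T" "t - s \<le> 1"
  shows "\<bar>g t - g s\<bar> \<le> K * (2 powr \<gamma> * (1 + 2 / (1 - 2 powr - \<gamma>))) * (t - s) powr \<gamma>"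
proof -
  define \<rho> where "\<rho> = 2 powr - \<gamma>"
  have \<rho>: "0 < \<rho>" "\<rho> < 1" using \<gamma> by (auto simp: \<rho>_def powr_minus inverse_eq_divide)
  define fl where "fl u n = nat \<lfloor>u * 2 ^ n\<rfloor>" for u :: real and n :: nat
  define a where "a u n = real (fl u n) / 2 ^ n" for u n
  have fl: "real (fl u n) \<le> u * 2 ^ n" "u * 2 ^ n < real (fl u n) + 1" if "0 \<le> u" for u n
    using that by (auto simp: fl_def of_nat_nat)
  have step: "\<bar>g (a u (Suc n)) - g (a u n)\<bar> \<le> K * \<rho> ^ Suc n" if u: "0 \<le> u" "u \<le> real T" for u n
  proof -
    have "real (2 * fl u n) < real (fl u (Suc n)) + 1" "real (fl u (Suc n)) < real (2 * fl u n) + 2"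
      using fl[OF u(1), of n] fl[OF u(1), of "Suc n"] by auto
    then have "fl u (Suc n) = 2 * fl u n \<or> fl u (Suc n) = Suc (2 * fl u n)" by linarith
    then show ?thesis
    proof
      assume "fl u (Suc n) = 2 * fl u n"
      then have "a u (Suc n) = a u n" by (simp add: a_def)
      then show ?thesis using K \<rho> by simp
    next
      assume e: "fl u (Suc n) = Suc (2 * fl u n)"
      have "real (Suc (2 * fl u n)) \<le> real T * 2 ^ Suc n"
        using fl(1)[OF u(1), of "Suc n"] u(2) unfolding e by (meson mult_right_mono order_trans zero_le_numeral zero_le_power)
      then have "real (Suc (2 * fl u n)) \<le> real (T * 2 ^ Suc n)" by simp
      then have "2 * fl u n < T * 2 ^ Suc n" by (simp only: of_nat_le_iff Suc_le_eq)
      from incr[OF this] have "\<bar>g (real (Suc (2 * fl u n)) / 2 ^ Suc n) - g (real (2 * fl u n) / 2 ^ Suc n)\<bar> \<le> K * \<rho> ^ Suc n"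
        unfolding \<rho>_def .
      then show ?thesis unfolding a_def e by simp
    qed
  qed
  have tail: "\<bar>g u - g (a u n)\<bar> \<le> K * \<rho> ^ n / (1 - \<rho>)" if u: "0 \<le> u" "u \<le> real T" for u n
  proof -
    have part: "\<bar>g (a u (n + m)) - g (a u n)\<bar> \<le> K * \<rho> ^ n / (1 - \<rho>)" for m
    proof -
      have "\<bar>g (a u (n + m)) - g (a u n)\<bar> \<le> (\<Sum>i<m. K * \<rho> ^ n * \<rho> ^ i)"
      proof (induction m)
        case (Suc m)
        have "\<bar>g (a u (Suc (n + m))) - g (a u (n + m))\<bar> \<le> K * \<rho> ^ Suc (n + m)" by (rule step[OF u])
        also have "\<dots> \<le> K * \<rho> ^ (n + m)" using K \<rho> by (intro mult_left_mono power_decreasing) auto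
        also have "\<dots> = K * \<rho> ^ n * \<rho> ^ m" by (simp add: power_add)
        finally show ?case using Suc by simp
      qed simp
      also have "\<dots> = K * \<rho> ^ n * (\<Sum>i<m. \<rho> ^ i)" by (simp add: sum_distrib_left)
      also have "(\<Sum>i<m. \<rho> ^ i) \<le> 1 / (1 - \<rho>)"
        using \<rho> sum_le_suminf[of "\<lambda>i. \<rho> ^ i" "{..<m}"] suminf_geometric[of \<rho>] summable_geometric[of \<rho>] by simp
      finally show ?thesis using K \<rho> by (simp add: mult_left_mono)
    qed
    have "(\<lambda>m. a u (n + m)) \<longlonglongrightarrow> u"
    proof (rule tendsto_sandwich[of "\<lambda>m. u - (1 / 2) ^ (n + m)" _ _ "\<lambda>_. u"])
      show "\<forall>\<^sub>F m in sequentially. u - (1 / 2) ^ (n + m) \<le> a u (n + m)"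
      proof (intro always_eventually allI)
        fix m
        have "u \<le> (real (fl u (n + m)) + 1) / 2 ^ (n + m)"
          using fl(2)[OF u(1), of "n + m"] by (simp add: pos_le_divide_eq)
        then show "u - (1 / 2) ^ (n + m) \<le> a u (n + m)" by (simp add: a_def add_divide_distrib power_one_over)
      qed
      show "\<forall>\<^sub>F m in sequentially. a u (n + m) \<le> u"
        using fl(1)[OF u(1)] by (intro always_eventually allI) (simp add: a_def pos_divide_le_eq)
      have "(\<lambda>m. (1 / 2 :: real) ^ (n + m)) \<longlonglongrightarrow> 0"
        using LIMSEQ_ignore_initial_segment[OF LIMSEQ_power_zero[of "1 / 2 :: real"], of n] by (simp add: add.commute)
      from tendsto_diff[OF tendsto_const this, of u] show "(\<lambda>m. u - (1 / 2) ^ (n + m)) \<longlonglongrightarrow> u" by simp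
    qed simp
    then have "(\<lambda>m. g (a u (n + m))) \<longlonglongrightarrow> g u"
      by (rule continuous_on_tendsto_compose[OF cont]) (use u in \<open>auto simp: a_def\<close>)
    then have "(\<lambda>m. \<bar>g (a u (n + m)) - g (a u n)\<bar>) \<longlonglongrightarrow> \<bar>g u - g (a u n)\<bar>"
      by (intro tendsto_intros)
    then show ?thesis by (rule LIMSEQ_le_const2) (use part in blast)
  qed
  show ?thesis
  proof (cases "s = t")
    case False
    then have h: "0 < t - s" using st by simp
    \<comment> \<open>The upper bound on \<open>t - s\<close> makes the floors adjacent; the lower
      bound turns \<open>\<rho> ^ n\<close> back into a power of \<open>t - s\<close>, at the price
      of \<open>2 powr \<gamma>\<close>.\<close>
    obtain n where n: "t - s \<le> (1 / 2) ^ n" "(1 / 2) ^ Suc n < t - s"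
    proof -
      obtain N where N: "(1 / 2 :: real) ^ N < t - s" using real_arch_pow_inv[OF h, of "1/2"] by auto
      define M where "M = (LEAST M. (1 / 2 :: real) ^ M < t - s)"
      have M: "(1 / 2 :: real) ^ M < t - s" unfolding M_def using N by (rule LeastI)
      have "M \<noteq> 0" using M st(4) by (auto intro: ccontr)
      then obtain k where k: "M = Suc k" using not0_implies_Suc by blast
      have "\<not> (1 / 2 :: real) ^ k < t - s" using k not_less_Least[of k "\<lambda>M. (1 / 2 :: real) ^ M < t - s"] by (auto simp: M_def)
      then show ?thesis using that M k by (simp add: not_less)
    qed
    have mid: "\<bar>g (a t n) - g (a s n)\<bar> \<le> K * \<rho> ^ n"
    proof -
      have "t * 2 ^ n - s * 2 ^ n \<le> 1"
        using n(1) by (simp add: power_one_over pos_le_divide_eq left_diff_distrib)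
      moreover have "s * 2 ^ n \<le> t * 2 ^ n" using st by (intro mult_right_mono) auto
      moreover have "0 \<le> t" using st by simp
      ultimately have "real (fl s n) < real (fl t n) + 1" "real (fl t n) < real (fl s n) + 2"
        using fl[OF st(1), of n] fl[of t n] by linarith+
      then have "fl t n = fl s n \<or> fl t n = Suc (fl s n)" by linarith
      then show ?thesis
      proof
        assume "fl t n = fl s n"
        then show ?thesis using K \<rho> by (simp add: a_def)
      next
        assume e: "fl t n = Suc (fl s n)"
        have "real (Suc (fl s n)) \<le> real T * 2 ^ n"
          using fl(1)[of t n] st unfolding e by (meson mult_right_mono order_trans zero_le_numeral zero_le_power)
        then have "real (Suc (fl s n)) \<le> real (T * 2 ^ n)" by simp
        then have "fl s n < T * 2 ^ n" by (simp only: of_nat_le_iff Suc_le_eq)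
        from incr[OF this] show ?thesis unfolding a_def e \<rho>_def .
      qed
    qed
    have "\<bar>g t - g s\<bar> \<le> K * \<rho> ^ n + 2 * (K * \<rho> ^ n / (1 - \<rho>))"
      using tail[of s n] tail[of t n] mid st by linarith
    also have "\<dots> = K * (1 + 2 / (1 - \<rho>)) * \<rho> ^ n" by (simp add: algebra_simps)
    finally have 1: "\<bar>g t - g s\<bar> \<le> K * (1 + 2 / (1 - \<rho>)) * \<rho> ^ n" .
    have "\<rho> ^ n = ((1 / 2) ^ n) powr \<gamma>"
      by (simp add: \<rho>_def powr_minus powr_realpow[symmetric] powr_powr powr_divide power_one_over powr_power mult.commute inverse_eq_divide)
    also have "((1 / 2 :: real) ^ n) powr \<gamma> \<le> (2 * (t - s)) powr \<gamma>"
      using n(2) \<gamma> by (intro powr_mono2) auto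
    also have "(2 * (t - s)) powr \<gamma> = 2 powr \<gamma> * (t - s) powr \<gamma>" using h by (intro powr_mult)
    finally have "K * (1 + 2 / (1 - \<rho>)) * \<rho> ^ n \<le> K * (1 + 2 / (1 - \<rho>)) * (2 powr \<gamma> * (t - s) powr \<gamma>)"
      using K \<rho> by (intro mult_left_mono) auto
    with 1 show ?thesis unfolding \<rho>_def[symmetric] by (simp add: mult_ac)
  qed simp
qed

section \<open>The Young integral and its first-order approximation\<close>

lemma tagged_division_of_points:
  fixes p :: "nat \<Rightarrow> real"
  assumes "\<And>k. k < Suc m \<Longrightarrow> p k < p (Suc k)"
  shows "(\<lambda>k. (p k, {p k..p (Suc k)})) ` {..<Suc m} tagged_division_of {p 0..p (Suc m)}"
  using assms
proof (induction m)
  case 0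
  then have "p 0 < p 1" by simp
  then show ?case using tagged_division_of_self_real[of "p 0" "p 0" "p 1"] by (auto simp: lessThan_Suc)
next
  case (Suc m)
  let ?q = "\<lambda>k. (p k, {p k..p (Suc k)})"
  have less: "p 0 < p (Suc m)"
  proof -
    have "p 0 < p (Suc k)" if "k \<le> m" for k
      using that
    proof (induction k)
      case (Suc k)
      then show ?case using Suc.IH Suc.prems \<open>\<And>k. k < Suc (Suc m) \<Longrightarrow> p k < p (Suc k)\<close>[of "Suc k"] by simp
    qed (use Suc.prems in simp)
    then show ?thesis by simp
  qed
  have last: "p (Suc m) < p (Suc (Suc m))" using Suc.prems by simp
  have "?q ` {..<Suc m} \<union> {?q (Suc m)} tagged_division_of {p 0..p (Suc m)} \<union> {p (Suc m)..p (Suc (Suc m))}"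
  proof (rule tagged_division_Un)
    show "?q ` {..<Suc m} tagged_division_of {p 0..p (Suc m)}" using Suc by simp
    show "{?q (Suc m)} tagged_division_of {p (Suc m)..p (Suc (Suc m))}"
      using last by (intro tagged_division_of_self_real) simp
  qed auto
  also have "{p 0..p (Suc m)} \<union> {p (Suc m)..p (Suc (Suc m))} = {p 0..p (Suc (Suc m))}" using less last by auto
  also have "?q ` {..<Suc m} \<union> {?q (Suc m)} = ?q ` {..<Suc (Suc m)}" by (auto simp: lessThan_Suc)
  finally show ?case .
qed

lemma sum_lessThan_double:
  fixes a :: "nat \<Rightarrow> real"
  shows "(\<Sum>k<2 * m. a k) = (\<Sum>k<m. a (2 * k) + a (2 * k + 1))"
  by (induction m) simp_all

text \<open>Both integrals start at 0. The interval from \<open>s\<close> to \<open>t\<close> is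
  reached by appending its dyadic left-point partition to a fine tagged division of the interval
  from 0 to \<open>s\<close>, and subtracting.\<close>

lemma rs_integral_dyadic_limit:
  assumes Is: "has_rs_integral f g 0 s Is" and It: "has_rs_integral f g 0 t It" and st: "0 \<le> s" "s < t"
  shows "(\<lambda>n. \<Sum>k<2 ^ n. f (s + real k * ((t - s) / 2 ^ n)) * (g (s + real (Suc k) * ((t - s) / 2 ^ n)) - g (s + real k * ((t - s) / 2 ^ n))))
    \<longlonglongrightarrow> It - Is"
proof (rule LIMSEQ_I)
  fix e :: real assume e: "0 < e"
  obtain d1 where d1: "0 < d1" "\<And>p. p tagged_division_of {0..s} \<Longrightarrow> (\<lambda>x. ball x d1) fine p \<Longrightarrow>
        \<bar>(\<Sum>(x, K)\<in>p. f x * (g (Sup K) - g (Inf K))) - Is\<bar> < e / 2"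
    using Is e unfolding has_rs_integral_def by (meson half_gt_zero)
  obtain d2 where d2: "0 < d2" "\<And>p. p tagged_division_of {0..t} \<Longrightarrow> (\<lambda>x. ball x d2) fine p \<Longrightarrow>
        \<bar>(\<Sum>(x, K)\<in>p. f x * (g (Sup K) - g (Inf K))) - It\<bar> < e / 2"
    using It e unfolding has_rs_integral_def by (meson half_gt_zero)
  define d where "d = min d1 d2"
  have d: "0 < d" using d1 d2 by (simp add: d_def)
  obtain N where N: "(1 / 2 :: real) ^ N < d / (t - s)"
    using real_arch_pow_inv[of "d / (t - s)" "1/2"] d st by auto
  have "norm ((\<Sum>k<2 ^ n. f (s + real k * ((t - s) / 2 ^ n)) * (g (s + real (Suc k) * ((t - s) / 2 ^ n)) - g (s + real k * ((t - s) / 2 ^ n)))) - (It - Is)) < e"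
    if n: "N \<le> n" for n
  proof -
    define h where "h = (t - s) / 2 ^ n"
    have h: "0 < h" "h < d"
    proof -
      show "0 < h" using st by (simp add: h_def)
      have "(1 / 2 :: real) ^ n \<le> (1 / 2) ^ N" using n by (intro power_decreasing) auto
      then have "(1 / 2 :: real) ^ n < d / (t - s)" using N by linarith
      then show "h < d" using st by (simp add: h_def pos_less_divide_eq power_one_over mult.commute)
    qed
    define p where "p k = s + real k * h" for k
    have p: "p k < p (Suc k)" for k using h by (simp add: p_def algebra_simps)
    have p0: "p 0 = s" "p (2 ^ n) = t" by (simp_all add: p_def h_def)
    have ps: "s \<le> p k" for k using h by (simp add: p_def)
    let ?q = "(\<lambda>k. (p k, {p k..p (Suc k)})) ` {..<2 ^ n}"
    have q: "?q tagged_division_of {s..t}"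
    proof -
      obtain m where m: "2 ^ n = Suc m" using not0_implies_Suc[of "2 ^ n"] by auto
      show ?thesis using tagged_division_of_points[of m p] p p0 unfolding m by simp
    qed
    have qf: "(\<lambda>x. ball x d) fine ?q"
      unfolding fine_def using h by (auto simp: dist_real_def p_def algebra_simps)
    obtain r where r: "r tagged_division_of {0..s}" "(\<lambda>x. ball x d) fine r"
      using fine_division_exists_real[of "\<lambda>x. ball x d" 0 s] d by (auto simp: gauge_ball)
    \<comment> \<open>Splitting the sum needs disjoint sets of tagged intervals: those of
      \<open>?q\<close> have positive length to the right of \<open>s\<close>.\<close>
    have disj: "r \<inter> ?q = {}"
    proof (rule ccontr)
      assume "r \<inter> ?q \<noteq> {}"
      then obtain k where "(p k, {p k..p (Suc k)}) \<in> r" by auto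
      then have "{p k..p (Suc k)} \<subseteq> {0..s}" using r(1) by blast
      moreover have "p (Suc k) \<in> {p k..p (Suc k)}" using p[of k] by simp
      ultimately have "p (Suc k) \<le> s" by auto
      then show False using ps[of k] p[of k] by linarith
    qed
    have un: "r \<union> ?q tagged_division_of {0..t}"
    proof -
      have "r \<union> ?q tagged_division_of {0..s} \<union> {s..t}"
        by (rule tagged_division_Un[OF r(1) q]) auto
      also have "{0..s} \<union> {s..t} = {0..t}" using st by auto
      finally show ?thesis .
    qed
    have fineD: "(\<lambda>x. ball x d') fine u" if "(\<lambda>x. ball x d) fine u" "d \<le> d'" for u d'
      unfolding fine_def
    proof (clarify)
      fix y K z assume "(y, K) \<in> u" "z \<in> K"
      then have "z \<in> ball y d" using that(1) unfolding fine_def by blast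
      then show "z \<in> ball y d'" using that(2) by simp
    qed
    have "(\<Sum>(x, K)\<in>?q. f x * (g (Sup K) - g (Inf K))) = (\<Sum>k<2 ^ n. f (p k) * (g (p (Suc k)) - g (p k)))"
    proof (subst sum.reindex)
      have "strict_mono p" using p by (simp add: strict_mono_Suc_iff)
      then show "inj_on (\<lambda>k. (p k, {p k..p (Suc k)})) {..<2 ^ n}"
        by (auto simp: inj_on_def strict_mono_eq)
      show "(sum ((\<lambda>(x, K). f x * (g (Sup K) - g (Inf K))) \<circ> (\<lambda>k. (p k, {p k..p (Suc k)}))) {..<2 ^ n}) = (\<Sum>k<2 ^ n. f (p k) * (g (p (Suc k)) - g (p k)))"
        using p[THEN less_imp_le] by (intro sum.cong refl) simp
    qed
    moreover have "(\<Sum>(x, K)\<in>r \<union> ?q. f x * (g (Sup K) - g (Inf K))) = (\<Sum>(x, K)\<in>r. f x * (g (Sup K) - g (Inf K))) + (\<Sum>(x, K)\<in>?q. f x * (g (Sup K) - g (Inf K)))"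
      using tagged_division_of_finite[OF r(1)] disj by (intro sum.union_disjoint) auto
    moreover have "\<bar>(\<Sum>(x, K)\<in>r. f x * (g (Sup K) - g (Inf K))) - Is\<bar> < e / 2"
      by (rule d1(2)[OF r(1) fineD[OF r(2)]]) (simp add: d_def)
    moreover have "\<bar>(\<Sum>(x, K)\<in>r \<union> ?q. f x * (g (Sup K) - g (Inf K))) - It\<bar> < e / 2"
      by (rule d2(2)[OF un fineD[OF fine_Un[OF r(2) qf]]]) (simp add: d_def)
    ultimately have "\<bar>(\<Sum>k<2 ^ n. f (p k) * (g (p (Suc k)) - g (p k))) - (It - Is)\<bar> < e"
      unfolding abs_less_iff by linarith
    then show ?thesis unfolding p_def h_def real_norm_def .
  qed
  then show "\<exists>N. \<forall>n\<ge>N. norm ((\<Sum>k<2 ^ n. f (s + real k * ((t - s) / 2 ^ n)) * (g (s + real (Suc k) * ((t - s) / 2 ^ n)) - g (s + real k * ((t - s) / 2 ^ n)))) - (It - Is)) < e"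
    by blast
qed

text \<open>The Young-Love estimate. Passing from level \<open>n\<close> to the next adds, for each
  of \<open>2 ^ n\<close> intervals, the increment of \<open>f\<close> over its left half times that
  of \<open>g\<close> over its right half. These sums decay with ratio
  \<open>2 powr (1 - (\<theta> + \<gamma>))\<close>, and level 0 is
  \<open>f s * (g t - g s)\<close>.\<close>

lemma young_estimate:
  assumes Is: "has_rs_integral f g 0 s Is" and It: "has_rs_integral f g 0 t It" and st: "0 \<le> s" "s < t"
    and f: "\<And>u v. u \<in> {s..t} \<Longrightarrow> v \<in> {s..t} \<Longrightarrow> \<bar>f u - f v\<bar> \<le> F * \<bar>u - v\<bar> powr \<theta>"
    and g: "\<And>u v. u \<in> {s..t} \<Longrightarrow> v \<in> {s..t} \<Longrightarrow> \<bar>g u - g v\<bar> \<le> G * \<bar>u - v\<bar> powr \<gamma>"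
    and \<alpha>: "1 < \<theta> + \<gamma>" and FG: "0 \<le> F" "0 \<le> G"
  shows "\<bar>It - Is - f s * (g t - g s)\<bar> \<le> F * G * (t - s) powr (\<theta> + \<gamma>) / (1 - 2 powr (1 - (\<theta> + \<gamma>)))"
proof -
  define D where "D n = (\<Sum>k<2 ^ n. f (s + real k * ((t - s) / 2 ^ n)) * (g (s + real (Suc k) * ((t - s) / 2 ^ n)) - g (s + real k * ((t - s) / 2 ^ n))))" for n
  define r where "r = 2 powr (1 - (\<theta> + \<gamma>))"
  have r: "0 < r" "r < 1" using \<alpha> powr_less_mono[of "1 - (\<theta> + \<gamma>)" 0 "2 :: real"] by (auto simp: r_def)
  define A where "A = F * G * (t - s) powr (\<theta> + \<gamma>)"
  have A: "0 \<le> A" using FG by (simp add: A_def)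
  have step: "\<bar>D (Suc n) - D n\<bar> \<le> A * r ^ n" for n
  proof -
    define h where "h = (t - s) / 2 ^ Suc n"
    have h: "0 < h" using st by (simp add: h_def)
    define p where "p k = s + real k * h" for k
    have mem: "p k \<in> {s..t}" if "k \<le> 2 ^ Suc n" for k
    proof -
      have "real k * h \<le> 2 ^ Suc n * h" using that h by (intro mult_right_mono) (auto simp: of_nat_le_iff[symmetric, where 'a = real] simp del: of_nat_le_iff)
      also have "\<dots> = t - s" by (simp add: h_def)
      finally show ?thesis using h by (simp add: p_def)
    qed
    have "D (Suc n) = (\<Sum>k<2 * 2 ^ n. f (p k) * (g (p (Suc k)) - g (p k)))"
      unfolding D_def p_def h_def by simp
    also have "\<dots> = (\<Sum>k<2 ^ n. f (p (2 * k)) * (g (p (Suc (2 * k))) - g (p (2 * k))) + f (p (2 * k + 1)) * (g (p (Suc (2 * k + 1))) - g (p (2 * k + 1))))"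
      by (rule sum_lessThan_double)
    finally have D1: "D (Suc n) = \<dots>" .
    have Dn: "D n = (\<Sum>k<2 ^ n. f (p (2 * k)) * (g (p (Suc (2 * k + 1))) - g (p (2 * k))))"
    proof -
      have "p (2 * k) = s + real k * ((t - s) / 2 ^ n)" for k by (simp add: p_def h_def)
      from this[of "Suc _"] this show ?thesis unfolding D_def by simp
    qed
    have "D (Suc n) - D n = (\<Sum>k<2 ^ n. (f (p (2 * k + 1)) - f (p (2 * k))) * (g (p (Suc (2 * k + 1))) - g (p (2 * k + 1))))"
      unfolding D1 Dn sum_subtractf[symmetric] by (intro sum.cong refl) (simp add: algebra_simps)
    also have "\<bar>\<dots>\<bar> \<le> (\<Sum>k<(2::nat) ^ n. F * G * h powr (\<theta> + \<gamma>))"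
    proof (rule order_trans[OF sum_abs sum_mono])
      fix k assume "k \<in> {..<(2::nat) ^ n}"
      then have k: "k < 2 ^ n" by simp
      have "\<bar>f (p (2 * k + 1)) - f (p (2 * k))\<bar> \<le> F * \<bar>p (2 * k + 1) - p (2 * k)\<bar> powr \<theta>"
        using k by (intro f mem) auto
      moreover have "\<bar>g (p (Suc (2 * k + 1))) - g (p (2 * k + 1))\<bar> \<le> G * \<bar>p (Suc (2 * k + 1)) - p (2 * k + 1)\<bar> powr \<gamma>"
        using k by (intro g mem) auto
      moreover have "\<bar>p (2 * k + 1) - p (2 * k)\<bar> = h" "\<bar>p (Suc (2 * k + 1)) - p (2 * k + 1)\<bar> = h"
        using h by (simp_all add: p_def algebra_simps)
      ultimately have "\<bar>f (p (2 * k + 1)) - f (p (2 * k))\<bar> * \<bar>g (p (Suc (2 * k + 1))) - g (p (2 * k + 1))\<bar> \<le> (F * h powr \<theta>) * (G * h powr \<gamma>)"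
        using FG by (intro mult_mono) auto
      then show "\<bar>(f (p (2 * k + 1)) - f (p (2 * k))) * (g (p (Suc (2 * k + 1))) - g (p (2 * k + 1)))\<bar> \<le> F * G * h powr (\<theta> + \<gamma>)"
        unfolding abs_mult powr_add by (simp only: mult_ac)
    qed
    also have "\<dots> = 2 ^ n * (F * G * h powr (\<theta> + \<gamma>))" by simp
    also have "h powr (\<theta> + \<gamma>) = (t - s) powr (\<theta> + \<gamma>) / 2 powr (real (Suc n) * (\<theta> + \<gamma>))"
    proof -
      have e: "(2::real) ^ Suc n = 2 powr real (Suc n)" by (rule powr_realpow[symmetric]) simp
      show ?thesis unfolding h_def e using st by (simp only: powr_divide powr_powr powr_ge_zero diff_ge_0_iff_ge less_imp_le)
    qed
    also have "2 ^ n * (F * G * ((t - s) powr (\<theta> + \<gamma>) / 2 powr (real (Suc n) * (\<theta> + \<gamma>)))) = A * (2 powr (real n) / 2 powr (real (Suc n) * (\<theta> + \<gamma>)))"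
      by (simp add: A_def powr_realpow)
    also have "2 powr (real n) / 2 powr (real (Suc n) * (\<theta> + \<gamma>)) = (2 powr (real n - real (Suc n) * (\<theta> + \<gamma>)) :: real)"
      by (simp add: powr_diff)
    \<comment> \<open>\<open>h\<close> is the mesh of level \<open>Suc n\<close>; dropping one
      factor \<open>2 powr - (\<theta> + \<gamma>)\<close> only enlarges the bound and leaves a
      clean geometric term.\<close>
    also have "A * (2 powr (real n - real (Suc n) * (\<theta> + \<gamma>))) \<le> A * (2 powr (real n * (1 - (\<theta> + \<gamma>))))"
      using A \<alpha> by (intro mult_left_mono powr_mono) (auto simp: algebra_simps)
    also have "2 powr (real n * (1 - (\<theta> + \<gamma>))) = r ^ n"
      by (simp add: r_def powr_power mult.commute)
    finally show ?thesis .
  qed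
  have "\<bar>D n - D 0\<bar> \<le> A / (1 - r)" for n
  proof -
    have "\<bar>D n - D 0\<bar> \<le> (\<Sum>i<n. A * r ^ i)"
    proof (induction n)
      case (Suc n)
      then show ?case using step[of n] by simp
    qed simp
    also have "\<dots> = A * (\<Sum>i<n. r ^ i)" by (simp add: sum_distrib_left)
    also have "\<dots> \<le> A * (1 / (1 - r))"
      using A r sum_le_suminf[of "\<lambda>i. r ^ i" "{..<n}"] suminf_geometric[of r] summable_geometric[of r]
      by (intro mult_left_mono) auto
    finally show ?thesis by simp
  qed
  moreover have "(\<lambda>n. \<bar>D n - D 0\<bar>) \<longlonglongrightarrow> \<bar>It - Is - D 0\<bar>"
    unfolding D_def by (intro tendsto_intros rs_integral_dyadic_limit[OF Is It st])
  ultimately have "\<bar>It - Is - D 0\<bar> \<le> A / (1 - r)" by (intro LIMSEQ_le_const2) auto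
  moreover have "D 0 = f s * (g t - g s)" by (simp add: D_def)
  ultimately show ?thesis by (simp add: A_def r_def)
qed

lemma integral_diff_bound:
  fixes h :: "real \<Rightarrow> real"
  assumes "continuous_on {0..t} h" "0 \<le> s" "s \<le> t" "\<And>r. r \<in> {s..t} \<Longrightarrow> \<bar>h r\<bar> \<le> B"
  shows "\<bar>integral {0..t} h - integral {0..s} h\<bar> \<le> B * (t - s)"
proof -
  have "integral {0..s} h + integral {s..t} h = integral {0..t} h"
    using assms by (intro Henstock_Kurzweil_Integration.integral_combine integrable_continuous_interval) auto
  moreover have "norm (integral {s..t} h) \<le> B * (t - s)"
    using assms by (intro integral_bound continuous_on_subset[OF assms(1)]) auto
  ultimately show ?thesis by (simp add: real_norm_def[symmetric] del: real_norm_def) (metis add_diff_cancel_left')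
qed

section \<open>Growth of solutions of a Young equation\<close>

locale young_equation =
  fixes L G \<gamma> T :: real and \<sigma> b g x :: "real \<Rightarrow> real"
  assumes L: "0 < L" and \<sigma>_lip: "\<And>u v. \<bar>\<sigma> u - \<sigma> v\<bar> \<le> L * \<bar>u - v\<bar>"
    and \<sigma>_growth: "\<And>u. \<bar>\<sigma> u\<bar> \<le> L * (1 + \<bar>u\<bar>)" and b_growth: "\<And>u. \<bar>b u\<bar> \<le> L * (1 + \<bar>u\<bar>)"
    and b_cont: "continuous_on UNIV b" and T: "0 \<le> T"
    and \<gamma>: "1 / 2 < \<gamma>" "\<gamma> \<le> 1" and G: "0 \<le> G"
    and g: "\<And>s t. s \<in> {0..T} \<Longrightarrow> t \<in> {0..T} \<Longrightarrow> \<bar>t - s\<bar> \<le> 1 \<Longrightarrow> \<bar>g t - g s\<bar> \<le> G * \<bar>t - s\<bar> powr \<gamma>"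
    and x_cont: "continuous_on {0..T} x"
    and eq: "\<And>t. t \<in> {0..T} \<Longrightarrow> \<exists>I. has_rs_integral (\<lambda>r. \<sigma> (x r)) g 0 t I \<and> x t = x 0 + I + integral {0..t} (\<lambda>r. b (x r))"
begin

lemma bx_cont: "t \<le> T \<Longrightarrow> continuous_on {0..t} (\<lambda>r. b (x r))"
  by (rule continuous_on_compose2[OF b_cont continuous_on_subset[OF x_cont]]) auto

text \<open>\<open>\<gamma>'\<close> is allowed to differ from \<open>\<gamma>\<close> because the a priori regularity of the solution may
  only be compatible with an integrator of regularity close to \<open>H\<close>.\<close>

lemma increment_bound:
  assumes st: "0 \<le> s" "s < t" "t \<le> T"
    and hx: "\<And>u v. u \<in> {s..t} \<Longrightarrow> v \<in> {s..t} \<Longrightarrow> \<bar>x u - x v\<bar> \<le> F * \<bar>u - v\<bar> powr \<theta>"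
    and hg: "\<And>u v. u \<in> {s..t} \<Longrightarrow> v \<in> {s..t} \<Longrightarrow> \<bar>g u - g v\<bar> \<le> G' * \<bar>u - v\<bar> powr \<gamma>'"
    and \<alpha>: "1 < \<theta> + \<gamma>'" and F: "0 \<le> F" "0 \<le> G'"
    and B: "\<And>r. r \<in> {s..t} \<Longrightarrow> \<bar>x r\<bar> \<le> B"
  shows "\<bar>x t - x s\<bar> \<le> L * (1 + B) * (G' * (t - s) powr \<gamma>')
    + L * F * G' * (t - s) powr (\<theta> + \<gamma>') / (1 - 2 powr (1 - (\<theta> + \<gamma>'))) + L * (1 + B) * (t - s)"
proof -
  obtain Is where Is: "has_rs_integral (\<lambda>r. \<sigma> (x r)) g 0 s Is" "x s = x 0 + Is + integral {0..s} (\<lambda>r. b (x r))"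
    using eq[of s] st by auto
  obtain It where It: "has_rs_integral (\<lambda>r. \<sigma> (x r)) g 0 t It" "x t = x 0 + It + integral {0..t} (\<lambda>r. b (x r))"
    using eq[of t] st by auto
  have "\<bar>It - Is - \<sigma> (x s) * (g t - g s)\<bar> \<le> L * F * G' * (t - s) powr (\<theta> + \<gamma>') / (1 - 2 powr (1 - (\<theta> + \<gamma>')))"
  proof (rule young_estimate[OF Is(1) It(1) st(1,2) _ hg \<alpha>])
    fix u v assume uv: "u \<in> {s..t}" "v \<in> {s..t}"
    have "\<bar>\<sigma> (x u) - \<sigma> (x v)\<bar> \<le> L * \<bar>x u - x v\<bar>" by (rule \<sigma>_lip)
    also have "\<dots> \<le> L * (F * \<bar>u - v\<bar> powr \<theta>)" using L hx[OF uv] by (intro mult_left_mono) auto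
    finally show "\<bar>\<sigma> (x u) - \<sigma> (x v)\<bar> \<le> L * F * \<bar>u - v\<bar> powr \<theta>" by (simp add: mult.assoc)
  qed (use L F in auto)
  moreover have "\<bar>\<sigma> (x s) * (g t - g s)\<bar> \<le> L * (1 + B) * (G' * (t - s) powr \<gamma>')"
  proof -
    have "\<bar>\<sigma> (x s)\<bar> \<le> L * (1 + B)"
      using order_trans[OF \<sigma>_growth[of "x s"]] B[of s] L st by (auto intro: mult_left_mono)
    moreover have "\<bar>g t - g s\<bar> \<le> G' * (t - s) powr \<gamma>'" using hg[of t s] st by simp
    ultimately show ?thesis
      unfolding abs_mult by (intro mult_mono) (auto intro: order_trans[OF abs_ge_zero])
  qed
  moreover have "\<bar>integral {0..t} (\<lambda>r. b (x r)) - integral {0..s} (\<lambda>r. b (x r))\<bar> \<le> L * (1 + B) * (t - s)"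
  proof (rule integral_diff_bound[OF bx_cont[OF st(3)] st(1) less_imp_le[OF st(2)]])
    fix r assume "r \<in> {s..t}"
    then show "\<bar>b (x r)\<bar> \<le> L * (1 + B)"
      using order_trans[OF b_growth[of "x r"]] B[of r] L by (auto intro: mult_left_mono)
  qed
  ultimately show ?thesis
    unfolding Is(2) It(2) abs_le_iff by linarith
qed

text \<open>The three terms of \<open>increment_bound\<close> have orders \<open>\<gamma>'\<close>,
  \<open>\<theta> + \<gamma>'\<close> and 1, all at least \<open>\<gamma>\<close> on intervals of
  length at most 1. The resulting constant is not controlled; it provides the finiteness on which
  \<open>one_step\<close> relies.\<close>

lemma holder_upgrade:
  assumes hx: "holder_on \<theta> {0..T} x"
    and hg: "\<And>s t. s \<in> {0..T} \<Longrightarrow> t \<in> {0..T} \<Longrightarrow> \<bar>t - s\<bar> \<le> 1 \<Longrightarrow> \<bar>g t - g s\<bar> \<le> G' * \<bar>t - s\<bar> powr \<gamma>'"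
    and \<gamma>': "\<gamma> \<le> \<gamma>'" "1 < \<theta> + \<gamma>'" and G': "0 \<le> G'"
  shows "\<exists>A\<ge>0. \<forall>s\<in>{0..T}. \<forall>t\<in>{0..T}. \<bar>t - s\<bar> \<le> 1 \<longrightarrow> \<bar>x t - x s\<bar> \<le> A * \<bar>t - s\<bar> powr \<gamma>"
proof -
  obtain C where C: "\<And>u v. u \<in> {0..T} \<Longrightarrow> v \<in> {0..T} \<Longrightarrow> \<bar>x u - x v\<bar> \<le> C * \<bar>u - v\<bar> powr \<theta>"
    using hx unfolding holder_on_def by blast
  define F where "F = max C 0"
  have F: "\<bar>x u - x v\<bar> \<le> F * \<bar>u - v\<bar> powr \<theta>" if "u \<in> {0..T}" "v \<in> {0..T}" for u v
    using order_trans[OF C[OF that], of "F * \<bar>u - v\<bar> powr \<theta>"] by (simp add: F_def mult_right_mono)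
  have "bounded (x ` {0..T})" by (intro compact_imp_bounded compact_continuous_image x_cont compact_Icc)
  then obtain B where "\<forall>y\<in>x ` {0..T}. norm y \<le> B" unfolding bounded_iff by blast
  then have B: "\<And>r. r \<in> {0..T} \<Longrightarrow> \<bar>x r\<bar> \<le> B" by simp
  have B0: "0 \<le> B" using B[of 0] T by auto
  define r where "r = 2 powr (1 - (\<theta> + \<gamma>'))"
  have r: "0 < r" "r < 1" using \<gamma>' powr_less_mono[of "1 - (\<theta> + \<gamma>')" 0 "2 :: real"] by (auto simp: r_def)
  define A where "A = L * (1 + B) * G' + L * F * G' / (1 - r) + L * (1 + B)"
  have A: "0 \<le> A" using L B0 G' r by (auto simp: A_def F_def)
  have main: "\<bar>x t - x s\<bar> \<le> A * (t - s) powr \<gamma>" if st: "0 \<le> s" "s < t" "t \<le> T" "t - s \<le> 1" for s t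
  proof -
    have "\<bar>x t - x s\<bar> \<le> L * (1 + B) * (G' * (t - s) powr \<gamma>') + L * F * G' * (t - s) powr (\<theta> + \<gamma>') / (1 - r) + L * (1 + B) * (t - s)"
      unfolding r_def using st hg F G' by (intro increment_bound \<gamma>' B) (auto simp: F_def abs_minus_commute)
    also have "\<dots> \<le> L * (1 + B) * (G' * (t - s) powr \<gamma>) + L * F * G' * (t - s) powr \<gamma> / (1 - r) + L * (1 + B) * (t - s) powr \<gamma>"
    proof -
      have 1: "(t - s) powr \<gamma>' \<le> (t - s) powr \<gamma>" "(t - s) powr (\<theta> + \<gamma>') \<le> (t - s) powr \<gamma>" "t - s \<le> (t - s) powr \<gamma>"
        using st \<gamma> \<gamma>' powr_mono'[of \<gamma> \<gamma>' "t - s"] powr_mono'[of \<gamma> "\<theta> + \<gamma>'" "t - s"] powr_mono'[of \<gamma> 1 "t - s"] by auto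
      show ?thesis
        using L B0 G' r by (intro add_mono mult_left_mono divide_right_mono 1) (auto simp: F_def)
    qed
    also have "\<dots> = A * (t - s) powr \<gamma>" by (simp add: A_def algebra_simps)
    finally show ?thesis .
  qed
  have "\<bar>x t - x s\<bar> \<le> A * \<bar>t - s\<bar> powr \<gamma>" if "s \<in> {0..T}" "t \<in> {0..T}" "\<bar>t - s\<bar> \<le> 1" for s t
    using that main[of s t] main[of t s] A by (cases s t rule: linorder_cases) (auto simp: abs_minus_commute)
  then show ?thesis using A by blast
qed

text \<open>The constant of \<open>young_estimate\<close> when both exponents are
  \<open>\<gamma>\<close>.\<close>

definition C where "C = 1 / (1 - 2 powr (1 - 2 * \<gamma>))"

lemma C_nonneg: "0 \<le> C"
  using \<gamma> powr_less_mono[of "1 - 2 * \<gamma>" 0 "2 :: real"] by (auto simp: C_def)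

text \<open>The best Hoelder constant \<open>N\<close> of \<open>x\<close> on the interval is at
  most a term in the starting value plus \<open>N / 2\<close>, by the choice of
  \<open>\<delta>\<close>. The half can be absorbed because \<open>N\<close> is finite, which comes
  from \<open>A\<close>; the final bound does not contain \<open>A\<close>.\<close>

lemma one_step:
  assumes hx: "\<And>s t. s \<in> {0..T} \<Longrightarrow> t \<in> {0..T} \<Longrightarrow> \<bar>t - s\<bar> \<le> 1 \<Longrightarrow> \<bar>x t - x s\<bar> \<le> A * \<bar>t - s\<bar> powr \<gamma>"
    and \<delta>: "0 < \<delta>" "\<delta> \<le> 1" "L * (C + 1) * (G + 1) * \<delta> powr \<gamma> \<le> 1 / 2"
    and u: "0 \<le> u" "u + \<delta> \<le> T" and t: "t \<in> {u..u + \<delta>}"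
  shows "1 + \<bar>x t\<bar> \<le> 2 * (1 + \<bar>x u\<bar>)"
proof -
  let ?P = "{(s, t). u \<le> s \<and> s < t \<and> t \<le> u + \<delta>}"
  define q where "q = (\<lambda>(s, t). \<bar>x t - x s\<bar> / (t - s) powr \<gamma>)"
  have bdd: "bdd_above (q ` ?P)"
  proof (rule bdd_aboveI2[where M = A])
    fix p assume "p \<in> ?P"
    then obtain s t where p: "p = (s, t)" "u \<le> s" "s < t" "t \<le> u + \<delta>" by auto
    then have "\<bar>x t - x s\<bar> \<le> A * (t - s) powr \<gamma>" using hx[of s t] u \<delta> by simp
    then show "q p \<le> A" using p by (simp add: q_def divide_le_eq)
  qed
  have "(u, u + \<delta>) \<in> ?P" using \<delta> by simp
  then have ne: "?P \<noteq> {}" by blast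
  define N where "N = (SUP p\<in>?P. q p)"
  have Nq: "q p \<le> N" if "p \<in> ?P" for p unfolding N_def by (rule cSUP_upper[OF that bdd])
  have N0: "0 \<le> N"
  proof -
    have "0 \<le> q (u, u + \<delta>)" by (simp add: q_def)
    also have "\<dots> \<le> N" using \<delta> by (intro Nq) auto
    finally show ?thesis .
  qed
  have xN: "\<bar>x r - x s\<bar> \<le> N * \<bar>r - s\<bar> powr \<gamma>" if "r \<in> {u..u + \<delta>}" "s \<in> {u..u + \<delta>}" for r s
  proof -
    have "\<bar>x t - x s\<bar> \<le> N * (t - s) powr \<gamma>" if "u \<le> s" "s < t" "t \<le> u + \<delta>" for s t
      using Nq[of "(s, t)"] that by (simp add: q_def divide_le_eq)
    from this[of s r] this[of r s] show ?thesis
      using that by (cases r s rule: linorder_cases) (auto simp: abs_minus_commute)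
  qed
  have gle: "(r - u) powr \<gamma> \<le> \<delta> powr \<gamma>" if "u \<le> r" "r \<le> u + \<delta>" for r
    using that \<gamma> by (intro powr_mono2) auto
  define X where "X = \<bar>x u\<bar>"
  define B where "B = X + N * \<delta> powr \<gamma>"
  have B: "\<bar>x r\<bar> \<le> B" if "r \<in> {u..u + \<delta>}" for r
  proof -
    have "\<bar>x r - x u\<bar> \<le> N * \<bar>r - u\<bar> powr \<gamma>" using that \<delta> by (intro xN) auto
    also have "\<dots> \<le> N * \<delta> powr \<gamma>" using that N0 gle[of r] by (intro mult_left_mono) auto
    finally show ?thesis by (simp add: B_def X_def abs_le_iff) linarith
  qed
  have B0: "0 \<le> B" using N0 by (simp add: B_def X_def)
  have "q p \<le> L * (1 + B) * (G + 1) + C * L * N * G * \<delta> powr \<gamma>" if pp: "p \<in> ?P" for p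
  proof -
    obtain s t where p: "p = (s, t)" "u \<le> s" "s < t" "t \<le> u + \<delta>" using pp by auto
    have st0: "0 < (t - s) powr \<gamma>" using p by simp
    have "\<bar>x t - x s\<bar> \<le> L * (1 + B) * (G * (t - s) powr \<gamma>) + L * N * G * (t - s) powr (\<gamma> + \<gamma>) / (1 - 2 powr (1 - (\<gamma> + \<gamma>))) + L * (1 + B) * (t - s)"
      using p u \<delta> \<gamma> N0 G g by (intro increment_bound xN B) (auto simp: abs_minus_commute)
    also have "\<dots> = L * (1 + B) * (G * (t - s) powr \<gamma>) + L * N * G * C * (t - s) powr (\<gamma> + \<gamma>) + L * (1 + B) * (t - s)"
    proof -
      have "C = 1 / (1 - 2 powr (1 - (\<gamma> + \<gamma>)))" unfolding C_def by (simp only: mult_2)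
      then show ?thesis by (simp only: times_divide_eq_right times_divide_eq_left mult_1_right)
    qed
    also have "\<dots> \<le> L * (1 + B) * (G * (t - s) powr \<gamma>) + L * N * G * C * (\<delta> powr \<gamma> * (t - s) powr \<gamma>) + L * (1 + B) * (t - s) powr \<gamma>"
    proof -
      have "(t - s) powr \<gamma> \<le> \<delta> powr \<gamma>" using p \<gamma> by (intro powr_mono2) auto
      then have 1: "(t - s) powr (\<gamma> + \<gamma>) \<le> \<delta> powr \<gamma> * (t - s) powr \<gamma>"
        unfolding powr_add by (rule mult_right_mono) simp
      have 2: "t - s \<le> (t - s) powr \<gamma>" using p \<delta> \<gamma> powr_mono'[of \<gamma> 1 "t - s"] by auto
      show ?thesis
        using L N0 G B0 C_nonneg by (intro add_mono mult_left_mono 1 2 order_refl) auto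
    qed
    also have "\<dots> = (L * (1 + B) * (G + 1) + C * L * N * G * \<delta> powr \<gamma>) * (t - s) powr \<gamma>" by (simp add: algebra_simps)
    finally show ?thesis using p st0 by (simp add: q_def divide_le_eq)
  qed
  then have "N \<le> L * (1 + B) * (G + 1) + C * L * N * G * \<delta> powr \<gamma>"
    unfolding N_def by (intro cSUP_least[OF ne])
  \<comment> \<open>Expanding \<open>B = X + N * \<delta> powr \<gamma>\<close> gathers all
    occurrences of \<open>N\<close>, whose total coefficient is then at most one half.\<close>
  also have "\<dots> = L * (G + 1) * (1 + X) + N * (L * (G + 1 + C * G) * \<delta> powr \<gamma>)" by (simp add: B_def algebra_simps)
  also have "\<dots> \<le> L * (G + 1) * (1 + X) + N * (1 / 2)"
  proof -
    have "L * (G + 1 + C * G) * \<delta> powr \<gamma> \<le> L * ((C + 1) * (G + 1)) * \<delta> powr \<gamma>"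
      using L C_nonneg by (intro mult_right_mono mult_left_mono) (auto simp: algebra_simps)
    also have "\<dots> \<le> 1 / 2" using \<delta>(3) by (simp add: mult_ac)
    finally show ?thesis using N0 by (intro add_left_mono mult_left_mono)
  qed
  finally have "N \<le> 2 * (L * (G + 1) * (1 + X))" by simp
  then have "N * \<delta> powr \<gamma> \<le> 2 * (L * (G + 1) * (1 + X)) * \<delta> powr \<gamma>" by (rule mult_right_mono) simp
  also have "\<dots> = 2 * (L * (G + 1) * \<delta> powr \<gamma>) * (1 + X)" by simp
  also have "\<dots> \<le> 2 * (1 / 2) * (1 + X)"
  proof -
    have "L * (G + 1) * \<delta> powr \<gamma> \<le> L * (C + 1) * (G + 1) * \<delta> powr \<gamma>"
      using L C_nonneg G by (intro mult_right_mono) (auto simp: algebra_simps)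
    then show ?thesis using \<delta>(3) by (intro mult_right_mono) (auto simp: X_def)
  qed
  finally show ?thesis using B[OF t] by (simp add: B_def X_def)
qed

text \<open>\<open>one_step\<close> iterated over \<open>n\<close> steps of length
  \<open>T / n\<close>, each at most doubling \<open>1 + |x|\<close>.\<close>

lemma growth_bound:
  assumes hx: "\<And>s t. s \<in> {0..T} \<Longrightarrow> t \<in> {0..T} \<Longrightarrow> \<bar>t - s\<bar> \<le> 1 \<Longrightarrow> \<bar>x t - x s\<bar> \<le> A * \<bar>t - s\<bar> powr \<gamma>"
    and n: "0 < n" "0 < T" "T \<le> real n" "L * (C + 1) * (G + 1) * (T / real n) powr \<gamma> \<le> 1 / 2" and t: "t \<in> {0..T}"
  shows "1 + \<bar>x t\<bar> \<le> 2 ^ n * (1 + \<bar>x 0\<bar>)"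
proof -
  define \<delta> where "\<delta> = T / real n"
  have \<delta>: "0 < \<delta>" "\<delta> \<le> 1" "L * (C + 1) * (G + 1) * \<delta> powr \<gamma> \<le> 1 / 2" "real n * \<delta> = T"
    using n by (auto simp: \<delta>_def)
  have "1 + \<bar>x r\<bar> \<le> 2 ^ Suc k * (1 + \<bar>x 0\<bar>)" if "k < n" "r \<in> {real k * \<delta>..real k * \<delta> + \<delta>}" for k r
    using that
  proof (induction k arbitrary: r)
    case 0
    have "\<delta> \<le> T" using n \<delta>(4) \<delta>(1) mult_right_mono[of 1 "real n" \<delta>] by simp
    then show ?case using 0 one_step[OF hx \<delta>(1-3), of 0 r] by simp
  next
    case (Suc k)
    have "real (Suc (Suc k)) * \<delta> \<le> real n * \<delta>" using Suc.prems \<delta> by (intro mult_right_mono) auto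
    then have "real (Suc k) * \<delta> + \<delta> \<le> T" using \<delta>(4) by (simp add: algebra_simps)
    then have "1 + \<bar>x r\<bar> \<le> 2 * (1 + \<bar>x (real (Suc k) * \<delta>)\<bar>)"
      using Suc.prems \<delta> by (intro one_step[OF hx \<delta>(1-3)]) auto
    also have "1 + \<bar>x (real (Suc k) * \<delta>)\<bar> \<le> 2 ^ Suc k * (1 + \<bar>x 0\<bar>)"
      using Suc.prems \<delta> by (intro Suc.IH) (auto simp: algebra_simps)
    finally show ?case by simp
  qed
  note steps = this
  have "\<exists>k<n. t \<in> {real k * \<delta>..real k * \<delta> + \<delta>}"
  proof (cases "t = T")
    \<comment> \<open>The floor of \<open>t / \<delta>\<close> would be \<open>n\<close> here, one
      too many, so the right end is assigned to the last step.\<close>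
    case True
    then show ?thesis using n \<delta> by (intro exI[of _ "n - 1"]) (auto simp: of_nat_diff algebra_simps)
  next
    case False
    define k where "k = nat \<lfloor>t / \<delta>\<rfloor>"
    have k: "real k \<le> t / \<delta>" "t / \<delta> < real k + 1" using t \<delta> by (auto simp: k_def of_nat_nat)
    have "t / \<delta> < real n" using t False \<delta> by (simp add: divide_less_eq)
    then have "k < n" using k by linarith
    moreover have "t \<in> {real k * \<delta>..real k * \<delta> + \<delta>}"
      using k \<delta> by (auto simp: le_divide_eq divide_less_eq algebra_simps)
    ultimately show ?thesis by blast
  qed
  then obtain k where k: "k < n" "t \<in> {real k * \<delta>..real k * \<delta> + \<delta>}" by blast
  have "1 + \<bar>x t\<bar> \<le> 2 ^ Suc k * (1 + \<bar>x 0\<bar>)" by (rule steps[OF k])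
  also have "\<dots> \<le> 2 ^ n * (1 + \<bar>x 0\<bar>)"
    using k by (intro mult_right_mono power_increasing) auto
  finally show ?thesis .
qed

end

section \<open>Moments of the solution\<close>

text \<open>\<open>exp (- x\<^sup>2 / 2 + x\<^sup>2 / 8)\<close> is up to a factor the normal
  density of variance \<open>4 / 3\<close>, so this is one of its moments.\<close>

lemma integrable_std_normal_exp_moment:
  "integrable lborel (\<lambda>x. std_normal_density x * (x ^ (2 * p) * exp (x\<^sup>2 / 8)))"
proof -
  have "std_normal_density x * (x ^ (2 * p) * exp (x\<^sup>2 / 8))
      = sqrt (4 / 3) * (normal_density 0 (sqrt (4 / 3)) x * (x - 0) ^ (2 * p))" for x :: real
  proof -
    have "exp (- x\<^sup>2 / 2) * exp (x\<^sup>2 / 8) = exp (- (x - 0)\<^sup>2 / (2 * (sqrt (4 / 3))\<^sup>2))"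
      by (simp add: exp_add[symmetric] power_divide real_sqrt_pow2)
    then show ?thesis
      unfolding std_normal_density_def normal_density_def using real_sqrt_mult[of 4 2]
      by (simp add: real_sqrt_mult real_sqrt_divide field_simps)
  qed
  then show ?thesis by (simp only: integrable_mult_right integrable_normal_moment real_sqrt_gt_0_iff zero_less_divide_iff zero_less_numeral simp_thms)
qed

section \<open>Exponential moments of the increments of fractional Brownian motion\<close>

context prob_space
begin

lemma gaussian_rv_integrable:
  assumes "gaussian_rv M Z"
  shows "integrable M Z" "integrable M (\<lambda>\<omega>. (Z \<omega>)\<^sup>2)"
proof -
  have [measurable]: "Z \<in> borel_measurable M" using assms by (simp add: gaussian_rv_def)
  consider c where "AE \<omega> in M. Z \<omega> = c"
    | m s where "0 < s" "distributed M lborel Z (\<lambda>x. ennreal (normal_density m s x))"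
    using assms by (auto simp: gaussian_rv_def)
  then have "integrable M Z \<and> integrable M (\<lambda>\<omega>. (Z \<omega>)\<^sup>2)"
  proof cases
    case 1
    have "integrable M Z" by (subst integrable_cong_AE[of _ _ "\<lambda>_. c"]) (use 1 in auto)
    moreover have "integrable M (\<lambda>\<omega>. (Z \<omega>)\<^sup>2)"
      by (subst integrable_cong_AE[of _ _ "\<lambda>_. c\<^sup>2"]) (use 1 in auto)
    ultimately show ?thesis ..
  next
    case 2
    have "integrable lborel (\<lambda>x. normal_density m s x * (x - m) ^ 2 + 2 * m * (normal_density m s x * (x - m) ^ 1) + m\<^sup>2 * (normal_density m s x * (x - m) ^ 0))"
      using integrable_normal_moment[OF 2(1), of m] by (intro Bochner_Integration.integrable_add integrable_mult_right)
    then have "integrable lborel (\<lambda>x. normal_density m s x * x\<^sup>2)"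
      by (rule back_subst[of "integrable lborel"]) (auto simp: power2_eq_square algebra_simps)
    then show ?thesis
      using distributed_integrable[OF 2(2), of "\<lambda>x. x"] distributed_integrable[OF 2(2), of "\<lambda>x. x\<^sup>2"]
        integrable_normal_moment_nz_1[OF 2(1)] by simp
  qed
  then show "integrable M Z" "integrable M (\<lambda>\<omega>. (Z \<omega>)\<^sup>2)" by auto
qed

lemma fbm_gaussian_rv:
  assumes "fractional_brownian_motion H M B" "0 \<le> t"
  shows "gaussian_rv M (B t)"
proof -
  have "gaussian_process M B" using assms by (simp add: fractional_brownian_motion_def)
  then have "gaussian_rv M (\<lambda>\<omega>. \<Sum>u\<in>{t}. 1 * B u \<omega>)"
    unfolding gaussian_process_def by (elim allE[of _ "{t}"] allE[of _ "\<lambda>_. 1"]) (use assms in auto)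
  then show ?thesis by simp
qed

text \<open>An increment is a linear combination of two values, hence Gaussian. The covariance gives
  it the variance \<open>(t - s) powr (2 * H)\<close>, which is positive and so excludes the
  constant case.\<close>

lemma fbm_increment_distributed:
  assumes B: "fractional_brownian_motion H M B" and st: "0 \<le> s" "s < t"
  shows "distributed M lborel (\<lambda>\<omega>. (B t \<omega> - B s \<omega>) / (t - s) powr H) std_normal_density"
proof -
  define Z where "Z \<omega> = B t \<omega> - B s \<omega>" for \<omega>
  have i: "integrable M (B t)" "integrable M (B s)" "integrable M (\<lambda>\<omega>. (B t \<omega>)\<^sup>2)" "integrable M (\<lambda>\<omega>. (B s \<omega>)\<^sup>2)"
    using gaussian_rv_integrable[OF fbm_gaussian_rv[OF B]] st by auto
  then have [measurable]: "B t \<in> borel_measurable M" "B s \<in> borel_measurable M" by auto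
  have ist: "integrable M (\<lambda>\<omega>. B s \<omega> * B t \<omega>)"
  proof (rule Bochner_Integration.integrable_bound)
    show "integrable M (\<lambda>\<omega>. (B t \<omega>)\<^sup>2 + (B s \<omega>)\<^sup>2)" using i by simp
    have "\<bar>x * y\<bar> \<le> y\<^sup>2 + x\<^sup>2" for x y :: real
      using sum_squares_bound[of "\<bar>x\<bar>" "\<bar>y\<bar>"] zero_le_power2[of x] zero_le_power2[of y]
        mult_nonneg_nonneg[of "\<bar>x\<bar>" "\<bar>y\<bar>"] unfolding abs_mult power2_abs by linarith
    then show "AE \<omega> in M. norm (B s \<omega> * B t \<omega>) \<le> norm ((B t \<omega>)\<^sup>2 + (B s \<omega>)\<^sup>2)" by simp
  qed simp
  have "gaussian_process M B" using B by (simp add: fractional_brownian_motion_def)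
  then have "gaussian_rv M (\<lambda>\<omega>. \<Sum>u\<in>{s, t}. (if u = t then 1 else - 1) * B u \<omega>)"
    unfolding gaussian_process_def by (elim allE[of _ "{s, t}"] allE[of _ "\<lambda>u. if u = t then 1 else - 1"]) (use st in auto)
  then have g: "gaussian_rv M Z" unfolding Z_def[abs_def] using st by simp
  have E0: "expectation Z = 0" unfolding Z_def[abs_def] using i B st by (simp add: fractional_brownian_motion_def)
  have E1: "expectation (\<lambda>\<omega>. (Z \<omega>)\<^sup>2) = (t - s) powr (2 * H)"
  proof -
    have cov: "expectation (\<lambda>\<omega>. B u \<omega> * B v \<omega>) = (u powr (2 * H) + v powr (2 * H) - \<bar>v - u\<bar> powr (2 * H)) / 2"
      if "0 \<le> u" "0 \<le> v" for u v
      using B that by (simp add: fractional_brownian_motion_def)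
    have "(Z \<omega>)\<^sup>2 = (B t \<omega>)\<^sup>2 - 2 * (B s \<omega> * B t \<omega>) + (B s \<omega>)\<^sup>2" for \<omega>
      by (simp add: Z_def power2_eq_square algebra_simps)
    then have "expectation (\<lambda>\<omega>. (Z \<omega>)\<^sup>2) = expectation (\<lambda>\<omega>. (B t \<omega>)\<^sup>2) - 2 * expectation (\<lambda>\<omega>. B s \<omega> * B t \<omega>) + expectation (\<lambda>\<omega>. (B s \<omega>)\<^sup>2)"
      using i ist by simp
    also have "\<dots> = (t - s) powr (2 * H)"
      unfolding power2_eq_square using cov[of t t] cov[of s t] cov[of s s] st by simp
    finally show ?thesis .
  qed
  have pos: "0 < (t - s) powr (2 * H)" using st by simp
  consider c where "AE \<omega> in M. Z \<omega> = c"
    | m \<sigma> where "0 < \<sigma>" "distributed M lborel Z (\<lambda>x. ennreal (normal_density m \<sigma> x))"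
    using g by (auto simp: gaussian_rv_def)
  then show ?thesis
  proof cases
    case 1
    have [measurable]: "Z \<in> borel_measurable M" using g by (simp add: gaussian_rv_def)
    have "expectation Z = expectation (\<lambda>_. c)" by (rule integral_cong_AE) (use 1 in auto)
    then have "c = 0" using E0 prob_space by simp
    have "expectation (\<lambda>\<omega>. (Z \<omega>)\<^sup>2) = expectation (\<lambda>_. 0)" by (rule integral_cong_AE) (use 1 \<open>c = 0\<close> in auto)
    then show ?thesis using E1 pos by simp
  next
    case 2
    have "m = 0" using normal_distributed_expectation[OF 2] E0 by simp
    have "\<sigma>\<^sup>2 = (t - s) powr (2 * H)"
      using normal_distributed_variance[OF 2] E0 E1 by simp
    also have "\<dots> = ((t - s) powr H)\<^sup>2" by (simp add: power2_eq_square powr_add[symmetric])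
    finally have "\<sigma> = (t - s) powr H" using 2(1) by (simp add: power2_eq_iff_nonneg)
    then show ?thesis
      using 2(2) normal_standard_normal_convert[OF 2(1), of Z m] \<open>m = 0\<close> by (simp add: Z_def[abs_def])
  qed
qed

lemma path_of_measurable:
  assumes "\<And>t. 0 \<le> t \<Longrightarrow> Z t \<in> borel_measurable M"
  shows "path_of Z \<in> measurable M path_space"
  unfolding path_of_def by (rule measurable_restrict) (use assms in auto)

text \<open>The scaled increment is \<open>r\<close> times a standard normal variable in absolute
  value. For \<open>r \<le> 1\<close> the exponential is dominated by that of the normal variable,
  while the factor \<open>r ^ (2 * p)\<close> is kept for summation over the dyadic levels.\<close>

lemma fbm_increment_moment:
  assumes B: "fractional_brownian_motion H M B" and st: "0 \<le> s" "s < t" and r: "0 \<le> r" "r \<le> 1" and a: "a * (t - s) powr H = r"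
  shows "(\<integral>\<^sup>+\<omega>. ennreal ((a * \<bar>B t \<omega> - B s \<omega>\<bar>) ^ (2 * p) * exp ((a * \<bar>B t \<omega> - B s \<omega>\<bar>)\<^sup>2 / 8)) \<partial>M)
    \<le> ennreal (r ^ (2 * p) * (\<integral>x. std_normal_density x * (x ^ (2 * p) * exp (x\<^sup>2 / 8)) \<partial>lborel))"
proof -
  define Z where "Z \<omega> = (B t \<omega> - B s \<omega>) / (t - s) powr H" for \<omega>
  have dZ: "distributed M lborel Z std_normal_density"
    unfolding Z_def[abs_def] by (rule fbm_increment_distributed[OF B st])
  have "a * \<bar>B t \<omega> - B s \<omega>\<bar> = r * \<bar>Z \<omega>\<bar>" for \<omega>
    unfolding Z_def a[symmetric] using st by (simp add: abs_divide)
  then have le: "(a * \<bar>B t \<omega> - B s \<omega>\<bar>) ^ (2 * p) * exp ((a * \<bar>B t \<omega> - B s \<omega>\<bar>)\<^sup>2 / 8) \<le> r ^ (2 * p) * ((Z \<omega>) ^ (2 * p) * exp ((Z \<omega>)\<^sup>2 / 8))" for \<omega>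
  proof -
    have "r\<^sup>2 * (Z \<omega>)\<^sup>2 \<le> (Z \<omega>)\<^sup>2" using r by (intro mult_left_le_one_le) (auto simp: power_le_one)
    then have "exp ((r * \<bar>Z \<omega>\<bar>)\<^sup>2 / 8) \<le> exp ((Z \<omega>)\<^sup>2 / 8)" by (simp add: power_mult_distrib)
    then show ?thesis unfolding \<open>a * \<bar>B t \<omega> - B s \<omega>\<bar> = r * \<bar>Z \<omega>\<bar>\<close>
      using r by (simp add: power_mult_distrib power_mult mult.assoc mult_left_mono)
  qed
  have "(\<integral>\<^sup>+\<omega>. ennreal ((a * \<bar>B t \<omega> - B s \<omega>\<bar>) ^ (2 * p) * exp ((a * \<bar>B t \<omega> - B s \<omega>\<bar>)\<^sup>2 / 8)) \<partial>M)
      \<le> (\<integral>\<^sup>+\<omega>. ennreal (r ^ (2 * p)) * ennreal ((Z \<omega>) ^ (2 * p) * exp ((Z \<omega>)\<^sup>2 / 8)) \<partial>M)"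
    using le r by (intro nn_integral_mono) (simp add: ennreal_mult[symmetric] ennreal_leI)
  also have "\<dots> = (\<integral>\<^sup>+x. ennreal (std_normal_density x) * (ennreal (r ^ (2 * p)) * ennreal (x ^ (2 * p) * exp (x\<^sup>2 / 8))) \<partial>lborel)"
    by (rule distributed_nn_integral[OF dZ, symmetric]) simp
  also have "\<dots> = (\<integral>\<^sup>+x. ennreal (r ^ (2 * p) * (std_normal_density x * (x ^ (2 * p) * exp (x\<^sup>2 / 8)))) \<partial>lborel)"
    using r by (intro nn_integral_cong) (simp add: ennreal_mult zero_le_even_power mult_ac)
  also have "\<dots> = ennreal (\<integral>x. r ^ (2 * p) * (std_normal_density x * (x ^ (2 * p) * exp (x\<^sup>2 / 8))) \<partial>lborel)"
    by (intro nn_integral_eq_integral integrable_mult_right integrable_std_normal_exp_moment) (use r in auto)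
  finally show ?thesis by simp
qed

text \<open>An elementary Fernique-type bound: the root on the right is a constant \<open>K\<close>
  for which \<open>exp (K\<^sup>2 / 8)\<close> is integrable, as it equals
  \<open>exp (1 / 8) + U\<close>. That \<open>U\<close> is a functional of the path makes it
  independent of \<open>X 0\<close> later.\<close>

lemma fbm_dyadic_increments:
  fixes T :: nat
  assumes B: "fractional_brownian_motion H M B" and \<gamma>: "\<gamma> < H"
  shows "\<exists>U\<in>borel_measurable path_space. (\<forall>w. 0 \<le> U w) \<and> integrable M (\<lambda>\<omega>. U (path_of B \<omega>)) \<and>
    (AE \<omega> in M. \<forall>n k. k < T * 2 ^ n \<longrightarrow>
      \<bar>B (real (Suc k) / 2 ^ n) \<omega> - B (real k / 2 ^ n) \<omega>\<bar> \<le> sqrt (8 * ln (exp (1 / 8) + U (path_of B \<omega>))) * (2 powr - \<gamma>) ^ n)"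
proof -
  define \<rho> where "\<rho> = 2 powr (\<gamma> - H)"
  have \<rho>: "0 < \<rho>" "\<rho> < 1" using \<gamma> powr_less_cancel_iff[of 2 "\<gamma> - H" 0] by (simp_all add: \<rho>_def)
  \<comment> \<open>Level \<open>n\<close> has \<open>T * 2 ^ n\<close> increments, each of expected
    weight at most \<open>(\<rho> ^ n) ^ (2 * p) * c\<close>; this \<open>p\<close> makes the sum
    over the levels converge.\<close>
  obtain p where p: "(\<rho>\<^sup>2) ^ p < 1 / 2"
    using real_arch_pow_inv[of "1 / 2" "\<rho>\<^sup>2"] \<rho> by (auto simp: power_less_one_iff)
  define c where "c = (\<integral>x. std_normal_density x * (x ^ (2 * p) * exp (x\<^sup>2 / 8)) \<partial>lborel)"
  have c: "0 \<le> c" unfolding c_def by (rule integral_nonneg_AE) (auto intro!: AE_I2 mult_nonneg_nonneg)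
  define h where "h y = y ^ (2 * p) * exp (y\<^sup>2 / 8)" for y :: real
  have h0: "0 \<le> h y" for y unfolding h_def by simp
  define a where "a n k w = (2 powr \<gamma>) ^ n * \<bar>w (real (Suc k) / 2 ^ n) - w (real k / 2 ^ n)\<bar>" for n k and w :: "real \<Rightarrow> real"
  define V where "V w = (\<Sum>n. \<Sum>k<T * 2 ^ n. ennreal (h (a n k w)))" for w
  \<comment> \<open>\<open>enn2real\<close> sends an infinite \<open>V\<close> to 0; since
    \<open>V\<close> has finite expectation along \<open>B\<close>, this happens on a null set
    only.\<close>
  define U where "U w = enn2real (V w)" for w
  have [measurable]: "(\<lambda>w. w t) \<in> borel_measurable path_space" if "0 \<le> t" for t
    using that by (intro measurable_component_singleton) auto
  have [measurable]: "a n k \<in> borel_measurable path_space" for n k unfolding a_def by measurable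
  have Vm [measurable]: "V \<in> borel_measurable path_space" unfolding V_def h_def by measurable
  have Um [measurable]: "U \<in> borel_measurable path_space" unfolding U_def by measurable
  have Bm [measurable]: "path_of B \<in> measurable M path_space"
    by (rule path_of_measurable) (use fbm_gaussian_rv[OF B] in \<open>auto simp: gaussian_rv_def\<close>)
  have a_path: "a n k (path_of B \<omega>) = (2 powr \<gamma>) ^ n * \<bar>B (real (Suc k) / 2 ^ n) \<omega> - B (real k / 2 ^ n) \<omega>\<bar>" for n k \<omega>
    by (simp add: a_def path_of_def)
  have Eh: "(\<integral>\<^sup>+\<omega>. ennreal (h (a n k (path_of B \<omega>))) \<partial>M) \<le> ennreal ((\<rho> ^ n) ^ (2 * p) * c)" for n k
    unfolding h_def a_path c_def
  proof (rule fbm_increment_moment[OF B])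
    have "(1 / 2 ^ n) powr H = (2 powr - H) ^ n"
      by (simp add: powr_realpow[symmetric] powr_powr powr_divide powr_minus field_simps)
    moreover have "real (Suc k) / 2 ^ n - real k / 2 ^ n = 1 / 2 ^ n" by (simp add: diff_divide_distrib[symmetric])
    ultimately show "(2 powr \<gamma>) ^ n * (real (Suc k) / 2 ^ n - real k / 2 ^ n) powr H = \<rho> ^ n"
      by (simp add: \<rho>_def power_mult_distrib[symmetric] powr_add[symmetric])
  qed (use \<rho> in \<open>auto simp: divide_strict_right_mono power_le_one\<close>)
  have EV: "(\<integral>\<^sup>+\<omega>. V (path_of B \<omega>) \<partial>M) < \<infinity>"
  proof -
    define q where "q = 2 * (\<rho>\<^sup>2) ^ p"
    have q: "0 \<le> q" "q < 1" using p \<rho> by (auto simp: q_def)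
    have "(\<integral>\<^sup>+\<omega>. V (path_of B \<omega>) \<partial>M) = (\<Sum>n. \<Sum>k<T * 2 ^ n. \<integral>\<^sup>+\<omega>. ennreal (h (a n k (path_of B \<omega>))) \<partial>M)"
      unfolding V_def h_def by (subst nn_integral_suminf, measurable) (subst nn_integral_sum, measurable)
    also have "\<dots> \<le> (\<Sum>n. ennreal (real T * c * q ^ n))"
    proof (rule suminf_le)
      fix n
      have "(\<Sum>k<T * 2 ^ n. \<integral>\<^sup>+\<omega>. ennreal (h (a n k (path_of B \<omega>))) \<partial>M) \<le> (\<Sum>k<T * 2 ^ n. ennreal ((\<rho> ^ n) ^ (2 * p) * c))"
        by (rule sum_mono) (rule Eh)
      also have "\<dots> = ennreal (real (T * 2 ^ n) * ((\<rho> ^ n) ^ (2 * p) * c))"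
        using \<rho> c by (simp add: ennreal_of_nat_eq_real_of_nat ennreal_mult[symmetric])
      also have "real (T * 2 ^ n) * ((\<rho> ^ n) ^ (2 * p) * c) = real T * c * q ^ n"
        by (simp add: q_def power_mult_distrib power_mult[symmetric] mult_ac)
      finally show "(\<Sum>k<T * 2 ^ n. \<integral>\<^sup>+\<omega>. ennreal (h (a n k (path_of B \<omega>))) \<partial>M) \<le> ennreal (real T * c * q ^ n)" .
    qed auto
    also have "\<dots> < \<infinity>"
    proof -
      have "summable (\<lambda>n. real T * c * q ^ n)" using q by (intro summable_mult summable_geometric) auto
      then show ?thesis using q c by (subst suminf_ennreal2) auto
    qed
    finally show ?thesis .
  qed
  have Vfin: "AE \<omega> in M. V (path_of B \<omega>) \<noteq> \<infinity>"
    by (rule nn_integral_PInf_AE) (use EV in auto)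
  have iU: "integrable M (\<lambda>\<omega>. U (path_of B \<omega>))"
  proof (rule integrableI_nonneg)
    show "(\<integral>\<^sup>+\<omega>. ennreal (U (path_of B \<omega>)) \<partial>M) < \<infinity>"
      using order.strict_trans1[OF nn_integral_mono EV, of "\<lambda>\<omega>. ennreal (U (path_of B \<omega>))"]
      by (simp add: U_def ennreal_enn2real_if)
  qed (auto simp: U_def)
  have "AE \<omega> in M. \<forall>n k. k < T * 2 ^ n \<longrightarrow>
      \<bar>B (real (Suc k) / 2 ^ n) \<omega> - B (real k / 2 ^ n) \<omega>\<bar> \<le> sqrt (8 * ln (exp (1 / 8) + U (path_of B \<omega>))) * (2 powr - \<gamma>) ^ n"
    using Vfin
  proof eventually_elim
    case (elim \<omega>)
    let ?w = "path_of B \<omega>"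
    show ?case
    proof (intro allI impI)
      fix n k assume k: "k < T * 2 ^ n"
      have "ennreal (h (a n k ?w)) \<le> (\<Sum>k<T * 2 ^ n. ennreal (h (a n k ?w)))"
        by (rule member_le_sum) (use k in auto)
      also have "\<dots> \<le> V ?w" unfolding V_def
        using sum_le_suminf[of "\<lambda>n. \<Sum>k<T * 2 ^ n. ennreal (h (a n k ?w))" "{n}"] by simp
      also have "\<dots> = ennreal (U ?w)" unfolding U_def using elim by (simp add: top.not_eq_extremum)
      finally have hU: "h (a n k ?w) \<le> U ?w" by (simp add: U_def)
      define y where "y = a n k ?w"
      have y: "0 \<le> y" by (simp add: y_def a_def)
      \<comment> \<open>The power of \<open>y\<close> in \<open>h\<close> is below 1 only for
        \<open>y < 1\<close>, and there \<open>exp (1 / 8)\<close> takes over.\<close>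
      have "exp (y\<^sup>2 / 8) \<le> exp (1 / 8) + h y"
      proof (cases "y \<le> 1")
        case True
        then have "exp (y\<^sup>2 / 8) \<le> exp (1 / 8)" using y by (simp add: power_le_one)
        then show ?thesis using h0[of y] by linarith
      next
        case False
        then have "1 * exp (y\<^sup>2 / 8) \<le> h y" unfolding h_def by (intro mult_right_mono) auto
        then show ?thesis using exp_gt_zero[of "1/8 :: real"] by linarith
      qed
      also have "\<dots> \<le> exp (1 / 8) + U ?w" using hU by (simp add: y_def)
      finally have "y\<^sup>2 / 8 \<le> ln (exp (1 / 8) + U ?w)"
        using ln_ge_iff[of "exp (1 / 8) + U ?w" "y\<^sup>2 / 8"] exp_gt_zero[of "1/8 :: real"] by (simp add: U_def add_pos_nonneg)
      then have "y \<le> sqrt (8 * ln (exp (1 / 8) + U ?w))" by (intro real_le_rsqrt) simp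
      then have "y * (2 powr - \<gamma>) ^ n \<le> sqrt (8 * ln (exp (1 / 8) + U ?w)) * (2 powr - \<gamma>) ^ n"
        by (rule mult_right_mono) simp
      moreover have "y * (2 powr - \<gamma>) ^ n = ((2 powr \<gamma>) ^ n * (2 powr - \<gamma>) ^ n) * \<bar>B (real (Suc k) / 2 ^ n) \<omega> - B (real k / 2 ^ n) \<omega>\<bar>"
        unfolding y_def a_path by simp
      moreover have "(2 powr \<gamma>) ^ n * (2 powr - \<gamma>) ^ n = 1"
        by (simp add: power_mult_distrib[symmetric] powr_add[symmetric])
      ultimately show "\<bar>B (real (Suc k) / 2 ^ n) \<omega> - B (real k / 2 ^ n) \<omega>\<bar> \<le> sqrt (8 * ln (exp (1 / 8) + U ?w)) * (2 powr - \<gamma>) ^ n"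
        by simp
    qed
  qed
  then show ?thesis using iU by (intro bexI[of _ U]) (auto simp: U_def)
qed

end

section \<open>From pathwise growth to a square integrable supremum\<close>

lemma bounded_holder_derivative_linear_growth:
  assumes "bounded_holder_derivative \<alpha> f"
  obtains L where "0 < L" "\<And>u v. \<bar>f u - f v\<bar> \<le> L * \<bar>u - v\<bar>" "\<And>u. \<bar>f u\<bar> \<le> L * (1 + \<bar>u\<bar>)"
proof -
  obtain D where D: "\<And>x. \<bar>deriv f x\<bar> \<le> D"
    using assms unfolding bounded_holder_derivative_def bounded_iff by auto
  have lip: "\<bar>f u - f v\<bar> \<le> D * \<bar>u - v\<bar>" for u v
  proof -
    have "(f has_field_derivative deriv f x) (at x within UNIV)" for x
      using assms unfolding bounded_holder_derivative_def differentiable_on_def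
      by (auto simp: field_differentiable_derivI real_differentiableE field_differentiable_def
          intro!: DERIV_deriv_iff_real_differentiable[THEN iffD2])
    then have "norm (f u - f v) \<le> D * norm (u - v)"
      using D by (intro field_differentiable_bound[of UNIV f "deriv f"]) auto
    then show ?thesis by simp
  qed
  define L where "L = 1 + \<bar>D\<bar> + \<bar>f 0\<bar>"
  show ?thesis
  proof (rule that)
    show "0 < L" by (simp add: L_def)
    show "\<bar>f u - f v\<bar> \<le> L * \<bar>u - v\<bar>" for u v
      by (rule order_trans[OF lip]) (intro mult_right_mono, auto simp: L_def)
    show "\<bar>f u\<bar> \<le> L * (1 + \<bar>u\<bar>)" for u
    proof -
      have "\<bar>f u\<bar> \<le> \<bar>f 0\<bar> + D * \<bar>u\<bar>" using lip[of u 0] by simp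
      also have "\<dots> \<le> L * 1 + L * \<bar>u\<bar>" by (intro add_mono mult_right_mono) (auto simp: L_def)
      finally show ?thesis by (simp add: algebra_simps)
    qed
  qed
qed

lemma holder_on_continuous:
  assumes "holder_on \<theta> S f"
  shows "continuous_on S f"
  unfolding continuous_on_def
proof
  fix x assume x: "x \<in> S"
  obtain C where C: "\<And>y. y \<in> S \<Longrightarrow> \<bar>f y - f x\<bar> \<le> C * \<bar>y - x\<bar> powr \<theta>" and \<theta>: "0 < \<theta>"
    using assms x unfolding holder_on_def by blast
  have "((\<lambda>y. f y - f x) \<longlongrightarrow> 0) (at x within S)"
  proof (rule Lim_null_comparison)
    show "\<forall>\<^sub>F y in at x within S. norm (f y - f x) \<le> C * \<bar>y - x\<bar> powr \<theta>"
      using C by (auto simp: eventually_at_filter)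
    have "((\<lambda>y. \<bar>y - x\<bar>) \<longlongrightarrow> \<bar>x - x\<bar>) (at x within S)" by (intro tendsto_intros)
    then show "((\<lambda>y. C * \<bar>y - x\<bar> powr \<theta>) \<longlongrightarrow> 0) (at x within S)"
      using \<theta> by (intro tendsto_mult_right_zero tendsto_zero_powrI[of _ _ _ \<theta>]) auto
  qed
  then show "(f \<longlongrightarrow> f x) (at x within S)" by (simp add: LIM_zero_iff)
qed

text \<open>Beyond the point \<open>y\<^sub>0\<close> with
  \<open>y\<^sub>0 powr (\<delta> - 2) = e\<close> the power is at most
  \<open>e * y\<^sup>2\<close>; up to that point it is at most its value there.\<close>

lemma powr_le_const_plus_square:
  fixes \<delta> e :: real
  assumes "0 \<le> \<delta>" "\<delta> < 2" "0 < e"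
  shows "\<exists>C\<ge>0. \<forall>y\<ge>0. y powr \<delta> \<le> C + e * y\<^sup>2"
proof -
  define y\<^sub>0 where "y\<^sub>0 = e powr (- 1 / (2 - \<delta>))"
  have y\<^sub>0: "0 < y\<^sub>0" "y\<^sub>0 powr (\<delta> - 2) = e"
  proof -
    have "(\<delta> - 2) / (2 - \<delta>) = - 1" using assms by (simp add: divide_simps)
    then show "y\<^sub>0 powr (\<delta> - 2) = e" using assms by (simp add: y\<^sub>0_def powr_powr)
  qed (use assms in \<open>simp add: y\<^sub>0_def\<close>)
  have "y powr \<delta> \<le> y\<^sub>0 powr \<delta> + e * y\<^sup>2" if "0 \<le> y" for y
  proof (cases "y \<le> y\<^sub>0")
    case True
    then have "y powr \<delta> \<le> y\<^sub>0 powr \<delta>" using assms that by (intro powr_mono2) auto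
    then show ?thesis using assms by (simp add: add_increasing2)
  next
    case False
    then have "0 < y" using y\<^sub>0 by simp
    have "y powr (\<delta> - 2) \<le> e"
      using powr_mono2'[of "\<delta> - 2" y\<^sub>0 y] False y\<^sub>0 assms by simp
    then have "y\<^sup>2 * y powr (\<delta> - 2) \<le> y\<^sup>2 * e" by (rule mult_left_mono) simp
    moreover have "y\<^sup>2 * y powr (\<delta> - 2) = y powr \<delta>"
      using \<open>0 < y\<close> by (simp add: powr_realpow[symmetric, of y 2] powr_add[symmetric] del: powr_realpow powr_numeral)
    ultimately show ?thesis by (simp add: mult.commute add_increasing)
  qed
  then show ?thesis by (intro exI[of _ "y\<^sub>0 powr \<delta>"]) auto
qed

text \<open>The exponent grows like \<open>y powr \<delta>\<close> with \<open>\<delta> < 2\<close>,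
  so a constant plus a small multiple of \<open>y\<^sup>2\<close> dominates it. The base 4 is the
  square of the factor 2 gained per step.\<close>

lemma powr_powr_le_exp_square:
  fixes T a c \<delta> :: real
  assumes "0 \<le> T" "0 \<le> a" "0 \<le> c" "0 \<le> \<delta>" "\<delta> < 2"
  shows "\<exists>D>0. \<forall>y\<ge>0. 4 powr (T * (1 + (a * (c * y + 1)) powr \<delta>) + 2) \<le> D * exp (y\<^sup>2 / 8)"
proof -
  define l where "l = ln 4 * T * (2 * a\<^sup>2 * c\<^sup>2)"
  have l: "0 \<le> l" using assms by (simp add: l_def)
  \<comment> \<open>Tuned so that the coefficient \<open>l * e\<close> of \<open>y\<^sup>2\<close>
    is at most \<open>1 / 8\<close>.\<close>
  define e where "e = 1 / (8 * (1 + l))"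
  have e: "0 < e" using l by (simp add: e_def)
  have le: "l * e \<le> 1 / 8" using l by (simp add: e_def divide_simps)
  obtain C where C: "0 \<le> C" "\<And>y. 0 \<le> y \<Longrightarrow> y powr \<delta> \<le> C + e * y\<^sup>2"
    using powr_le_const_plus_square[OF assms(4,5) e] by blast
  define E where "E = ln 4 * (T * (1 + (C + e * (2 * a\<^sup>2))) + 2)"
  have "4 powr (T * (1 + (a * (c * y + 1)) powr \<delta>) + 2) \<le> exp E * exp (y\<^sup>2 / 8)" if y: "0 \<le> y" for y
  proof -
    have "(a * (c * y + 1)) powr \<delta> \<le> C + e * (a * (c * y + 1))\<^sup>2"
      using assms y by (intro C(2)) simp
    also have "(a * (c * y + 1))\<^sup>2 \<le> 2 * a\<^sup>2 * c\<^sup>2 * y\<^sup>2 + 2 * a\<^sup>2"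
    proof -
      have "(c * y + 1)\<^sup>2 \<le> 2 * (c * y)\<^sup>2 + 2" using sum_squares_bound[of "c * y" 1] by (simp add: power2_sum)
      from mult_left_mono[OF this, of "a\<^sup>2"] show ?thesis
        by (simp only: power_mult_distrib) (simp add: algebra_simps)
    qed
    finally have "(a * (c * y + 1)) powr \<delta> \<le> C + e * (2 * a\<^sup>2 * c\<^sup>2 * y\<^sup>2 + 2 * a\<^sup>2)"
      using e by simp
    then have "T * (1 + (a * (c * y + 1)) powr \<delta>) + 2 \<le> T * (1 + (C + e * (2 * a\<^sup>2 * c\<^sup>2 * y\<^sup>2 + 2 * a\<^sup>2))) + 2"
      using assms by (intro add_right_mono mult_left_mono add_left_mono)
    then have "ln 4 * (T * (1 + (a * (c * y + 1)) powr \<delta>) + 2) \<le> ln 4 * (T * (1 + (C + e * (2 * a\<^sup>2 * c\<^sup>2 * y\<^sup>2 + 2 * a\<^sup>2))) + 2)"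
      by (rule mult_left_mono) simp
    also have "\<dots> = E + (l * e) * y\<^sup>2" by (simp add: E_def l_def algebra_simps)
    also have "\<dots> \<le> E + y\<^sup>2 / 8" using mult_right_mono[OF le, of "y\<^sup>2"] by simp
    finally show ?thesis by (simp add: powr_def exp_add[symmetric] mult.commute)
  qed
  then show ?thesis by (intro exI[of _ "exp E"]) auto
qed

context prob_space
begin

text \<open>Two regularities of the noise are used: \<open>\<gamma> 0\<close>, halfway between 1/2
  and \<open>H\<close>, for the moment estimate, and some \<open>\<gamma> j\<close> close to
  \<open>H\<close> for upgrading the solution, whose given exponent depends on the path. The
  sequence \<open>\<gamma>\<close> increases to \<open>H\<close>, so countably many null sets cover
  all paths.\<close>

lemma sde_sup_second_moment:
  fixes T :: real
  assumes H: "1 / 2 < H" "H < 1" and B: "fractional_brownian_motion H M B" and X: "sde_solution H \<sigma> b M B X"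
    and \<sigma>: "bounded_holder_derivative \<alpha> \<sigma>" and b: "bounded_holder_derivative \<alpha>' b"
    and X0: "integrable M (\<lambda>\<omega>. (X 0 \<omega>)\<^sup>2)" and T: "0 < T"
  shows "\<exists>S\<in>borel_measurable M. integrable M (\<lambda>\<omega>. (S \<omega>)\<^sup>2) \<and> (AE \<omega> in M. \<forall>t\<in>{0..T}. \<bar>X t \<omega>\<bar> \<le> S \<omega>)"
proof -
  obtain L1 where L1: "0 < L1" "\<And>u v. \<bar>\<sigma> u - \<sigma> v\<bar> \<le> L1 * \<bar>u - v\<bar>" "\<And>u. \<bar>\<sigma> u\<bar> \<le> L1 * (1 + \<bar>u\<bar>)"
    using bounded_holder_derivative_linear_growth[OF \<sigma>] by blast
  obtain L2 where L2: "0 < L2" "\<And>u v. \<bar>b u - b v\<bar> \<le> L2 * \<bar>u - v\<bar>" "\<And>u. \<bar>b u\<bar> \<le> L2 * (1 + \<bar>u\<bar>)"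
    using bounded_holder_derivative_linear_growth[OF b] by blast
  define L where "L = max L1 L2"
  have L: "0 < L" "\<And>u v. \<bar>\<sigma> u - \<sigma> v\<bar> \<le> L * \<bar>u - v\<bar>" "\<And>u. \<bar>\<sigma> u\<bar> \<le> L * (1 + \<bar>u\<bar>)" "\<And>u. \<bar>b u\<bar> \<le> L * (1 + \<bar>u\<bar>)"
    using L1(1) by (auto simp: L_def intro!: order_trans[OF L1(2)] order_trans[OF L1(3)] order_trans[OF L2(3)] mult_right_mono)
  have b_cont: "continuous_on UNIV b"
    using b by (simp add: bounded_holder_derivative_def differentiable_imp_continuous_on)
  define N where "N = nat \<lceil>T\<rceil>"
  have N: "T \<le> real N" using T by (simp add: N_def)
  define \<gamma> where "\<gamma> j = H - (H - 1 / 2) / 2 / real (Suc j)" for j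
  have \<gamma>: "1 / 2 < \<gamma> j" "\<gamma> j < H" "\<gamma> 0 \<le> \<gamma> j" for j
  proof -
    have "(H - 1 / 2) / 2 / real (Suc j) \<le> (H - 1 / 2) / 2 / 1" using H by (intro divide_left_mono) auto
    moreover have "0 < (H - 1 / 2) / 2 / real (Suc j)" using H by simp
    ultimately show "1 / 2 < \<gamma> j" "\<gamma> j < H" "\<gamma> 0 \<le> \<gamma> j" using H by (auto simp: \<gamma>_def)
  qed
  have \<gamma>_lim: "\<gamma> \<longlonglongrightarrow> H"
  proof -
    have "(\<lambda>j. H - (H - 1 / 2) / 2 / real (Suc j)) \<longlonglongrightarrow> H - 0"
      by (intro tendsto_diff tendsto_const lim_const_over_n[THEN LIMSEQ_Suc])
    then show ?thesis by (simp add: \<gamma>_def[abs_def])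
  qed
  have "\<forall>j. \<exists>U. U \<in> borel_measurable path_space \<and> (\<forall>w. 0 \<le> U w) \<and> integrable M (\<lambda>\<omega>. U (path_of B \<omega>)) \<and>
    (AE \<omega> in M. \<forall>n k. k < N * 2 ^ n \<longrightarrow>
      \<bar>B (real (Suc k) / 2 ^ n) \<omega> - B (real k / 2 ^ n) \<omega>\<bar> \<le> sqrt (8 * ln (exp (1 / 8) + U (path_of B \<omega>))) * (2 powr - \<gamma> j) ^ n)"
    using fbm_dyadic_increments[OF B \<gamma>(2)] unfolding Bex_def by (intro allI)
  from choice[OF this] obtain U where U0: "\<forall>j. U j \<in> borel_measurable path_space \<and> (\<forall>w. 0 \<le> U j w) \<and> integrable M (\<lambda>\<omega>. U j (path_of B \<omega>)) \<and>
    (AE \<omega> in M. \<forall>n k. k < N * 2 ^ n \<longrightarrow>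
      \<bar>B (real (Suc k) / 2 ^ n) \<omega> - B (real k / 2 ^ n) \<omega>\<bar> \<le> sqrt (8 * ln (exp (1 / 8) + U j (path_of B \<omega>))) * (2 powr - \<gamma> j) ^ n)"
    ..
  have U: "\<And>j. U j \<in> borel_measurable path_space" "\<And>j w. 0 \<le> U j w"
    "\<And>j. integrable M (\<lambda>\<omega>. U j (path_of B \<omega>))"
    "\<And>j. AE \<omega> in M. \<forall>n k. k < N * 2 ^ n \<longrightarrow>
      \<bar>B (real (Suc k) / 2 ^ n) \<omega> - B (real k / 2 ^ n) \<omega>\<bar> \<le> sqrt (8 * ln (exp (1 / 8) + U j (path_of B \<omega>))) * (2 powr - \<gamma> j) ^ n"
    using U0[THEN spec] by simp_all
  define K where "K j w = sqrt (8 * ln (exp (1 / 8) + U j w))" for j w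
  have K: "0 \<le> K j w" for j w unfolding K_def
    using U(2)[of j w] one_le_exp_iff[of "1/8 :: real"] by (intro real_sqrt_ge_zero mult_nonneg_nonneg ln_ge_zero) linarith+
  have exp_K: "exp ((K j w)\<^sup>2 / 8) = exp (1 / 8) + U j w" for j w
  proof -
    have "1 \<le> exp (1 / 8) + U j w" using U(2)[of j w] one_le_exp_iff[of "1/8 :: real"] by linarith
    then show ?thesis by (simp add: K_def)
  qed
  define c where "c j = 2 powr \<gamma> j * (1 + 2 / (1 - 2 powr - \<gamma> j))" for j
  have c: "0 \<le> c j" for j
  proof -
    have "2 powr - \<gamma> j < 2 powr 0" using \<gamma>(1)[of j] by (intro powr_less_mono) auto
    then show ?thesis by (simp add: c_def)
  qed
  define Cy where "Cy = 1 / (1 - 2 powr (1 - 2 * \<gamma> 0))"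
  have Cy: "0 \<le> Cy"
  proof -
    have "2 powr (1 - 2 * \<gamma> 0) < 2 powr 0" using \<gamma>(1)[of 0] by (intro powr_less_mono) auto
    then show ?thesis by (simp add: Cy_def)
  qed
  \<comment> \<open>With \<open>G = c 0 * K\<close> the step condition reads
    \<open>a * (G + 1) * (T / n) powr \<gamma> 0 \<le> 1\<close>, that is, \<open>n\<close> is at
    least \<open>T * (a * (G + 1)) powr (1 / \<gamma> 0)\<close>. \<open>q\<close> bounds such an
    \<open>n\<close> after rounding, and its extra summand \<open>T\<close> ensures
    \<open>T \<le> n\<close>.\<close>
  define a where "a = 2 * L * (Cy + 1)"
  have a: "0 < a" using L Cy by (simp add: a_def)
  define q where "q y = T * (1 + (a * (c 0 * y + 1)) powr (1 / \<gamma> 0)) + 2" for y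
  have \<delta>: "0 \<le> 1 / \<gamma> 0" "1 / \<gamma> 0 < 2" using \<gamma>(1)[of 0] by (auto simp: divide_less_eq)
  obtain D where D: "0 < D" "\<And>y. 0 \<le> y \<Longrightarrow> 4 powr q y \<le> D * exp (y\<^sup>2 / 8)"
    unfolding q_def using powr_powr_le_exp_square[of T a "c 0" "1 / \<gamma> 0"] T a c \<delta> by (auto simp: less_imp_le)
  define S where "S \<omega> = 2 powr q (K 0 (path_of B \<omega>)) * (1 + \<bar>X 0 \<omega>\<bar>)" for \<omega>
  have [measurable]: "U 0 \<in> borel_measurable path_space" by (rule U)
  have pB [measurable]: "path_of B \<in> measurable M path_space"
    by (rule path_of_measurable) (use fbm_gaussian_rv[OF B] in \<open>auto simp: gaussian_rv_def\<close>)
  have [measurable]: "X 0 \<in> borel_measurable M" using X by (simp add: sde_solution_def)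
  have Sm: "S \<in> borel_measurable M" unfolding S_def q_def K_def by measurable
  have iS: "integrable M (\<lambda>\<omega>. (S \<omega>)\<^sup>2)"
  proof -
    have qm: "(\<lambda>w. 4 powr q (K 0 w)) \<in> borel_measurable path_space" unfolding q_def K_def by measurable
    \<comment> \<open>\<open>X 0\<close> is independent of the sigma-algebra generated by the path
      of \<open>B\<close>, and a measurable functional of that path generates a smaller one.\<close>
    have "indep_var borel (X 0) borel ((\<lambda>w. 4 powr q (K 0 w)) \<circ> path_of B)"
      unfolding indep_var_eq
    proof (intro conjI)
      let ?V = "sets (vimage_algebra (space M) (path_of B) path_space)"
      have "((\<lambda>w. 4 powr q (K 0 w)) \<circ> path_of B) -` A \<inter> space M \<in> ?V" if "A \<in> sets borel" for A
      proof -
        have "((\<lambda>w. 4 powr q (K 0 w)) \<circ> path_of B) -` A \<inter> space M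
            = path_of B -` ((\<lambda>w. 4 powr q (K 0 w)) -` A \<inter> space path_space) \<inter> space M"
          using measurable_space[OF pB] by auto
        then show ?thesis using in_vimage_algebra measurable_sets[OF qm that] by metis
      qed
      then have "sigma_sets (space M) {((\<lambda>w. 4 powr q (K 0 w)) \<circ> path_of B) -` A \<inter> space M | A. A \<in> sets borel} \<subseteq> ?V"
        using sets.sigma_sets_subset[of _ "vimage_algebra (space M) (path_of B) path_space"] by (simp add: Setcompr_eq_image image_subset_iff)
      moreover have "indep_set (sigma_sets (space M) {X 0 -` A \<inter> space M | A. A \<in> sets borel}) ?V"
        using X by (simp add: sde_solution_def sets_vimage_algebra)
      ultimately show "indep_set (sigma_sets (space M) {X 0 -` A \<inter> space M | A. A \<in> sets borel})
          (sigma_sets (space M) {((\<lambda>w. 4 powr q (K 0 w)) \<circ> path_of B) -` A \<inter> space M | A. A \<in> sets borel})"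
        unfolding indep_set_def by (elim indep_sets_mono_sets) (auto split: bool.split)
    qed (use measurable_comp[OF pB qm] in auto)
    then have iv: "indep_var borel ((\<lambda>x. (1 + \<bar>x\<bar>)\<^sup>2) \<circ> X 0) borel (id \<circ> ((\<lambda>w. 4 powr q (K 0 w)) \<circ> path_of B))"
      by (rule indep_var_compose) (auto simp: id_def)
    then have iv: "indep_var borel ((\<lambda>x. (1 + \<bar>x\<bar>)\<^sup>2) \<circ> X 0) borel ((\<lambda>w. 4 powr q (K 0 w)) \<circ> path_of B)" by simp
    have 1: "integrable M ((\<lambda>x. (1 + \<bar>x\<bar>)\<^sup>2) \<circ> X 0)"
    proof (rule Bochner_Integration.integrable_bound)
      show "integrable M (\<lambda>\<omega>. 2 * (X 0 \<omega>)\<^sup>2 + 2)" using X0 by simp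
      have "(1 + \<bar>x\<bar>)\<^sup>2 \<le> 2 * x\<^sup>2 + 2" for x :: real using sum_squares_bound[of 1 "\<bar>x\<bar>"] by (simp add: power2_sum)
      then show "AE \<omega> in M. norm (((\<lambda>x. (1 + \<bar>x\<bar>)\<^sup>2) \<circ> X 0) \<omega>) \<le> norm (2 * (X 0 \<omega>)\<^sup>2 + 2)" by simp
    qed (simp add: comp_def)
    have 2: "integrable M ((\<lambda>w. 4 powr q (K 0 w)) \<circ> path_of B)"
    proof (rule Bochner_Integration.integrable_bound)
      show "integrable M (\<lambda>\<omega>. D * (exp (1 / 8) + U 0 (path_of B \<omega>)))" using U(3) by simp
      have "4 powr q (K 0 w) \<le> D * (exp (1 / 8) + U 0 w)" for w using D(2)[OF K, of 0 w] by (simp add: exp_K)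
      then show "AE \<omega> in M. norm (((\<lambda>w. 4 powr q (K 0 w)) \<circ> path_of B) \<omega>) \<le> norm (D * (exp (1 / 8) + U 0 (path_of B \<omega>)))"
        using abs_ge_self order_trans by (intro AE_I2) (simp, blast)
    qed (use measurable_comp[OF pB qm] in simp)
    have "(S \<omega>)\<^sup>2 = ((\<lambda>x. (1 + \<bar>x\<bar>)\<^sup>2) \<circ> X 0) \<omega> * ((\<lambda>w. 4 powr q (K 0 w)) \<circ> path_of B) \<omega>" for \<omega>
    proof -
      have "(2 powr y)\<^sup>2 = 4 powr y" for y :: real using powr_mult[of 2 2 y] by (simp add: power2_eq_square)
      then show ?thesis by (simp add: S_def power_mult_distrib)
    qed
    then show ?thesis using indep_var_integrable[OF iv 1 2] by simp
  qed
  have "AE \<omega> in M. continuous_on {0..} (\<lambda>t. B t \<omega>)" using B by (simp add: fractional_brownian_motion_def)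
  moreover have "AE \<omega> in M. young_solution H \<sigma> b (\<lambda>t. B t \<omega>) (\<lambda>t. X t \<omega>)" using X by (simp add: sde_solution_def)
  moreover have "AE \<omega> in M. \<forall>j n k. k < N * 2 ^ n \<longrightarrow>
      \<bar>B (real (Suc k) / 2 ^ n) \<omega> - B (real k / 2 ^ n) \<omega>\<bar> \<le> K j (path_of B \<omega>) * (2 powr - \<gamma> j) ^ n"
    unfolding K_def using U(4) by (subst AE_all_countable) blast
  ultimately have "AE \<omega> in M. \<forall>t\<in>{0..T}. \<bar>X t \<omega>\<bar> \<le> S \<omega>"
  proof eventually_elim
    case (elim \<omega>)
    let ?w = "path_of B \<omega>"
    have hB: "\<bar>B t \<omega> - B s \<omega>\<bar> \<le> K j ?w * c j * \<bar>t - s\<bar> powr \<gamma> j" if "s \<in> {0..T}" "t \<in> {0..T}" "\<bar>t - s\<bar> \<le> 1" for s t j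
    proof -
      have *: "\<bar>B t \<omega> - B s \<omega>\<bar> \<le> K j ?w * c j * (t - s) powr \<gamma> j" if "0 \<le> s" "s \<le> t" "t \<le> T" "t - s \<le> 1" for s t
        unfolding c_def using that N \<gamma>(1)[of j] elim(3)
        by (intro dyadic_chaining[OF elim(1) _ K, where T = N]) auto
      show ?thesis
      proof (cases "s \<le> t")
        case True then show ?thesis using *[of s t] that by simp
      next
        case False then show ?thesis using *[of t s] that by (simp add: abs_minus_commute)
      qed
    qed
    obtain \<theta> where \<theta>: "1 - H < \<theta>" "holder_on \<theta> {0..T} (\<lambda>t. X t \<omega>)"
      using elim(2) T unfolding young_solution_def by blast
    have xc: "continuous_on {0..T} (\<lambda>t. X t \<omega>)" by (rule holder_on_continuous[OF \<theta>(2)])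
    interpret ye: young_equation L "K 0 ?w * c 0" "\<gamma> 0" T \<sigma> b "\<lambda>t. B t \<omega>" "\<lambda>t. X t \<omega>"
    proof
      show "\<exists>I. has_rs_integral (\<lambda>r. \<sigma> (X r \<omega>)) (\<lambda>t. B t \<omega>) 0 t I \<and> X t \<omega> = X 0 \<omega> + I + integral {0..t} (\<lambda>r. b (X r \<omega>))"
        if "t \<in> {0..T}" for t
        using elim(2) that unfolding young_solution_def by auto
    qed (use L b_cont T \<gamma>(1)[of 0] \<gamma>(2)[of 0] H K c hB xc in \<open>auto simp: less_imp_le\<close>)
    \<comment> \<open>\<open>\<theta>\<close> depends on \<open>\<omega>\<close>, and with it the
      index \<open>j\<close> for which Young's condition holds.\<close>
    have "\<forall>\<^sub>F j in sequentially. 1 - \<theta> < \<gamma> j" by (rule order_tendstoD(1)[OF \<gamma>_lim]) (use \<theta> in simp)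
    then obtain j where j: "1 - \<theta> < \<gamma> j" by (auto simp: eventually_sequentially)
    have "\<exists>A\<ge>0. \<forall>s\<in>{0..T}. \<forall>t\<in>{0..T}. \<bar>t - s\<bar> \<le> 1 \<longrightarrow> \<bar>X t \<omega> - X s \<omega>\<bar> \<le> A * \<bar>t - s\<bar> powr \<gamma> 0"
      by (rule ye.holder_upgrade[OF \<theta>(2) hB[of _ _ j] \<gamma>(3)]) (use j K c in auto)
    then obtain A where A: "\<And>s t. s \<in> {0..T} \<Longrightarrow> t \<in> {0..T} \<Longrightarrow> \<bar>t - s\<bar> \<le> 1 \<Longrightarrow> \<bar>X t \<omega> - X s \<omega>\<bar> \<le> A * \<bar>t - s\<bar> powr \<gamma> 0"
      by blast
    define u where "u = a * (c 0 * K 0 ?w + 1)"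
    have u: "0 < u" using a c[of 0] K[of 0 ?w] by (auto simp: u_def intro!: mult_pos_pos add_nonneg_pos)
    define r where "r = T * (1 + u powr (1 / \<gamma> 0))"
    define n where "n = nat \<lceil>r\<rceil> + 1"
    have r: "0 < r" "T \<le> r" "T * u powr (1 / \<gamma> 0) \<le> r" using T by (auto simp: r_def algebra_simps intro: add_pos_nonneg)
    have n: "0 < n" "r \<le> real n" "real n \<le> r + 2"
      using r(1) by (auto simp: n_def of_nat_nat) linarith+
    have "T / real n \<le> u powr (- 1 / \<gamma> 0)"
    proof -
      have "T * u powr (1 / \<gamma> 0) \<le> real n" using r n by linarith
      then show ?thesis using u n by (simp add: powr_minus_divide divide_simps mult.commute)
    qed
    then have "(T / real n) powr \<gamma> 0 \<le> (u powr (- 1 / \<gamma> 0)) powr \<gamma> 0" using T \<gamma>(1)[of 0] by (intro powr_mono2) auto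
    also have "(u powr (- 1 / \<gamma> 0)) powr \<gamma> 0 = u powr - 1" using \<gamma>(1)[of 0] by (simp only: powr_powr) simp
    also have "\<dots> = 1 / u" using u by (simp add: powr_minus_divide)
    finally have le: "u * (T / real n) powr \<gamma> 0 \<le> 1" using u by (simp add: pos_le_divide_eq mult.commute)
    have "L * (ye.C + 1) * (K 0 ?w * c 0 + 1) * (T / real n) powr \<gamma> 0 = u * (T / real n) powr \<gamma> 0 / 2"
      by (simp add: u_def a_def Cy_def ye.C_def mult_ac)
    also have "\<dots> \<le> 1 / 2" using le by simp
    finally have small: "L * (ye.C + 1) * (K 0 ?w * c 0 + 1) * (T / real n) powr \<gamma> 0 \<le> 1 / 2" .
    show ?case
    proof
      fix t assume t: "t \<in> {0..T}"
      have "1 + \<bar>X t \<omega>\<bar> \<le> 2 ^ n * (1 + \<bar>X 0 \<omega>\<bar>)"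
        by (rule ye.growth_bound[OF A n(1) T order_trans[OF r(2) n(2)] small t])
      also have "\<dots> \<le> 2 powr q (K 0 ?w) * (1 + \<bar>X 0 \<omega>\<bar>)"
      proof (rule mult_right_mono)
        have "(2::real) ^ n = 2 powr real n" by (simp add: powr_realpow)
        also have "\<dots> \<le> 2 powr q (K 0 ?w)" using n by (simp add: q_def r_def u_def)
        finally show "(2::real) ^ n \<le> 2 powr q (K 0 ?w)" .
      qed simp
      finally show "\<bar>X t \<omega>\<bar> \<le> S \<omega>" by (simp add: S_def)
    qed
  qed
  then show ?thesis using Sm iS by blast
qed

end

section \<open>Wigner matrices with square integrable entries\<close>

text \<open>Off-diagonal entries occur twice and diagonal ones carry \<open>sqrt 2\<close>, so every
  coordinate has weight at most \<open>2 / N\<close>.\<close>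

lemma wigner_matrix_entries_le:
  "(\<Sum>k<N. \<Sum>l<N. (wigner_matrix N x $$ (k, l) - wigner_matrix N y $$ (k, l))\<^sup>2)
    \<le> 2 / real N * (\<Sum>i<N. \<Sum>j<N. (x i j - y i j)\<^sup>2)"
proof (cases "N = 0")
  case False
  define D where "D i j = (x i j - y i j)\<^sup>2" for i j
  have "(wigner_matrix N x $$ (k, l) - wigner_matrix N y $$ (k, l))\<^sup>2 \<le> (D k l + D l k) / real N" if "k < N" "l < N" for k l
  proof (cases "k = l")
    case True
    have "(sqrt 2 / sqrt (real N) * x l l - sqrt 2 / sqrt (real N) * y l l)\<^sup>2 = 2 * D l l / real N"
      unfolding right_diff_distrib[symmetric] by (simp add: D_def power_mult_distrib power_divide)
    then show ?thesis using that True by (simp add: wigner_matrix_nth)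
  next
    case False
    have *: "(1 / sqrt (real N) * x i j - 1 / sqrt (real N) * y i j)\<^sup>2 = D i j / real N" for i j
      unfolding right_diff_distrib[symmetric] by (simp add: D_def power_mult_distrib power_divide)
    have "D (min k l) (max k l) \<le> D k l + D l k" by (simp add: D_def min_def max_def)
    then show ?thesis using that False * by (simp add: wigner_matrix_nth divide_right_mono)
  qed
  then have "(\<Sum>k<N. \<Sum>l<N. (wigner_matrix N x $$ (k, l) - wigner_matrix N y $$ (k, l))\<^sup>2)
      \<le> (\<Sum>k<N. \<Sum>l<N. (D k l + D l k) / real N)"
    by (intro sum_mono) auto
  also have "\<dots> = ((\<Sum>k<N. \<Sum>l<N. D k l) + (\<Sum>k<N. \<Sum>l<N. D l k)) / real N"
    by (simp add: sum.distrib sum_divide_distrib add_divide_distrib)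
  also have "(\<Sum>k<N. \<Sum>l<N. D l k) = (\<Sum>k<N. \<Sum>l<N. D k l)" by (rule sum.swap)
  finally show ?thesis by (simp add: D_def)
qed simp

text \<open>The bound depends on the mean square difference \<open>e\<close> of the entries and not
  on \<open>N\<close>. It serves both for truncating the entries and for comparing nearby
  times.\<close>

lemma stieltjes_wigner_diff_le:
  assumes z: "0 < Im z" and N: "0 < N" and e: "(\<Sum>i<N. \<Sum>j<N. (x i j - y i j)\<^sup>2) \<le> (real N)\<^sup>2 * e"
  shows "cmod (stieltjes (empirical_spectral_measure (wigner_matrix N x)) z
    - stieltjes (empirical_spectral_measure (wigner_matrix N y)) z) \<le> sqrt (2 * e) / (Im z)\<^sup>2"
proof -
  let ?A = "wigner_matrix N x" and ?B = "wigner_matrix N y"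
  let ?D = "\<Sum>k<N. \<Sum>l<N. (?A $$ (k, l) - ?B $$ (k, l))\<^sup>2"
  have "cmod (stieltjes (empirical_spectral_measure ?A) z - stieltjes (empirical_spectral_measure ?B) z)
      = cmod ((\<Sum>i<N. resolvent ?A z $$ (i, i)) - (\<Sum>i<N. resolvent ?B z $$ (i, i))) / real N"
    by (simp add: stieltjes_empirical_spectral_measure[OF wigner_matrix_symmetric z] diff_divide_distrib[symmetric] norm_divide)
  also have "\<dots> \<le> sqrt (real N * ?D) / (Im z)\<^sup>2 / real N"
    by (intro divide_right_mono resolvent_trace_diff_HS wigner_matrix_symmetric z) simp
  also have "\<dots> \<le> sqrt (2 * e * (real N)\<^sup>2) / (Im z)\<^sup>2 / real N"
  proof -
    have "?D \<le> 2 / real N * ((real N)\<^sup>2 * e)"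
      using wigner_matrix_entries_le e by (rule order_trans[OF _ mult_left_mono]) simp
    then have "real N * ?D \<le> real N * (2 / real N * ((real N)\<^sup>2 * e))" by (rule mult_left_mono) simp
    then have "real N * ?D \<le> 2 * e * (real N)\<^sup>2" using N by (simp add: mult_ac)
    then show ?thesis by (intro divide_right_mono real_sqrt_le_mono) auto
  qed
  also have "\<dots> = sqrt (2 * e) / (Im z)\<^sup>2" using N by (simp add: real_sqrt_mult)
  finally show ?thesis .
qed

text \<open>The second moment of the spectral measure is the squared Hilbert-Schmidt norm over
  \<open>N\<close>, bounded by comparison with the zero matrix. It feeds tightness.\<close>

lemma second_moment_wigner_le:
  assumes N: "0 < N" and e: "(\<Sum>i<N. \<Sum>j<N. (x i j)\<^sup>2) \<le> (real N)\<^sup>2 * e"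
  shows "(\<integral>y. y\<^sup>2 \<partial>empirical_spectral_measure (wigner_matrix N x)) \<le> 2 * e"
proof -
  let ?A = "wigner_matrix N x"
  have "(\<integral>y. y\<^sup>2 \<partial>empirical_spectral_measure ?A) = (\<Sum>i<N. \<Sum>j<N. (?A $$ (i, j))\<^sup>2) / real N"
    by (subst integral_empirical_spectral_measure[OF wigner_matrix_symmetric])
      (auto simp: sum_sq_entries_eq_eigenvalues[OF wigner_matrix_symmetric] divide_inverse)
  also have "\<dots> \<le> (2 / real N * (\<Sum>i<N. \<Sum>j<N. (x i j)\<^sup>2)) / real N"
  proof -
    have "wigner_matrix N (\<lambda>_ _. 0) $$ (k, l) = 0" if "k < N" "l < N" for k l using that by (simp add: wigner_matrix_nth)
    then have "(\<Sum>k<N. \<Sum>l<N. (?A $$ (k, l))\<^sup>2) = (\<Sum>k<N. \<Sum>l<N. (?A $$ (k, l) - wigner_matrix N (\<lambda>_ _. 0) $$ (k, l))\<^sup>2)"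
      by (intro sum.cong) auto
    then show ?thesis using wigner_matrix_entries_le[of N x "\<lambda>_ _. 0"] by (intro divide_right_mono) auto
  qed
  also have "\<dots> \<le> (2 / real N * ((real N)\<^sup>2 * e)) / real N"
    by (intro divide_right_mono mult_left_mono e) auto
  also have "\<dots> = 2 * e" using N by (simp add: power2_eq_square)
  finally show ?thesis .
qed

lemma integrable_empirical_spectral_measure:
  fixes f :: "real \<Rightarrow> real"
  assumes "f \<in> borel_measurable borel"
  shows "integrable (empirical_spectral_measure (wigner_matrix N x)) f"
proof -
  have "dim_row (wigner_matrix N x) = N" using wigner_matrix_symmetric(1) by auto
  then show ?thesis
    unfolding empirical_spectral_measure_def using assms
    by (subst integrable_distr_eq) (auto simp: uniform_count_measure_def integrable_point_measure_finite)
qed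

text \<open>Truncation at level \<open>k\<close> reduces to bounded entries. Truncated mean and
  variance converge to the true ones, and the array bound makes the mean square truncation error
  eventually at most \<open>dk k\<close>, which tends to 0. \<open>N\<close> goes to infinity first,
  then \<open>k\<close>.\<close>

lemma (in prob_space) iid_wigner_quadratic_limit:
  fixes x :: "nat \<times> nat \<Rightarrow> 'a \<Rightarrow> real"
  assumes indep: "indep_vars (\<lambda>_. borel) x UNIV"
    and dist: "\<And>p. distr M borel (x p) = distr M borel (x (0, 0))"
    and int2: "integrable M (\<lambda>\<omega>. (x (0, 0) \<omega>)\<^sup>2)" and z: "0 < Im z"
    and m: "m = expectation (x (0, 0))" and v: "v = expectation (\<lambda>\<omega>. (x (0, 0) \<omega>)\<^sup>2) - m\<^sup>2"
  shows "AE \<omega> in M. (\<lambda>N. of_real v * (stieltjes (empirical_spectral_measure (wigner_matrix N (\<lambda>i j. x (i, j) \<omega>))) z)\<^sup>2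
    + z * stieltjes (empirical_spectral_measure (wigner_matrix N (\<lambda>i j. x (i, j) \<omega>))) z + 1) \<longlonglongrightarrow> 0"
proof -
  have xm[measurable]: "x p \<in> borel_measurable M" for p using indep unfolding indep_vars_def by blast
  have int1: "integrable M (x (0, 0))" using int2 by (rule square_integrable_imp_integrable[rotated]) simp
  have eqE: "expectation (\<lambda>\<omega>. f (x p \<omega>)) = expectation (\<lambda>\<omega>. f (x (0, 0) \<omega>))" if "f \<in> borel_measurable borel" for f :: "real \<Rightarrow> real" and p
    using that dist[of p] integral_distr[OF xm that, of p] integral_distr[OF xm that, of "(0, 0)"] by simp
  define clip where "clip k y = max (- real (Suc k)) (min (real (Suc k)) y)" for k and y :: real
  have clip_m[measurable]: "clip k \<in> borel_measurable borel" for k unfolding clip_def by measurable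
  have clip_le: "\<bar>clip k y\<bar> \<le> \<bar>y\<bar>" "\<bar>clip k y\<bar> \<le> real (Suc k)" for k y by (auto simp: clip_def)
  have clip_lim: "(\<lambda>k. clip k y) \<longlonglongrightarrow> y" for y
  proof (rule tendsto_eventually)
    obtain n where "\<bar>y\<bar> \<le> real n" using real_arch_simple by blast
    then have "clip k y = y" if "n \<le> k" for k using that by (auto simp: clip_def)
    then show "\<forall>\<^sub>F k in sequentially. clip k y = y" by (auto simp: eventually_sequentially)
  qed
  define mk where "mk k = expectation (\<lambda>\<omega>. clip k (x (0, 0) \<omega>))" for k
  define vk where "vk k = expectation (\<lambda>\<omega>. (clip k (x (0, 0) \<omega>))\<^sup>2) - (mk k)\<^sup>2" for k
  define ek where "ek k = expectation (\<lambda>\<omega>. (x (0, 0) \<omega> - clip k (x (0, 0) \<omega>))\<^sup>2)" for k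
  have mk: "mk \<longlonglongrightarrow> m" unfolding mk_def m
  proof (rule integral_dominated_convergence[where w = "\<lambda>\<omega>. \<bar>x (0, 0) \<omega>\<bar>"])
    show "AE \<omega> in M. norm (clip k (x (0, 0) \<omega>)) \<le> \<bar>x (0, 0) \<omega>\<bar>" for k using clip_le by simp
  qed (use int1 clip_lim in auto)
  have "(\<lambda>k. expectation (\<lambda>\<omega>. (clip k (x (0, 0) \<omega>))\<^sup>2)) \<longlonglongrightarrow> expectation (\<lambda>\<omega>. (x (0, 0) \<omega>)\<^sup>2)"
  proof (rule integral_dominated_convergence[where w = "\<lambda>\<omega>. (x (0, 0) \<omega>)\<^sup>2"])
    show "AE \<omega> in M. norm ((clip k (x (0, 0) \<omega>))\<^sup>2) \<le> (x (0, 0) \<omega>)\<^sup>2" for k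
      using clip_le(1) by (simp add: abs_le_square_iff)
  qed (use int2 in \<open>auto intro!: tendsto_power clip_lim\<close>)
  then have vk: "vk \<longlonglongrightarrow> v" unfolding vk_def[abs_def] v by (intro tendsto_diff tendsto_power mk)
  have diff_sq: "(y - clip k y)\<^sup>2 \<le> y\<^sup>2" for k y
    by (rule abs_le_square_iff[THEN iffD1]) (auto simp: clip_def)
  have "ek \<longlonglongrightarrow> expectation (\<lambda>\<omega>. 0)" unfolding ek_def[abs_def]
  proof (rule integral_dominated_convergence[where w = "\<lambda>\<omega>. (x (0, 0) \<omega>)\<^sup>2"])
    have "(\<lambda>k. (y - clip k y)\<^sup>2) \<longlonglongrightarrow> (y - y)\<^sup>2" for y by (intro tendsto_intros clip_lim)
    then show "AE \<omega> in M. (\<lambda>k. (x (0, 0) \<omega> - clip k (x (0, 0) \<omega>))\<^sup>2) \<longlonglongrightarrow> 0" by simp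
  qed (use int2 diff_sq in auto)
  then have ek: "ek \<longlonglongrightarrow> 0" by simp
  \<comment> \<open>The factor 4 is that of \<open>iid_square_array_eventually_le\<close>;
    \<open>1 / real (Suc k)\<close> provides the strict inequality it asks for.\<close>
  define dk where "dk k = 4 * (ek k + 1 / real (Suc k))" for k
  have "dk \<longlonglongrightarrow> 4 * (0 + 0)" unfolding dk_def[abs_def] by (intro tendsto_intros ek LIMSEQ_Suc[OF lim_1_over_n])
  then have dk: "dk \<longlonglongrightarrow> 0" by simp
  define s where "s N \<omega> = stieltjes (empirical_spectral_measure (wigner_matrix N (\<lambda>i j. x (i, j) \<omega>))) z" for N \<omega>
  define sk where "sk k N \<omega> = stieltjes (empirical_spectral_measure (wigner_matrix N (\<lambda>i j. clip k (x (i, j) \<omega>)))) z" for k N \<omega>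
  have A: "AE \<omega> in M. (\<lambda>N. of_real (vk k) * (sk k N \<omega>)\<^sup>2 + z * sk k N \<omega> + 1) \<longlonglongrightarrow> 0" for k
  proof -
    interpret bw: bounded_wigner M "\<lambda>p \<omega>. clip k (x p \<omega>)" "real (Suc k)" "mk k" "vk k" z
    proof
      show "indep_vars (\<lambda>_. borel) (\<lambda>p \<omega>. clip k (x p \<omega>)) UNIV"
        by (rule indep_vars_compose2[OF indep]) simp
      show "expectation (\<lambda>\<omega>. clip k (x p \<omega>)) = mk k" for p unfolding mk_def by (rule eqE) simp
      show "expectation (\<lambda>\<omega>. (clip k (x p \<omega>))\<^sup>2) = (mk k)\<^sup>2 + vk k" for p
        using eqE[of "\<lambda>y. (clip k y)\<^sup>2" p] by (simp add: vk_def)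
    qed (use clip_le z in auto)
    have "sk k N \<omega> = bw.s N \<omega>" for N \<omega>
      unfolding sk_def bw.s_def bw.R_def bw.W_def
      by (rule stieltjes_empirical_spectral_measure[OF wigner_matrix_symmetric z])
    then show ?thesis using bw.quadratic_limit by simp
  qed
  have Bk: "AE \<omega> in M. \<forall>\<^sub>F N in sequentially. (\<Sum>i<N. \<Sum>j<N. (x (i, j) \<omega> - clip k (x (i, j) \<omega>))\<^sup>2) \<le> 4 * (real N)\<^sup>2 * (ek k + 1 / real (Suc k))" for k
  proof (rule iid_square_array_eventually_le[where Z = "\<lambda>p \<omega>. (x p \<omega> - clip k (x p \<omega>))\<^sup>2"])
    have gm: "(\<lambda>y. (y - clip k y)\<^sup>2) \<in> borel_measurable borel" by measurable
    show "indep_vars (\<lambda>_. borel) (\<lambda>p \<omega>. (x p \<omega> - clip k (x p \<omega>))\<^sup>2) UNIV"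
      by (rule indep_vars_compose2[OF indep]) simp
    show "distr M borel (\<lambda>\<omega>. (x p \<omega> - clip k (x p \<omega>))\<^sup>2) = distr M borel (\<lambda>\<omega>. (x (0, 0) \<omega> - clip k (x (0, 0) \<omega>))\<^sup>2)" for p
      using distr_distr[OF gm xm, of p] distr_distr[OF gm xm, of "(0, 0)"] dist[of p] by (simp add: comp_def)
    show "integrable M (\<lambda>\<omega>. (x (0, 0) \<omega> - clip k (x (0, 0) \<omega>))\<^sup>2)"
      by (rule Bochner_Integration.integrable_bound[OF int2]) (use diff_sq in auto)
  qed (auto simp: ek_def)
  have "AE \<omega> in M. \<forall>k. (\<lambda>N. of_real (vk k) * (sk k N \<omega>)\<^sup>2 + z * sk k N \<omega> + 1) \<longlonglongrightarrow> 0"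
    using A by (simp add: AE_all_countable)
  moreover have "AE \<omega> in M. \<forall>k. \<forall>\<^sub>F N in sequentially. (\<Sum>i<N. \<Sum>j<N. (x (i, j) \<omega> - clip k (x (i, j) \<omega>))\<^sup>2) \<le> (real N)\<^sup>2 * dk k"
  proof -
    have eq: "4 * (real N)\<^sup>2 * (ek k + 1 / real (Suc k)) = (real N)\<^sup>2 * dk k" for N k unfolding dk_def by (rule mult.left_commute[THEN trans[OF mult.assoc]])
    show ?thesis by (subst AE_all_countable) (intro allI Bk[unfolded eq])
  qed
  ultimately show ?thesis unfolding s_def[symmetric]
  proof eventually_elim
    case (elim \<omega>)
    let ?\<eta> = "Im z"
    define E where "E k = \<bar>v - vk k\<bar> / ?\<eta>\<^sup>2 + (\<bar>v\<bar> * (2 / ?\<eta>) + cmod z) * (sqrt (2 * dk k) / ?\<eta>\<^sup>2)" for k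
    have "E \<longlonglongrightarrow> \<bar>v - v\<bar> / ?\<eta>\<^sup>2 + (\<bar>v\<bar> * (2 / ?\<eta>) + cmod z) * (sqrt (2 * 0) / ?\<eta>\<^sup>2)"
      unfolding E_def[abs_def] using z by (intro tendsto_intros vk dk) auto
    then have E: "E \<longlonglongrightarrow> 0" by simp
    show ?case
    proof (rule tendstoI)
      fix e :: real assume e: "0 < e"
      have "\<forall>\<^sub>F k in sequentially. E k < e / 2" by (rule order_tendstoD(2)[OF E]) (use e in simp)
      then obtain k where k: "E k < e / 2" by (auto simp: eventually_sequentially)
      have "\<forall>\<^sub>F N in sequentially. dist (of_real (vk k) * (sk k N \<omega>)\<^sup>2 + z * sk k N \<omega> + 1) 0 < e / 2"
        using elim(1) e by (intro tendstoD) auto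
      then show "\<forall>\<^sub>F N in sequentially. dist (of_real v * (s N \<omega>)\<^sup>2 + z * s N \<omega> + 1) 0 < e"
        using elim(2)[rule_format, of k] eventually_gt_at_top[of 0]
      proof eventually_elim
        case (elim N)
        have d: "cmod (s N \<omega> - sk k N \<omega>) \<le> sqrt (2 * dk k) / ?\<eta>\<^sup>2"
          unfolding s_def sk_def using elim by (intro stieltjes_wigner_diff_le[OF z]) auto
        have esm: "real_distribution (empirical_spectral_measure (wigner_matrix N y))" for y
          by (rule real_distribution_empirical_spectral_measure[OF wigner_matrix_symmetric elim(3)])
        have b: "cmod (s N \<omega>) \<le> 1 / ?\<eta>" "cmod (sk k N \<omega>) \<le> 1 / ?\<eta>"
          unfolding s_def sk_def by (intro real_distribution.norm_stieltjes_le[OF esm z])+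
        \<comment> \<open>The two quadratics differ by a change of the variance and a change of the
          transform; the latter contains the factor \<open>s - sk\<close>.\<close>
        have eq: "of_real v * (s N \<omega>)\<^sup>2 + z * s N \<omega> + 1 = (of_real (vk k) * (sk k N \<omega>)\<^sup>2 + z * sk k N \<omega> + 1)
          + of_real (v - vk k) * (sk k N \<omega>)\<^sup>2 + (of_real v * (s N \<omega> + sk k N \<omega>) + z) * (s N \<omega> - sk k N \<omega>)"
          by (simp add: power2_eq_square algebra_simps)
        have "cmod (of_real (v - vk k) * (sk k N \<omega>)\<^sup>2) \<le> \<bar>v - vk k\<bar> / ?\<eta>\<^sup>2"
        proof -
          have "(cmod (sk k N \<omega>))\<^sup>2 \<le> (1 / ?\<eta>)\<^sup>2" by (intro power_mono b) simp
          then have "\<bar>v - vk k\<bar> * (cmod (sk k N \<omega>))\<^sup>2 \<le> \<bar>v - vk k\<bar> * (1 / ?\<eta>)\<^sup>2" by (rule mult_left_mono) simp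
          then show ?thesis unfolding norm_mult norm_power norm_of_real by (simp add: power_divide)
        qed
        moreover have "cmod ((of_real v * (s N \<omega> + sk k N \<omega>) + z) * (s N \<omega> - sk k N \<omega>)) \<le> (\<bar>v\<bar> * (2 / ?\<eta>) + cmod z) * (sqrt (2 * dk k) / ?\<eta>\<^sup>2)"
        proof -
          have "cmod (s N \<omega> + sk k N \<omega>) \<le> 2 / ?\<eta>" using norm_triangle_ineq[of "s N \<omega>" "sk k N \<omega>"] b by simp
          then have "cmod (of_real v * (s N \<omega> + sk k N \<omega>)) \<le> \<bar>v\<bar> * (2 / ?\<eta>)"
            unfolding norm_mult norm_of_real by (rule mult_left_mono) simp
          then have "cmod (of_real v * (s N \<omega> + sk k N \<omega>) + z) \<le> \<bar>v\<bar> * (2 / ?\<eta>) + cmod z"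
            by (intro norm_triangle_mono) auto
          then show ?thesis unfolding norm_mult using d z by (intro mult_mono) auto
        qed
        ultimately have "cmod (of_real v * (s N \<omega>)\<^sup>2 + z * s N \<omega> + 1) \<le> cmod (of_real (vk k) * (sk k N \<omega>)\<^sup>2 + z * sk k N \<omega> + 1) + E k"
          using norm_triangle_ineq[of "(of_real (vk k) * (sk k N \<omega>)\<^sup>2 + z * sk k N \<omega> + 1)
          + of_real (v - vk k) * (sk k N \<omega>)\<^sup>2" "(of_real v * (s N \<omega> + sk k N \<omega>) + z) * (s N \<omega> - sk k N \<omega>)"]
            norm_triangle_ineq[of "(of_real (vk k) * (sk k N \<omega>)\<^sup>2 + z * sk k N \<omega> + 1)" "of_real (v - vk k) * (sk k N \<omega>)\<^sup>2"]
          unfolding E_def eq by linarith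
        then show ?case using elim(1) k by (simp add: dist_norm)
      qed
    qed
  qed
qed

section \<open>Modulus of continuity\<close>

text \<open>Rational pairs keep the supremum countable, hence measurable on the product
  sigma-algebra without appeal to continuity. The window shrinks to 0 with \<open>n\<close>; for
  \<open>n = 0\<close> and \<open>T > 0\<close> its width \<open>2 * T\<close> admits all pairs of
  points, so the modulus then also bounds increments from time 0.\<close>

definition modulus :: "real \<Rightarrow> nat \<Rightarrow> (real \<Rightarrow> real) \<Rightarrow> real" where
  "modulus T n w = enn2real (SUP p\<in>{p \<in> (\<rat> \<inter> {0..T}) \<times> (\<rat> \<inter> {0..T}). \<bar>fst p - snd p\<bar> < 2 * T / real (Suc n)}. ennreal \<bar>w (fst p) - w (snd p)\<bar>)"

lemma modulus_measurable [measurable]: "modulus T n \<in> borel_measurable path_space"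
  unfolding modulus_def
proof (intro borel_measurable_enn2real borel_measurable_SUP)
  show "countable {p \<in> (\<rat> \<inter> {0..T}) \<times> (\<rat> \<inter> {0..T}). \<bar>fst p - snd p\<bar> < 2 * T / real (Suc n)}"
    by (rule countable_subset[of _ "(\<rat> \<inter> {0..T}) \<times> (\<rat> \<inter> {0..T})"]) (auto intro!: countable_SIGMA countable_Int1 countable_rat)
  fix p assume "p \<in> {p \<in> (\<rat> \<inter> {0..T}) \<times> (\<rat> \<inter> {0..T}). \<bar>fst p - snd p\<bar> < 2 * T / real (Suc n)}"
  then have [measurable]: "(\<lambda>w. w (fst p)) \<in> borel_measurable path_space" "(\<lambda>w. w (snd p)) \<in> borel_measurable path_space"
    by (auto intro!: measurable_component_singleton)
  show "(\<lambda>w. ennreal \<bar>w (fst p) - w (snd p)\<bar>) \<in> borel_measurable path_space" by measurable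
qed

lemma modulus_nonneg: "0 \<le> modulus T n w" by (simp add: modulus_def)

lemma modulus_cong: "(\<And>t. t \<in> {0..T} \<Longrightarrow> w t = w' t) \<Longrightarrow> modulus T n w = modulus T n w'"
  unfolding modulus_def by (intro arg_cong[where f = enn2real] SUP_cong) auto

lemma modulus_le:
  assumes "0 \<le> c" "\<And>s t. s \<in> {0..T} \<Longrightarrow> t \<in> {0..T} \<Longrightarrow> \<bar>s - t\<bar> < 2 * T / real (Suc n) \<Longrightarrow> \<bar>w s - w t\<bar> \<le> c"
  shows "modulus T n w \<le> c"
  unfolding modulus_def using assms by (intro enn2real_leI SUP_least ennreal_leI) auto

lemma rational_sequence_in_interval:
  fixes t T :: real
  assumes "0 < T" "t \<in> {0..T}"
  obtains r where "\<And>k. r k \<in> \<rat> \<inter> {0..T}" "r \<longlonglongrightarrow> t"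
proof -
  have "\<exists>q\<in>\<rat> \<inter> {0..T}. \<bar>q - t\<bar> < 1 / real (Suc k)" for k
  proof -
    define h where "h = 1 / real (Suc k)"
    have "0 < h" by (simp add: h_def)
    then have "max 0 (t - h) < min T (t + h)" using assms by auto
    from Rats_dense_in_real[OF this] show ?thesis unfolding h_def[symmetric] by (auto intro!: bexI)
  qed
  then obtain r where r: "\<And>k. r k \<in> \<rat> \<inter> {0..T}" "\<And>k. \<bar>r k - t\<bar> < 1 / real (Suc k)" by metis
  have "(\<lambda>k. r k - t) \<longlonglongrightarrow> 0"
    by (rule Lim_null_comparison[OF _ LIMSEQ_Suc[OF lim_1_over_n]]) (use r(2) in \<open>auto intro!: always_eventually less_imp_le\<close>)
  then show ?thesis using r(1) by (intro that[of r]) (auto simp: LIM_zero_iff)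
qed

text \<open>By continuity the increment is a limit of rational increments, and the window is an open
  condition, so the approximants eventually lie in it. Boundedness of \<open>w\<close> keeps the
  supremum finite, so that \<open>enn2real\<close> does not turn it into 0.\<close>

lemma modulus_ge:
  assumes w: "continuous_on {0..T} w" and T: "0 < T" and st: "s \<in> {0..T}" "t \<in> {0..T}" "\<bar>s - t\<bar> < 2 * T / real (Suc n)"
  shows "\<bar>w s - w t\<bar> \<le> modulus T n w"
proof -
  let ?I = "{p \<in> (\<rat> \<inter> {0..T}) \<times> (\<rat> \<inter> {0..T}). \<bar>fst p - snd p\<bar> < 2 * T / real (Suc n)}"
  obtain D where D: "\<And>r. r \<in> {0..T} \<Longrightarrow> \<bar>w r\<bar> \<le> D"
    using compact_imp_bounded[OF compact_continuous_image[OF w compact_Icc]] by (metis bounded_iff imageI real_norm_def)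
  have fin: "(SUP p\<in>?I. ennreal \<bar>w (fst p) - w (snd p)\<bar>) \<le> ennreal (2 * D)"
  proof (rule SUP_least)
    fix p assume "p \<in> ?I"
    then show "ennreal \<bar>w (fst p) - w (snd p)\<bar> \<le> ennreal (2 * D)"
      using D[of "fst p"] D[of "snd p"] by (intro ennreal_leI) auto
  qed
  then have fin: "(SUP p\<in>?I. ennreal \<bar>w (fst p) - w (snd p)\<bar>) < \<top>" using order.strict_trans1 ennreal_less_top by blast
  have rat: "\<bar>w a - w b\<bar> \<le> modulus T n w" if "a \<in> \<rat> \<inter> {0..T}" "b \<in> \<rat> \<inter> {0..T}" "\<bar>a - b\<bar> < 2 * T / real (Suc n)" for a b
  proof -
    have "ennreal \<bar>w (fst (a, b)) - w (snd (a, b))\<bar> \<le> (SUP p\<in>?I. ennreal \<bar>w (fst p) - w (snd p)\<bar>)"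
      by (rule SUP_upper) (use that in auto)
    also have "\<dots> = ennreal (modulus T n w)" unfolding modulus_def using fin by simp
    finally show ?thesis by (simp add: modulus_nonneg)
  qed
  obtain a where a: "\<And>k. a k \<in> \<rat> \<inter> {0..T}" "a \<longlonglongrightarrow> s" using rational_sequence_in_interval[OF T st(1)] by blast
  obtain b where b: "\<And>k. b k \<in> \<rat> \<inter> {0..T}" "b \<longlonglongrightarrow> t" using rational_sequence_in_interval[OF T st(2)] by blast
  have wa: "(\<lambda>k. w (a k)) \<longlonglongrightarrow> w s" using a st by (intro continuous_on_tendsto_compose[OF w]) auto
  have wb: "(\<lambda>k. w (b k)) \<longlonglongrightarrow> w t" using b st by (intro continuous_on_tendsto_compose[OF w]) auto
  have "(\<lambda>k. \<bar>w (a k) - w (b k)\<bar>) \<longlonglongrightarrow> \<bar>w s - w t\<bar>" by (intro tendsto_intros wa wb)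
  moreover have "(\<lambda>k. \<bar>a k - b k\<bar>) \<longlonglongrightarrow> \<bar>s - t\<bar>" by (intro tendsto_intros a b)
  then have "\<forall>\<^sub>F k in sequentially. \<bar>a k - b k\<bar> < 2 * T / real (Suc n)" by (rule order_tendstoD(2)) (rule st)
  then have "\<forall>\<^sub>F k in sequentially. \<bar>w (a k) - w (b k)\<bar> \<le> modulus T n w"
    by eventually_elim (intro rat a b)
  ultimately show ?thesis by (rule tendsto_upperbound) simp
qed

lemma modulus_tendsto:
  assumes w: "continuous_on {0..T} w"
  shows "(\<lambda>n. modulus T n w) \<longlonglongrightarrow> 0"
proof (rule LIMSEQ_I)
  fix e :: real assume e: "0 < e"
  have "uniformly_continuous_on {0..T} w" by (rule compact_uniformly_continuous[OF w compact_Icc])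
  then obtain d where d: "0 < d" "\<And>s t. s \<in> {0..T} \<Longrightarrow> t \<in> {0..T} \<Longrightarrow> \<bar>s - t\<bar> < d \<Longrightarrow> \<bar>w s - w t\<bar> < e / 2"
    using e unfolding uniformly_continuous_on_def dist_real_def by (metis half_gt_zero)
  have "(\<lambda>n. 2 * T / real (Suc n)) \<longlonglongrightarrow> 0" by (intro lim_const_over_n[THEN LIMSEQ_Suc])
  then have "\<forall>\<^sub>F n in sequentially. 2 * T / real (Suc n) < d" by (rule order_tendstoD(2)) (rule d)
  then obtain n0 where n0: "\<And>n. n0 \<le> n \<Longrightarrow> 2 * T / real (Suc n) < d" by (auto simp: eventually_sequentially)
  have "norm (modulus T n w - 0) < e" if "n0 \<le> n" for n
  proof -
    have "modulus T n w \<le> e / 2"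
      by (rule modulus_le) (use e d(2) n0[OF that] in \<open>auto intro!: less_imp_le\<close>)
    then show ?thesis using modulus_nonneg[of T n w] e by simp
  qed
  then show "\<exists>n0. \<forall>n\<ge>n0. norm (modulus T n w - 0) < e" by blast
qed

text \<open>Dominated convergence with \<open>4 * (S \<omega>)\<^sup>2\<close>: the square
  integrable supremum of the path turns continuity into small mean square moduli.\<close>

lemma modulus_second_moment:
  assumes X: "\<And>t. 0 \<le> t \<Longrightarrow> X t \<in> borel_measurable P" and c: "AE \<omega> in P. continuous_on {0..T} (\<lambda>t. X t \<omega>)"
    and S: "S \<in> borel_measurable P" "integrable P (\<lambda>\<omega>. (S \<omega>)\<^sup>2)" "AE \<omega> in P. \<forall>t\<in>{0..T}. \<bar>X t \<omega>\<bar> \<le> S \<omega>" and T: "0 < T"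
  shows "integrable P (\<lambda>\<omega>. (modulus T n (path_of X \<omega>))\<^sup>2)"
    and "(\<lambda>n. \<integral>\<omega>. (modulus T n (path_of X \<omega>))\<^sup>2 \<partial>P) \<longlonglongrightarrow> 0"
proof -
  have p: "path_of X \<in> measurable P path_space"
    unfolding path_of_def by (rule measurable_restrict) (use X in auto)
  have eq: "modulus T n (path_of X \<omega>) = modulus T n (\<lambda>t. X t \<omega>)" for n \<omega> by (rule modulus_cong) (simp add: path_of_def)
  have m [measurable]: "(\<lambda>\<omega>. modulus T n (path_of X \<omega>)) \<in> borel_measurable P" for n
    using measurable_comp[OF p modulus_measurable] by (simp add: comp_def)
  have i4: "integrable P (\<lambda>\<omega>. 4 * (S \<omega>)\<^sup>2)" using S by simp
  have bd: "AE \<omega> in P. norm ((modulus T n (path_of X \<omega>))\<^sup>2) \<le> 4 * (S \<omega>)\<^sup>2" for n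
    using S(3)
  proof eventually_elim
    case (elim \<omega>)
    have S0: "0 \<le> S \<omega>" using elim T abs_ge_zero order_trans by (metis atLeastAtMost_iff less_imp_le order_refl)
    have "modulus T n (path_of X \<omega>) \<le> 2 * S \<omega>" unfolding eq
    proof (rule modulus_le)
      show "\<bar>X s \<omega> - X t \<omega>\<bar> \<le> 2 * S \<omega>" if "s \<in> {0..T}" "t \<in> {0..T}" for s t
        using elim[rule_format, OF that(1)] elim[rule_format, OF that(2)] by linarith
    qed (use S0 in simp)
    then have "(modulus T n (path_of X \<omega>))\<^sup>2 \<le> (2 * S \<omega>)\<^sup>2" by (intro power_mono modulus_nonneg)
    then show ?case by simp
  qed
  show "integrable P (\<lambda>\<omega>. (modulus T n (path_of X \<omega>))\<^sup>2)"
    by (rule Bochner_Integration.integrable_bound[OF i4]) (use bd in \<open>auto elim!: eventually_mono\<close>)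
  have "(\<lambda>n. \<integral>\<omega>. (modulus T n (path_of X \<omega>))\<^sup>2 \<partial>P) \<longlonglongrightarrow> (\<integral>\<omega>. 0 \<partial>P)"
  proof (rule integral_dominated_convergence[OF _ _ i4])
    show "AE \<omega> in P. (\<lambda>n. (modulus T n (path_of X \<omega>))\<^sup>2) \<longlonglongrightarrow> 0"
      using c
    proof eventually_elim
      case (elim \<omega>)
      from tendsto_power[OF modulus_tendsto[OF elim], of 2] show ?case by (simp add: eq)
    qed
  qed (use bd in auto)
  then show "(\<lambda>n. \<integral>\<omega>. (modulus T n (path_of X \<omega>))\<^sup>2 \<partial>P) \<longlonglongrightarrow> 0" by simp
qed

section \<open>Transfer from the law of \<open>X\<close> to the copies\<close>

lemma (in prob_space) iid_copies_functional:
  assumes Xs: "iid_copies M Xs P X" and F: "F \<in> borel_measurable path_space" and p: "path_of X \<in> measurable P path_space"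
  shows "indep_vars (\<lambda>_. borel) (\<lambda>p \<omega>. F (path_of (Xs (fst p) (snd p)) \<omega>)) UNIV"
    and "distr M borel (\<lambda>\<omega>. F (path_of (Xs i j) \<omega>)) = distr P borel (\<lambda>\<omega>. F (path_of X \<omega>))"
    and "(\<lambda>\<omega>. F (path_of (Xs i j) \<omega>)) \<in> borel_measurable M"
    and "(\<lambda>\<omega>. F (path_of X \<omega>)) \<in> borel_measurable P"
proof -
  have iv: "indep_vars (\<lambda>_. path_space) (\<lambda>p. path_of (Xs (fst p) (snd p))) UNIV"
    using Xs unfolding iid_copies_def case_prod_unfold by blast
  show "indep_vars (\<lambda>_. borel) (\<lambda>p \<omega>. F (path_of (Xs (fst p) (snd p)) \<omega>)) UNIV"
    by (rule indep_vars_compose2[OF iv]) (rule F)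
  have m: "path_of (Xs i j) \<in> measurable M path_space" for i j
  proof -
    have "\<forall>p. path_of (Xs (fst p) (snd p)) \<in> measurable M path_space" using iv unfolding indep_vars_def by blast
    from this[rule_format, of "(i, j)"] show ?thesis by simp
  qed
  have "distr M path_space (path_of (Xs i j)) = distr P path_space (path_of X)"
    using Xs unfolding iid_copies_def by blast
  then show "distr M borel (\<lambda>\<omega>. F (path_of (Xs i j) \<omega>)) = distr P borel (\<lambda>\<omega>. F (path_of X \<omega>))"
    using distr_distr[OF F m, of i j] distr_distr[OF F p] by (simp add: comp_def)
  show "(\<lambda>\<omega>. F (path_of (Xs i j) \<omega>)) \<in> borel_measurable M" using measurable_comp[OF m F] by (simp add: comp_def)
  show "(\<lambda>\<omega>. F (path_of X \<omega>)) \<in> borel_measurable P" using measurable_comp[OF p F] by (simp add: comp_def)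
qed

lemma (in prob_space) iid_copies_functional_integral:
  assumes Xs: "iid_copies M Xs P X" and F: "F \<in> borel_measurable path_space" and p: "path_of X \<in> measurable P path_space"
  shows "integrable M (\<lambda>\<omega>. F (path_of (Xs i j) \<omega>)) \<longleftrightarrow> integrable P (\<lambda>\<omega>. F (path_of X \<omega>) :: real)"
    and "expectation (\<lambda>\<omega>. F (path_of (Xs i j) \<omega>)) = (\<integral>\<omega>. F (path_of X \<omega>) \<partial>P)"
proof -
  note f = iid_copies_functional[OF Xs F p]
  show "integrable M (\<lambda>\<omega>. F (path_of (Xs i j) \<omega>)) \<longleftrightarrow> integrable P (\<lambda>\<omega>. F (path_of X \<omega>))"
    using integrable_distr_eq[OF f(3), of "\<lambda>x. x" i j] integrable_distr_eq[OF f(4), of "\<lambda>x. x"] f(2)[of i j] by simp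
  show "expectation (\<lambda>\<omega>. F (path_of (Xs i j) \<omega>)) = (\<integral>\<omega>. F (path_of X \<omega>) \<partial>P)"
    using integral_distr[OF f(3), of "\<lambda>x. x" i j] integral_distr[OF f(4), of "\<lambda>x. x"] f(2)[of i j] by simp
qed

lemma (in prob_space) iid_copies_eventually_le:
  assumes Xs: "iid_copies M Xs P X" and F: "F \<in> borel_measurable path_space" and p: "path_of X \<in> measurable P path_space"
    and nonneg: "\<And>w. 0 \<le> F w" and int: "integrable P (\<lambda>\<omega>. F (path_of X \<omega>))" and e: "(\<integral>\<omega>. F (path_of X \<omega>) \<partial>P) < e"
  shows "AE \<omega> in M. \<forall>\<^sub>F N in sequentially. (\<Sum>i<N. \<Sum>j<N. F (path_of (Xs i j) \<omega>)) \<le> (real N)\<^sup>2 * (4 * e)"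
proof -
  note f = iid_copies_functional[OF Xs F p] and g = iid_copies_functional_integral[OF Xs F p]
  from iid_square_array_eventually_le[OF f(1) nonneg, of e] show ?thesis
    using f(2) g int e by (simp add: mult_ac)
qed

section \<open>Convergence uniformly in time\<close>

text \<open>The transform is Lipschitz away from the real line, so the equation passes from the
  dense set to every \<open>z\<close> above it by approximation within
  \<open>Im w > Im z / 2\<close>.\<close>

lemma semicircle_law_if_quadratic_on_dense:
  assumes \<nu>: "real_distribution \<nu>" and d: "0 \<le> d"
    and dense: "\<And>X. open X \<Longrightarrow> X \<noteq> {} \<Longrightarrow> \<exists>z\<in>Z. z \<in> X"
    and quad: "\<And>z. z \<in> Z \<Longrightarrow> 0 < Im z \<Longrightarrow> of_real (d\<^sup>2) * (stieltjes \<nu> z)\<^sup>2 + z * stieltjes \<nu> z + 1 = 0"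
  shows "\<nu> = semicircle_law d"
proof (rule semicircle_law_if_quadratic[OF \<nu> d])
  fix z :: complex assume z: "0 < Im z"
  interpret real_distribution \<nu> by fact
  have "\<exists>w\<in>Z. cmod (w - z) < 1 / real (Suc k) \<and> Im z / 2 < Im w" for k
  proof -
    have "\<exists>w\<in>Z. w \<in> ball z (1 / real (Suc k)) \<inter> {w. Im w > Im z / 2}"
    proof (rule dense)
      show "open (ball z (1 / real (Suc k)) \<inter> {w. Im w > Im z / 2})"
        by (intro open_Int open_ball open_halfspace_Im_gt)
      have "z \<in> ball z (1 / real (Suc k)) \<inter> {w. Im w > Im z / 2}" using z by simp
      then show "ball z (1 / real (Suc k)) \<inter> {w. Im w > Im z / 2} \<noteq> {}" by blast
    qed
    then show ?thesis by (auto simp: dist_norm norm_minus_commute)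
  qed
  then obtain w where w: "\<And>k. w k \<in> Z" "\<And>k. cmod (w k - z) < 1 / real (Suc k)" "\<And>k. Im z / 2 < Im (w k)" by metis
  have "(\<lambda>k. w k - z) \<longlonglongrightarrow> 0"
    by (rule Lim_null_comparison[OF _ LIMSEQ_Suc[OF lim_1_over_n]]) (use w(2) in \<open>auto intro!: always_eventually less_imp_le\<close>)
  then have wz: "w \<longlonglongrightarrow> z" by (simp add: LIM_zero_iff)
  have "(\<lambda>k. stieltjes \<nu> (w k) - stieltjes \<nu> z) \<longlonglongrightarrow> 0"
  proof (rule Lim_null_comparison)
    show "\<forall>\<^sub>F k in sequentially. norm (stieltjes \<nu> (w k) - stieltjes \<nu> z) \<le> cmod (w k - z) / (Im z / 2 * Im z)"
    proof (intro always_eventually allI)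
      fix k
      have "norm (stieltjes \<nu> (w k) - stieltjes \<nu> z) \<le> cmod (w k - z) / (Im (w k) * Im z)"
        using w(3)[of k] z by (intro stieltjes_lipschitz) auto
      also have "\<dots> \<le> cmod (w k - z) / (Im z / 2 * Im z)"
        using w(3)[of k] z by (intro divide_left_mono mult_right_mono mult_pos_pos) auto
      finally show "norm (stieltjes \<nu> (w k) - stieltjes \<nu> z) \<le> cmod (w k - z) / (Im z / 2 * Im z)" .
    qed
    have "(\<lambda>k. cmod (w k - z) / (Im z / 2 * Im z)) \<longlonglongrightarrow> cmod (z - z) / (Im z / 2 * Im z)"
      using z by (intro tendsto_intros wz) auto
    then show "(\<lambda>k. cmod (w k - z) / (Im z / 2 * Im z)) \<longlonglongrightarrow> 0" by simp
  qed
  then have "(\<lambda>k. stieltjes \<nu> (w k)) \<longlonglongrightarrow> stieltjes \<nu> z" by (simp add: LIM_zero_iff)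
  then have "(\<lambda>k. of_real (d\<^sup>2) * (stieltjes \<nu> (w k))\<^sup>2 + w k * stieltjes \<nu> (w k) + 1) \<longlonglongrightarrow> of_real (d\<^sup>2) * (stieltjes \<nu> z)\<^sup>2 + z * stieltjes \<nu> z + 1"
    by (intro tendsto_intros wz)
  moreover have "of_real (d\<^sup>2) * (stieltjes \<nu> (w k))\<^sup>2 + w k * stieltjes \<nu> (w k) + 1 = 0" for k
    using w(3)[of k] z by (intro quad w(1)) auto
  ultimately show "of_real (d\<^sup>2) * (stieltjes \<nu> z)\<^sup>2 + z * stieltjes \<nu> z + 1 = 0"
    using LIMSEQ_unique[OF _ tendsto_const] by simp
qed

text \<open>One realisation, seen as deterministic data. It isolates what a sample has to satisfy
  for uniform convergence; each assumption will hold almost surely as a countable intersection of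
  events.\<close>

locale wigner_path =
  fixes T C :: real and x :: "nat \<Rightarrow> nat \<Rightarrow> real \<Rightarrow> real" and \<delta> :: "nat \<Rightarrow> real" and v :: "real \<Rightarrow> real" and Z :: "complex set"
  assumes T: "0 < T" and cont: "\<And>i j. continuous_on {0..T} (x i j)"
    and \<delta>: "\<delta> \<longlonglongrightarrow> 0" "\<And>n. \<forall>\<^sub>F N in sequentially. (\<Sum>i<N. \<Sum>j<N. (modulus T n (x i j))\<^sup>2) \<le> (real N)\<^sup>2 * \<delta> n"
    and C: "\<forall>\<^sub>F N in sequentially. (\<Sum>i<N. \<Sum>j<N. 2 * (x i j 0)\<^sup>2 + 2 * (modulus T 0 (x i j))\<^sup>2) \<le> (real N)\<^sup>2 * C"
    and v: "continuous_on {0..T} v" "\<And>t. t \<in> {0..T} \<Longrightarrow> 0 \<le> v t"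
    and Z: "\<And>X. open X \<Longrightarrow> X \<noteq> {} \<Longrightarrow> \<exists>z\<in>Z. z \<in> X"
    and quad: "\<And>q z. q \<in> \<rat> \<inter> {0..T} \<Longrightarrow> z \<in> Z \<Longrightarrow> 0 < Im z \<Longrightarrow>
      (\<lambda>N. of_real (v q) * (stieltjes (empirical_spectral_measure (wigner_matrix N (\<lambda>i j. x i j q))) z)\<^sup>2
        + z * stieltjes (empirical_spectral_measure (wigner_matrix N (\<lambda>i j. x i j q))) z + 1) \<longlonglongrightarrow> 0"
begin

definition L where "L N t = empirical_spectral_measure (wigner_matrix N (\<lambda>i j. x i j t))"

lemma real_distribution_L: "0 < N \<Longrightarrow> real_distribution (L N t)"
  unfolding L_def by (rule real_distribution_empirical_spectral_measure[OF wigner_matrix_symmetric])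

text \<open>Three errors below \<open>e / 3\<close>: comparing time \<open>u k\<close> with a
  rational time \<open>q\<close> through the modulus, replacing \<open>v q\<close> by
  \<open>v t\<close>, and the given limit at \<open>q\<close>. The modulus index \<open>n\<close> is
  fixed first, then \<open>q\<close> within its window around \<open>t\<close>.\<close>

lemma stieltjes_L_tendsto_quadratic:
  assumes N: "filterlim N at_top sequentially" and u: "\<And>k. u k \<in> {0..T}" "u \<longlonglongrightarrow> t" and t: "t \<in> {0..T}"
    and z: "z \<in> Z" "0 < Im z"
  shows "(\<lambda>k. of_real (v t) * (stieltjes (L (N k) (u k)) z)\<^sup>2 + z * stieltjes (L (N k) (u k)) z + 1) \<longlonglongrightarrow> 0"
proof (rule tendstoI)
  fix e :: real assume e: "0 < e"
  let ?\<eta> = "Im z"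
  have "(\<lambda>n. (v t * (2 / ?\<eta>) + cmod z) * (sqrt (2 * \<delta> n) / ?\<eta>\<^sup>2)) \<longlonglongrightarrow> (v t * (2 / ?\<eta>) + cmod z) * (sqrt (2 * 0) / ?\<eta>\<^sup>2)"
    using z by (intro tendsto_intros \<delta>) auto
  then have "(\<lambda>n. (v t * (2 / ?\<eta>) + cmod z) * (sqrt (2 * \<delta> n) / ?\<eta>\<^sup>2)) \<longlonglongrightarrow> 0" by simp
  from order_tendstoD(2)[OF this, of "e / 3"] e obtain n where n: "(v t * (2 / ?\<eta>) + cmod z) * (sqrt (2 * \<delta> n) / ?\<eta>\<^sup>2) < e / 3"
    by (auto simp: eventually_sequentially)
  obtain r where r: "\<And>k. r k \<in> \<rat> \<inter> {0..T}" "r \<longlonglongrightarrow> t" using rational_sequence_in_interval[OF T t] by blast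
  have "(\<lambda>k. \<bar>v t - v (r k)\<bar> / ?\<eta>\<^sup>2) \<longlonglongrightarrow> \<bar>v t - v t\<bar> / ?\<eta>\<^sup>2"
    using z r t by (intro tendsto_intros continuous_on_tendsto_compose[OF v(1)]) auto
  then have "(\<lambda>k. \<bar>v t - v (r k)\<bar> / ?\<eta>\<^sup>2) \<longlonglongrightarrow> 0" by simp
  from order_tendstoD(2)[OF this, of "e / 3"] e have e1: "\<forall>\<^sub>F k in sequentially. \<bar>v t - v (r k)\<bar> / ?\<eta>\<^sup>2 < e / 3" by simp
  have h: "0 < 2 * T / real (Suc n)" using T by simp
  have "(\<lambda>k. \<bar>t - r k\<bar>) \<longlonglongrightarrow> \<bar>t - t\<bar>" by (intro tendsto_intros r)
  from order_tendstoD(2)[OF this, of "2 * T / real (Suc n)"] h have e2: "\<forall>\<^sub>F k in sequentially. \<bar>t - r k\<bar> < 2 * T / real (Suc n)" by simp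
  from eventually_conj[OF e1 e2] obtain j where j: "\<bar>v t - v (r j)\<bar> / ?\<eta>\<^sup>2 < e / 3" "\<bar>t - r j\<bar> < 2 * T / real (Suc n)"
    by (auto simp: eventually_sequentially)
  define q where "q = r j"
  have q: "q \<in> \<rat> \<inter> {0..T}" using r by (simp add: q_def)
  have "(\<lambda>k. \<bar>u k - q\<bar>) \<longlonglongrightarrow> \<bar>t - q\<bar>" by (intro tendsto_intros u)
  then have near: "\<forall>\<^sub>F k in sequentially. \<bar>u k - q\<bar> < 2 * T / real (Suc n)"
    by (rule order_tendstoD(2)) (use j in \<open>simp add: q_def\<close>)
  have Qq: "\<forall>\<^sub>F k in sequentially. cmod (of_real (v q) * (stieltjes (L (N k) q) z)\<^sup>2 + z * stieltjes (L (N k) q) z + 1) < e / 3"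
  proof -
    have "(\<lambda>k. of_real (v q) * (stieltjes (L (N k) q) z)\<^sup>2 + z * stieltjes (L (N k) q) z + 1) \<longlonglongrightarrow> 0"
      using filterlim_compose[OF quad[OF q z] N] by (simp add: L_def)
    from tendstoD[OF this, of "e / 3"] e show ?thesis by simp
  qed
  have d: "\<forall>\<^sub>F k in sequentially. (\<Sum>i<N k. \<Sum>j<N k. (modulus T n (x i j))\<^sup>2) \<le> (real (N k))\<^sup>2 * \<delta> n"
    by (rule eventually_compose_filterlim[OF \<delta>(2) N])
  have N0: "\<forall>\<^sub>F k in sequentially. 0 < N k" by (rule eventually_compose_filterlim[OF eventually_gt_at_top N])
  show "\<forall>\<^sub>F k in sequentially. dist (of_real (v t) * (stieltjes (L (N k) (u k)) z)\<^sup>2 + z * stieltjes (L (N k) (u k)) z + 1) 0 < e"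
    using near Qq d N0
  proof eventually_elim
    case (elim k)
    define a where "a = stieltjes (L (N k) (u k)) z"
    define b where "b = stieltjes (L (N k) q) z"
    have ab: "cmod a \<le> 1 / ?\<eta>" "cmod b \<le> 1 / ?\<eta>"
      unfolding a_def b_def using real_distribution.norm_stieltjes_le[OF real_distribution_L[OF elim(4)] z(2)] by auto
    have "cmod (a - b) \<le> sqrt (2 * \<delta> n) / ?\<eta>\<^sup>2"
      unfolding a_def b_def L_def
    proof (rule stieltjes_wigner_diff_le[OF z(2) elim(4)])
      have "(\<Sum>i<N k. \<Sum>j<N k. (x i j (u k) - x i j q)\<^sup>2) \<le> (\<Sum>i<N k. \<Sum>j<N k. (modulus T n (x i j))\<^sup>2)"
      proof (intro sum_mono)
        fix i j
        have "\<bar>x i j (u k) - x i j q\<bar> \<le> modulus T n (x i j)"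
          using u(1) q elim(1) by (intro modulus_ge[OF cont T]) auto
        then show "(x i j (u k) - x i j q)\<^sup>2 \<le> (modulus T n (x i j))\<^sup>2"
          using modulus_nonneg[of T n "x i j"] by (simp add: abs_le_square_iff[symmetric])
      qed
      then show "(\<Sum>i<N k. \<Sum>j<N k. (x i j (u k) - x i j q)\<^sup>2) \<le> (real (N k))\<^sup>2 * \<delta> n" using elim(3) by linarith
    qed
    moreover have "cmod (of_real (v t) * (a + b) + z) \<le> v t * (2 / ?\<eta>) + cmod z"
    proof -
      have "cmod (a + b) \<le> 2 / ?\<eta>" using norm_triangle_ineq[of a b] ab by simp
      then have "v t * cmod (a + b) \<le> v t * (2 / ?\<eta>)" by (rule mult_left_mono) (rule v(2)[OF t])
      then have "cmod (of_real (v t) * (a + b)) \<le> v t * (2 / ?\<eta>)"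
        unfolding norm_mult norm_of_real using v(2)[OF t] by simp
      then show ?thesis by (intro norm_triangle_mono) auto
    qed
    ultimately have "cmod (of_real (v t) * (a + b) + z) * cmod (a - b) \<le> (v t * (2 / ?\<eta>) + cmod z) * (sqrt (2 * \<delta> n) / ?\<eta>\<^sup>2)"
      using v(2)[OF t] z(2) by (intro mult_mono) auto
    then have 1: "cmod ((of_real (v t) * (a + b) + z) * (a - b)) < e / 3" using n unfolding norm_mult by linarith
    have 2: "cmod (of_real (v t - v q) * b\<^sup>2) < e / 3"
    proof -
      have "(cmod b)\<^sup>2 \<le> (1 / ?\<eta>)\<^sup>2" by (intro power_mono ab) simp
      then have "\<bar>v t - v q\<bar> * (cmod b)\<^sup>2 \<le> \<bar>v t - v q\<bar> * (1 / ?\<eta>)\<^sup>2" by (rule mult_left_mono) simp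
      also have "\<dots> < e / 3" using j(1) by (simp add: q_def power_divide)
      finally show ?thesis unfolding norm_mult norm_power norm_of_real .
    qed
    have eq: "of_real (v t) * a\<^sup>2 + z * a + 1 = (of_real (v q) * b\<^sup>2 + z * b + 1) + of_real (v t - v q) * b\<^sup>2 + (of_real (v t) * (a + b) + z) * (a - b)"
      by (simp add: power2_eq_square algebra_simps)
    have "cmod (of_real (v q) * b\<^sup>2 + z * b + 1) < e / 3" using elim(2) by (simp add: b_def)
    then have "cmod (of_real (v t) * a\<^sup>2 + z * a + 1) < e"
      unfolding eq using 1 2 norm_triangle_ineq[of "(of_real (v q) * b\<^sup>2 + z * b + 1) + of_real (v t - v q) * b\<^sup>2" "(of_real (v t) * (a + b) + z) * (a - b)"]
        norm_triangle_ineq[of "of_real (v q) * b\<^sup>2 + z * b + 1" "of_real (v t - v q) * b\<^sup>2"] by linarith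
    then show ?case by (simp add: a_def dist_norm)
  qed
qed

text \<open>The modulus of index 0 bounds the increment from time 0, so the estimate is uniform in
  \<open>t\<close>.\<close>

lemma second_moment_L_le:
  assumes "0 < N" "(\<Sum>i<N. \<Sum>j<N. 2 * (x i j 0)\<^sup>2 + 2 * (modulus T 0 (x i j))\<^sup>2) \<le> (real N)\<^sup>2 * K" "t \<in> {0..T}"
  shows "(\<integral>y. y\<^sup>2 \<partial>L N t) \<le> 2 * K"
  unfolding L_def
proof (rule second_moment_wigner_le[OF assms(1)])
  have "(\<Sum>i<N. \<Sum>j<N. (x i j t)\<^sup>2) \<le> (\<Sum>i<N. \<Sum>j<N. 2 * (x i j 0)\<^sup>2 + 2 * (modulus T 0 (x i j))\<^sup>2)"
  proof (intro sum_mono)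
    fix i j
    have "\<bar>x i j t - x i j 0\<bar> \<le> modulus T 0 (x i j)"
      using assms(3) T by (intro modulus_ge[OF cont T]) auto
    then have "(x i j t - x i j 0)\<^sup>2 \<le> (modulus T 0 (x i j))\<^sup>2"
      using modulus_nonneg[of T 0 "x i j"] by (simp add: abs_le_square_iff[symmetric])
    moreover have "a\<^sup>2 \<le> 2 * b\<^sup>2 + 2 * (a - b)\<^sup>2" for a b :: real
      using zero_le_power2[of "a - 2 * b"] by (simp add: power2_eq_square algebra_simps)
    ultimately show "(x i j t)\<^sup>2 \<le> 2 * (x i j 0)\<^sup>2 + 2 * (modulus T 0 (x i j))\<^sup>2"
      by (meson add_left_mono mult_left_mono order_trans zero_le_numeral)
  qed
  then show "(\<Sum>i<N. \<Sum>j<N. (x i j t)\<^sup>2) \<le> (real N)\<^sup>2 * K" using assms(2) by linarith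
qed

text \<open>Every subsequential limit of the transforms solves the quadratic with
  \<open>v t\<close>, and only the semicircle law does. The times \<open>u k\<close> move along with
  \<open>N k\<close>, because this is the form from which uniformity in time is deduced.\<close>

lemma levy_dist_L_tendsto:
  assumes N: "filterlim N at_top sequentially" and u: "\<And>k. u k \<in> {0..T}" "u \<longlonglongrightarrow> t" and t: "t \<in> {0..T}"
  shows "(\<lambda>k. levy_dist (semicircle_law (sqrt (v t))) (L (N k) (u k))) \<longlonglongrightarrow> 0"
proof -
  have "\<forall>\<^sub>F k in sequentially. 0 < N k" by (rule eventually_compose_filterlim[OF eventually_gt_at_top N])
  moreover have "\<forall>\<^sub>F k in sequentially. (\<Sum>i<N k. \<Sum>j<N k. 2 * (x i j 0)\<^sup>2 + 2 * (modulus T 0 (x i j))\<^sup>2) \<le> (real (N k))\<^sup>2 * C"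
    by (rule eventually_compose_filterlim[OF C N])
  ultimately have "\<forall>\<^sub>F k in sequentially. 0 < N k \<and> (\<Sum>i<N k. \<Sum>j<N k. 2 * (x i j 0)\<^sup>2 + 2 * (modulus T 0 (x i j))\<^sup>2) \<le> (real (N k))\<^sup>2 * C"
    by (rule eventually_conj)
  then obtain k0 where k0: "\<And>k. k0 \<le> k \<Longrightarrow> 0 < N k"
    "\<And>k. k0 \<le> k \<Longrightarrow> (\<Sum>i<N k. \<Sum>j<N k. 2 * (x i j 0)\<^sup>2 + 2 * (modulus T 0 (x i j))\<^sup>2) \<le> (real (N k))\<^sup>2 * C"
    unfolding eventually_sequentially by blast
  \<comment> \<open>Positivity of \<open>N k\<close> and the moment bound hold from
    \<open>k0\<close> on, while the criterion wants them for all indices; hence the shift.\<close>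
  have "(\<lambda>k. levy_dist (semicircle_law (sqrt (v t))) (L (N (k + k0)) (u (k + k0)))) \<longlonglongrightarrow> 0"
  proof (rule levy_dist_tendsto_if_stieltjes_limits_unique)
    show "(\<integral>y. y\<^sup>2 \<partial>L (N (k + k0)) (u (k + k0))) \<le> 2 * C" for k
      by (rule second_moment_L_le[OF k0(1) k0(2) u(1)]) simp_all
    show "integrable (L (N (k + k0)) (u (k + k0))) (\<lambda>y. y\<^sup>2)" for k
      unfolding L_def by (rule integrable_empirical_spectral_measure) simp
    show "real_distribution (semicircle_law (sqrt (v t)))"
      by (rule real_distribution_semicircle_law) (use v(2)[OF t] in simp)
    fix r \<rho> assume r: "strict_mono (r :: nat \<Rightarrow> nat)" and \<rho>: "real_distribution \<rho>"
      and lim: "\<And>z. 0 < Im z \<Longrightarrow> (\<lambda>k. stieltjes (L (N (r k + k0)) (u (r k + k0))) z) \<longlonglongrightarrow> stieltjes \<rho> z"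
    have rk: "filterlim (\<lambda>k. r k + k0) at_top sequentially"
      by (rule filterlim_at_top_mono[OF filterlim_subseq[OF r]]) simp
    show "\<rho> = semicircle_law (sqrt (v t))"
    proof (rule semicircle_law_if_quadratic_on_dense[OF \<rho> _ Z])
      fix z assume z: "z \<in> Z" "0 < Im z"
      have "(\<lambda>k. of_real (v t) * (stieltjes (L (N (r k + k0)) (u (r k + k0))) z)\<^sup>2 + z * stieltjes (L (N (r k + k0)) (u (r k + k0))) z + 1) \<longlonglongrightarrow> 0"
        by (rule stieltjes_L_tendsto_quadratic[OF filterlim_compose[OF N rk] u(1) filterlim_compose[OF u(2) rk] t z])
      moreover have "(\<lambda>k. of_real (v t) * (stieltjes (L (N (r k + k0)) (u (r k + k0))) z)\<^sup>2 + z * stieltjes (L (N (r k + k0)) (u (r k + k0))) z + 1)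
          \<longlonglongrightarrow> of_real (v t) * (stieltjes \<rho> z)\<^sup>2 + z * stieltjes \<rho> z + 1"
        by (intro tendsto_intros lim z)
      ultimately have "of_real (v t) * (stieltjes \<rho> z)\<^sup>2 + z * stieltjes \<rho> z + 1 = 0" by (rule LIMSEQ_unique[rotated])
      then show "of_real ((sqrt (v t))\<^sup>2) * (stieltjes \<rho> z)\<^sup>2 + z * stieltjes \<rho> z + 1 = 0" using v(2)[OF t] by simp
    qed (use v(2)[OF t] in auto)
  qed (auto intro!: real_distribution_L k0)
  then show ?thesis by (rule LIMSEQ_offset)
qed

text \<open>For fixed \<open>N\<close> the transform depends continuously on finitely many entries,
  and transforms determine the limit law.\<close>

lemma levy_dist_L_continuous:
  assumes N: "0 < N" and u: "\<And>k. u k \<in> {0..T}" "u \<longlonglongrightarrow> t" and t: "t \<in> {0..T}"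
  shows "(\<lambda>k. levy_dist (L N t) (L N (u k))) \<longlonglongrightarrow> 0"
proof (rule levy_dist_tendsto_if_stieltjes_limits_unique)
  let ?K = "(\<Sum>i<N. \<Sum>j<N. 2 * (x i j 0)\<^sup>2 + 2 * (modulus T 0 (x i j))\<^sup>2) / (real N)\<^sup>2"
  show "(\<integral>y. y\<^sup>2 \<partial>L N (u k)) \<le> 2 * ?K" for k
    by (rule second_moment_L_le) (use N u(1) in auto)
  show "integrable (L N (u k)) (\<lambda>y. y\<^sup>2)" for k
    unfolding L_def by (rule integrable_empirical_spectral_measure) simp
  fix r \<rho> assume r: "strict_mono (r :: nat \<Rightarrow> nat)" and \<rho>: "real_distribution \<rho>"
    and lim: "\<And>z. 0 < Im z \<Longrightarrow> (\<lambda>k. stieltjes (L N (u (r k))) z) \<longlonglongrightarrow> stieltjes \<rho> z"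
  show "\<rho> = L N t"
  proof (rule stieltjes_unique[OF \<rho> real_distribution_L[OF N]])
    fix z assume z: "0 < Im z"
    have ur: "(\<lambda>k. u (r k)) \<longlonglongrightarrow> t" by (rule filterlim_compose[OF u(2) filterlim_subseq[OF r]])
    let ?D = "\<lambda>k. (\<Sum>i<N. \<Sum>j<N. (x i j (u (r k)) - x i j t)\<^sup>2)"
    have "?D \<longlonglongrightarrow> (\<Sum>i<N. \<Sum>j<N. (x i j t - x i j t)\<^sup>2)"
      using u(1) t by (intro tendsto_intros continuous_on_tendsto_compose[OF cont _ _ ] ur) auto
    then have D: "?D \<longlonglongrightarrow> 0" by simp
    have "(\<lambda>k. stieltjes (L N (u (r k))) z - stieltjes (L N t) z) \<longlonglongrightarrow> 0"
    proof (rule Lim_null_comparison)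
      show "\<forall>\<^sub>F k in sequentially. norm (stieltjes (L N (u (r k))) z - stieltjes (L N t) z) \<le> sqrt (2 * (?D k / (real N)\<^sup>2)) / (Im z)\<^sup>2"
        unfolding L_def using N by (intro always_eventually allI stieltjes_wigner_diff_le[OF z N]) simp
      have "(\<lambda>k. sqrt (2 * (?D k / (real N)\<^sup>2)) / (Im z)\<^sup>2) \<longlonglongrightarrow> sqrt (2 * (0 / (real N)\<^sup>2)) / (Im z)\<^sup>2"
        using N z by (intro tendsto_intros D) auto
      then show "(\<lambda>k. sqrt (2 * (?D k / (real N)\<^sup>2)) / (Im z)\<^sup>2) \<longlonglongrightarrow> 0" by simp
    qed
    then have "(\<lambda>k. stieltjes (L N (u (r k))) z) \<longlonglongrightarrow> stieltjes (L N t) z" by (simp add: LIM_zero_iff)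
    then show "stieltjes \<rho> z = stieltjes (L N t) z" using lim[OF z] LIMSEQ_unique by blast
  qed
qed (rule real_distribution_L[OF N])+

end

section \<open>From sequential to uniform convergence in the Levy metric\<close>

lemma cfunspace_prob_metric_memI:
  assumes f: "\<And>t. t \<in> {0..T} \<Longrightarrow> real_distribution (f t)"
    and cont: "\<And>u t. (\<And>k. u k \<in> {0..T}) \<Longrightarrow> u \<longlonglongrightarrow> t \<Longrightarrow> t \<in> {0..T} \<Longrightarrow> (\<lambda>k. levy_dist (f t) (f (u k))) \<longlonglongrightarrow> 0"
  shows "(\<lambda>t\<in>{0..T::real}. f t) \<in> mspace (cfunspace (top_of_set {0..T}) prob_metric)"
proof -
  have "continuous_map (top_of_set {0..T}) levy.mtopology (\<lambda>t\<in>{0..T}. f t)"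
    unfolding levy.continuous_map_to_metric
  proof (intro ballI allI impI)
    fix t and e :: real assume "t \<in> topspace (top_of_set {0..T})" and e: "0 < e"
    then have t: "t \<in> {0..T}" by simp
    have "((\<lambda>s. levy_dist (f t) (f s)) \<longlongrightarrow> 0) (at t within {0..T})"
      unfolding tendsto_at_iff_sequentially using cont[OF _ _ t] by (auto simp: comp_def)
    from order_tendstoD(2)[OF this e] obtain d where d: "0 < d" "\<And>s. s \<in> {0..T} \<Longrightarrow> s \<noteq> t \<Longrightarrow> dist s t < d \<Longrightarrow> levy_dist (f t) (f s) < e"
      unfolding eventually_at by blast
    have "levy_dist (f t) (f t) = 0" using f[OF t] by simp
    then have "levy_dist (f t) (f s) < e" if "s \<in> {0..T}" "dist s t < d" for s
      using d(2)[OF that(1) _ that(2)] e by (cases "s = t") auto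
    then have "f s \<in> levy.mball (f t) e" if "s \<in> {0..T} \<inter> ball t d" for s
      using that f t by (simp add: levy.in_mball dist_commute)
    then show "\<exists>U. openin (top_of_set {0..T}) U \<and> t \<in> U \<and> (\<forall>s\<in>U. (\<lambda>t\<in>{0..T}. f t) s \<in> levy.mball ((\<lambda>t\<in>{0..T}. f t) t) e)"
      using t d(1) by (intro exI[of _ "{0..T} \<inter> ball t d"]) (auto intro: openin_open_Int)
  qed
  then have "continuous_map (top_of_set {0..T}) (mtopology_of prob_metric) (\<lambda>t\<in>{0..T}. f t)"
    by (simp add: mtopology_of_def)
  \<comment> \<open>On a compact domain continuity already yields the boundedness that membership in
    \<open>cfunspace\<close> demands.\<close>
  moreover have "compactin (top_of_set {0..T}) (topspace (top_of_set {0..T}))"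
    by (simp add: compactin_subtopology)
  ultimately show ?thesis using f by (subst compactin_mspace_cfunspace) auto
qed

text \<open>Convergence along all sequences \<open>t\<^sub>k \<rightarrow> t\<close>, \<open>N\<^sub>k \<rightarrow> \<infinity>\<close> forces the limit to be continuous and the
  convergence to be uniform on the compact interval.\<close>

lemma levy_uniform_limit:
  fixes T :: real
  assumes T: "0 \<le> T" and \<mu>: "\<And>t. t \<in> {0..T} \<Longrightarrow> real_distribution (\<mu> t)"
    and L: "\<And>N t. 0 < N \<Longrightarrow> real_distribution (L N t)"
    and conv: "\<And>N u t. filterlim N at_top sequentially \<Longrightarrow> (\<And>k. u k \<in> {0..T}) \<Longrightarrow> u \<longlonglongrightarrow> t \<Longrightarrow> t \<in> {0..T} \<Longrightarrow>
      (\<lambda>k. levy_dist (\<mu> t) (L (N k) (u k))) \<longlonglongrightarrow> 0"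
    and cont: "\<And>N u t. 0 < N \<Longrightarrow> (\<And>k. u k \<in> {0..T}) \<Longrightarrow> u \<longlonglongrightarrow> t \<Longrightarrow> t \<in> {0..T} \<Longrightarrow> (\<lambda>k. levy_dist (L N t) (L N (u k))) \<longlonglongrightarrow> 0"
  shows "limitin (mtopology_of (cfunspace (top_of_set {0..T}) prob_metric)) (\<lambda>N. \<lambda>t\<in>{0..T}. L N t) (\<lambda>t\<in>{0..T}. \<mu> t) sequentially"
proof -
  \<comment> \<open>Diagonal choice: \<open>N k > k\<close> with \<open>L (N k) (u k)\<close> close
    to \<open>\<mu> (u k)\<close>; the same sequence converges to \<open>\<mu> t\<close> by
    \<open>conv\<close>.\<close>
  have \<mu>_cont: "(\<lambda>k. levy_dist (\<mu> t) (\<mu> (u k))) \<longlonglongrightarrow> 0" if u: "\<And>k. u k \<in> {0..T}" "u \<longlonglongrightarrow> t" and t: "t \<in> {0..T}" for u t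
  proof -
    have "\<exists>n>k. levy_dist (\<mu> (u k)) (L n (u k)) < 1 / real (Suc k)" for k
    proof -
      have "(\<lambda>n. levy_dist (\<mu> (u k)) (L n (u k))) \<longlonglongrightarrow> 0"
        by (rule conv) (auto simp: u(1) filterlim_ident intro: u(1)[unfolded atLeastAtMost_iff, THEN conjunct1] u(1)[unfolded atLeastAtMost_iff, THEN conjunct2])
      from order_tendstoD(2)[OF this, of "1 / real (Suc k)"]
      have "\<forall>\<^sub>F n in sequentially. levy_dist (\<mu> (u k)) (L n (u k)) < 1 / real (Suc k)" by simp
      from eventually_conj[OF this eventually_gt_at_top[of k]] show ?thesis
        by (auto simp: eventually_sequentially)
    qed
    then obtain N where N: "\<And>k. k < N k" "\<And>k. levy_dist (\<mu> (u k)) (L (N k) (u k)) < 1 / real (Suc k)" by metis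
    have "filterlim N at_top sequentially"
      by (rule filterlim_at_top_mono[OF filterlim_ident]) (use N(1) in \<open>auto intro!: always_eventually less_imp_le\<close>)
    from conv[OF this u t] have "(\<lambda>k. levy_dist (\<mu> t) (L (N k) (u k)) + 1 / real (Suc k)) \<longlonglongrightarrow> 0 + 0"
      by (intro tendsto_add LIMSEQ_Suc[OF lim_1_over_n])
    then have lim: "(\<lambda>k. levy_dist (\<mu> t) (L (N k) (u k)) + 1 / real (Suc k)) \<longlonglongrightarrow> 0" by simp
    show ?thesis
    proof (rule Lim_null_comparison[OF always_eventually lim], rule allI)
      fix k
      have "0 < N k" using N(1)[of k] by simp
      then have "levy_dist (\<mu> t) (\<mu> (u k)) \<le> levy_dist (\<mu> t) (L (N k) (u k)) + levy_dist (L (N k) (u k)) (\<mu> (u k))"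
        using \<mu>[OF t] \<mu>[OF u(1)[of k]] L by (intro levy.triangle) auto
      then show "norm (levy_dist (\<mu> t) (\<mu> (u k))) \<le> levy_dist (\<mu> t) (L (N k) (u k)) + 1 / real (Suc k)"
        using N(2)[of k] levy_dist_nonneg[of "\<mu> t" "\<mu> (u k)"] levy.commute[of "L (N k) (u k)" "\<mu> (u k)"] by simp
    qed
  qed
  \<comment> \<open>Otherwise compactness provides bad times converging to some \<open>t\<close>,
    where \<open>conv\<close> and the continuity of the limit contradict the distance
    \<open>e\<close>.\<close>
  have unif: "\<forall>\<^sub>F N in sequentially. \<forall>t\<in>{0..T}. levy_dist (\<mu> t) (L N t) < e" if e: "0 < e" for e
  proof (rule ccontr)
    assume "\<not> ?thesis"
    then have "\<exists>N\<ge>n. \<exists>t\<in>{0..T}. e \<le> levy_dist (\<mu> t) (L N t)" for n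
      unfolding eventually_sequentially by (auto simp: not_less)
    then have "\<forall>n. \<exists>N t. n < N \<and> t \<in> {0..T} \<and> e \<le> levy_dist (\<mu> t) (L N t)"
      by (metis Suc_le_lessD)
    then obtain N u where N: "\<And>n. n < N n" "\<And>n. u n \<in> {0..T}" "\<And>n. e \<le> levy_dist (\<mu> (u n)) (L (N n) (u n))" by metis
    obtain t r where t: "t \<in> {0..T}" and r: "strict_mono (r :: nat \<Rightarrow> nat)" and ur: "(u \<circ> r) \<longlonglongrightarrow> t"
      using compact_Icc[of 0 T, unfolded compact_def, rule_format, of u] N(2) by blast
    have Nr: "filterlim (\<lambda>k. N (r k)) at_top sequentially"
      by (rule filterlim_at_top_mono[OF filterlim_subseq[OF r]]) (use N(1) in \<open>auto intro!: always_eventually less_imp_le\<close>)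
    have ur': "(\<lambda>k. u (r k)) \<longlonglongrightarrow> t" using ur by (simp add: comp_def)
    have "(\<lambda>k. levy_dist (\<mu> t) (\<mu> (u (r k))) + levy_dist (\<mu> t) (L (N (r k)) (u (r k)))) \<longlonglongrightarrow> 0 + 0"
      by (intro tendsto_add \<mu>_cont conv[OF Nr] N(2) ur' t)
    then have "\<forall>\<^sub>F k in sequentially. levy_dist (\<mu> t) (\<mu> (u (r k))) + levy_dist (\<mu> t) (L (N (r k)) (u (r k))) < e"
      using e by (intro order_tendstoD(2)) auto
    then obtain k where k: "levy_dist (\<mu> t) (\<mu> (u (r k))) + levy_dist (\<mu> t) (L (N (r k)) (u (r k))) < e"
      by (auto simp: eventually_sequentially)
    have "0 < N (r k)" using N(1)[of "r k"] by simp
    then have "levy_dist (\<mu> (u (r k))) (L (N (r k)) (u (r k))) \<le> levy_dist (\<mu> (u (r k))) (\<mu> t) + levy_dist (\<mu> t) (L (N (r k)) (u (r k)))"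
      using \<mu>[OF t] \<mu>[OF N(2)] L by (intro levy.triangle) auto
    then show False using k N(3)[of "r k"] levy.commute[of "\<mu> (u (r k))" "\<mu> t"] by linarith
  qed
  interpret C: Metric_space "mspace (cfunspace (top_of_set {0..T}) prob_metric)" "mdist (cfunspace (top_of_set {0..T}) prob_metric)"
    by (rule Metric_space_mspace_mdist)
  have mu_mem: "(\<lambda>t\<in>{0..T}. \<mu> t) \<in> mspace (cfunspace (top_of_set {0..T}) prob_metric)"
    by (rule cfunspace_prob_metric_memI[OF \<mu> \<mu>_cont])
  \<comment> \<open>The index \<open>N = 0\<close> is left out: the spectral measure of an empty
    matrix has no mass. The limit does not see it.\<close>
  have L_mem: "(\<lambda>t\<in>{0..T}. L N t) \<in> mspace (cfunspace (top_of_set {0..T}) prob_metric)" if "0 < N" for N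
    by (rule cfunspace_prob_metric_memI[OF L[OF that] cont[OF that]])
  show ?thesis
    unfolding mtopology_of_def C.limitin_metric
  proof (intro conjI mu_mem allI impI)
    fix e :: real assume e: "0 < e"
    then have "\<forall>\<^sub>F N in sequentially. \<forall>t\<in>{0..T}. levy_dist (\<mu> t) (L N t) < e / 2" by (intro unif) simp
    then show "\<forall>\<^sub>F N in sequentially. (\<lambda>t\<in>{0..T}. L N t) \<in> mspace (cfunspace (top_of_set {0..T}) prob_metric) \<and>
        mdist (cfunspace (top_of_set {0..T}) prob_metric) (\<lambda>t\<in>{0..T}. L N t) (\<lambda>t\<in>{0..T}. \<mu> t) < e"
      using eventually_gt_at_top[of 0]
    proof eventually_elim
      case (elim N)
      have "mdist (cfunspace (top_of_set {0..T}) prob_metric) (\<lambda>t\<in>{0..T}. L N t) (\<lambda>t\<in>{0..T}. \<mu> t) \<le> e / 2"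
        by (rule mdist_cfunspace_le) (use e elim(1) levy.commute in \<open>auto intro: less_imp_le\<close>)
      then show ?case using L_mem[OF elim(2)] e by simp
    qed
  qed
qed

theorem theorem3p2:
  fixes H \<epsilon> C\<^sub>0 T :: real
    and \<sigma> b \<phi> :: "real \<Rightarrow> real"
    and P :: "'w measure" and B X :: "real \<Rightarrow> 'w \<Rightarrow> real"
    and M :: "'v measure" and Xs :: "nat \<Rightarrow> nat \<Rightarrow> real \<Rightarrow> 'v \<Rightarrow> real"
    and L :: "nat \<Rightarrow> real \<Rightarrow> 'v \<Rightarrow> real measure"
    and m d :: "real \<Rightarrow> real"
  assumes H: "1/2 < H" "H < 1"
    and P: "prob_space P"
    and B: "fractional_brownian_motion H P B"
    and X: "sde_solution H \<sigma> b P B X"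
    and M: "prob_space M"
    and Xs: "iid_copies M Xs P X"
    and L: "\<And>N t \<omega>. L N t \<omega> =
      empirical_spectral_measure (wigner_matrix N (\<lambda>i j. Xs i j t \<omega>))"
    and \<epsilon>: "0 < \<epsilon>" "\<epsilon> < H - 1/2"
    and coeffs: "bounded_holder_derivative (1 / (H - \<epsilon>) - 1) \<sigma>"
      "bounded_holder_derivative (1 / (H - \<epsilon>) - 1) b"
    and H1_or_H2: "(bounded (range \<sigma>) \<and> bounded (range b)) \<or>
      ((SUP x. \<bar>deriv \<sigma> x\<bar>) + (SUP x. \<bar>deriv b x\<bar>) > 0 \<and> integrable P (\<lambda>\<omega>. \<bar>X 0 \<omega>\<bar> ^ 4))"
    and \<phi>: "\<And>x. 0 < \<phi> x" "\<phi> differentiable_on UNIV" "continuous_on UNIV (deriv \<phi>)"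
      "bounded (range (deriv \<phi>))" "filterlim \<phi> at_top at_infinity"
    and C\<^sub>0: "0 < C\<^sub>0" "AE \<omega> in M. \<forall>N\<ge>1. (\<integral>x. \<phi> x \<partial>L N 0 \<omega>) \<le> C\<^sub>0"
    and X0: "integrable P (\<lambda>\<omega>. \<bar>X 0 \<omega>\<bar> ^ 2)"
    and m: "\<And>t. m t = (\<integral>\<omega>. X t \<omega> \<partial>P)"
    and d: "\<And>t. d t = sqrt ((\<integral>\<omega>. \<bar>X t \<omega>\<bar> ^ 2 \<partial>P) - (m t)\<^sup>2)"
    and T: "0 < T"
  shows "\<exists>\<mu>.
    (AE \<omega> in M. limitin (mtopology_of (cfunspace (top_of_set {0..T}) prob_metric))
        (\<lambda>N. \<lambda>t\<in>{0..T}. L N t \<omega>) (\<lambda>t\<in>{0..T}. \<mu> t) sequentially) \<and>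
    (\<forall>t\<in>{0..T}. \<mu> t =
      (if d t = 0 then return borel 0
       else density lborel (\<lambda>x. ennreal (semicircle_density (x / d t) / d t))))"
proof -
  interpret P: prob_space P by (rule P)
  interpret M: prob_space M by (rule M)
  have Xm: "X t \<in> borel_measurable P" if "0 \<le> t" for t using X that by (simp add: sde_solution_def)
  have pX: "path_of X \<in> measurable P path_space" by (rule P.path_of_measurable[OF Xm])
  have "integrable P (\<lambda>\<omega>. (X 0 \<omega>)\<^sup>2)" using X0 by simp
  from P.sde_sup_second_moment[OF H B X coeffs this T] obtain S where S: "S \<in> borel_measurable P" "integrable P (\<lambda>\<omega>. (S \<omega>)\<^sup>2)"
    "AE \<omega> in P. \<forall>t\<in>{0..T}. \<bar>X t \<omega>\<bar> \<le> S \<omega>" by blast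
  have Xc: "AE \<omega> in P. continuous_on {0..T} (\<lambda>t. X t \<omega>)"
  proof -
    have "AE \<omega> in P. young_solution H \<sigma> b (\<lambda>t. B t \<omega>) (\<lambda>t. X t \<omega>)" using X by (simp add: sde_solution_def)
    then show ?thesis
    proof eventually_elim
      case (elim \<omega>)
      then show ?case using T holder_on_continuous unfolding young_solution_def by blast
    qed
  qed
  have mom: "integrable P (\<lambda>\<omega>. (modulus T n (path_of X \<omega>))\<^sup>2)"
    "(\<lambda>n. \<integral>\<omega>. (modulus T n (path_of X \<omega>))\<^sup>2 \<partial>P) \<longlonglongrightarrow> 0" for n
    by (rule modulus_second_moment[where S = S], erule Xm, rule Xc, rule S, rule S, rule S, rule T)+
  have iS: "integrable P S" by (rule P.square_integrable_imp_integrable[OF S(1,2)])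
  have iX2: "integrable P (\<lambda>\<omega>. (X t \<omega>)\<^sup>2)" if "t \<in> {0..T}" for t
  proof (rule Bochner_Integration.integrable_bound[OF S(2)])
    show "AE \<omega> in P. norm ((X t \<omega>)\<^sup>2) \<le> norm ((S \<omega>)\<^sup>2)"
      using S(3)
    proof eventually_elim
      case (elim \<omega>)
      then have "\<bar>X t \<omega>\<bar> \<le> \<bar>S \<omega>\<bar>" using that by force
      then show ?case by (simp add: abs_le_square_iff)
    qed
  qed (use Xm that in auto)
  define v where "v t = (\<integral>\<omega>. (X t \<omega>)\<^sup>2 \<partial>P) - (m t)\<^sup>2" for t
  have dv: "d t = sqrt (v t)" for t by (simp add: d v_def)
  have v0: "0 \<le> v t" if "t \<in> {0..T}" for t
  proof -
    have "integrable P (X t)" by (rule P.square_integrable_imp_integrable[OF Xm iX2[OF that]]) (use that in auto)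
    then have "P.variance (X t) = v t" unfolding v_def m using iX2[OF that] by (rule P.variance_eq)
    then show ?thesis using P.variance_positive[of "X t"] by simp
  qed
  \<comment> \<open>Dominated convergence of the first two moments, with \<open>S\<close> and its
    square as dominating functions over the whole time interval.\<close>
  have v_cont: "continuous_on {0..T} v"
  proof (rule continuous_on_sequentiallyI)
    fix u t assume u: "\<forall>k. u k \<in> {0..T}" and t: "t \<in> {0..T}" and ut: "u \<longlonglongrightarrow> t"
    have lim: "AE \<omega> in P. (\<lambda>k. X (u k) \<omega>) \<longlonglongrightarrow> X t \<omega>"
      using Xc by eventually_elim (use u t ut in \<open>auto intro: continuous_on_tendsto_compose\<close>)
    have "(\<lambda>k. \<integral>\<omega>. X (u k) \<omega> \<partial>P) \<longlonglongrightarrow> (\<integral>\<omega>. X t \<omega> \<partial>P)"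
    proof (rule integral_dominated_convergence[OF _ _ iS lim])
      show "AE \<omega> in P. norm (X (u k) \<omega>) \<le> S \<omega>" for k using S(3) by eventually_elim (use u in simp)
    qed (use Xm u t in auto)
    moreover have "(\<lambda>k. \<integral>\<omega>. (X (u k) \<omega>)\<^sup>2 \<partial>P) \<longlonglongrightarrow> (\<integral>\<omega>. (X t \<omega>)\<^sup>2 \<partial>P)"
    proof (rule integral_dominated_convergence[OF _ _ S(2)])
      show "AE \<omega> in P. (\<lambda>k. (X (u k) \<omega>)\<^sup>2) \<longlonglongrightarrow> (X t \<omega>)\<^sup>2"
        using lim by eventually_elim (intro tendsto_power)
      show "AE \<omega> in P. norm ((X (u k) \<omega>)\<^sup>2) \<le> (S \<omega>)\<^sup>2" for k
        using S(3)
      proof eventually_elim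
        case (elim \<omega>)
        then have "\<bar>X (u k) \<omega>\<bar> \<le> \<bar>S \<omega>\<bar>" using u by (intro order_trans[OF _ abs_ge_self]) auto
        then show ?case by (simp add: abs_le_square_iff)
      qed
    qed (use Xm u t in auto)
    ultimately show "(\<lambda>k. v (u k)) \<longlonglongrightarrow> v t" unfolding v_def m by (intro tendsto_intros)
  qed
  define E where "E n = (\<integral>\<omega>. (modulus T n (path_of X \<omega>))\<^sup>2 \<partial>P)" for n
  \<comment> \<open>The factor 4 comes from \<open>iid_copies_eventually_le\<close>, whose strict
    hypothesis is met through the margin \<open>1 / real (Suc n)\<close>.\<close>
  define \<delta> where "\<delta> n = 4 * (E n + 1 / real (Suc n))" for n
  have "\<delta> \<longlonglongrightarrow> 4 * (0 + 0)"
    unfolding \<delta>_def E_def by (intro tendsto_intros mom(2) LIMSEQ_Suc[OF lim_1_over_n])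
  then have \<delta>: "\<delta> \<longlonglongrightarrow> 0" by simp
  have path_modulus: "modulus T n (path_of (Xs i j) \<omega>) = modulus T n (\<lambda>t. Xs i j t \<omega>)" for n i j \<omega>
    by (rule modulus_cong) (simp add: path_of_def)
  have path_at: "path_of Y \<omega> t = Y t \<omega>" if "0 \<le> t" for t \<omega> and Y :: "real \<Rightarrow> 'x \<Rightarrow> real"
    using that by (simp add: path_of_def)
  have coord: "(\<lambda>w. w t) \<in> borel_measurable path_space" if "0 \<le> t" for t
    using that by (intro measurable_component_singleton) auto
  have A1: "AE \<omega> in M. \<forall>n. \<forall>\<^sub>F N in sequentially. (\<Sum>i<N. \<Sum>j<N. (modulus T n (\<lambda>t. Xs i j t \<omega>))\<^sup>2) \<le> (real N)\<^sup>2 * \<delta> n"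
  proof (subst AE_all_countable, rule allI)
    fix n
    have "AE \<omega> in M. \<forall>\<^sub>F N in sequentially. (\<Sum>i<N. \<Sum>j<N. (modulus T n (path_of (Xs i j) \<omega>))\<^sup>2) \<le> (real N)\<^sup>2 * (4 * (E n + 1 / real (Suc n)))"
      by (rule M.iid_copies_eventually_le[OF Xs _ pX, where F = "\<lambda>w. (modulus T n w)\<^sup>2"]) (use mom(1)[of n] in \<open>auto simp: E_def\<close>)
    then show "AE \<omega> in M. \<forall>\<^sub>F N in sequentially. (\<Sum>i<N. \<Sum>j<N. (modulus T n (\<lambda>t. Xs i j t \<omega>))\<^sup>2) \<le> (real N)\<^sup>2 * \<delta> n"
      by (simp only: path_modulus \<delta>_def)
  qed
  define C where "C = 4 * ((\<integral>\<omega>. 2 * (X 0 \<omega>)\<^sup>2 + 2 * (modulus T 0 (path_of X \<omega>))\<^sup>2 \<partial>P) + 1)"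
  have A2: "AE \<omega> in M. \<forall>\<^sub>F N in sequentially. (\<Sum>i<N. \<Sum>j<N. 2 * (Xs i j 0 \<omega>)\<^sup>2 + 2 * (modulus T 0 (\<lambda>t. Xs i j t \<omega>))\<^sup>2) \<le> (real N)\<^sup>2 * C"
  proof -
    have [measurable]: "(\<lambda>w. w 0) \<in> borel_measurable path_space" by (rule coord) simp
    have "AE \<omega> in M. \<forall>\<^sub>F N in sequentially. (\<Sum>i<N. \<Sum>j<N. 2 * (path_of (Xs i j) \<omega> 0)\<^sup>2 + 2 * (modulus T 0 (path_of (Xs i j) \<omega>))\<^sup>2)
        \<le> (real N)\<^sup>2 * (4 * ((\<integral>\<omega>. 2 * (X 0 \<omega>)\<^sup>2 + 2 * (modulus T 0 (path_of X \<omega>))\<^sup>2 \<partial>P) + 1))"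
      by (rule M.iid_copies_eventually_le[OF Xs _ pX, where F = "\<lambda>w. 2 * (w 0)\<^sup>2 + 2 * (modulus T 0 w)\<^sup>2"])
        (use mom(1)[of 0] iX2[of 0] T in \<open>auto simp: path_at\<close>)
    then show ?thesis by (simp only: path_modulus path_at order_refl C_def)
  qed
  \<comment> \<open>Countability of \<open>Z\<close> and of the rational times lets one null set
    serve for all pairs \<open>(q, z)\<close>.\<close>
  obtain Z :: "complex set" where Z: "countable Z" "\<And>X. open X \<Longrightarrow> X \<noteq> {} \<Longrightarrow> \<exists>z\<in>Z. z \<in> X"
    by (rule countable_dense_setE) blast
  have A3: "AE \<omega> in M. \<forall>q\<in>\<rat> \<inter> {0..T}. \<forall>z\<in>Z \<inter> {z. 0 < Im z}.
    (\<lambda>N. of_real (v q) * (stieltjes (L N q \<omega>) z)\<^sup>2 + z * stieltjes (L N q \<omega>) z + 1) \<longlonglongrightarrow> 0"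
  proof (subst AE_ball_countable, (intro countable_Int1 countable_rat), intro ballI, subst AE_ball_countable, (intro countable_Int1 Z), intro ballI)
    fix q z assume q: "q \<in> \<rat> \<inter> {0..T}" and z: "z \<in> Z \<inter> {z. 0 < Im z}"
    have q0: "0 \<le> q" using q by simp
    note f = M.iid_copies_functional[OF Xs coord[OF q0] pX]
    note g = M.iid_copies_functional_integral[OF Xs _ pX]
    have "integrable M (\<lambda>\<omega>. (Xs 0 0 q \<omega>)\<^sup>2) \<longleftrightarrow> integrable P (\<lambda>\<omega>. (X q \<omega>)\<^sup>2)"
      "M.expectation (\<lambda>\<omega>. (Xs 0 0 q \<omega>)\<^sup>2) = (\<integral>\<omega>. (X q \<omega>)\<^sup>2 \<partial>P)"
      using g[of "\<lambda>w. (w q)\<^sup>2" 0 0] coord[OF q0] by (simp_all add: path_at q0)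
    moreover have "M.expectation (Xs 0 0 q) = m q"
      using g(2)[of "\<lambda>w. w q" 0 0] coord[OF q0] by (simp add: path_at q0 m)
    ultimately show "AE \<omega> in M. (\<lambda>N. of_real (v q) * (stieltjes (L N q \<omega>) z)\<^sup>2 + z * stieltjes (L N q \<omega>) z + 1) \<longlonglongrightarrow> 0"
      using M.iid_wigner_quadratic_limit[of "\<lambda>p. Xs (fst p) (snd p) q" z "m q" "v q"] f iX2[of q] q z
      unfolding L by (simp add: path_at q0 v_def)
  qed
  have A4: "AE \<omega> in M. \<forall>i j. continuous_on {0..} (\<lambda>t. Xs i j t \<omega>)"
    using Xs by (simp add: AE_all_countable iid_copies_def)
  \<comment> \<open>Outside the exceptional sets of \<open>A1\<close> to \<open>A4\<close> every
    realisation satisfies \<open>wigner_path\<close>, and the rest is deterministic.\<close>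
  have "AE \<omega> in M. limitin (mtopology_of (cfunspace (top_of_set {0..T}) prob_metric))
        (\<lambda>N. \<lambda>t\<in>{0..T}. L N t \<omega>) (\<lambda>t\<in>{0..T}. semicircle_law (d t)) sequentially"
    using A1 A2 A3 A4
  proof eventually_elim
    case (elim \<omega>)
    have c: "continuous_on {0..T} (\<lambda>t. Xs i j t \<omega>)" for i j
      by (rule continuous_on_subset[OF elim(4)[rule_format, of i j]]) auto
    interpret wp: wigner_path T C "\<lambda>i j t. Xs i j t \<omega>" \<delta> v Z
      by unfold_locales (use T c \<delta> elim(1-3) v_cont v0 Z(2) in \<open>auto simp: L\<close>)
    have LL: "L N t \<omega> = wp.L N t" for N t by (simp add: L wp.L_def)
    show ?case unfolding LL dv
      by (rule levy_uniform_limit[OF _ _ wp.real_distribution_L wp.levy_dist_L_tendsto wp.levy_dist_L_continuous])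
        (use T v0 real_distribution_semicircle_law in auto)
  qed
  \<comment> \<open>\<open>semicircle_law\<close> makes the same case distinction at
    \<open>d t = 0\<close> as the claim.\<close>
  then show ?thesis by (intro exI[of _ "\<lambda>t. semicircle_law (d t)"]) (simp add: semicircle_law_def)
qed

end
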